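(* Let $\Gamma$ be a finite group acting on an affine scheme $X$ and on a finite-dimensional Lie algebra $\mathfrak{g}$, and let $\mathfrak{M}=M(X,\mathfrak{g})^\Gamma$. Then the map $$(\mathfrak{M}/[\mathfrak{M},\mathfrak{M}])^*\times\mathcal{E}\to\mathcal{S},\qquad (\lambda,\Psi)\mapsto\lambda\otimes\mathrm{ev}_\Psi,$$ is surjective. In particular, all irreducible finite-dimensional representations of $\mathfrak{M}$ are tensor products of an evaluation representation and a one-dimensional representation. Furthermore, for $\lambda,\lambda'\in(\mathfrak{M}/[\mathfrak{M},\mathfrak{M}])^*$ and $\Psi,\Psi'\in\mathcal{E}$, we have $\lambda\otimes\mathrm{ev}_\Psi=\lambda'\otimes\mathrm{ev}_{\Psi'}$ if and only if there exists $\Phi\in\mathcal{E}$ such that $\dim\mathrm{ev}_\Phi=1$, $\lambda'=\lambda-\mathrm{ev}_\Phi$ and $\mathrm{ev}_{\Psi'}=\mathrm{ev}_{\Psi\otimes\Phi}$. Here $\Psi\otimes\Phi\in\mathcal{E}$ is given by $(\Psi\otimes\Phi)(x)=\Psi(x)\otimes\Phi(x)$, where $\Psi(x)$ (respectively $\Phi(x)$) is the one-dimensional trivial representation if $x\notin\operatorname{supp}\Psi$ (respectively $x\notin\operatorname{supp}\Phi$). In particular, the restriction of the map $(\lambda,\Psi)\mapsto\lambda\otimes\mathrm{ev}_\Psi$ to either factor (times the zero element of the other) is injective.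
   Context: $k$ is an algebraically closed field of characteristic zero; all tensor products are over $k$. $X=\operatorname{Spec}A$ is an affine $k$-scheme ($A$ a commutative associative unital $k$-algebra, not assumed finitely generated or reduced). The finite group $\Gamma$ acts on $X$ by scheme automorphisms (over $k$), hence on $A$ by $g\cdot f=f\circ g^{-1}$, and on the finite-dimensional $k$-Lie algebra $\mathfrak{g}$ by Lie algebra automorphisms. $\mathfrak{M}=M(X,\mathfrak{g})^\Gamma$ is the Lie algebra of $\Gamma$-equivariant regular maps $X\to\mathfrak{g}$ with pointwise operations; equivalently $\mathfrak{M}=(\mathfrak{g}\otimes A)^\Gamma$ for the diagonal action, with bracket $[u\otimes f,v\otimes h]=[u,v]\otimes fh$. $X_{\rm rat}$ is the set of $k$-rational points of $X$. For $x\in X_{\rm rat}$ and $\alpha=\sum_i u_i\otimes f_i$, put $\alpha(x)=\sum_i f_i(x)u_i$. Let $\Gamma_x=\{g\in\Gamma:g\cdot x=x\}$ and $\mathfrak{g}^x=\{u\in\mathfrak{g}:g\cdot u=u\ \forall g\in\Gamma_x\}$; one has $\alpha(x)\in\mathfrak{g}^x$ for $\alpha\in\mathfrak{M}$. For a finite subset $\mathbf{x}\subseteq X_{\rm rat}$ let $\mathrm{ev}_{\mathbf x}:\mathfrak{M}\to\bigoplus_{x\in\mathbf{x}}\mathfrak{g}^x$, $\alpha\mapsto(\alpha(x))_{x\in\mathbf{x}}$. Given representations $\rho_x:\mathfrak{g}^x\to\operatorname{End}_kV_x$ ($x\in\mathbf{x}$), the associated evaluation representation $\mathrm{ev}_{\mathbf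 x}(\rho_x)_{x\in\mathbf{x}}$ of $\mathfrak{M}$ on $\bigotimes_{x\in\mathbf x}V_x$ is the composition of $\mathrm{ev}_{\mathbf x}$ with the tensor product representation of $\bigoplus_{x\in\mathbf{x}}\mathfrak{g}^x$ (in which $\mathfrak g^x$ acts on the factor $V_x$). $\mathcal{R}_x$ is the set of isomorphism classes of irreducible finite-dimensional representations of $\mathfrak{g}^x$, and $\mathcal{R}_X=\bigsqcup_{x\in X_{\rm rat}}\mathcal{R}_x$, with $\Gamma$ acting by $g\cdot[\rho]=[\rho\circ g^{-1}]\in\mathcal{R}_{g\cdot x}$ for $[\rho]\in\mathcal{R}_x$. $\mathcal{E}$ is the set of finitely supported $\Gamma$-equivariant functions $\Psi:X_{\rm rat}\to\mathcal{R}_X$ with $\Psi(x)\in\mathcal{R}_x$, where $\operatorname{supp}\Psi=\{x:\Psi(x)\neq0\}$ and $0$ denotes the class of the one-dimensional trivial representation; the zero element of $\mathcal{E}$ is the function that is identically $0$. For $\Psi\in\mathcal{E}$, $\mathrm{ev}_\Psi$ is the isomorphism class of $\mathrm{ev}_{\mathbf x}(\Psi(x))_{x\in\mathbf{x}}$, where $\mathbf{x}$ contains exactly one element of each $\Gamma$-orbit in $\operatorname{supp}\Psi$ (this is independent of the choice of $\mathbf x$); if $\operatorname{supp}\Psi=\emptyset$, $\mathrm{ev}_\Psi$ is the class of the one-dimensional trivial representation. $\mathcal{S}$ is the set of isomorphism classes of irreducible finite-dimensional representations of $\mathfrak{M}$; $\mathrm{ev}_\Psi\in\mathcal{S}$.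 $(\mathfrak{M}/[\mathfrak{M},\mathfrak{M}])^*$ is identified with the linear forms on $\mathfrak{M}$ vanishing on $[\mathfrak{M},\mathfrak{M}]$, i.e. with the isomorphism classes of one-dimensional representations of $\mathfrak{M}$; in particular $\mathrm{ev}_\Phi$ with $\dim\mathrm{ev}_\Phi=1$ is regarded as such a linear form. *)

theory Defs
  imports
    "HOL-Algebra.Group_Action"
    "HOL-Library.FuncSet"
    "HOL-Library.Function_Algebras"
    "HOL-Computational_Algebra.Polynomial"
    "Jordan_Normal_Form.VS_Connect"
begin

section \<open>Tensor product of two vector spaces\<close>

definition bilinear_map ::
  "('k::field \<Rightarrow> 'u::ab_group_add \<Rightarrow> 'u) \<Rightarrow> ('k \<Rightarrow> 'v::ab_group_add \<Rightarrow> 'v) \<Rightarrow>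
   ('k \<Rightarrow> 'w::ab_group_add \<Rightarrow> 'w) \<Rightarrow> ('u \<Rightarrow> 'v \<Rightarrow> 'w) \<Rightarrow> bool"
where
  "bilinear_map sU sV sW b \<longleftrightarrow>
     (\<forall>v. Vector_Spaces.linear sU sW (\<lambda>u. b u v)) \<and> (\<forall>u. Vector_Spaces.linear sV sW (b u))"

text \<open>The tensor product of \<open>U\<close> and \<open>V\<close> is realised inside the dual of the space of bilinear forms
  on \<open>U \<times> V\<close>: the pure tensor of \<open>u\<close> and \<open>v\<close> is evaluation of bilinear forms at \<open>(u, v)\<close>, and the
  tensor product is the set of all finite sums of pure tensors.  Over a field this is the tensor
  product; the universal property is lemma \<open>tensor_lift_sum\<close> below.\<close>

type_synonym ('k, 'u, 'v) tens = "('u \<Rightarrow> 'v \<Rightarrow> 'k) \<Rightarrow> 'k"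

definition pure_tensor ::
  "('k::field \<Rightarrow> 'u::ab_group_add \<Rightarrow> 'u) \<Rightarrow> ('k \<Rightarrow> 'v::ab_group_add \<Rightarrow> 'v) \<Rightarrow> 'u \<Rightarrow> 'v \<Rightarrow> ('k, 'u, 'v) tens"
where
  "pure_tensor sU sV u v = (\<lambda>b. if bilinear_map sU sV (*) b then b u v else 0)"

definition tensor_space ::
  "('k::field \<Rightarrow> 'u::ab_group_add \<Rightarrow> 'u) \<Rightarrow> ('k \<Rightarrow> 'v::ab_group_add \<Rightarrow> 'v) \<Rightarrow> ('k, 'u, 'v) tens set"
where
  "tensor_space sU sV = {t. \<exists>ps. t = (\<Sum>(u, v)\<leftarrow>ps. pure_tensor sU sV u v)}"

definition tens_scale :: "'k::field \<Rightarrow> ('k, 'u, 'v) tens \<Rightarrow> ('k, 'u, 'v) tens" where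
  "tens_scale c t = (\<lambda>b. c * t b)"

text \<open>The linear map on the tensor product induced by a bilinear map \<open>F\<close>.\<close>

definition tensor_lift ::
  "('k::field \<Rightarrow> 'u::ab_group_add \<Rightarrow> 'u) \<Rightarrow> ('k \<Rightarrow> 'v::ab_group_add \<Rightarrow> 'v) \<Rightarrow>
   ('u \<Rightarrow> 'v \<Rightarrow> 'w::ab_group_add) \<Rightarrow> ('k, 'u, 'v) tens \<Rightarrow> 'w"
where
  "tensor_lift sU sV F t =
     (THE w. \<exists>ps. t = (\<Sum>(u, v)\<leftarrow>ps. pure_tensor sU sV u v) \<and> w = (\<Sum>(u, v)\<leftarrow>ps. F u v))"

lemma bilinear_mapD:
  assumes "bilinear_map sU sV sW b"
  shows "b (u + u') v = b u v + b u' v" "b u (v + v') = b u v + b u v'"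
    "b (sU c u) v = sW c (b u v)" "b u (sV c v) = sW c (b u v)"
  using assms unfolding bilinear_map_def
  by (metis Vector_Spaces.linear_iff)+

lemma bilinear_pure_tensor:
  assumes "vector_space sU" "vector_space sV"
  shows "bilinear_map sU sV tens_scale (pure_tensor sU sV)"
proof -
  have "vector_space (tens_scale :: 'a \<Rightarrow> ('a, 'b, 'c) tens \<Rightarrow> ('a, 'b, 'c) tens)"
    by unfold_locales (auto simp: tens_scale_def fun_eq_iff algebra_simps)
  then show ?thesis
    using assms unfolding bilinear_map_def
    by (auto simp: Vector_Spaces.linear_iff fun_eq_iff pure_tensor_def tens_scale_def
        dest: bilinear_mapD)
qed

lemma pure_tensor_sum_apply:
  "bilinear_map sU sV (*) b \<Longrightarrow>
   (\<Sum>(u, v)\<leftarrow>ps. pure_tensor sU sV u v) b = (\<Sum>(u, v)\<leftarrow>ps. b u v)"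
  by (induction ps) (auto simp: pure_tensor_def)

lemma tensor_lift_sum:
  assumes F: "bilinear_map sU sV sW F"
  shows "tensor_lift sU sV F (\<Sum>(u, v)\<leftarrow>ps. pure_tensor sU sV u v) = (\<Sum>(u, v)\<leftarrow>ps. F u v)"
  unfolding tensor_lift_def
proof (rule the_equality)
  show "\<exists>qs. (\<Sum>(u, v)\<leftarrow>ps. pure_tensor sU sV u v) = (\<Sum>(u, v)\<leftarrow>qs. pure_tensor sU sV u v) \<and>
      (\<Sum>(u, v)\<leftarrow>ps. F u v) = (\<Sum>(u, v)\<leftarrow>qs. F u v)"
    by blast
next
  fix w
  assume "\<exists>qs. (\<Sum>(u, v)\<leftarrow>ps. pure_tensor sU sV u v) = (\<Sum>(u, v)\<leftarrow>qs. pure_tensor sU sV u v) \<and>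
      w = (\<Sum>(u, v)\<leftarrow>qs. F u v)"
  then obtain qs where
    eq: "(\<Sum>(u, v)\<leftarrow>ps. pure_tensor sU sV u v) = (\<Sum>(u, v)\<leftarrow>qs. pure_tensor sU sV u v)"
    and w: "w = (\<Sum>(u, v)\<leftarrow>qs. F u v)" by blast
  have vs: "vector_space sW" "vector_space sU" "vector_space sV"
    using F unfolding bilinear_map_def Vector_Spaces.linear_iff by auto
  interpret W: vector_space sW by fact
  have k: "vector_space ((*) :: 'a \<Rightarrow> 'a \<Rightarrow> 'a)"
    by unfold_locales (auto simp: algebra_simps)
  interpret P: vector_space_pair sW "(*) :: 'a \<Rightarrow> 'a \<Rightarrow> 'a"
    using vs k by (simp add: vector_space_pair_def)
  let ?w = "\<Sum>(u, v)\<leftarrow>ps. F u v"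
  show "w = ?w"
  proof (rule ccontr)
    assume "w \<noteq> ?w"
    then have "W.independent {w - ?w}" by simp
    then obtain \<phi> where \<phi>: "Vector_Spaces.linear sW (*) \<phi>" "\<phi> (w - ?w) = 1"
      using P.linear_independent_extend[of "{w - ?w}" "\<lambda>_. 1"] by auto
    have add: "\<phi> (x + y) = \<phi> x + \<phi> y" and scale: "\<phi> (sW c x) = c * \<phi> x" for x y c
      using \<phi>(1) by (simp_all add: Vector_Spaces.linear_iff)
    have zero: "\<phi> 0 = 0" using scale[of 0 0] by simp
    have b: "bilinear_map sU sV (*) (\<lambda>u v. \<phi> (F u v))"
      using vs k unfolding bilinear_map_def Vector_Spaces.linear_iff
      by (simp add: bilinear_mapD[OF F] add scale)
    have sum: "\<phi> (\<Sum>(u, v)\<leftarrow>rs. F u v) = (\<Sum>(u, v)\<leftarrow>rs. \<phi> (F u v))" for rs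
      by (induction rs) (auto simp: add zero)
    have "\<phi> w = \<phi> ?w"
      using fun_cong[OF eq, of "\<lambda>u v. \<phi> (F u v)"] unfolding w
      by (simp add: pure_tensor_sum_apply[OF b] sum)
    moreover have "\<phi> w = \<phi> (w - ?w) + \<phi> ?w" using add[of "w - ?w" ?w] by simp
    ultimately show False using \<phi>(2) by simp
  qed
qed

lemma tensor_lift_pure:
  "bilinear_map sU sV sW F \<Longrightarrow> tensor_lift sU sV F (pure_tensor sU sV u v) = F u v"
  using tensor_lift_sum[of sU sV sW F "[(u, v)]"] by simp

section \<open>Lie algebras\<close>

definition lie_algebra :: "('k::field \<Rightarrow> 'l::ab_group_add \<Rightarrow> 'l) \<Rightarrow> ('l \<Rightarrow> 'l \<Rightarrow> 'l) \<Rightarrow> bool" where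
  "lie_algebra s br \<longleftrightarrow>
     vector_space s \<and> bilinear_map s s s br \<and> (\<forall>x. br x x = 0) \<and>
     (\<forall>x y z. br x (br y z) + br y (br z x) + br z (br x y) = 0)"

text \<open>A Lie algebra carried by a subset of an additive group; addition is that of the type.\<close>

record ('k, 'l) lie_struct =
  lie_carrier :: "'l set"
  lie_scale :: "'k \<Rightarrow> 'l \<Rightarrow> 'l"
  lie_bracket :: "'l \<Rightarrow> 'l \<Rightarrow> 'l"

section \<open>Finite-dimensional representations\<close>

text \<open>A finite-dimensional representation is given in coordinates: \<open>(n, \<rho>)\<close> is a representation on
  the space of column vectors of length \<open>n\<close>.  The values of \<open>\<rho>\<close> outside the Lie algebra are
  irrelevant.\<close>

type_synonym ('k, 'l) rep = "nat \<times> ('l \<Rightarrow> 'k mat)"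

definition is_rep :: "('k::field, 'l::ab_group_add) lie_struct \<Rightarrow> ('k, 'l) rep \<Rightarrow> bool" where
  "is_rep L \<pi> \<longleftrightarrow> (case \<pi> of (n, \<rho>) \<Rightarrow>
     (\<forall>x\<in>lie_carrier L. \<rho> x \<in> carrier_mat n n) \<and>
     (\<forall>x\<in>lie_carrier L. \<forall>y\<in>lie_carrier L. \<rho> (x + y) = \<rho> x + \<rho> y) \<and>
     (\<forall>c. \<forall>x\<in>lie_carrier L. \<rho> (lie_scale L c x) = c \<cdot>\<^sub>m \<rho> x) \<and>
     (\<forall>x\<in>lie_carrier L. \<forall>y\<in>lie_carrier L.
        \<rho> (lie_bracket L x y) = \<rho> x * \<rho> y - \<rho> y * \<rho> x))"

definition irreducible_rep :: "('k::field, 'l::ab_group_add) lie_struct \<Rightarrow> ('k, 'l) rep \<Rightarrow> bool" where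
  "irreducible_rep L \<pi> \<longleftrightarrow> is_rep L \<pi> \<and> (case \<pi> of (n, \<rho>) \<Rightarrow>
     n > 0 \<and>
     (\<forall>W. VectorSpace.subspace class_ring W (module_vec TYPE('k) n) \<and>
          (\<forall>x\<in>lie_carrier L. \<forall>w\<in>W. \<rho> x *\<^sub>v w \<in> W) \<longrightarrow>
          W = {0\<^sub>v n} \<or> W = carrier_vec n))"

definition rep_iso :: "('k::field, 'l) lie_struct \<Rightarrow> ('k, 'l) rep \<Rightarrow> ('k, 'l) rep \<Rightarrow> bool" where
  "rep_iso L \<pi> \<tau> \<longleftrightarrow> (case (\<pi>, \<tau>) of ((n, \<rho>), (m, \<sigma>)) \<Rightarrow>
     n = m \<and>
     (\<exists>P\<in>carrier_mat n n. invertible_mat P \<and> (\<forall>x\<in>lie_carrier L. P * \<rho> x = \<sigma> x * P)))"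

definition iso_class :: "('k::field, 'l::ab_group_add) lie_struct \<Rightarrow> ('k, 'l) rep \<Rightarrow> ('k, 'l) rep set" where
  "iso_class L \<pi> = {\<tau>. is_rep L \<tau> \<and> rep_iso L \<pi> \<tau>}"

definition irr_classes :: "('k::field, 'l::ab_group_add) lie_struct \<Rightarrow> ('k, 'l) rep set set" where
  "irr_classes L = iso_class L ` {\<pi>. irreducible_rep L \<pi>}"

definition class_dim :: "('k, 'l) rep set \<Rightarrow> nat" where
  "class_dim C = (THE n. \<exists>\<pi>\<in>C. fst \<pi> = n)"

definition trivial_rep :: "('k::field, 'l) rep" where
  "trivial_rep = (1, \<lambda>x. 0\<^sub>m 1 1)"

definition pull_rep :: "('h \<Rightarrow> 'l) \<Rightarrow> ('k, 'l) rep \<Rightarrow> ('k, 'h) rep" where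
  "pull_rep f \<pi> = (fst \<pi>, \<lambda>x. snd \<pi> (f x))"

text \<open>The Kronecker product: the matrix of the tensor product of two linear maps.\<close>

definition kronecker :: "'k::field mat \<Rightarrow> 'k mat \<Rightarrow> 'k mat" where
  "kronecker A B = mat (dim_row A * dim_row B) (dim_col A * dim_col B)
     (\<lambda>(i, j). A $$ (i div dim_row B, j div dim_col B) * B $$ (i mod dim_row B, j mod dim_col B))"

definition tensor_rep :: "('k::field, 'l) rep \<Rightarrow> ('k, 'l) rep \<Rightarrow> ('k, 'l) rep" where
  "tensor_rep \<pi> \<tau> = (case (\<pi>, \<tau>) of ((n, \<rho>), (m, \<sigma>)) \<Rightarrow>
     (n * m, \<lambda>x. kronecker (\<rho> x) (1\<^sub>m m) + kronecker (1\<^sub>m n) (\<sigma> x)))"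

text \<open>Up to isomorphism a tensor product depends only on the classes of its factors, so all members
  of the following union are the same class.\<close>

definition class_tensor ::
  "('k::field, 'l::ab_group_add) lie_struct \<Rightarrow> ('k, 'l) rep set \<Rightarrow> ('k, 'l) rep set \<Rightarrow> ('k, 'l) rep set"
where
  "class_tensor L C C' = (\<Union>\<pi>\<in>C. \<Union>\<tau>\<in>C'. iso_class L (tensor_rep \<pi> \<tau>))"

definition derived :: "('k::field, 'l::ab_group_add) lie_struct \<Rightarrow> 'l set" where
  "derived L = Modules.module.span (lie_scale L)
     {lie_bracket L x y | x y. x \<in> lie_carrier L \<and> y \<in> lie_carrier L}"

text \<open>The dual of \<open>L / [L, L]\<close>, as linear forms on \<open>L\<close> vanishing on \<open>[L, L]\<close>.  The forms are
  undefined outside the carrier, so that equality of forms is equality on the carrier.\<close>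

definition abelian_dual :: "('k::field, 'l::ab_group_add) lie_struct \<Rightarrow> ('l \<Rightarrow> 'k) set" where
  "abelian_dual L = {l \<in> extensional (lie_carrier L).
     (\<forall>x\<in>lie_carrier L. \<forall>y\<in>lie_carrier L. l (x + y) = l x + l y) \<and>
     (\<forall>c. \<forall>x\<in>lie_carrier L. l (lie_scale L c x) = c * l x) \<and>
     (\<forall>x\<in>derived L. l x = 0)}"

definition zero_form :: "('k::field, 'l) lie_struct \<Rightarrow> 'l \<Rightarrow> 'k" where
  "zero_form L = (\<lambda>x\<in>lie_carrier L. 0)"

definition diff_form :: "('k::field, 'l) lie_struct \<Rightarrow> ('l \<Rightarrow> 'k) \<Rightarrow> ('l \<Rightarrow> 'k) \<Rightarrow> 'l \<Rightarrow> 'k" where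
  "diff_form L l m = (\<lambda>x\<in>lie_carrier L. l x - m x)"

definition form_class :: "('k::field, 'l::ab_group_add) lie_struct \<Rightarrow> ('l \<Rightarrow> 'k) \<Rightarrow> ('k, 'l) rep set" where
  "form_class L l = iso_class L (1, \<lambda>x. mat 1 1 (\<lambda>_. l x))"

text \<open>The linear form corresponding to a class of one-dimensional representations.\<close>

definition class_form :: "('k::field, 'l::ab_group_add) lie_struct \<Rightarrow> ('k, 'l) rep set \<Rightarrow> 'l \<Rightarrow> 'k" where
  "class_form L C = (THE l. l \<in> abelian_dual L \<and> form_class L l = C)"

section \<open>The equivariant data\<close>

text \<open>A finite group \<open>\<Gamma>\<close> acting on \<open>X = Spec A\<close> and on \<open>\<gg>\<close>.  An action on the affine scheme \<open>X\<close> over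
  \<open>k\<close> is given by the corresponding action \<open>g \<cdot> f = f \<circ> g\<^sup>-\<^sup>1\<close> on \<open>A\<close> by algebra automorphisms.  The unit
  of \<open>A\<close> is a separate component, not that of a type class, in order to allow the zero algebra.\<close>

record ('c, 'k, 'a, 'g) equivariant_data =
  grp :: "'c monoid"
  unitA :: 'a
  scaleA :: "'k \<Rightarrow> 'a \<Rightarrow> 'a"
  actA :: "'c \<Rightarrow> 'a \<Rightarrow> 'a"
  scaleg :: "'k \<Rightarrow> 'g \<Rightarrow> 'g"
  brg :: "'g \<Rightarrow> 'g \<Rightarrow> 'g"
  actg :: "'c \<Rightarrow> 'g \<Rightarrow> 'g"

definition equivariant_setting ::
  "('c, 'k::field, 'a::comm_ring, 'g::ab_group_add) equivariant_data \<Rightarrow> bool"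
where
  "equivariant_setting D \<longleftrightarrow>
     group (grp D) \<and> finite (carrier (grp D)) \<and>
     bilinear_map (scaleA D) (scaleA D) (scaleA D) (*) \<and> (\<forall>f. unitA D * f = f) \<and>
     lie_algebra (scaleg D) (brg D) \<and>
     (\<exists>B. finite_dimensional_vector_space (scaleg D) B) \<and>
     group_action (grp D) UNIV (actA D) \<and>
     (\<forall>g\<in>carrier (grp D). Vector_Spaces.linear (scaleA D) (scaleA D) (actA D g) \<and>
        (\<forall>f h. actA D g (f * h) = actA D g f * actA D g h) \<and> actA D g (unitA D) = unitA D) \<and>
     group_action (grp D) UNIV (actg D) \<and>
     (\<forall>g\<in>carrier (grp D). Vector_Spaces.linear (scaleg D) (scaleg D) (actg D g) \<and>
        (\<forall>u v. actg D g (brg D u v) = brg D (actg D g u) (actg D g v)))"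

abbreviation ptens :: "('c, 'k::field, 'a::comm_ring, 'g::ab_group_add) equivariant_data \<Rightarrow>
  'g \<Rightarrow> 'a \<Rightarrow> ('k, 'g, 'a) tens" where
  "ptens D \<equiv> pure_tensor (scaleg D) (scaleA D)"

abbreviation tlift :: "('c, 'k::field, 'a::comm_ring, 'g::ab_group_add) equivariant_data \<Rightarrow>
  ('g \<Rightarrow> 'a \<Rightarrow> 'w::ab_group_add) \<Rightarrow> ('k, 'g, 'a) tens \<Rightarrow> 'w" where
  "tlift D \<equiv> tensor_lift (scaleg D) (scaleA D)"

definition tens_bracket :: "('c, 'k::field, 'a::comm_ring, 'g::ab_group_add) equivariant_data \<Rightarrow>
  ('k, 'g, 'a) tens \<Rightarrow> ('k, 'g, 'a) tens \<Rightarrow> ('k, 'g, 'a) tens" where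
  "tens_bracket D s t = tlift D (\<lambda>u f. tlift D (\<lambda>v h. ptens D (brg D u v) (f * h)) t) s"

lemma equivariant_setting_vs:
  assumes "equivariant_setting D"
  shows "vector_space (scaleg D)" "vector_space (scaleA D)"
  using assms unfolding equivariant_setting_def lie_algebra_def bilinear_map_def Vector_Spaces.linear_iff
  by auto

lemma tens_bracket_pure:
  assumes D: "equivariant_setting D"
  shows "tens_bracket D (ptens D u f) (ptens D v h) = ptens D (brg D u v) (f * h)"
proof -
  note vs = equivariant_setting_vs[OF D]
  note pt = bilinear_pure_tensor[OF vs]
  have br: "bilinear_map (scaleg D) (scaleg D) (scaleg D) (brg D)"
    and mult: "bilinear_map (scaleA D) (scaleA D) (scaleA D) (*)"
    using D by (auto simp: equivariant_setting_def lie_algebra_def)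
  have vst: "vector_space (tens_scale :: _ \<Rightarrow> ('b, 'd, 'c) tens \<Rightarrow> _)"
    using pt by (auto simp: bilinear_map_def Vector_Spaces.linear_iff)
  note rules = bilinear_mapD[OF pt] bilinear_mapD[OF br] bilinear_mapD[OF mult]
  have inner: "bilinear_map (scaleg D) (scaleA D) tens_scale (\<lambda>v h. ptens D (brg D u v) (f * h))"
    for u f
    using vs vst unfolding bilinear_map_def Vector_Spaces.linear_iff by (simp add: rules)
  have outer: "bilinear_map (scaleg D) (scaleA D) tens_scale (\<lambda>u f. ptens D (brg D u v) (f * h))"
    using vs vst unfolding bilinear_map_def Vector_Spaces.linear_iff by (simp add: rules)
  show ?thesis
    unfolding tens_bracket_def by (simp add: tensor_lift_pure[OF inner] tensor_lift_pure[OF outer])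
qed
definition tens_act :: "('c, 'k::field, 'a::comm_ring, 'g::ab_group_add) equivariant_data \<Rightarrow>
  'c \<Rightarrow> ('k, 'g, 'a) tens \<Rightarrow> ('k, 'g, 'a) tens" where
  "tens_act D g = tlift D (\<lambda>u f. ptens D (actg D g u) (actA D g f))"

definition map_alg :: "('c, 'k::field, 'a::comm_ring, 'g::ab_group_add) equivariant_data \<Rightarrow>
  ('k, ('k, 'g, 'a) tens) lie_struct" where
  "map_alg D = \<lparr>
     lie_carrier = {t \<in> tensor_space (scaleg D) (scaleA D). \<forall>g\<in>carrier (grp D). tens_act D g t = t},
     lie_scale = tens_scale,
     lie_bracket = tens_bracket D\<rparr>"

section \<open>Rational points and evaluation\<close>

text \<open>A \<open>k\<close>-rational point of \<open>Spec A\<close> is a \<open>k\<close>-algebra homomorphism \<open>x : A \<rightarrow> k\<close>; thus \<open>x f\<close> is the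
  value of \<open>f\<close> at \<open>x\<close>.\<close>

definition rat_points :: "('c, 'k::field, 'a::comm_ring, 'g) equivariant_data \<Rightarrow> ('a \<Rightarrow> 'k) set" where
  "rat_points D = {x. Vector_Spaces.linear (scaleA D) (*) x \<and>
     (\<forall>f h. x (f * h) = x f * x h) \<and> x (unitA D) = 1}"

text \<open>\<open>f(g \<cdot> x) = (g\<^sup>-\<^sup>1 \<cdot> f)(x)\<close>\<close>

definition point_act :: "('c, 'k, 'a, 'g) equivariant_data \<Rightarrow> 'c \<Rightarrow> ('a \<Rightarrow> 'k) \<Rightarrow> 'a \<Rightarrow> 'k" where
  "point_act D g x = x \<circ> actA D (inv\<^bsub>grp D\<^esub> g)"

definition fix_alg :: "('c, 'k, 'a, 'g) equivariant_data \<Rightarrow> ('a \<Rightarrow> 'k) \<Rightarrow> ('k, 'g) lie_struct" where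
  "fix_alg D x = \<lparr>
     lie_carrier = {u. \<forall>g\<in>stabilizer (grp D) (point_act D) x. actg D g u = u},
     lie_scale = scaleg D,
     lie_bracket = brg D\<rparr>"

definition value_at :: "('c, 'k::field, 'a::comm_ring, 'g::ab_group_add) equivariant_data \<Rightarrow>
  ('a \<Rightarrow> 'k) \<Rightarrow> ('k, 'g, 'a) tens \<Rightarrow> 'g" where
  "value_at D x = tlift D (\<lambda>u f. scaleg D (x f) u)"

lemma value_at_sum:
  assumes D: "equivariant_setting D" and x: "x \<in> rat_points D"
  shows "value_at D x (\<Sum>(u, f)\<leftarrow>ps. ptens D u f) = (\<Sum>(u, f)\<leftarrow>ps. scaleg D (x f) u)"
proof -
  interpret g: vector_space "scaleg D" by (rule equivariant_setting_vs[OF D])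
  have "bilinear_map (scaleg D) (scaleA D) (scaleg D) (\<lambda>u f. scaleg D (x f) u)"
    using x equivariant_setting_vs[OF D] unfolding bilinear_map_def rat_points_def Vector_Spaces.linear_iff
    by (auto simp: g.scale_right_distrib g.scale_left_distrib mult.commute)
  then show ?thesis unfolding value_at_def by (rule tensor_lift_sum)
qed

text \<open>The tensor product representation of a finite direct sum of Lie algebras, whose elements are
  families indexed by the points in the list \<open>xs\<close>; the list fixes the order of the tensor factors.\<close>

definition outer_tensor_rep :: "'x list \<Rightarrow> ('x \<Rightarrow> ('k::field, 'l) rep) \<Rightarrow> ('k, 'x \<Rightarrow> 'l) rep" where
  "outer_tensor_rep xs \<rho> =
     foldr (\<lambda>x \<pi>. tensor_rep (pull_rep (\<lambda>v. v x) (\<rho> x)) \<pi>) xs trivial_rep"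

definition eval_rep :: "('c, 'k::field, 'a::comm_ring, 'g::ab_group_add) equivariant_data \<Rightarrow>
  ('a \<Rightarrow> 'k) list \<Rightarrow> (('a \<Rightarrow> 'k) \<Rightarrow> ('k, 'g) rep) \<Rightarrow> ('k, ('k, 'g, 'a) tens) rep" where
  "eval_rep D xs \<rho> = pull_rep (\<lambda>t x. value_at D x t) (outer_tensor_rep xs \<rho>)"

definition evaluation_representation ::
  "('c, 'k::field, 'a::comm_ring, 'g::ab_group_add) equivariant_data \<Rightarrow>
   ('k, ('k, 'g, 'a) tens) rep \<Rightarrow> bool" where
  "evaluation_representation D \<pi> \<longleftrightarrow>
     (\<exists>xs \<rho>. distinct xs \<and> set xs \<subseteq> rat_points D \<and> (\<forall>x\<in>set xs. is_rep (fix_alg D x) (\<rho> x)) \<and>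
             \<pi> = eval_rep D xs \<rho>)"

section \<open>The classes \<open>ev\<^sub>\<Psi>\<close>\<close>

definition zero_class :: "('c, 'k::field, 'a, 'g::ab_group_add) equivariant_data \<Rightarrow>
  ('a \<Rightarrow> 'k) \<Rightarrow> ('k, 'g) rep set" where
  "zero_class D x = iso_class (fix_alg D x) trivial_rep"

text \<open>\<open>g \<cdot> [\<rho>] = [\<rho> \<circ> g\<^sup>-\<^sup>1]\<close>.  As \<open>g\<close> acts bijectively, the image of a full isomorphism class is again
  a full isomorphism class.\<close>

definition class_act :: "('c, 'k, 'a, 'g) equivariant_data \<Rightarrow> 'c \<Rightarrow> ('k, 'g) rep set \<Rightarrow> ('k, 'g) rep set" where
  "class_act D g C = pull_rep (actg D (inv\<^bsub>grp D\<^esub> g)) ` C"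

definition supp :: "('c, 'k::field, 'a::comm_ring, 'g::ab_group_add) equivariant_data \<Rightarrow>
  (('a \<Rightarrow> 'k) \<Rightarrow> ('k, 'g) rep set) \<Rightarrow> ('a \<Rightarrow> 'k) set" where
  "supp D \<Psi> = {x \<in> rat_points D. \<Psi> x \<noteq> zero_class D x}"

definition equivariant_classes :: "('c, 'k::field, 'a::comm_ring, 'g::ab_group_add) equivariant_data \<Rightarrow>
  (('a \<Rightarrow> 'k) \<Rightarrow> ('k, 'g) rep set) set" where
  "equivariant_classes D = {\<Psi> \<in> (\<Pi>\<^sub>E x\<in>rat_points D. irr_classes (fix_alg D x)).
     finite (supp D \<Psi>) \<and>
     (\<forall>g\<in>carrier (grp D). \<forall>x\<in>rat_points D. \<Psi> (point_act D g x) = class_act D g (\<Psi> x))}"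

definition zero_fun_class :: "('c, 'k::field, 'a::comm_ring, 'g::ab_group_add) equivariant_data \<Rightarrow>
  ('a \<Rightarrow> 'k) \<Rightarrow> ('k, 'g) rep set" where
  "zero_fun_class D = (\<lambda>x\<in>rat_points D. zero_class D x)"

definition tensor_fun_class :: "('c, 'k::field, 'a::comm_ring, 'g::ab_group_add) equivariant_data \<Rightarrow>
  (('a \<Rightarrow> 'k) \<Rightarrow> ('k, 'g) rep set) \<Rightarrow> (('a \<Rightarrow> 'k) \<Rightarrow> ('k, 'g) rep set) \<Rightarrow>
  ('a \<Rightarrow> 'k) \<Rightarrow> ('k, 'g) rep set" where
  "tensor_fun_class D \<Psi> \<Phi> = (\<lambda>x\<in>rat_points D. class_tensor (fix_alg D x) (\<Psi> x) (\<Phi> x))"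

definition orbit_transversal :: "('c, 'k::field, 'a::comm_ring, 'g::ab_group_add) equivariant_data \<Rightarrow>
  (('a \<Rightarrow> 'k) \<Rightarrow> ('k, 'g) rep set) \<Rightarrow> ('a \<Rightarrow> 'k) list \<Rightarrow> bool" where
  "orbit_transversal D \<Psi> xs \<longleftrightarrow> distinct xs \<and> set xs \<subseteq> supp D \<Psi> \<and>
     (\<forall>x\<in>supp D \<Psi>. \<exists>!y. y \<in> set xs \<inter> orbit (grp D) (point_act D) x)"

text \<open>The isomorphism class does not depend on the transversal, its order, or the representatives of
  the classes \<open>\<Psi> x\<close>, so all members of the following union are the same class.\<close>

definition ev_class :: "('c, 'k::field, 'a::comm_ring, 'g::ab_group_add) equivariant_data \<Rightarrow>
  (('a \<Rightarrow> 'k) \<Rightarrow> ('k, 'g) rep set) \<Rightarrow> ('k, ('k, 'g, 'a) tens) rep set" where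
  "ev_class D \<Psi> = \<Union>{iso_class (map_alg D) (eval_rep D xs \<rho>) | xs \<rho>.
     orbit_transversal D \<Psi> xs \<and> (\<forall>x\<in>set xs. \<rho> x \<in> \<Psi> x)}"

definition form_tensor_ev :: "('c, 'k::field, 'a::comm_ring, 'g::ab_group_add) equivariant_data \<Rightarrow>
  (('k, 'g, 'a) tens \<Rightarrow> 'k) \<Rightarrow> (('a \<Rightarrow> 'k) \<Rightarrow> ('k, 'g) rep set) \<Rightarrow>
  ('k, ('k, 'g, 'a) tens) rep set" where
  "form_tensor_ev D l \<Psi> = class_tensor (map_alg D) (form_class (map_alg D) l) (ev_class D \<Psi>)"

end

theory Submission
  imports Defs "Jordan_Normal_Form.Char_Poly"
begin

text \<open>
  Let \<open>M\<close> be the Lie algebra of equivariant maps and \<open>R\<close> the ring of invariant functions.  The proof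
  below stays within linear algebra over \<open>M\<close> and \<open>R\<close>: it rests on Schur's lemma, on traces of nilpotent
  matrices and on the integrality of \<open>A\<close> over \<open>R\<close>, and not on the structure theory of Lie algebras.

  \<^emph>\<open>Twisting.\<close>  Subtracting the form \<open>trace / n\<close> from an irreducible representation leaves an irreducible
  representation \<open>\<rho>\<close> by matrices of trace zero (lemma \<open>traceless_twist\<close>).  Let \<open>K\<close> be its kernel.  An ideal \<open>E\<close>
  with \<open>\<rho> [E, E] = 0\<close> lies in \<open>K\<close> (lemma \<open>irr_no_abelian_ideal\<close>): its elements have a single eigenvalue, which
  is \<open>0\<close> because of the trace, so they act as commuting nilpotent matrices and their common kernel is
  everything.  Hence \<open>M / K\<close> has no nonzero abelian ideals, and it follows that \<open>R K \<subseteq> K\<close>.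

  \<^emph>\<open>Finitely many points suffice.\<close>  The core is \<open>factors_through_evaluation\<close>: \<open>K\<close> contains the ideal
  \<open>ker_eval xs\<close> of the maps that vanish at the points of some finite list \<open>xs\<close>, taken from distinct orbits.  If the image of
  \<open>ker_eval xs\<close> in the finite-dimensional algebra \<open>M / K\<close> is not zero, it contains a minimal ideal
  \<open>E / K\<close>.  This ideal is perfect, so that \<open>R\<close> acts on it, and \<open>R\<close> acts by a character \<open>\<chi>\<close> because it is minimal.  As \<open>A\<close>
  is integral over \<open>R\<close>, there is a rational point \<open>x\<close> that induces \<open>\<chi>\<close> (lemma \<open>lying_over\<close>).  Adding \<open>x\<close> to
  \<open>xs\<close> makes the image smaller: otherwise every element of \<open>E\<close> is congruent modulo \<open>K\<close> to a map vanishing on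
  the orbit of \<open>x\<close>.  Finitely many coefficients occur in such maps, and they are nilpotent modulo the ideal of
  \<open>A\<close> generated by the kernel of \<open>\<chi>\<close>.  Perfectness of \<open>E / K\<close> permits to raise them to powers, so \<open>E\<close> is congruent
  to maps with coefficients in that ideal, and then \<open>[E, E] \<subseteq> K\<close>, a contradiction.

  \<^emph>\<open>Decomposition.\<close>  Evaluation at points of distinct orbits is onto the direct sum of the isotropy algebras
  (lemma \<open>eval_surjective_at\<close>).  An irreducible representation of a sum of two commuting ideals is a tensor product
  (lemma \<open>decompose_rep\<close>), so an irreducible representation that vanishes on \<open>ker_eval xs\<close> is an evaluation
  representation (lemma \<open>evaluation_decomposition\<close>).  Its factors are carried along the orbits by the group to give an
  element of \<open>\<E>\<close> (lemma \<open>extend_classes\<close>).  This proves surjectivity.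

  \<^emph>\<open>Uniqueness.\<close>  The class \<open>ev\<^sub>\<Psi>\<close> can be computed from any list of points in distinct orbits that covers the
  support (lemma \<open>ev_class_eq\<close>), so that two families can be compared on a common list \<open>xs\<close>.  If
  \<open>\<lambda> \<otimes> ev\<^sub>\<Psi> = \<lambda>' \<otimes> ev\<^sub>\<Psi>'\<close>, then \<open>\<lambda> - \<lambda>'\<close> vanishes on \<open>ker_eval xs\<close> and is therefore a sum of linear forms on the
  isotropy algebras, that is, of the form \<open>ev\<^sub>\<Phi>\<close> (lemma \<open>form_vanishing_on_kernel_is_ev\<close>).  Finally, the factor of an
  evaluation representation at \<open>x\<close> is recovered by restriction to the maps that vanish at all other points
  (lemma \<open>eval_rep_determines_factors\<close>), which gives the injectivity in \<open>\<Psi>\<close>.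
\<close>

section \<open>Subspaces and injective matrices\<close>

abbreviation Mat :: "nat => nat => 'k mat set" where "Mat \<equiv> carrier_mat"
abbreviation Vec :: "nat => 'k vec set" where "Vec \<equiv> carrier_vec"
abbreviation carr :: "('k, 'l) lie_struct => 'l set" where "carr \<equiv> lie_carrier"
abbreviation kron :: "'k::field mat => 'k mat => 'k mat" where "kron \<equiv> kronecker"
abbreviation irrep :: "('k::field, 'l::ab_group_add) lie_struct => ('k, 'l) rep => bool" where "irrep \<equiv> irreducible_rep"
abbreviation tensor :: "('k::field, 'l) rep => ('k, 'l) rep => ('k, 'l) rep" where "tensor \<equiv> tensor_rep"
lemmas one_Mat = one_carrier_mat

definition vsub :: "nat => 'k::field vec set => bool" where
 "vsub n W \<longleftrightarrow> W \<subseteq> Vec n & 0\<^sub>v n \<in> W & (\<forall>u\<in>W. \<forall>v\<in>W. u + v \<in> W) & (\<forall>c. \<forall>v\<in>W. c \<cdot>\<^sub>v v \<in> W)"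

lemma subspace_iff_vsub:
 "VectorSpace.subspace class_ring W (module_vec TYPE('k::field) n) \<longleftrightarrow> vsub n W"
 using vec_vs[where ?'a='k, of n]
 unfolding VectorSpace.subspace_def LinearCombinations.submodule_def vsub_def
 by (auto simp: module_vec_def vectorspace_def)

definition mat_inj :: "'k::field mat => bool" where
 "mat_inj A \<longleftrightarrow> (\<forall>v\<in>Vec (dim_col A). A *\<^sub>v v = 0\<^sub>v (dim_row A) \<longrightarrow> v = 0\<^sub>v (dim_col A))"

definition mat_im :: "'k::field mat => 'k vec set" where
 "mat_im A = (\<lambda>v. A *\<^sub>v v) ` Vec (dim_col A)"

lemma mat_assoc_dim:
 assumes "dim_col A = dim_row B" "dim_col B = dim_row C"
 shows "(A * B) * C = A * (B * (C :: 'k::field mat))"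
 by (rule assoc_mult_mat[of _ "dim_row A" "dim_col A" _ "dim_col B" _ "dim_col C"]) (use assms in auto)

lemma mat_vec_assoc_dim:
 assumes "dim_col A = dim_row B" "dim_col B = dim_vec v"
 shows "(A * B) *\<^sub>v v = A *\<^sub>v (B *\<^sub>v (v :: 'k::field vec))"
 by (rule assoc_mult_mat_vec[of _ "dim_row A" "dim_col A" _ "dim_col B"]) (use assms in "auto intro: carrier_vecI")

lemma mult_zero_vec [simp]: "m = dim_col A ==> A *\<^sub>v 0\<^sub>v m = (0\<^sub>v (dim_row A) :: 'k::field vec)"
 by (intro eq_vecI) auto

lemma zero_mult_vec [simp]: "dim_vec v = m ==> 0\<^sub>m n m *\<^sub>v v = (0\<^sub>v n :: 'k::field vec)"
 by (intro eq_vecI) (auto simp: scalar_prod_def)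

declare assoc_mult_mat [simp del] assoc_mult_mat_vec [simp del]

lemma smult_mult_mat_vec_right:
 assumes "A \<in> Mat n m" "v \<in> Vec m"
 shows "A *\<^sub>v ((c::'k::field) \<cdot>\<^sub>v v) = c \<cdot>\<^sub>v (A *\<^sub>v v)"
 using assms by (simp add: mult_mat_vec)

lemma smult_mult_mat_vec_left:
 assumes "A \<in> Mat n m" "v \<in> Vec m"
 shows "((c::'k::field) \<cdot>\<^sub>m A) *\<^sub>v v = c \<cdot>\<^sub>v (A *\<^sub>v v)"
 using assms by (intro eq_vecI) (auto simp: scalar_prod_def sum_distrib_left mult.assoc)

lemma mat_eq_by_vec:
 assumes "A \<in> Mat n m" "B \<in> Mat n m" "!!v. v \<in> Vec m ==> A *\<^sub>v v = B *\<^sub>v v"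
 shows "A = (B :: 'k::field mat)"
proof (rule eq_matI)
 fix i j assume ij: "i < dim_row B" "j < dim_col B"
 have "(A *\<^sub>v unit_vec m j) $ i = (B *\<^sub>v unit_vec m j) $ i" using assms(3)[of "unit_vec m j"] by simp
 thus "A $$ (i,j) = B $$ (i,j)" using assms(1,2) ij by auto
qed (use assms in auto)

lemma vsub_mat_im:
 assumes "A \<in> Mat n m" shows "vsub n (mat_im A)"
proof -
 have "\<exists>z\<in>Vec m. A *\<^sub>v x + A *\<^sub>v y = A *\<^sub>v z" if "x \<in> Vec m" "y \<in> Vec m" for x y
  using assms that by (intro bexI[of _ "x+y"]) (auto simp: mult_add_distrib_mat_vec)
 moreover have "\<exists>z\<in>Vec m. c \<cdot>\<^sub>v (A *\<^sub>v x) = A *\<^sub>v z" if "x \<in> Vec m" for x c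
  using assms that by (intro bexI[of _ "c \<cdot>\<^sub>v x"]) (auto simp: smult_mult_mat_vec_right)
 moreover have "\<exists>z\<in>Vec m. 0\<^sub>v n = A *\<^sub>v z"
  using assms by (intro bexI[of _ "0\<^sub>v m"]) auto
 ultimately show ?thesis
  using assms unfolding vsub_def mat_im_def by (auto simp: image_iff)
qed

text \<open>Padded with zero rows to a square, a matrix with more columns than rows has determinant zero.\<close>

lemma mat_inj_dim_le:
 assumes A: "A \<in> Mat n e" "mat_inj A" shows "e \<le> n"
proof (rule ccontr)
 assume ne: "\<not> e \<le> n"
 define B where "B = mat e e (\<lambda>(i,j). if i < n then A $$ (i,j) else 0)"
 have B: "B \<in> Mat e e" by (auto simp: B_def)
 have "B = mat\<^sub>r e e (\<lambda>i. if i = n then 0\<^sub>v e else row B i)"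
  using ne by (intro eq_matI) (auto simp: B_def)
 hence "det B = 0"
  using det_row_0[of n e "\<lambda>i. row B i"] ne B by auto
 then obtain v where v: "v \<in> Vec e" "v ~= 0\<^sub>v e" "B *\<^sub>v v = 0\<^sub>v e"
  using det_0_iff_vec_prod_zero_field[OF B] by auto
 have "A *\<^sub>v v = 0\<^sub>v n"
 proof (rule eq_vecI)
  fix i assume i: "i < dim_vec (0\<^sub>v n)"
  have "row A i = row B i" using i ne A by (intro eq_vecI) (auto simp: B_def)
  hence "(A *\<^sub>v v) $ i = (B *\<^sub>v v) $ i" using i ne A B by auto
  thus "(A *\<^sub>v v) $ i = 0\<^sub>v n $ i" using v i ne by auto
 qed (use A in auto)
 thus False using A v unfolding mat_inj_def by auto
qed

lemma mat_inj_inverse: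
 assumes A: "A \<in> Mat n n" "mat_inj A"
 obtains B where "B \<in> Mat n n" "A * B = 1\<^sub>m n" "B * A = 1\<^sub>m n"
proof -
 have "det A ~= 0"
  using det_0_iff_vec_prod_zero_field[OF A(1)] A unfolding mat_inj_def by auto
 from det_non_zero_imp_unit[OF A(1) this, of "()"] show ?thesis
  using that unfolding Units_def ring_mat_def by auto
qed

lemma invertible_matI:
 assumes "A \<in> Mat n n" "B \<in> Mat n n" "A * B = 1\<^sub>m n" "B * A = 1\<^sub>m n"
 shows "invertible_mat A"
 using assms unfolding invertible_mat_def inverts_mat_def by auto

lemma invertible_matE:
 assumes "invertible_mat (A::'k::field mat)" "A \<in> Mat n n"
 obtains B where "B \<in> Mat n n" "A * B = 1\<^sub>m n" "B * A = 1\<^sub>m n"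
proof -
 from assms obtain B where B: "A * B = 1\<^sub>m (dim_row A)" "B * A = 1\<^sub>m (dim_row B)"
  unfolding invertible_mat_def inverts_mat_def by auto
 have "dim_col (A * B) = n" "dim_col (B * A) = dim_row B" using B assms by auto
 hence "B \<in> Mat n n" using assms(2) by auto
 thus ?thesis using B assms that by auto
qed

lemma mat_inj_invertible:
 assumes "A \<in> Mat n n" "mat_inj A" shows "invertible_mat A"
 by (rule mat_inj_inverse[OF assms]) (use assms invertible_matI in blast)

lemma mat_inj_mult:
 assumes "A \<in> Mat n m" "B \<in> Mat m p" "mat_inj A" "mat_inj B"
 shows "mat_inj (A * B)"
 using assms unfolding mat_inj_def by (auto simp: assoc_mult_mat_vec)

lemma mat_inj_vec_eq:
 assumes "A \<in> Mat n m" "mat_inj A" "u \<in> Vec m" "v \<in> Vec m" "A *\<^sub>v u = A *\<^sub>v v"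
 shows "u = v"
proof -
 have "A *\<^sub>v (u - v) = 0\<^sub>v n"
  using assms by (simp add: mult_minus_distrib_mat_vec)
 hence "u - v = 0\<^sub>v m" using assms unfolding mat_inj_def by auto
 thus ?thesis using assms
  by (intro eq_vecI) (auto simp: vec_eq_iff)
qed

lemma mat_inj_cancel:
 assumes "A \<in> Mat n m" "mat_inj A" "X \<in> Mat m p" "Y \<in> Mat m p" "A * X = A * Y"
 shows "X = Y"
proof (rule mat_eq_by_vec[of _ m p])
 fix v :: "'a vec" assume v: "v \<in> Vec p"
 have "A *\<^sub>v (X *\<^sub>v v) = A *\<^sub>v (Y *\<^sub>v v)"
  using arg_cong[OF assms(5), of "\<lambda>M. M *\<^sub>v v"] assms(1,3,4) v by (simp add: mat_vec_assoc_dim)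
 thus "X *\<^sub>v v = Y *\<^sub>v v"
  by (rule mat_inj_vec_eq[OF assms(1,2) mult_mat_vec_carrier[OF assms(3) v] mult_mat_vec_carrier[OF assms(4) v]])
qed (use assms in auto)

lemma factor_through_mat_im:
 assumes B: "B \<in> Mat n e" and C: "C \<in> Mat n m"
  and im: "!!v. v \<in> Vec m ==> C *\<^sub>v v \<in> mat_im B"
 obtains X where "X \<in> Mat e m" "C = B * X"
proof -
 have "\<exists>x. x \<in> Vec e & C *\<^sub>v unit_vec m j = B *\<^sub>v x" if "j < m" for j
  using im[of "unit_vec m j"] B unfolding mat_im_def by auto
 then obtain x where x: "x j \<in> Vec e" "C *\<^sub>v unit_vec m j = B *\<^sub>v x j" if "j < m" for j
  by metis
 define X where "X = mat e m (\<lambda>(i,j). x j $ i)"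
 have "C = B * X"
 proof (rule eq_matI)
  fix i j assume ij: "i < dim_row (B * X)" "j < dim_col (B * X)"
  hence j: "j < m" by (auto simp: X_def)
  have "col X j = x j" using x(1)[OF j] j by (intro eq_vecI) (auto simp: X_def)
  hence "(B * X) $$ (i,j) = (B *\<^sub>v x j) $ i" using ij by auto
  also have "... = C $$ (i,j)" unfolding x(2)[OF j, symmetric] using ij j B C by auto
  finally show "C $$ (i,j) = (B * X) $$ (i,j)" by simp
 qed (use B C in "auto simp: X_def")
 thus ?thesis using that[of X] by (auto simp: X_def)
qed

definition adjoin_cols :: "'k::field mat => 'k mat => 'k mat" where
 "adjoin_cols B C = mat (dim_row B) (dim_col B + dim_col C)
  (\<lambda>(i,j). if j < dim_col B then B $$ (i,j) else C $$ (i, j - dim_col B))"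

lemma adjoin_cols_carrier:
 "B \<in> Mat n e ==> C \<in> Mat n d ==> adjoin_cols B C \<in> Mat n (e + d)"
 by (auto simp: adjoin_cols_def)

lemma adjoin_cols_mult_vec:
 assumes "B \<in> Mat n e" "C \<in> Mat n d" "v \<in> Vec (e + d)"
 shows "adjoin_cols B C *\<^sub>v v = B *\<^sub>v vec e (($) v) + C *\<^sub>v vec d (\<lambda>i. v $ (e + i))"
proof (rule eq_vecI)
 fix i assume "i < dim_vec (B *\<^sub>v vec e (($) v) + C *\<^sub>v vec d (\<lambda>i. v $ (e + i)))"
 hence i: "i < n" using assms by auto
 have "(\<Sum>j = 0..<e + d. f j) = (\<Sum>j = 0..<e. f j) + (\<Sum>j = 0..<d. f (e + j))" for f :: "nat => 'a"
  using sum.atLeastLessThan_concat[of 0 e "e + d" f] sum.shift_bounds_nat_ivl[of f 0 e d]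
  by (simp add: add.commute)
 thus "(adjoin_cols B C *\<^sub>v v) $ i = (B *\<^sub>v vec e (($) v) + C *\<^sub>v vec d (\<lambda>i. v $ (e + i))) $ i"
  using assms i by (simp add: adjoin_cols_def scalar_prod_def)
qed (use assms in "auto simp: adjoin_cols_def")

lemma adjoin_cols_inj:
 assumes B: "B \<in> Mat n e" "mat_inj B" and C: "C \<in> Mat n d"
  and disj: "!!v. v \<in> Vec d ==> C *\<^sub>v v \<in> mat_im B ==> v = 0\<^sub>v d"
 shows "mat_inj (adjoin_cols B C)"
 unfolding mat_inj_def
proof (intro ballI impI)
 fix v assume v: "v \<in> Vec (dim_col (adjoin_cols B C))"
  "adjoin_cols B C *\<^sub>v v = 0\<^sub>v (dim_row (adjoin_cols B C))"
 have vc: "v \<in> Vec (e + d)" using v B C by (auto simp: adjoin_cols_def)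
 define x y where "x = vec e (($) v)" and "y = vec d (\<lambda>i. v $ (e + i))"
 have xy: "x \<in> Vec e" "y \<in> Vec d" by (auto simp: x_def y_def)
 have eq: "B *\<^sub>v x + C *\<^sub>v y = 0\<^sub>v n"
  using adjoin_cols_mult_vec[OF B(1) C vc] v(2) B by (auto simp: x_def y_def adjoin_cols_def)
 have "C *\<^sub>v y = B *\<^sub>v (- x)"
 proof (rule eq_vecI)
  fix i assume "i < dim_vec (B *\<^sub>v - x)"
  hence i: "i < n" using B by auto
  have "(B *\<^sub>v x + C *\<^sub>v y) $ i = 0" unfolding eq using i by simp
  thus "(C *\<^sub>v y) $ i = (B *\<^sub>v - x) $ i" using i B C xy
   by (simp add: add_eq_0_iff)
 qed (use B C in auto)
 hence y0: "y = 0\<^sub>v d" using xy B by (intro disj) (auto simp: mat_im_def)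
 hence "B *\<^sub>v x = 0\<^sub>v n" using eq B C xy by (auto simp: right_zero_vec)
 hence x0: "x = 0\<^sub>v e" using B xy unfolding mat_inj_def by auto
 have "v = 0\<^sub>v (e + d)"
 proof (rule eq_vecI)
  fix i assume i: "i < dim_vec (0\<^sub>v (e + d) :: 'a vec)"
  show "v $ i = 0\<^sub>v (e + d) $ i"
  proof (cases "i < e")
   case True
   hence "v $ i = x $ i" by (simp add: x_def)
   thus ?thesis using x0 True by simp
  next
   case False
   hence "v $ i = y $ (i - e)" using i by (auto simp: y_def)
   moreover have "i - e < d" using False i by auto
   ultimately show ?thesis using y0 False i by simp
  qed
 qed (use vc in auto)
 thus "v = 0\<^sub>v (dim_col (adjoin_cols B C))" using B C by (auto simp: adjoin_cols_def)
qed

text \<open>An injective matrix with image inside \<open>W\<close> and as many columns as possible has image \<open>W\<close>, since a vector of \<open>W\<close>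
  outside the image could be adjoined as a further column.  In this way invariant subspaces become intertwining matrices.\<close>

lemma vsub_basis:
 assumes W: "vsub n W"
 obtains e B where "B \<in> Mat n e" "mat_inj B" "mat_im B = W"
proof -
 define P where "P e \<longleftrightarrow> (\<exists>B\<in>Mat n e. mat_inj B & mat_im B \<subseteq> W)" for e
 have P0: "P 0"
  unfolding P_def
 proof (intro bexI conjI)
  show "(0\<^sub>m n 0 :: 'a mat) \<in> Mat n 0" by auto
  show "mat_inj (0\<^sub>m n 0 :: 'a mat)" by (auto simp: mat_inj_def)
  show "mat_im (0\<^sub>m n 0 :: 'a mat) \<subseteq> W" using W by (auto simp: mat_im_def vsub_def)
 qed
 have bound: "P e ==> e \<le> n" for e unfolding P_def using mat_inj_dim_le by blast
 define e where "e = (GREATEST e. P e)"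
 have Pe: "P e" unfolding e_def by (rule GreatestI_nat[of P 0 n]) (use P0 bound in auto)
 have max: "P e' ==> e' \<le> e" for e' unfolding e_def by (rule Greatest_le_nat[of P _ n]) (use bound in auto)
 from Pe obtain B where B: "B \<in> Mat n e" "mat_inj B" "mat_im B \<subseteq> W" unfolding P_def by auto
 have "W \<subseteq> mat_im B"
 proof (rule ccontr)
  assume "\<not> W \<subseteq> mat_im B"
  then obtain w where w: "w \<in> W" "w \<notin> mat_im B" by auto
  have wc: "w \<in> Vec n" using w W by (auto simp: vsub_def)
  define C where "C = mat n 1 (\<lambda>(i,j). w $ i)"
  have C: "C \<in> Mat n 1" by (auto simp: C_def)
  have Cv: "C *\<^sub>v v = (v $ 0) \<cdot>\<^sub>v w" if "v \<in> Vec 1" for v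
   using that wc by (intro eq_vecI) (auto simp: C_def scalar_prod_def)
  have imB: "vsub n (mat_im B)" by (rule vsub_mat_im[OF B(1)])
  have "v = 0\<^sub>v 1" if v: "v \<in> Vec 1" "C *\<^sub>v v \<in> mat_im B" for v
  proof (rule ccontr)
   assume "v ~= 0\<^sub>v 1"
   hence "v $ 0 ~= 0" using v by (auto simp: vec_eq_iff)
   moreover have "(1 / v $ 0) \<cdot>\<^sub>v ((v $ 0) \<cdot>\<^sub>v w) \<in> mat_im B"
    using imB v Cv unfolding vsub_def by auto
   ultimately show False using w by (simp add: smult_smult_assoc)
  qed
  hence inj: "mat_inj (adjoin_cols B C)" by (rule adjoin_cols_inj[OF B(1,2) C])
  have "adjoin_cols B C *\<^sub>v v \<in> W" if "v \<in> Vec (e + 1)" for v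
  proof -
   have "B *\<^sub>v vec e (($) v) \<in> W" using B by (auto simp: mat_im_def)
   moreover have "C *\<^sub>v vec 1 (\<lambda>i. v $ (e + i)) \<in> W" using Cv[of "vec 1 (\<lambda>i. v $ (e + i))"] w W
    by (auto simp: vsub_def)
   ultimately show ?thesis using adjoin_cols_mult_vec[OF B(1) C that] W by (auto simp: vsub_def)
  qed
  hence "mat_im (adjoin_cols B C) \<subseteq> W" using adjoin_cols_carrier[OF B(1) C] by (auto simp: mat_im_def)
  hence "P (e + 1)" unfolding P_def using inj adjoin_cols_carrier[OF B(1) C] by auto
  thus False using max by fastforce
 qed
 thus ?thesis using that B by auto
qed

lemma mat_im_inj_eq_dim:
 assumes "B \<in> Mat n e" "mat_inj B" "B' \<in> Mat n e'" "mat_inj B'" "mat_im B \<subseteq> mat_im B'"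
 shows "e \<le> e'" "e = e' ==> mat_im B = mat_im B'"
proof -
 obtain X where X: "X \<in> Mat e' e" "B = B' * X"
  by (rule factor_through_mat_im[OF assms(3,1)]) (use assms in "auto simp: mat_im_def")
 have Xi: "mat_inj X"
  unfolding mat_inj_def
 proof (intro ballI impI)
  fix v assume v: "v \<in> Vec (dim_col X)" "X *\<^sub>v v = 0\<^sub>v (dim_row X)"
  hence "B *\<^sub>v v = B' *\<^sub>v (X *\<^sub>v v)" using X assms(3) by (simp add: mat_vec_assoc_dim)
  hence "B *\<^sub>v v = 0\<^sub>v n" using v X assms by auto
  thus "v = 0\<^sub>v (dim_col X)" using assms v X unfolding mat_inj_def by auto
 qed
 show "e \<le> e'" using mat_inj_dim_le[OF X(1) Xi] .
 assume e: "e = e'"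
 obtain Y where Y: "Y \<in> Mat e e" "X * Y = 1\<^sub>m e"
  using mat_inj_inverse[OF _ Xi] X e by metis
 have "B' *\<^sub>v v \<in> mat_im B" if v: "v \<in> Vec e'" for v
 proof -
  have "B *\<^sub>v (Y *\<^sub>v v) = B' *\<^sub>v (X *\<^sub>v (Y *\<^sub>v v))" using X Y(1) assms(3) v e by (simp add: mat_vec_assoc_dim)
  also have "X *\<^sub>v (Y *\<^sub>v v) = (X * Y) *\<^sub>v v" using X(1) Y(1) v e by (simp add: mat_vec_assoc_dim)
  finally have "B *\<^sub>v (Y *\<^sub>v v) = B' *\<^sub>v v" using Y v e by auto
  moreover have "Y *\<^sub>v v \<in> Vec (dim_col B)" using Y v e assms by auto
  ultimately show ?thesis unfolding mat_im_def by (metis imageI)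
 qed
 thus "mat_im B = mat_im B'" using assms by (auto simp: mat_im_def)
qed

lemma mat_im_square_inj:
 assumes "B \<in> Mat n n" "mat_inj B" shows "mat_im B = Vec n"
proof -
 have "mat_im B = mat_im (1\<^sub>m n)"
  by (rule mat_im_inj_eq_dim(2)[OF assms(1,2), of _ n]) (use assms in "auto simp: mat_im_def mat_inj_def")
 thus ?thesis by (auto simp: mat_im_def)
qed

lemma vsub_sum:
 assumes W: "vsub n W" and f: "!!i. i < (m::nat) ==> f i \<in> W"
 shows "vec n (\<lambda>r. \<Sum>i<m. c i * (f i $ r)) \<in> W"
 using f
proof (induction m)
 case 0
 have "vec n (\<lambda>r. 0) = (0\<^sub>v n :: 'a vec)" by auto
 thus ?case using W by (simp add: vsub_def)
next
 case (Suc m)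
 have "f m \<in> Vec n" using Suc.prems W by (auto simp: vsub_def)
 hence "vec n (\<lambda>r. \<Sum>i<Suc m. c i * (f i $ r)) = vec n (\<lambda>r. \<Sum>i<m. c i * (f i $ r)) + c m \<cdot>\<^sub>v f m"
  by (intro eq_vecI) auto
 thus ?case using Suc W by (auto simp: vsub_def)
qed

lemma vsub_units:
 assumes W: "vsub n W" and u: "!!i. i < n ==> unit_vec n i \<in> W"
 shows "W = Vec n"
proof -
 have "v \<in> W" if v: "v \<in> Vec n" for v
 proof -
  have "vec n (\<lambda>r. \<Sum>i<n. v $ i * (unit_vec n i $ r)) \<in> W" by (rule vsub_sum[OF W]) (use u in auto)
  moreover have "vec n (\<lambda>r. \<Sum>i<n. v $ i * (unit_vec n i $ r)) = v"
  proof (rule eq_vecI)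
   fix r assume r: "r < dim_vec v"
   have "(\<Sum>i<n. v $ i * (unit_vec n i $ r)) = (\<Sum>i<n. if i = r then v $ i else 0)"
    by (rule sum.cong) (use r v in auto)
   thus "vec n (\<lambda>r. \<Sum>i<n. v $ i * (unit_vec n i $ r)) $ r = v $ r"
    using r v by simp
  qed (use v in auto)
  ultimately show ?thesis by simp
 qed
 thus ?thesis using W by (auto simp: vsub_def)
qed

section \<open>Irreducible families of operators\<close>

text \<open>Irreducibility of a family of matrices that is indexed by a mere set.  It can be applied to a representation restricted to an
  ideal, or to the maps that vanish at some points.\<close>

definition irr_fam :: "nat => 'l set => ('l => 'k::field mat) => bool" where
 "irr_fam n S \<rho> \<longleftrightarrow> n > 0 & (\<forall>x\<in>S. \<rho> x \<in> Mat n n) &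
  (\<forall>W. vsub n W & (\<forall>x\<in>S. \<forall>w\<in>W. \<rho> x *\<^sub>v w \<in> W) \<longrightarrow> W = {0\<^sub>v n} \<or> W = Vec n)"

lemma irreducible_rep_iff:
 "irrep L (n, \<rho>) \<longleftrightarrow> is_rep L (n, \<rho>) & irr_fam n (carr L) \<rho>"
 unfolding irreducible_rep_def irr_fam_def subspace_iff_vsub is_rep_def by auto

lemma irr_famD:
 assumes "irr_fam n S \<rho>" shows "n > 0" "!!x. x \<in> S ==> \<rho> x \<in> Mat n n"
 "!!W. vsub n W ==> (!!x w. x \<in> S ==> w \<in> W ==> \<rho> x *\<^sub>v w \<in> W) ==> W = {0\<^sub>v n} \<or> W = Vec n"
 using assms unfolding irr_fam_def by blast+

lemma invariant_subspace_matrix: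
 assumes \<rho>: "!!x. x \<in> S ==> \<rho> x \<in> Mat n n"
  and W: "vsub n W" "!!x w. x \<in> S ==> w \<in> W ==> \<rho> x *\<^sub>v w \<in> W"
 obtains e B \<nu> where "B \<in> Mat n e" "mat_inj B" "mat_im B = W"
  "!!x. x \<in> S ==> \<nu> x \<in> Mat e e" "!!x. x \<in> S ==> \<rho> x * B = B * \<nu> x"
proof -
 obtain e B where B: "B \<in> Mat n e" "mat_inj B" "mat_im B = W" by (rule vsub_basis[OF W(1)])
 have "\<exists>X. X \<in> Mat e e & \<rho> x * B = B * X" if x: "x \<in> S" for x
 proof (rule factor_through_mat_im[OF B(1)])
  show "\<rho> x * B \<in> Mat n e" by (rule mult_carrier_mat[OF \<rho>[OF x] B(1)])
  fix v :: "'b vec" assume v: "v \<in> Vec e"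
  have "(\<rho> x * B) *\<^sub>v v = \<rho> x *\<^sub>v (B *\<^sub>v v)" using \<rho>[OF x] B v by (intro assoc_mult_mat_vec) auto
  thus "(\<rho> x * B) *\<^sub>v v \<in> mat_im B" using W(2)[OF x, of "B *\<^sub>v v"] B v by (auto simp: mat_im_def)
 qed auto
 then obtain \<nu> where "!!x. x \<in> S ==> \<nu> x \<in> Mat e e" "!!x. x \<in> S ==> \<rho> x * B = B * \<nu> x" by metis
 thus ?thesis using that B by blast
qed

lemma mat_im_trivial:
 assumes "B \<in> Mat n 0" shows "mat_im B = {0\<^sub>v n}"
proof -
 have "B *\<^sub>v v = 0\<^sub>v n" if "v \<in> Vec 0" for v
  using assms that by (intro eq_vecI) (auto simp: scalar_prod_def)
 hence "mat_im B = (\<lambda>v. 0\<^sub>v n) ` (Vec 0 :: 'a vec set)"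
  using assms unfolding mat_im_def by (intro image_cong) auto
 moreover have "(Vec 0 :: 'a vec set) ~= {}" using zero_carrier_vec[of 0] by blast
 ultimately show ?thesis by (simp add: image_constant_conv)
qed

lemma intertwiner_comp:
 assumes "r \<in> Mat n n" "B \<in> Mat n e" "s \<in> Mat e e" "Q \<in> Mat e d" "t \<in> Mat d d"
  "r * B = B * s" "s * Q = Q * t"
 shows "r * (B * Q) = B * Q * (t :: 'k::field mat)"
proof -
 have "r * (B * Q) = (r * B) * Q" using assms(1-5) by (simp add: mat_assoc_dim)
 also have "... = B * (s * Q)" using assms(1-5) by (simp add: assms(6) mat_assoc_dim)
 also have "... = (B * Q) * t" using assms(1-5) by (simp add: assms(7) mat_assoc_dim)
 finally show ?thesis .
qed

text \<open>By descent: a family that is not irreducible restricts to a proper nonzero invariant subspace, of smaller dimension.\<close>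

lemma irr_subfamily:
 assumes "n > 0" "!!x. x \<in> S ==> \<rho> x \<in> Mat n n"
 shows "\<exists>d \<nu> Q. irr_fam d S \<nu> & Q \<in> Mat n d & mat_inj Q & (\<forall>x\<in>S. \<rho> x * Q = Q * \<nu> x)"
 using assms
proof (induction n arbitrary: \<rho> rule: less_induct)
 case (less n)
 show ?case
 proof (cases "irr_fam n S \<rho>")
  case True
  moreover have "\<forall>x\<in>S. \<rho> x * 1\<^sub>m n = 1\<^sub>m n * \<rho> x"
   using less.prems by (metis left_mult_one_mat right_mult_one_mat)
  ultimately show ?thesis
   by (intro exI[of _ n] exI[of _ \<rho>] exI[of _ "1\<^sub>m n"]) (auto simp: mat_inj_def)
 next
  case False
  then obtain W where W: "vsub n W" "!!x w. x \<in> S ==> w \<in> W ==> \<rho> x *\<^sub>v w \<in> W"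
   "W ~= {0\<^sub>v n}" "W ~= Vec n"
   using less.prems unfolding irr_fam_def by auto
  obtain e B \<nu> where B: "B \<in> Mat n e" "mat_inj B" "mat_im B = W"
   and \<nu>: "!!x. x \<in> S ==> \<nu> x \<in> Mat e e" "!!x. x \<in> S ==> \<rho> x * B = B * \<nu> x"
   using invariant_subspace_matrix[of S \<rho> n W] less.prems(2) W(1,2) by metis
  have "e \<le> n" by (rule mat_inj_dim_le[OF B(1,2)])
  moreover have "e ~= n" using mat_im_square_inj[of B n] B W by auto
  ultimately have en: "e < n" by simp
  have e0: "e > 0" using mat_im_trivial[of B n] B W by (cases e) auto
  obtain d \<tau> Q where Q: "irr_fam d S \<tau>" "Q \<in> Mat e d" "mat_inj Q"
   "!!x. x \<in> S ==> \<nu> x * Q = Q * \<tau> x" using less.IH[OF en e0, of \<nu>] \<nu>(1) by blast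
  have "\<rho> x * (B * Q) = (B * Q) * \<tau> x" if x: "x \<in> S" for x
   by (rule intertwiner_comp[OF less.prems(2)[OF x] B(1) \<nu>(1)[OF x] Q(2) irr_famD(2)[OF Q(1) x] \<nu>(2)[OF x] Q(4)[OF x]])
  moreover have "mat_inj (B * Q)" using mat_inj_mult B Q by blast
  ultimately show ?thesis using Q B
   by (intro exI[of _ d] exI[of _ \<tau>] exI[of _ "B * Q"]) auto
 qed
qed

lemma irr_subfamily_within:
 assumes \<rho>: "!!x. x \<in> S ==> \<rho> x \<in> Mat n n"
  and W: "vsub n W" "!!x w. x \<in> S ==> w \<in> W ==> \<rho> x *\<^sub>v w \<in> W" "W ~= {0\<^sub>v n}"
 shows "\<exists>d \<nu> Q. irr_fam d S \<nu> & Q \<in> Mat n d & mat_inj Q & mat_im Q \<subseteq> W & (\<forall>x\<in>S. \<rho> x * Q = Q * \<nu> x)"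
proof -
 obtain e B \<nu> where B: "B \<in> Mat n e" "mat_inj B" "mat_im B = W"
  and \<nu>: "!!x. x \<in> S ==> \<nu> x \<in> Mat e e" "!!x. x \<in> S ==> \<rho> x * B = B * \<nu> x"
  using invariant_subspace_matrix[of S \<rho> n W] \<rho> W(1,2) by metis
 have e0: "e > 0" using mat_im_trivial[of B n] B W by (cases e) auto
 obtain d \<tau> Q where Q: "irr_fam d S \<tau>" "Q \<in> Mat e d" "mat_inj Q"
  "!!x. x \<in> S ==> \<nu> x * Q = Q * \<tau> x" using irr_subfamily[OF e0, of S \<nu>] \<nu>(1) by blast
 have "\<rho> x * (B * Q) = (B * Q) * \<tau> x" if x: "x \<in> S" for x
  by (rule intertwiner_comp[OF \<rho>[OF x] B(1) \<nu>(1)[OF x] Q(2) irr_famD(2)[OF Q(1) x] \<nu>(2)[OF x] Q(4)[OF x]])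
 moreover have "mat_inj (B * Q)" using mat_inj_mult B Q by blast
 moreover have "mat_im (B * Q) \<subseteq> W"
  using B(1,3) Q(2) by (auto simp: mat_im_def mat_vec_assoc_dim)
 ultimately show ?thesis using Q B
  by (intro exI[of _ d] exI[of _ \<tau>] exI[of _ "B * Q"]) auto
qed

text \<open>The kernel and the image of an intertwiner are invariant subspaces.\<close>

lemma schur_iso:
 assumes \<rho>: "irr_fam n S \<rho>" and \<nu>: "irr_fam m S \<nu>" and Q: "Q \<in> Mat m n" "Q ~= 0\<^sub>m m n"
  and int: "!!x. x \<in> S ==> Q * \<rho> x = \<nu> x * Q"
 shows "n = m" "mat_inj Q" "invertible_mat Q"
proof -
 have intv: "Q *\<^sub>v (\<rho> x *\<^sub>v w) = \<nu> x *\<^sub>v (Q *\<^sub>v w)" if "x \<in> S" "w \<in> Vec n" for x w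
  using irr_famD(2)[OF \<rho> that(1)] irr_famD(2)[OF \<nu> that(1)] Q that arg_cong[OF int[OF that(1)], of "\<lambda>M. M *\<^sub>v w"]
  by (simp add: mat_vec_assoc_dim)
 define W where "W = {v \<in> Vec n. Q *\<^sub>v v = 0\<^sub>v m}"
 have "vsub n W" using Q unfolding vsub_def W_def
  by (auto simp: mult_add_distrib_mat_vec smult_mult_mat_vec_right)
 moreover have "\<rho> x *\<^sub>v w \<in> W" if "x \<in> S" "w \<in> W" for x w
  using that intv[of x w] irr_famD(2)[OF \<rho>, of x] irr_famD(2)[OF \<nu>, of x] unfolding W_def by auto
 ultimately have "W = {0\<^sub>v n} \<or> W = Vec n" by (rule irr_famD(3)[OF \<rho>])
 moreover have "W ~= Vec n"
 proof
  assume "W = Vec n"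
  hence "Q = 0\<^sub>m m n" using Q
   by (intro mat_eq_by_vec[of _ m n]) (auto simp: W_def)
  thus False using Q by simp
 qed
 ultimately show inj: "mat_inj Q" using Q unfolding mat_inj_def W_def by auto
 have "vsub m (mat_im Q)" by (rule vsub_mat_im[OF Q(1)])
 moreover have "\<nu> x *\<^sub>v w \<in> mat_im Q" if xw: "x \<in> S" "w \<in> mat_im Q" for x w
 proof -
  obtain v where v: "v \<in> Vec n" "w = Q *\<^sub>v v" using xw(2) Q(1) by (auto simp: mat_im_def)
  hence "\<nu> x *\<^sub>v w = Q *\<^sub>v (\<rho> x *\<^sub>v v)" using intv xw by auto
  moreover have "\<rho> x *\<^sub>v v \<in> Vec n" using v irr_famD(2)[OF \<rho>, of x] xw by auto
  ultimately show ?thesis using Q by (auto simp: mat_im_def)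
 qed
 ultimately have "mat_im Q = {0\<^sub>v m} \<or> mat_im Q = Vec m" by (rule irr_famD(3)[OF \<nu>])
 moreover have "mat_im Q ~= {0\<^sub>v m}"
 proof
  assume "mat_im Q = {0\<^sub>v m}"
  hence "Q = 0\<^sub>m m n" using Q
   by (intro mat_eq_by_vec[of _ m n]) (auto simp: mat_im_def)
  thus False using Q by simp
 qed
 ultimately have im: "mat_im Q = Vec m" by auto
 have "n \<le> m" by (rule mat_inj_dim_le[OF Q(1) inj])
 moreover have "m \<le> n"
  by (rule mat_im_inj_eq_dim(1)[of "1\<^sub>m m" m m Q n]) (use Q inj im in "auto simp: mat_im_def mat_inj_def")
 ultimately show nm: "n = m" by simp
 show "invertible_mat Q" using mat_inj_invertible[of Q m] Q inj nm by auto
qed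

text \<open>An eigenspace of a matrix that commutes with the family is an invariant subspace.\<close>

lemma schur_scalar:
 fixes \<rho> :: "'l => 'k::alg_closed_field mat"
 assumes \<rho>: "irr_fam n S \<rho>" and X: "X \<in> Mat n n" and com: "!!x. x \<in> S ==> X * \<rho> x = \<rho> x * X"
 shows "\<exists>c. X = c \<cdot>\<^sub>m 1\<^sub>m n"
proof -
 have "degree (char_poly X) = n" using degree_monic_char_poly[OF X] by auto
 then obtain c where "poly (char_poly X) c = 0" using alg_closed_imp_poly_has_root irr_famD(1)[OF \<rho>] by metis
 then obtain v where v: "v \<in> Vec n" "v ~= 0\<^sub>v n" "X *\<^sub>v v = c \<cdot>\<^sub>v v"
  using eigenvalue_root_char_poly[OF X] X unfolding eigenvalue_def eigenvector_def by auto
 define W where "W = {v \<in> Vec n. X *\<^sub>v v = c \<cdot>\<^sub>v v}"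
 have "vsub n W" using X unfolding vsub_def W_def
  by (auto simp: mult_add_distrib_mat_vec smult_mult_mat_vec_right smult_add_distrib_vec smult_smult_assoc mult.commute)
 moreover have "\<rho> x *\<^sub>v w \<in> W" if "x \<in> S" "w \<in> W" for x w
 proof -
  have r: "\<rho> x \<in> Mat n n" using irr_famD(2)[OF \<rho>] that by auto
  have "X *\<^sub>v (\<rho> x *\<^sub>v w) = \<rho> x *\<^sub>v (X *\<^sub>v w)"
   using that arg_cong[OF com[OF that(1)], of "\<lambda>M. M *\<^sub>v w"] X r
   unfolding W_def by (auto simp: mat_vec_assoc_dim)
  thus ?thesis using that r unfolding W_def by (auto simp: smult_mult_mat_vec_right)
 qed
 ultimately have "W = {0\<^sub>v n} \<or> W = Vec n" by (rule irr_famD(3)[OF \<rho>])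
 hence "W = Vec n" using v unfolding W_def by auto
 hence "X *\<^sub>v v = c \<cdot>\<^sub>v v" if "v \<in> Vec n" for v using that unfolding W_def by blast
 hence "X = c \<cdot>\<^sub>m 1\<^sub>m n" using X
  by (intro mat_eq_by_vec[of _ n n]) (auto simp: smult_mult_mat_vec_left[of _ n n])
 thus ?thesis by blast
qed

section \<open>The Kronecker product\<close>

lemma div_mod_bounds: "i < n * m ==> i div m < (n::nat) & i mod m < m"
 by (cases "m = 0") (auto simp: less_mult_imp_div_less)

lemma pair_index_less: "i < n ==> j < m ==> i * m + j < n * (m::nat)"
proof -
 assume "i < n" "j < m"
 hence "i * m + j < (i + 1) * m" by (simp add: algebra_simps)
 also have "... \<le> n * m" using \<open>i < n\<close> by (intro mult_right_mono) auto
 finally show ?thesis .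
qed

text \<open>Throughout, a number below \<open>n * m\<close> stands for the pair of its quotient and its remainder by \<open>m\<close>, as in the Kronecker product.\<close>

lemma sum_pair_index:
 fixes n m :: nat
 shows "(\<Sum>c = 0..<n * m. f (c div m) (c mod m)) = (\<Sum>i = 0..<n. \<Sum>j = 0..<m. f i j :: 'b::comm_monoid_add)"
proof (induction n)
 case (Suc n)
 have "(\<Sum>c = 0..<Suc n * m. f (c div m) (c mod m))
   = (\<Sum>c = 0..<n * m. f (c div m) (c mod m)) + (\<Sum>c = n * m..<n * m + m. f (c div m) (c mod m))"
  using sum.atLeastLessThan_concat[of 0 "n * m" "n * m + m" "\<lambda>c. f (c div m) (c mod m)"] by (simp add: add.commute)
 also have "(\<Sum>c = n * m..<n * m + m. f (c div m) (c mod m)) = (\<Sum>j = 0..<m. f n j)"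
  using sum.shift_bounds_nat_ivl[of "\<lambda>c. f (c div m) (c mod m)" 0 "n * m" m] by (simp add: add.commute)
 finally show ?case using Suc by simp
qed simp

lemma sum_pair_delta:
 fixes n m :: nat
 assumes "a < n" "b < m"
 shows "(\<Sum>i = 0..<n. \<Sum>j = 0..<m. if i = a & j = b then f i j else 0) = (f a b :: 'b::comm_monoid_add)"
proof -
 have "(\<Sum>j = 0..<m. if i = a & j = b then f i j else 0) = (if i = a then f a b else 0)" for i
  using assms by (cases "i = a") auto
 thus ?thesis using assms by simp
qed

lemma kron_carrier [simp, intro]:
 "A \<in> Mat n n' ==> B \<in> Mat m m' ==> kron A B \<in> Mat (n * m) (n' * m')"
 by (auto simp: kronecker_def)

lemma kron_dim [simp]: "dim_row (kron A B) = dim_row A * dim_row B" "dim_col (kron A B) = dim_col A * dim_col B"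
 by (auto simp: kronecker_def)

lemma kron_index:
 "i < dim_row A * dim_row B ==> j < dim_col A * dim_col B ==>
 kron A B $$ (i, j) = A $$ (i div dim_row B, j div dim_col B) * B $$ (i mod dim_row B, j mod dim_col B)"
 by (auto simp: kronecker_def)

lemma kron_mult:
 assumes "A \<in> Mat n a" "B \<in> Mat m b" "C \<in> Mat a p" "D \<in> Mat b q"
 shows "kron A B * kron C D = kron (A * C) (B * D)"
proof (rule eq_matI)
 fix i j assume "i < dim_row (kron (A * C) (B * D))" "j < dim_col (kron (A * C) (B * D))"
 hence ij: "i < n * m" "j < p * q" using assms by auto
 note b = div_mod_bounds[OF ij(1)] div_mod_bounds[OF ij(2)]
 have "(kron A B * kron C D) $$ (i,j) = (\<Sum>c = 0..<a * b. (A $$ (i div m, c div b) * B $$ (i mod m, c mod b)) *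
   (C $$ (c div b, j div q) * D $$ (c mod b, j mod q)))"
  using assms ij by (simp add: scalar_prod_def kron_index)
 also have "... = (\<Sum>k = 0..<a. \<Sum>l = 0..<b. (A $$ (i div m, k) * B $$ (i mod m, l)) *
   (C $$ (k, j div q) * D $$ (l, j mod q)))" by (rule sum_pair_index)
 also have "... = (\<Sum>k = 0..<a. A $$ (i div m, k) * C $$ (k, j div q)) * (\<Sum>l = 0..<b. B $$ (i mod m, l) * D $$ (l, j mod q))"
  unfolding sum_product by (intro sum.cong refl) (simp add: mult_ac)
 also have "... = kron (A * C) (B * D) $$ (i,j)"
  using assms ij b by (simp add: scalar_prod_def kron_index)
 finally show "(kron A B * kron C D) $$ (i,j) = kron (A * C) (B * D) $$ (i,j)" .
qed (use assms in auto)

lemma kron_add_left: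
 assumes "A \<in> Mat n a" "A' \<in> Mat n a" "B \<in> Mat m b"
 shows "kron (A + A') B = kron A B + kron A' B"
 by (rule eq_matI) (use assms in "auto simp: kron_index div_mod_bounds distrib_right")

lemma kron_add_right:
 assumes "A \<in> Mat n a" "B \<in> Mat m b" "B' \<in> Mat m b"
 shows "kron A (B + B') = kron A B + kron A B'"
 by (rule eq_matI) (use assms in "auto simp: kron_index div_mod_bounds distrib_left")

lemma kron_diff_left:
 assumes "A \<in> Mat n a" "A' \<in> Mat n a" "B \<in> Mat m b"
 shows "kron (A - A') B = kron A B - kron A' B"
 by (rule eq_matI) (use assms in "auto simp: kron_index div_mod_bounds left_diff_distrib")

lemma kron_diff_right:
 assumes "A \<in> Mat n a" "B \<in> Mat m b" "B' \<in> Mat m b"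
 shows "kron A (B - B') = kron A B - kron A B'"
 by (rule eq_matI) (use assms in "auto simp: kron_index div_mod_bounds right_diff_distrib")

lemma kron_smult_left: "kron (c \<cdot>\<^sub>m A) B = c \<cdot>\<^sub>m kron A B"
 by (rule eq_matI) (auto simp: kron_index div_mod_bounds)

lemma kron_smult_right: "kron A (c \<cdot>\<^sub>m B) = c \<cdot>\<^sub>m kron A B"
 by (rule eq_matI) (auto simp: kron_index div_mod_bounds)

lemma kron_one: "kron (1\<^sub>m n) (1\<^sub>m m) = (1\<^sub>m (n * m) :: 'k::field mat)"
proof (rule eq_matI)
 fix i j assume "i < dim_row (1\<^sub>m (n * m) :: 'k mat)" "j < dim_col (1\<^sub>m (n * m) :: 'k mat)"
 hence ij: "i < n * m" "j < n * m" by auto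
 have "i = j \<longleftrightarrow> i div m = j div m & i mod m = j mod m" by (metis div_mult_mod_eq)
 thus "kron (1\<^sub>m n) (1\<^sub>m m) $$ (i,j) = (1\<^sub>m (n * m) :: 'k mat) $$ (i,j)"
  using ij div_mod_bounds[OF ij(1)] div_mod_bounds[OF ij(2)] by (auto simp: kron_index)
qed auto

lemma kron_zero_left [simp]: "kron (0\<^sub>m n a) B = 0\<^sub>m (n * dim_row B) (a * dim_col B)"
 by (rule eq_matI) (auto simp: kron_index div_mod_bounds)

lemma kron_zero_right [simp]: "kron A (0\<^sub>m n a) = 0\<^sub>m (dim_row A * n) (dim_col A * a)"
 by (rule eq_matI) (auto simp: kron_index div_mod_bounds)

lemma kron_one_dim_left:
 assumes "C \<in> Mat 1 1" shows "kron C A = C $$ (0,0) \<cdot>\<^sub>m A"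
 by (rule eq_matI) (use assms in "auto simp: kron_index")

lemma kron_one_dim_right:
 assumes "C \<in> Mat 1 1" shows "kron A C = C $$ (0,0) \<cdot>\<^sub>m A"
 by (rule eq_matI) (use assms in "auto simp: kron_index")

lemma kron_assoc: "kron A (kron B C) = kron (kron A B) C"
proof (rule eq_matI)
 fix i j assume "i < dim_row (kron (kron A B) C)" "j < dim_col (kron (kron A B) C)"
 hence ij: "i < dim_row A * dim_row B * dim_row C" "j < dim_col A * dim_col B * dim_col C" by auto
 have ij': "i < dim_row A * (dim_row B * dim_row C)" "j < dim_col A * (dim_col B * dim_col C)"
  using ij by (auto simp: mult.assoc)
 note b = div_mod_bounds[OF ij(1)] div_mod_bounds[OF ij(2)] div_mod_bounds[OF ij'(1)] div_mod_bounds[OF ij'(2)]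
 have eq: "x div (q * r) = x div r div q & x mod (q * r) div r = x div r mod q & x mod (q * r) mod r = x mod r"
  if "x < p * q * r" for x p q r :: nat
 proof -
  have "x mod (q * r) = r * (x div r mod q) + x mod r" by (metis mod_mult2_eq mult.commute)
  moreover have "x div (q * r) = x div r div q" by (metis div_mult2_eq mult.commute)
  moreover have "0 < r" using that by (cases r) auto
  ultimately show ?thesis by simp
 qed
 show "kron A (kron B C) $$ (i,j) = kron (kron A B) C $$ (i,j)"
  using ij ij' b by (simp add: kron_index eq[OF ij(1)] eq[OF ij(2)])
qed (auto simp: mult.assoc)

lemma kron_left_inj:
 assumes "A \<in> Mat n n'" "B \<in> Mat n n'" "d > 0" "kron A (1\<^sub>m d) = kron B (1\<^sub>m d)"
 shows "A = (B :: 'k::field mat)"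
proof (rule eq_matI)
 fix i j assume "i < dim_row B" "j < dim_col B"
 hence ij: "i < n" "j < n'" using assms by auto
 have "i * d + 0 < n * d" "j * d + 0 < n' * d" using ij assms(3) by (auto intro: pair_index_less)
 thus "A $$ (i,j) = B $$ (i,j)"
  using arg_cong[OF assms(4), of "\<lambda>M. M $$ (i * d, j * d)"] assms(1-3) by (simp add: kron_index)
qed (use assms in auto)

lemma kron_right_inj:
 assumes "A \<in> Mat n n'" "B \<in> Mat n n'" "m > 0" "kron (1\<^sub>m m) A = kron (1\<^sub>m m) B"
 shows "A = (B :: 'k::field mat)"
proof (rule eq_matI)
 fix i j assume "i < dim_row B" "j < dim_col B"
 hence ij: "i < n" "j < n'" using assms by auto
 have "0 * n + i < m * n" "0 * n' + j < m * n'" using pair_index_less[OF assms(3) ij(1)] pair_index_less[OF assms(3) ij(2)] by auto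
 thus "A $$ (i,j) = B $$ (i,j)"
  using arg_cong[OF assms(4), of "\<lambda>M. M $$ (i, j)"] assms(1-3) ij by (simp add: kron_index)
qed (use assms in auto)

text \<open>The pure tensor of two vectors in the coordinates of the Kronecker product.\<close>

definition vten :: "'k::field vec => 'k vec => 'k vec" where
 "vten v u = vec (dim_vec v * dim_vec u) (\<lambda>i. v $ (i div dim_vec u) * u $ (i mod dim_vec u))"

lemma kron_vten:
 assumes "A \<in> Mat n a" "B \<in> Mat m b" "v \<in> Vec a" "u \<in> Vec b"
 shows "kron A B *\<^sub>v vten v u = vten (A *\<^sub>v v) (B *\<^sub>v u)"
proof (rule eq_vecI)
 fix i assume "i < dim_vec (vten (A *\<^sub>v v) (B *\<^sub>v u))"
 hence i: "i < n * m" using assms by (auto simp: vten_def)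
 note b = div_mod_bounds[OF i]
 have "(kron A B *\<^sub>v vten v u) $ i = (\<Sum>c = 0..<a * b. (A $$ (i div m, c div b) * B $$ (i mod m, c mod b)) *
   (v $ (c div b) * u $ (c mod b)))"
  using assms i by (simp add: scalar_prod_def kron_index vten_def)
 also have "... = (\<Sum>k = 0..<a. \<Sum>l = 0..<b. (A $$ (i div m, k) * B $$ (i mod m, l)) * (v $ k * u $ l))"
  by (rule sum_pair_index)
 also have "... = (\<Sum>k = 0..<a. A $$ (i div m, k) * v $ k) * (\<Sum>l = 0..<b. B $$ (i mod m, l) * u $ l)"
  unfolding sum_product by (intro sum.cong refl) (simp add: mult_ac)
 also have "... = vten (A *\<^sub>v v) (B *\<^sub>v u) $ i"
  using assms i b by (simp add: scalar_prod_def vten_def)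
 finally show "(kron A B *\<^sub>v vten v u) $ i = vten (A *\<^sub>v v) (B *\<^sub>v u) $ i" .
qed (use assms in "auto simp: vten_def")

text \<open>The columns of \<open>Q\<close> are tensors in \<open>k\<^sup>n \<otimes> k\<^sup>m\<close>.  Fixing a basis vector of one factor gives maps into the other one; the two
  definitions do this for the right and for the left factor.\<close>

definition left_block :: "nat => nat => 'k::field mat => nat => 'k mat" where
 "left_block n m Q l = mat n (dim_col Q) (\<lambda>(i,j). Q $$ (i * m + l, j))"

definition right_block :: "nat => nat => 'k::field mat => nat => 'k mat" where
 "right_block n m Q i = mat m (dim_col Q) (\<lambda>(l,j). Q $$ (i * m + l, j))"

lemma left_block_kron:
 assumes A: "A \<in> Mat n a" and Q: "Q \<in> Mat (a * m) d" and l: "l < m"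
 shows "left_block n m (kron A (1\<^sub>m m) * Q) l = A * left_block a m Q l"
proof (rule eq_matI)
 fix i j assume "i < dim_row (A * left_block a m Q l)" "j < dim_col (A * left_block a m Q l)"
 hence ij: "i < n" "j < d" using A Q by (auto simp: left_block_def)
 have il: "i * m + l < n * m" using ij l by (intro pair_index_less) auto
 have "(kron A (1\<^sub>m m) * Q) $$ (i * m + l, j) = (\<Sum>c = 0..<a * m. (A $$ (i, c div m) * 1\<^sub>m m $$ (l, c mod m)) * Q $$ ((c div m) * m + (c mod m), j))"
  using A Q il ij l by (simp add: scalar_prod_def kron_index)
 also have "... = (\<Sum>k = 0..<a. \<Sum>l' = 0..<m. (A $$ (i, k) * 1\<^sub>m m $$ (l, l')) * Q $$ (k * m + l', j))"
  by (rule sum_pair_index)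
 also have "... = (\<Sum>k = 0..<a. \<Sum>l' = 0..<m. if l' = l then A $$ (i, k) * Q $$ (k * m + l', j) else 0)"
  using l by (intro sum.cong) auto
 also have "... = (\<Sum>k = 0..<a. A $$ (i,k) * Q $$ (k * m + l, j))" using l by simp
 finally show "left_block n m (kron A (1\<^sub>m m) * Q) l $$ (i,j) = (A * left_block a m Q l) $$ (i,j)"
  using ij A Q by (simp add: left_block_def scalar_prod_def)
qed (use assms in "auto simp: left_block_def")

lemma right_block_kron:
 assumes B: "B \<in> Mat m m" and Q: "Q \<in> Mat (n * m) d" and i: "i < n"
 shows "right_block n m (kron (1\<^sub>m n) B * Q) i = B * right_block n m Q i"
proof (rule eq_matI)
 fix l j assume "l < dim_row (B * right_block n m Q i)" "j < dim_col (B * right_block n m Q i)"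
 hence lj: "l < m" "j < d" using B Q by (auto simp: right_block_def)
 have il: "i * m + l < n * m" using lj i by (intro pair_index_less) auto
 have "(kron (1\<^sub>m n) B * Q) $$ (i * m + l, j) = (\<Sum>c = 0..<n * m. (1\<^sub>m n $$ (i, c div m) * B $$ (l, c mod m)) * Q $$ ((c div m) * m + (c mod m), j))"
  using B Q il lj i by (simp add: scalar_prod_def kron_index)
 also have "... = (\<Sum>k = 0..<n. \<Sum>l' = 0..<m. (1\<^sub>m n $$ (i, k) * B $$ (l, l')) * Q $$ (k * m + l', j))"
  by (rule sum_pair_index)
 also have "... = (\<Sum>k = 0..<n. if k = i then (\<Sum>l' = 0..<m. B $$ (l, l') * Q $$ (k * m + l', j)) else 0)"
  using i by (intro sum.cong) auto
 also have "... = (\<Sum>l' = 0..<m. B $$ (l,l') * Q $$ (i * m + l', j))" using i by simp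
 finally show "right_block n m (kron (1\<^sub>m n) B * Q) i $$ (l,j) = (B * right_block n m Q i) $$ (l,j)"
  using lj B Q by (simp add: right_block_def scalar_prod_def)
qed (use assms in "auto simp: right_block_def")

lemma left_block_mult:
 assumes "Q \<in> Mat (n * m) d" "R \<in> Mat d e" "l < m"
 shows "left_block n m (Q * R) l = left_block n m Q l * R"
 by (rule eq_matI) (use assms in "auto simp: left_block_def scalar_prod_def pair_index_less")

lemma right_block_mult:
 assumes "Q \<in> Mat (n * m) d" "R \<in> Mat d e" "i < n"
 shows "right_block n m (Q * R) i = right_block n m Q i * R"
 by (rule eq_matI) (use assms in "auto simp: right_block_def scalar_prod_def pair_index_less")

lemma left_block_carrier [simp, intro]: "Q \<in> Mat N d ==> left_block n m Q l \<in> Mat n d"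
 by (auto simp: left_block_def)

lemma right_block_carrier [simp, intro]: "Q \<in> Mat N d ==> right_block n m Q l \<in> Mat m d"
 by (auto simp: right_block_def)

lemma left_blocks_zero:
 assumes Q: "Q \<in> Mat (n * m) d" and 0: "!!l. l < m ==> left_block n m Q l = 0\<^sub>m n d"
 shows "Q = 0\<^sub>m (n * m) d"
proof (rule eq_matI)
 fix i j assume "i < dim_row (0\<^sub>m (n * m) d :: 'a mat)" "j < dim_col (0\<^sub>m (n * m) d :: 'a mat)"
 hence ij: "i < n * m" "j < d" by auto
 note b = div_mod_bounds[OF ij(1)]
 have "left_block n m Q (i mod m) $$ (i div m, j) = 0" using 0[of "i mod m"] b ij by simp
 thus "Q $$ (i,j) = 0\<^sub>m (n * m) d $$ (i,j)" using b ij Q by (simp add: left_block_def)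
qed (use Q in auto)

text \<open>The permutation matrix that exchanges the factors of a tensor product.\<close>

definition flip :: "nat => nat => 'k::field mat" where
 "flip n m = mat (m * n) (n * m) (\<lambda>(r,c). if r div n = c mod m & r mod n = c div m then 1 else 0)"

lemma flip_carrier [simp, intro]: "flip n m \<in> Mat (m * n) (n * m)" by (auto simp: flip_def)

lemma flip_dim [simp]: "dim_row (flip n m) = m * n" "dim_col (flip n m) = n * m" by (auto simp: flip_def)

lemma flip_kron:
 assumes A: "A \<in> Mat n n'" and B: "B \<in> Mat m m'"
 shows "flip n m * kron A B = kron B A * flip n' m'"
proof (rule eq_matI)
 fix r c assume "r < dim_row (kron B A * flip n' m')" "c < dim_col (kron B A * flip n' m')"
 hence rc: "r < m * n" "c < n' * m'" using A B by (auto simp: flip_def)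
 note b = div_mod_bounds[OF rc(1)] div_mod_bounds[OF rc(2)]
 have "(flip n m * kron A B) $$ (r,c) = (\<Sum>k = 0..<n * m. (if r div n = k mod m & r mod n = k div m then 1 else 0) *
   (A $$ (k div m, c div m') * B $$ (k mod m, c mod m')))"
  using A B rc by (simp add: scalar_prod_def kron_index flip_def)
 also have "... = (\<Sum>i = 0..<n. \<Sum>j = 0..<m. (if r div n = j & r mod n = i then 1 else 0) *
   (A $$ (i, c div m') * B $$ (j, c mod m')))" by (rule sum_pair_index)
 also have "... = (\<Sum>i = 0..<n. \<Sum>j = 0..<m. if i = r mod n & j = r div n then A $$ (i, c div m') * B $$ (j, c mod m') else 0)"
  by (intro sum.cong refl) auto
 also have "... = A $$ (r mod n, c div m') * B $$ (r div n, c mod m')" using b by (intro sum_pair_delta) auto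
 finally have 1: "(flip n m * kron A B) $$ (r,c) = A $$ (r mod n, c div m') * B $$ (r div n, c mod m')" .
 have "(kron B A * flip n' m') $$ (r,c) = (\<Sum>k = 0..<m' * n'. (B $$ (r div n, k div n') * A $$ (r mod n, k mod n')) *
  (if k div n' = c mod m' & k mod n' = c div m' then 1 else 0))"
  using A B rc by (simp add: scalar_prod_def kron_index flip_def)
 also have "... = (\<Sum>i = 0..<m'. \<Sum>j = 0..<n'. (B $$ (r div n, i) * A $$ (r mod n, j)) *
  (if i = c mod m' & j = c div m' then 1 else 0))" by (rule sum_pair_index)
 also have "... = (\<Sum>i = 0..<m'. \<Sum>j = 0..<n'. if i = c mod m' & j = c div m' then B $$ (r div n, i) * A $$ (r mod n, j) else 0)"
  by (intro sum.cong refl) auto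
 also have "... = B $$ (r div n, c mod m') * A $$ (r mod n, c div m')" using b by (intro sum_pair_delta) auto
 also have "... = A $$ (r mod n, c div m') * B $$ (r div n, c mod m')" by simp
 finally show "(flip n m * kron A B) $$ (r,c) = (kron B A * flip n' m') $$ (r,c)" using 1 by simp
qed (use A B in "auto simp: flip_def")

lemma flip_flip: "flip n m * flip m n = (1\<^sub>m (m * n) :: 'k::field mat)"
proof (rule eq_matI)
 fix r c assume "r < dim_row (1\<^sub>m (m * n) :: 'k mat)" "c < dim_col (1\<^sub>m (m * n) :: 'k mat)"
 hence rc: "r < m * n" "c < m * n" by auto
 note b = div_mod_bounds[OF rc(1)] div_mod_bounds[OF rc(2)]
 have "(flip n m * flip m n) $$ (r,c) = (\<Sum>k = 0..<n * m. (if r div n = k mod m & r mod n = k div m then 1 else 0) *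
   (if k div m = c mod n & k mod m = c div n then 1 else (0::'k)))"
  using rc by (simp add: scalar_prod_def flip_def)
 also have "... = (\<Sum>i = 0..<n. \<Sum>j = 0..<m. (if r div n = j & r mod n = i then 1 else 0) *
   (if i = c mod n & j = c div n then 1 else 0))" by (rule sum_pair_index)
 also have "... = (\<Sum>i = 0..<n. \<Sum>j = 0..<m. if i = r mod n & j = r div n then (if i = c mod n & j = c div n then 1 else 0) else 0)"
  by (intro sum.cong refl) auto
 also have "... = (if r mod n = c mod n & r div n = c div n then 1 else 0)" using b by (intro sum_pair_delta) auto
 also have "... = (1\<^sub>m (m * n) :: 'k mat) $$ (r,c)"
 proof -
  have "r = c \<longleftrightarrow> r mod n = c mod n & r div n = c div n" by (metis div_mult_mod_eq)
  thus ?thesis using rc by simp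
 qed
 finally show "(flip n m * flip m n) $$ (r,c) = (1\<^sub>m (m * n) :: 'k mat) $$ (r,c)" .
qed (auto simp: flip_def)

section \<open>Sums of Kronecker products and tensor products of irreducible families\<close>

text \<open>The action \<open>A \<otimes> 1 + 1 \<otimes> B\<close> of an element of a Lie algebra on a tensor product.\<close>

definition ksum :: "nat => nat => 'k::field mat => 'k mat => 'k mat" where
 "ksum n m A B = kron A (1\<^sub>m m) + kron (1\<^sub>m n) B"

lemma ksum_carrier [simp, intro]:
 "A \<in> Mat n n ==> B \<in> Mat m m ==> ksum n m A B \<in> Mat (n * m) (n * m)"
 by (auto simp: ksum_def)

lemma ksum_zero_right: "A \<in> Mat n n ==> ksum n m A (0\<^sub>m m m) = kron A (1\<^sub>m m)"
 by (rule eq_matI) (auto simp: ksum_def)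

lemma ksum_zero_left: "B \<in> Mat m m ==> ksum n m (0\<^sub>m n n) B = kron (1\<^sub>m n) B"
 by (rule eq_matI) (auto simp: ksum_def)

lemma ksum_zero_zero: "ksum n m (0\<^sub>m n n) (0\<^sub>m m m) = 0\<^sub>m (n * m) (n * m)"
 by (rule eq_matI) (auto simp: ksum_def)

lemma ksum_add:
 assumes "A \<in> Mat n n" "A' \<in> Mat n n" "B \<in> Mat m m" "B' \<in> Mat m m"
 shows "ksum n m (A + A') (B + B') = ksum n m A B + ksum n m A' B'"
 unfolding ksum_def
 by (subst kron_add_left[OF assms(1,2) one_Mat], subst kron_add_right[OF one_Mat assms(3,4)],
   rule eq_matI) (use assms in auto)

lemma ksum_smult:
 assumes "A \<in> Mat n n" "B \<in> Mat m m"
 shows "ksum n m (c \<cdot>\<^sub>m A) (c \<cdot>\<^sub>m B) = c \<cdot>\<^sub>m ksum n m A B"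
 unfolding ksum_def kron_smult_left kron_smult_right
 by (rule eq_matI) (use assms in "auto simp: distrib_left")

lemma ksum_mult_ksum:
 assumes "A \<in> Mat n n" "A' \<in> Mat n n" "B \<in> Mat m m" "B' \<in> Mat m m"
 shows "ksum n m A B * ksum n m A' B' =
  (kron (A * A') (1\<^sub>m m) + kron A B') + (kron A' B + kron (1\<^sub>m n) (B * B'))"
proof -
 note c = kron_carrier[OF assms(1) one_Mat[of m]] kron_carrier[OF one_Mat[of n] assms(3)]
  kron_carrier[OF assms(2) one_Mat[of m]] kron_carrier[OF one_Mat[of n] assms(4)]
 have "ksum n m A B * ksum n m A' B' = kron A (1\<^sub>m m) * (kron A' (1\<^sub>m m) + kron (1\<^sub>m n) B')
   + kron (1\<^sub>m n) B * (kron A' (1\<^sub>m m) + kron (1\<^sub>m n) B')"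
  unfolding ksum_def by (rule add_mult_distrib_mat[OF c(1,2) add_carrier_mat[OF c(4)]])
 also have "... = (kron A (1\<^sub>m m) * kron A' (1\<^sub>m m) + kron A (1\<^sub>m m) * kron (1\<^sub>m n) B')
   + (kron (1\<^sub>m n) B * kron A' (1\<^sub>m m) + kron (1\<^sub>m n) B * kron (1\<^sub>m n) B')"
  unfolding mult_add_distrib_mat[OF c(1) c(3,4)] mult_add_distrib_mat[OF c(2) c(3,4)] ..
 also have "kron A (1\<^sub>m m) * kron A' (1\<^sub>m m) = kron (A * A') (1\<^sub>m m)"
  by (subst kron_mult[OF assms(1) one_Mat assms(2) one_Mat]) simp
 also have "kron A (1\<^sub>m m) * kron (1\<^sub>m n) B' = kron A B'"
  using assms by (subst kron_mult[OF assms(1) one_Mat one_Mat assms(4)]) simp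
 also have "kron (1\<^sub>m n) B * kron A' (1\<^sub>m m) = kron A' B"
  using assms by (subst kron_mult[OF one_Mat assms(3) assms(2) one_Mat]) simp
 also have "kron (1\<^sub>m n) B * kron (1\<^sub>m n) B' = kron (1\<^sub>m n) (B * B')"
  by (subst kron_mult[OF one_Mat assms(3) one_Mat assms(4)]) simp
 finally show ?thesis .
qed

lemma ksum_commutator:
 assumes "A \<in> Mat n n" "A' \<in> Mat n n" "B \<in> Mat m m" "B' \<in> Mat m m"
 shows "ksum n m (A * A' - A' * A) (B * B' - B' * B) = ksum n m A B * ksum n m A' B' - ksum n m A' B' * ksum n m A B"
proof -
 have p: "A * A' \<in> Mat n n" "A' * A \<in> Mat n n" "B * B' \<in> Mat m m" "B' * B \<in> Mat m m"
  using assms by auto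
 show ?thesis
  unfolding ksum_mult_ksum[OF assms] ksum_mult_ksum[OF assms(2,1,4,3)]
  unfolding ksum_def kron_diff_left[OF p(1,2) one_Mat] kron_diff_right[OF one_Mat p(3,4)]
  by (rule eq_matI) (use assms in auto)
qed

text \<open>On \<open>M1\<close> only the left factor acts, on \<open>M2\<close> only the right one.  A nonzero invariant subspace \<open>W\<close> contains the image of an injective
  intertwiner \<open>Q\<close> from an irreducible family for \<open>M1\<close>.  The blocks of \<open>Q\<close> are intertwiners to the left factor, so by Schur's lemma they are multiples of one
  isomorphism, and the image of \<open>Q\<close> is \<open>k\<^sup>n \<otimes> u\<close> for a vector \<open>u \<noteq> 0\<close>.  The vectors \<open>u\<close> with \<open>k\<^sup>n \<otimes> u \<subseteq> W\<close> form a subspace that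
  is invariant under \<open>M2\<close>, and so all vectors do.\<close>

lemma irr_fam_ksum:
 fixes \<pi> \<tau> :: "'l => 'k::alg_closed_field mat"
 assumes \<pi>: "irr_fam n M1 \<pi>" and \<tau>: "irr_fam m M2 \<tau>" and sub: "M1 \<subseteq> S" "M2 \<subseteq> S"
  and z1: "!!x. x \<in> M1 ==> \<tau> x = 0\<^sub>m m m" and z2: "!!x. x \<in> M2 ==> \<pi> x = 0\<^sub>m n n"
  and car: "!!x. x \<in> S ==> \<pi> x \<in> Mat n n" "!!x. x \<in> S ==> \<tau> x \<in> Mat m m"
 shows "irr_fam (n * m) S (\<lambda>x. ksum n m (\<pi> x) (\<tau> x))"
 unfolding irr_fam_def
proof (intro conjI allI impI ballI)
 show "0 < n * m" using irr_famD(1)[OF \<pi>] irr_famD(1)[OF \<tau>] by simp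
 show "ksum n m (\<pi> x) (\<tau> x) \<in> Mat (n * m) (n * m)" if "x \<in> S" for x using car that by auto
 fix W assume "vsub (n * m) W & (\<forall>x\<in>S. \<forall>w\<in>W. ksum n m (\<pi> x) (\<tau> x) *\<^sub>v w \<in> W)"
 hence W: "vsub (n * m) W" and inv: "!!x w. x \<in> S ==> w \<in> W ==> ksum n m (\<pi> x) (\<tau> x) *\<^sub>v w \<in> W" by auto
 show "W = {0\<^sub>v (n * m)} \<or> W = Vec (n * m)"
 proof (rule disj_imp[THEN iffD2, rule_format])
  assume W0: "W ~= {0\<^sub>v (n * m)}"
  define \<kappa> where "\<kappa> x = kron (\<pi> x) (1\<^sub>m m)" for x
  have \<kappa>: "ksum n m (\<pi> x) (\<tau> x) = \<kappa> x" if "x \<in> M1" for x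
   using that z1[OF that] irr_famD(2)[OF \<pi> that] by (simp add: \<kappa>_def ksum_zero_right)
  have "\<exists>d \<nu> Q. irr_fam d M1 \<nu> & Q \<in> Mat (n * m) d & mat_inj Q & mat_im Q \<subseteq> W & (\<forall>x\<in>M1. \<kappa> x * Q = Q * \<nu> x)"
  proof (rule irr_subfamily_within[OF _ W _ W0])
   show "\<kappa> x \<in> Mat (n * m) (n * m)" if "x \<in> M1" for x
    using irr_famD(2)[OF \<pi> that] by (auto simp: \<kappa>_def)
   show "\<kappa> x *\<^sub>v w \<in> W" if "x \<in> M1" "w \<in> W" for x w
    using inv[of x w] that sub \<kappa>[OF that(1)] by auto
  qed
  then obtain d \<nu> Q where Q: "irr_fam d M1 \<nu>" "Q \<in> Mat (n * m) d" "mat_inj Q" "mat_im Q \<subseteq> W"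
   "!!x. x \<in> M1 ==> \<kappa> x * Q = Q * \<nu> x" by auto
  define q where "q l = left_block n m Q l" for l
  have qc: "q l \<in> Mat n d" for l using Q by (auto simp: q_def)
  have qint: "q l * \<nu> x = \<pi> x * q l" if "l < m" "x \<in> M1" for l x
   using arg_cong[OF Q(5)[OF that(2)], of "\<lambda>M. left_block n m M l"] irr_famD(2)[OF \<pi> that(2)] irr_famD(2)[OF Q(1) that(2)]
   unfolding \<kappa>_def q_def by (simp add: left_block_kron[OF _ Q(2) that(1)] left_block_mult[OF Q(2) _ that(1)])
  have "Q ~= 0\<^sub>m (n * m) d"
  proof
   assume "Q = 0\<^sub>m (n * m) d"
   hence "unit_vec d 0 = (0\<^sub>v d :: 'k vec)" using Q(3) irr_famD(1)[OF Q(1)] by (auto simp: mat_inj_def)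
   thus False using irr_famD(1)[OF Q(1)] by (metis unit_vec_nonzero)
  qed
  then obtain l0 where l0: "l0 < m" "q l0 ~= 0\<^sub>m n d" using left_blocks_zero[OF Q(2)] unfolding q_def by blast
  note iso = schur_iso[OF Q(1) \<pi> qc l0(2) qint[OF l0(1)]]
  have dn: "d = n" using iso(1) by simp
  obtain R where R: "R \<in> Mat n n" "q l0 * R = 1\<^sub>m n" "R * q l0 = 1\<^sub>m n"
   using mat_inj_inverse[OF _ iso(2)] qc dn by metis
  have Rint: "R * \<pi> x = \<nu> x * R" if x: "x \<in> M1" for x
  proof -
   have c: "\<pi> x \<in> Mat n n" "\<nu> x \<in> Mat n n" using irr_famD(2)[OF \<pi> x] irr_famD(2)[OF Q(1) x] dn by auto
   have "R * \<pi> x = R * (\<pi> x * q l0) * R"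
    using c R qc[of l0] dn by (simp add: mat_assoc_dim)
   also have "... = R * q l0 * \<nu> x * R" unfolding qint[OF l0(1) x, symmetric]
    using c R(1) qc[of l0] dn by (simp add: mat_assoc_dim)
   finally show ?thesis using c R by simp
  qed
  have "\<exists>c. q l * R = c \<cdot>\<^sub>m 1\<^sub>m n" if l: "l < m" for l
  proof (rule schur_scalar[OF \<pi>])
   show "q l * R \<in> Mat n n" using qc[of l] R dn by auto
   fix x assume x: "x \<in> M1"
   have c: "\<pi> x \<in> Mat n n" "\<nu> x \<in> Mat n n" using irr_famD(2)[OF \<pi> x] irr_famD(2)[OF Q(1) x] dn by auto
   have "q l * R * \<pi> x = q l * (R * \<pi> x)" using c R(1) qc[of l] dn by (simp add: mat_assoc_dim)
   also have "... = (q l * \<nu> x) * R" unfolding Rint[OF x] using c R(1) qc[of l] dn by (simp add: mat_assoc_dim)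
   also have "... = \<pi> x * (q l * R)" unfolding qint[OF l x] using c R(1) qc[of l] dn by (simp add: mat_assoc_dim)
   finally show "q l * R * \<pi> x = \<pi> x * (q l * R)" .
  qed
  then obtain c where c: "!!l. l < m ==> q l * R = c l \<cdot>\<^sub>m 1\<^sub>m n" by metis
  define u where "u = vec m c"
  have uc: "u \<in> Vec m" by (simp add: u_def)
  have pure: "vten v u \<in> W" if v: "v \<in> Vec n" for v
  proof -
   have "Q *\<^sub>v (R *\<^sub>v v) = vten v u"
   proof (rule eq_vecI)
    fix i assume "i < dim_vec (vten v u)"
    hence i: "i < n * m" using v by (auto simp: vten_def u_def)
    note b = div_mod_bounds[OF i]
    have "(Q *\<^sub>v (R *\<^sub>v v)) $ i = (q (i mod m) *\<^sub>v (R *\<^sub>v v)) $ (i div m)"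
     using i b Q(2) R v dn by (simp add: q_def left_block_def scalar_prod_def)
    also have "q (i mod m) *\<^sub>v (R *\<^sub>v v) = (q (i mod m) * R) *\<^sub>v v" using qc[of "i mod m"] R v dn
     by (simp add: mat_vec_assoc_dim)
    also have "... = c (i mod m) \<cdot>\<^sub>v v" using c b v by (simp add: smult_mult_mat_vec_left[of _ n n])
    finally show "(Q *\<^sub>v (R *\<^sub>v v)) $ i = vten v u $ i" using b v i by (simp add: vten_def u_def)
   qed (use Q v in "auto simp: vten_def u_def")
   moreover have "R *\<^sub>v v \<in> Vec n" using R v by auto
   ultimately show ?thesis using Q(2,4) dn unfolding mat_im_def by force
  qed
  define U where "U = {u \<in> Vec m. \<forall>v\<in>Vec n. vten v u \<in> W}"
  have Usub: "vsub m U"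
   unfolding vsub_def
  proof (intro conjI ballI allI)
   show "U \<subseteq> Vec m" by (auto simp: U_def)
   have "vten v (0\<^sub>v m) = 0\<^sub>v (n * m)" if "v \<in> Vec n" for v :: "'k vec"
    using that div_mod_bounds[of _ n m] by (intro eq_vecI) (auto simp: vten_def)
   thus "0\<^sub>v m \<in> U" using W by (auto simp: U_def vsub_def)
   have add: "vten v (a + b) = vten v a + vten v b" if "v \<in> Vec n" "a \<in> Vec m" "b \<in> Vec m" for v a b :: "'k vec"
    using that div_mod_bounds[of _ n m] by (intro eq_vecI) (auto simp: vten_def distrib_left)
   show "a + b \<in> U" if "a \<in> U" "b \<in> U" for a b using that W add by (auto simp: U_def vsub_def)
   have sc: "vten v (c \<cdot>\<^sub>v a) = c \<cdot>\<^sub>v vten v a" if "v \<in> Vec n" "a \<in> Vec m" for v a :: "'k vec" and c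
    using that div_mod_bounds[of _ n m] by (intro eq_vecI) (auto simp: vten_def)
   show "c \<cdot>\<^sub>v a \<in> U" if "a \<in> U" for a c using that W sc by (auto simp: U_def vsub_def)
  qed
  have Uinv: "\<tau> x *\<^sub>v a \<in> U" if "x \<in> M2" "a \<in> U" for x a
  proof -
   have t: "\<tau> x \<in> Mat m m" using irr_famD(2)[OF \<tau> that(1)] .
   have "vten v (\<tau> x *\<^sub>v a) \<in> W" if v: "v \<in> Vec n" for v
   proof -
    have "ksum n m (\<pi> x) (\<tau> x) *\<^sub>v vten v a = vten v (\<tau> x *\<^sub>v a)"
     using z2 \<open>x \<in> M2\<close> t v \<open>a \<in> U\<close> by (simp add: ksum_zero_left kron_vten[of _ n n _ m m] U_def)
    thus ?thesis using inv[of x "vten v a"] sub \<open>x \<in> M2\<close> \<open>a \<in> U\<close> v by (auto simp: U_def)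
   qed
   thus ?thesis using t that by (auto simp: U_def)
  qed
  have "U ~= {0\<^sub>v m}"
  proof
   assume "U = {0\<^sub>v m}"
   hence "u = 0\<^sub>v m" using pure uc by (auto simp: U_def)
   hence "c l0 = 0" using l0(1) by (auto simp: u_def vec_eq_iff)
   hence "(1\<^sub>m n :: 'k mat) = 0 \<cdot>\<^sub>m 1\<^sub>m n" using c[OF l0(1)] R(2) by simp
   from arg_cong[OF this, of "\<lambda>M. M $$ (0,0)"] show False using irr_famD(1)[OF \<pi>] by simp
  qed
  hence U: "U = Vec m" using irr_famD(3)[OF \<tau> Usub Uinv] by auto
  show "W = Vec (n * m)"
  proof (rule vsub_units[OF W])
   fix i assume i: "i < n * m"
   note b = div_mod_bounds[OF i]
   have "unit_vec (n * m) i = vten (unit_vec n (i div m)) (unit_vec m (i mod m) :: 'k vec)"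
   proof (rule eq_vecI)
    fix j assume "j < dim_vec (vten (unit_vec n (i div m)) (unit_vec m (i mod m) :: 'k vec))"
    hence j: "j < n * m" by (simp add: vten_def)
    have "i = j \<longleftrightarrow> i div m = j div m & i mod m = j mod m" by (metis div_mult_mod_eq)
    thus "unit_vec (n * m) i $ j = vten (unit_vec n (i div m)) (unit_vec m (i mod m) :: 'k vec) $ j"
     using i j b div_mod_bounds[OF j] by (auto simp: vten_def)
   qed (simp add: vten_def)
   moreover have "unit_vec m (i mod m) \<in> U" unfolding U by simp
   ultimately show "unit_vec (n * m) i \<in> W" by (simp add: U_def)
  qed
 qed
qed

definition unit_col :: "nat => nat => 'k::field mat" where
 "unit_col m l = mat m 1 (\<lambda>(i,j). if i = l then 1 else 0)"

text \<open>Fixing a basis vector in both right factors cuts \<open>Q\<close> into blocks that intertwine the left factors; one of them is not zero.\<close>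

lemma left_factor_intertwiner:
 fixes Q :: "'k::field mat"
 assumes Q: "Q \<in> Mat (n' * m') (n * m)" "Q ~= 0\<^sub>m (n' * m') (n * m)"
  and \<pi>: "!!x. x \<in> S ==> \<pi> x \<in> Mat n n" "!!x. x \<in> S ==> \<pi>' x \<in> Mat n' n'"
  and int: "!!x. x \<in> S ==> Q * kron (\<pi> x) (1\<^sub>m m) = kron (\<pi>' x) (1\<^sub>m m') * Q"
 obtains R where "R \<in> Mat n' n" "R ~= 0\<^sub>m n' n" "!!x. x \<in> S ==> R * \<pi> x = \<pi>' x * R"
proof -
 define E :: "nat => 'k mat" where "E l = kron (1\<^sub>m n) (unit_col m l)" for l
 have ucc: "(unit_col m l :: 'k mat) \<in> Mat m 1" for l by (auto simp: unit_col_def)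
 have Ec: "E l \<in> Mat (n * m) n" for l using kron_carrier[OF one_Mat[of n] ucc] by (simp add: E_def)
 have QE: "(Q * E l) $$ (r, i) = Q $$ (r, i * m + l)" if "l < m" "r < n' * m'" "i < n" for l r i
 proof -
  have "(Q * E l) $$ (r, i) = (\<Sum>c = 0..<n * m. Q $$ (r, (c div m) * m + c mod m) * ((1\<^sub>m n) $$ (c div m, i) * unit_col m l $$ (c mod m, 0)))"
   using Q that Ec[of l] ucc[of l] by (simp add: scalar_prod_def E_def kron_index)
  also have "... = (\<Sum>a = 0..<n. \<Sum>b = 0..<m. Q $$ (r, a * m + b) * ((1\<^sub>m n) $$ (a, i) * unit_col m l $$ (b, 0)))"
   by (rule sum_pair_index)
  also have "... = (\<Sum>a = 0..<n. \<Sum>b = 0..<m. if a = i & b = l then Q $$ (r, a * m + b) else 0)"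
   using that by (intro sum.cong refl) (auto simp: unit_col_def)
  finally show ?thesis using sum_pair_delta[OF that(3,1), of "\<lambda>a b. Q $$ (r, a * m + b)"] by simp
 qed
 have "\<exists>l l'. l < m & l' < m' & left_block n' m' (Q * E l) l' ~= 0\<^sub>m n' n"
 proof (rule ccontr)
  assume a: "\<not> ?thesis"
  have z: "Q * E l = 0\<^sub>m (n' * m') n" if "l < m" for l
   using left_blocks_zero[OF mult_carrier_mat[OF Q(1) Ec[of l]]] a that by blast
  have "Q = 0\<^sub>m (n' * m') (n * m)"
  proof (rule eq_matI)
   fix r c assume "r < dim_row (0\<^sub>m (n' * m') (n * m) :: 'k mat)" "c < dim_col (0\<^sub>m (n' * m') (n * m) :: 'k mat)"
   hence rc: "r < n' * m'" "c < n * m" by auto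
   note b = div_mod_bounds[OF rc(2)]
   show "Q $$ (r,c) = 0\<^sub>m (n' * m') (n * m) $$ (r,c)"
    using QE[of "c mod m" r "c div m"] z[of "c mod m"] b rc by simp
  qed (use Q in auto)
  thus False using Q by simp
 qed
 then obtain l l' where l: "l < m" "l' < m'" "left_block n' m' (Q * E l) l' ~= 0\<^sub>m n' n" by auto
 define R where "R = left_block n' m' (Q * E l) l'"
 have QEc: "Q * E l \<in> Mat (n' * m') n" using Q Ec by auto
 have "R * \<pi> x = \<pi>' x * R" if x: "x \<in> S" for x
 proof -
  have c: "\<pi> x \<in> Mat n n" "\<pi>' x \<in> Mat n' n'" using \<pi> x by auto
  have e: "E l * \<pi> x = kron (\<pi> x) (1\<^sub>m m) * E l"
  proof -
   have "\<pi> x = kron (\<pi> x) (1\<^sub>m 1)" by (subst kron_one_dim_right) (auto intro!: eq_matI)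
   hence "E l * \<pi> x = kron (1\<^sub>m n) (unit_col m l) * kron (\<pi> x) (1\<^sub>m 1)" by (simp add: E_def)
   also have "... = kron (\<pi> x) (unit_col m l)"
    unfolding kron_mult[OF one_Mat ucc c(1) one_Mat] right_mult_one_mat[OF ucc] left_mult_one_mat[OF c(1)] ..
   also have "... = kron (\<pi> x) (1\<^sub>m m) * kron (1\<^sub>m n) (unit_col m l)"
    unfolding kron_mult[OF c(1) one_Mat one_Mat ucc] left_mult_one_mat[OF ucc] right_mult_one_mat[OF c(1)] ..
   finally show ?thesis by (simp add: E_def)
  qed
  have "R * \<pi> x = left_block n' m' ((Q * E l) * \<pi> x) l'"
   unfolding R_def by (rule left_block_mult[OF QEc c(1) l(2), symmetric])
  also have "(Q * E l) * \<pi> x = Q * (kron (\<pi> x) (1\<^sub>m m) * E l)"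
   using Q Ec[of l] c by (simp add: mat_assoc_dim e)
  also have "... = (Q * kron (\<pi> x) (1\<^sub>m m)) * E l" using Q Ec[of l] c by (simp add: mat_assoc_dim)
  also have "... = kron (\<pi>' x) (1\<^sub>m m') * (Q * E l)" unfolding int[OF x]
   using Q Ec[of l] c by (simp add: mat_assoc_dim)
  also have "left_block n' m' ... l' = \<pi>' x * R" unfolding R_def by (rule left_block_kron[OF c(2) QEc l(2)])
  finally show ?thesis .
 qed
 thus ?thesis using that[of R] l(3) QEc by (auto simp: R_def)
qed

lemma right_factor_intertwiner:
 fixes Q :: "'k::field mat"
 assumes Q: "Q \<in> Mat (n' * m') (n * m)" "Q ~= 0\<^sub>m (n' * m') (n * m)"
  and \<tau>: "!!x. x \<in> S ==> \<tau> x \<in> Mat m m" "!!x. x \<in> S ==> \<tau>' x \<in> Mat m' m'"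
  and int: "!!x. x \<in> S ==> Q * kron (1\<^sub>m n) (\<tau> x) = kron (1\<^sub>m n') (\<tau>' x) * Q"
 obtains R where "R \<in> Mat m' m" "R ~= 0\<^sub>m m' m" "!!x. x \<in> S ==> R * \<tau> x = \<tau>' x * R"
proof -
 define Q' where "Q' = flip n' m' * Q * flip m n"
 have fc: "(flip n' m' :: 'k mat) \<in> Mat (m' * n') (n' * m')" "(flip m n :: 'k mat) \<in> Mat (n * m) (m * n)"
  "(flip n m :: 'k mat) \<in> Mat (m * n) (n * m)" "(flip m' n' :: 'k mat) \<in> Mat (n' * m') (m' * n')" by auto
 have Q'c: "Q' \<in> Mat (m' * n') (m * n)" unfolding Q'_def
  by (rule mult_carrier_mat[OF mult_carrier_mat[OF fc(1) Q(1)] fc(2)])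
 have "flip m' n' * Q' * flip n m = Q"
 proof -
  have "flip m' n' * Q' * flip n m = (flip m' n' * flip n' m') * Q * (flip m n * flip n m)"
   using Q fc unfolding Q'_def by (simp add: mat_assoc_dim)
  thus ?thesis using Q by (simp add: flip_flip)
 qed
 hence "Q' ~= 0\<^sub>m (m' * n') (m * n)" using Q fc by auto
 moreover have "Q' * kron (\<tau> x) (1\<^sub>m n) = kron (\<tau>' x) (1\<^sub>m n') * Q'" if x: "x \<in> S" for x
 proof -
  have c: "\<tau> x \<in> Mat m m" "\<tau>' x \<in> Mat m' m'" using \<tau> x by auto
  have "Q' * kron (\<tau> x) (1\<^sub>m n) = flip n' m' * Q * (flip m n * kron (\<tau> x) (1\<^sub>m n))"
   using Q fc c unfolding Q'_def by (simp add: mat_assoc_dim)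
  also have "... = flip n' m' * (Q * kron (1\<^sub>m n) (\<tau> x)) * flip m n"
   unfolding flip_kron[OF c(1) one_Mat] using Q fc c by (simp add: mat_assoc_dim)
  also have "... = (flip n' m' * kron (1\<^sub>m n') (\<tau>' x)) * Q * flip m n"
   unfolding int[OF x] using Q fc c by (simp add: mat_assoc_dim)
  also have "... = kron (\<tau>' x) (1\<^sub>m n') * Q'"
   unfolding flip_kron[OF one_Mat c(2)] Q'_def using Q fc c by (simp add: mat_assoc_dim)
  finally show ?thesis .
 qed
 ultimately show ?thesis using left_factor_intertwiner[OF Q'c, of S \<tau> \<tau>'] \<tau> that by blast
qed

section \<open>Decomposing along commuting families\<close>

text \<open>The matrices \<open>u 0, \<dots>, u (m - 1)\<close> side by side, that is, the map \<open>k\<^sup>m \<otimes> k\<^sup>d \<rightarrow> k\<^sup>n\<close> sending \<open>e\<^sub>l \<otimes> v\<close> to \<open>u l *\<^sub>v v\<close>.\<close>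

definition blk :: "nat => nat => nat => (nat => 'k::field mat) => 'k mat" where
 "blk n d m u = mat n (m * d) (\<lambda>(r,c). u (c div d) $$ (r, c mod d))"

lemma blk_carrier [simp, intro]: "blk n d m u \<in> Mat n (m * d)" by (auto simp: blk_def)

lemma blk_dim [simp]: "dim_row (blk n d m u) = n" "dim_col (blk n d m u) = m * d" by (auto simp: blk_def)

lemma blk_Suc:
 assumes u: "u m \<in> Mat n d"
 shows "blk n d (Suc m) u = adjoin_cols (blk n d m u) (u m)"
proof (rule eq_matI)
 fix r c assume "r < dim_row (adjoin_cols (blk n d m u) (u m))" "c < dim_col (adjoin_cols (blk n d m u) (u m))"
 hence rc: "r < n" "c < m * d + d" using u by (auto simp: adjoin_cols_def)
 show "blk n d (Suc m) u $$ (r,c) = adjoin_cols (blk n d m u) (u m) $$ (r,c)"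
 proof (cases "c < m * d")
  case True
  thus ?thesis using rc u by (simp add: blk_def adjoin_cols_def)
 next
  case False
  then obtain i where i: "c = m * d + i" by (metis le_Suc_ex not_less)
  hence "i < d" using rc by simp
  hence "c div d = m" "c mod d = i" using i by auto
  thus ?thesis using rc u i by (simp add: blk_def adjoin_cols_def)
 qed
qed (use u in "auto simp: adjoin_cols_def blk_def")

lemma mult_blk:
 assumes "A \<in> Mat n n" "!!l. l < m ==> u l \<in> Mat n d"
 shows "A * blk n d m u = blk n d m (\<lambda>l. A * u l)"
proof (rule eq_matI)
 fix r c assume "r < dim_row (blk n d m (\<lambda>l. A * u l))" "c < dim_col (blk n d m (\<lambda>l. A * u l))"
 hence rc: "r < n" "c < m * d" by auto
 note b = div_mod_bounds[OF rc(2)]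
 show "(A * blk n d m u) $$ (r,c) = blk n d m (\<lambda>l. A * u l) $$ (r,c)"
  using assms(1) assms(2)[of "c div d"] rc b by (simp add: blk_def scalar_prod_def)
qed (use assms in auto)

lemma blk_mult_kron:
 assumes "s \<in> Mat d d" "!!l. l < m ==> u l \<in> Mat n d"
 shows "blk n d m u * kron (1\<^sub>m m) s = blk n d m (\<lambda>l. u l * s)"
proof (rule eq_matI)
 fix r c assume "r < dim_row (blk n d m (\<lambda>l. u l * s))" "c < dim_col (blk n d m (\<lambda>l. u l * s))"
 hence rc: "r < n" "c < m * d" by auto
 note b = div_mod_bounds[OF rc(2)]
 have "(blk n d m u * kron (1\<^sub>m m) s) $$ (r,c) =
  (\<Sum>k = 0..<m * d. u (k div d) $$ (r, k mod d) * (1\<^sub>m m $$ (k div d, c div d) * s $$ (k mod d, c mod d)))"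
  using assms(1) rc by (simp add: blk_def scalar_prod_def kron_index)
 also have "... = (\<Sum>l = 0..<m. \<Sum>i = 0..<d. u l $$ (r, i) * (1\<^sub>m m $$ (l, c div d) * s $$ (i, c mod d)))"
  by (rule sum_pair_index)
 also have "... = (\<Sum>l = 0..<m. if l = c div d then (\<Sum>i = 0..<d. u l $$ (r, i) * s $$ (i, c mod d)) else 0)"
  using b by (intro sum.cong refl) auto
 also have "... = (\<Sum>i = 0..<d. u (c div d) $$ (r, i) * s $$ (i, c mod d))" using b by simp
 finally show "(blk n d m u * kron (1\<^sub>m m) s) $$ (r,c) = blk n d m (\<lambda>l. u l * s) $$ (r,c)"
  using assms(1) assms(2)[of "c div d"] rc b by (simp add: blk_def scalar_prod_def)
qed (use assms in auto)

lemma mat_im_blk: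
 assumes W: "vsub n W" and u: "!!l. l < m ==> u l \<in> Mat n d" "!!l. l < m ==> mat_im (u l) \<subseteq> W"
 shows "mat_im (blk n d m u) \<subseteq> W"
 using u
proof (induction m)
 case 0
 thus ?case using W mat_im_trivial[of "blk n d 0 u" n] by (auto simp: vsub_def blk_def)
next
 case (Suc m)
 have um: "u m \<in> Mat n d" using Suc.prems by auto
 have "adjoin_cols (blk n d m u) (u m) *\<^sub>v v \<in> W" if v: "v \<in> Vec (m * d + d)" for v
 proof -
  have "blk n d m u *\<^sub>v vec (m * d) (($) v) \<in> W" using Suc by (auto simp: mat_im_def)
  moreover have "u m *\<^sub>v vec d (\<lambda>i. v $ (m * d + i)) \<in> W" using Suc.prems(2)[of m] um by (auto simp: mat_im_def)
  ultimately show ?thesis using adjoin_cols_mult_vec[OF blk_carrier um v] W by (auto simp: vsub_def)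
 qed
 moreover have "dim_col (adjoin_cols (blk n d m u) (u m)) = m * d + d" using um by (simp add: adjoin_cols_def)
 ultimately show ?case unfolding blk_Suc[of u m n d, OF um] by (auto simp: mat_im_def)
qed

lemma mult_unit_col_kron:
 fixes X :: "'k::field mat"
 assumes X: "X \<in> Mat N (m * d)" and "l < m" "r < N" "j < d"
 shows "(X * kron (unit_col m l) (1\<^sub>m d)) $$ (r, j) = X $$ (r, l * d + j)"
proof -
 have ucc: "(unit_col m l :: 'k mat) \<in> Mat m 1" by (auto simp: unit_col_def)
 have "(X * kron (unit_col m l) (1\<^sub>m d)) $$ (r, j) = (\<Sum>c = 0..<m * d. X $$ (r, (c div d) * d + c mod d) * (unit_col m l $$ (c div d, 0) * (1\<^sub>m d) $$ (c mod d, j)))"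
  using assms ucc by (simp add: scalar_prod_def kron_index)
 also have "... = (\<Sum>a = 0..<m. \<Sum>b = 0..<d. X $$ (r, a * d + b) * (unit_col m l $$ (a, 0) * (1\<^sub>m d) $$ (b, j)))"
  by (rule sum_pair_index)
 also have "... = (\<Sum>a = 0..<m. \<Sum>b = 0..<d. if a = l & b = j then X $$ (r, a * d + b) else 0)"
  using assms by (intro sum.cong refl) (auto simp: unit_col_def)
 finally show ?thesis using sum_pair_delta[OF assms(2,4), of "\<lambda>a b. X $$ (r, a * d + b)"] by simp
qed

text \<open>The \<open>d \<times> d\<close> blocks of \<open>X\<close> commute with the irreducible family, hence are scalars by Schur's lemma.\<close>

lemma commutant_one_kron:
 fixes \<nu> :: "'l => 'k::alg_closed_field mat"
 assumes \<nu>: "irr_fam d M \<nu>" and X: "X \<in> Mat (m * d) (m * d)"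
  and com: "!!z. z \<in> M ==> X * kron (1\<^sub>m m) (\<nu> z) = kron (1\<^sub>m m) (\<nu> z) * X"
 shows "\<exists>T\<in>Mat m m. X = kron T (1\<^sub>m d)"
proof -
 define E :: "nat => 'k mat" where "E l = kron (unit_col m l) (1\<^sub>m d)" for l
 have ucc: "(unit_col m l :: 'k mat) \<in> Mat m 1" for l by (auto simp: unit_col_def)
 have Ec: "E l \<in> Mat (m * d) d" for l using kron_carrier[OF ucc one_Mat[of d]] by (simp add: E_def)
 have XE: "X * E l \<in> Mat (m * d) d" for l using X Ec by auto
 define Y where "Y k l = right_block m d (X * E l) k" for k l
 have "\<exists>c. Y k l = c \<cdot>\<^sub>m 1\<^sub>m d" if k: "k < m" for k l
 proof (rule schur_scalar[OF \<nu>])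
  show "Y k l \<in> Mat d d" using XE by (auto simp: Y_def)
  fix z assume z: "z \<in> M"
  have s: "\<nu> z \<in> Mat d d" using irr_famD(2)[OF \<nu> z] .
  have one: "kron (1\<^sub>m 1) (\<nu> z) = \<nu> z" by (subst kron_one_dim_left) (auto intro!: eq_matI)
  have e: "E l * \<nu> z = kron (1\<^sub>m m) (\<nu> z) * E l"
  proof -
   have "E l * \<nu> z = kron (unit_col m l) (1\<^sub>m d) * kron (1\<^sub>m 1) (\<nu> z)" unfolding one by (simp add: E_def)
   also have "... = kron (unit_col m l) (\<nu> z)"
    unfolding kron_mult[OF ucc one_Mat one_Mat s] right_mult_one_mat[OF ucc] left_mult_one_mat[OF s] ..
   also have "... = kron (1\<^sub>m m) (\<nu> z) * kron (unit_col m l) (1\<^sub>m d)"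
    unfolding kron_mult[OF one_Mat s ucc one_Mat] left_mult_one_mat[OF ucc] right_mult_one_mat[OF s] ..
   finally show ?thesis by (simp add: E_def)
  qed
  have "Y k l * \<nu> z = right_block m d ((X * E l) * \<nu> z) k"
   unfolding Y_def by (rule right_block_mult[OF XE s k, symmetric])
  also have "(X * E l) * \<nu> z = (X * kron (1\<^sub>m m) (\<nu> z)) * E l"
   using X Ec[of l] s by (simp add: mat_assoc_dim e)
  also have "... = kron (1\<^sub>m m) (\<nu> z) * (X * E l)" unfolding com[OF z]
   using X Ec[of l] s by (simp add: mat_assoc_dim)
  also have "right_block m d ... k = \<nu> z * Y k l" unfolding Y_def by (rule right_block_kron[OF s XE k])
  finally show "Y k l * \<nu> z = \<nu> z * Y k l" .
 qed
 then obtain c where c: "!!k l. k < m ==> Y k l = c k l \<cdot>\<^sub>m 1\<^sub>m d" by metis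
 define T where "T = mat m m (\<lambda>(k,l). c k l)"
 have "X = kron T (1\<^sub>m d)"
 proof (rule eq_matI)
  fix a b assume "a < dim_row (kron T (1\<^sub>m d))" "b < dim_col (kron T (1\<^sub>m d))"
  hence ab: "a < m * d" "b < m * d" by (auto simp: T_def)
  note bd = div_mod_bounds[OF ab(1)] div_mod_bounds[OF ab(2)]
  have "X $$ (a,b) = (X * E (b div d)) $$ (a, b mod d)"
   unfolding E_def using mult_unit_col_kron[OF X, of "b div d" a "b mod d"] bd ab by simp
  also have "... = Y (a div d) (b div d) $$ (a mod d, b mod d)"
   using bd ab XE[of "b div d"] by (simp add: Y_def right_block_def Ec[THEN carrier_matD(2)])
  also have "... = kron T (1\<^sub>m d) $$ (a,b)"
   using bd ab c by (simp add: kron_index T_def)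
  finally show "X $$ (a,b) = kron T (1\<^sub>m d) $$ (a,b)" .
 qed (use X in "auto simp: T_def")
 thus ?thesis by (intro bexI[of _ T]) (auto simp: T_def)
qed

text \<open>Choose an irreducible restriction \<open>\<nu>\<close> of the family \<open>M2\<close> and intertwiners \<open>u 0, \<dots>, u (m - 1)\<close> from \<open>\<nu>\<close> to \<open>\<eta>\<close> such that the map
  \<open>P\<close> with these blocks is injective, with \<open>m\<close> maximal.  By irreducibility of \<open>\<nu>\<close> an intertwiner that does not map into the image of
  \<open>P\<close> could be adjoined, so the image of \<open>P\<close> contains the images of all intertwiners.  Since \<open>M1\<close> commutes with \<open>M2\<close> it maps
  intertwiners to intertwiners.  Hence the image of \<open>P\<close> is invariant and \<open>P\<close> is bijective.  In the coordinates given by \<open>P\<close> the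
  family \<open>M2\<close> acts on the right factor by construction, and \<open>M1\<close>, which commutes with it, on the left one.\<close>

lemma commuting_decomposition:
 fixes \<eta> :: "'l => 'k::alg_closed_field mat"
 assumes \<eta>: "irr_fam n S \<eta>" and sub: "M1 \<subseteq> S" "M2 \<subseteq> S"
  and com: "!!y z. y \<in> M1 ==> z \<in> M2 ==> \<eta> y * \<eta> z = \<eta> z * \<eta> y"
  and gen: "!!x. x \<in> S ==> \<exists>y\<in>M1. \<exists>z\<in>M2. \<eta> x = \<eta> y + \<eta> z"
 obtains m d \<nu> T P Pi where "irr_fam d M2 \<nu>" "m > 0" "m * d = n" "P \<in> Mat n n" "Pi \<in> Mat n n"
  "P * Pi = 1\<^sub>m n" "Pi * P = 1\<^sub>m n" "!!z. z \<in> M2 ==> Pi * \<eta> z * P = kron (1\<^sub>m m) (\<nu> z)"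
  "!!y. y \<in> M1 ==> T y \<in> Mat m m" "!!y. y \<in> M1 ==> Pi * \<eta> y * P = kron (T y) (1\<^sub>m d)"
proof -
 note n0 = irr_famD(1)[OF \<eta>]
 have c1: "!!y. y \<in> M1 ==> \<eta> y \<in> Mat n n" and c2: "!!y. y \<in> M2 ==> \<eta> y \<in> Mat n n"
  using irr_famD(2)[OF \<eta>] sub by auto
 obtain d \<nu> Q where Q: "irr_fam d M2 \<nu>" "Q \<in> Mat n d" "mat_inj Q" "!!z. z \<in> M2 ==> \<eta> z * Q = Q * \<nu> z"
  using irr_subfamily[OF n0, of M2 \<eta>] c2 by blast
 have s: "!!z. z \<in> M2 ==> \<nu> z \<in> Mat d d" using irr_famD(2)[OF Q(1)] .
 have d0: "d > 0" using irr_famD(1)[OF Q(1)] .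
 define I where "I = {\<phi> \<in> Mat n d. \<forall>z\<in>M2. \<eta> z * \<phi> = \<phi> * \<nu> z}"
 have Ic: "\<phi> \<in> I ==> \<phi> \<in> Mat n d" for \<phi> by (simp add: I_def)
 define PP where "PP m \<longleftrightarrow> (\<exists>u. (\<forall>l<m. u l \<in> I) & mat_inj (blk n d m u))" for m
 have PP0: "PP 0" unfolding PP_def
  by (intro exI[of _ "\<lambda>_. Q"]) (auto simp: mat_inj_def intro!: eq_vecI)
 have bound: "m \<le> n" if "PP m" for m
 proof -
  have "m * d \<le> n" using that mat_inj_dim_le unfolding PP_def by blast
  moreover have "m \<le> m * d" using d0 by (cases d) auto
  ultimately show ?thesis by linarith
 qed
 define m where "m = (GREATEST m. PP m)"
 have PPm: "PP m" unfolding m_def by (rule GreatestI_nat[of PP 0 n]) (use PP0 bound in auto)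
 have max: "PP m' ==> m' \<le> m" for m' unfolding m_def by (rule Greatest_le_nat[of PP _ n]) (use bound in auto)
 obtain u where u: "!!l. l < m ==> u l \<in> I" and inj: "mat_inj (blk n d m u)" using PPm unfolding PP_def by auto
 have uc: "!!l. l < m ==> u l \<in> Mat n d" using u Ic by auto
 define P where "P = blk n d m u"
 have Pc: "P \<in> Mat n (m * d)" by (simp add: P_def)
 have Pint: "\<eta> z * P = P * kron (1\<^sub>m m) (\<nu> z)" if z: "z \<in> M2" for z
 proof -
  have "\<eta> z * P = blk n d m (\<lambda>l. \<eta> z * u l)" unfolding P_def by (rule mult_blk[OF c2[OF z] uc])
  also have "... = blk n d m (\<lambda>l. u l * \<nu> z)"
  proof -
   have "\<eta> z * u l = u l * \<nu> z" if "l < m" for l using u[OF that] z by (auto simp: I_def)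
   thus ?thesis unfolding blk_def by (intro cong_mat) (auto simp: div_mod_bounds)
  qed
  also have "... = P * kron (1\<^sub>m m) (\<nu> z)" unfolding P_def by (rule blk_mult_kron[OF s[OF z] uc, symmetric])
  finally show ?thesis .
 qed
 define W where "W = mat_im P"
 have W: "vsub n W" unfolding W_def by (rule vsub_mat_im[OF Pc])
 have Winv2: "\<eta> z *\<^sub>v w \<in> W" if z: "z \<in> M2" and w: "w \<in> W" for z w
 proof -
  obtain v where v: "v \<in> Vec (m * d)" "w = P *\<^sub>v v" using w Pc by (auto simp: W_def mat_im_def)
  have "\<eta> z *\<^sub>v w = (\<eta> z * P) *\<^sub>v v" using v Pc c2[OF z] by (simp add: mat_vec_assoc_dim)
  also have "... = P *\<^sub>v (kron (1\<^sub>m m) (\<nu> z) *\<^sub>v v)" unfolding Pint[OF z] using v Pc s[OF z] by (simp add: mat_vec_assoc_dim)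
  finally show ?thesis
   using v Pc mult_mat_vec_carrier[OF kron_carrier[OF one_Mat[of m] s[OF z]] v(1)] by (auto simp: W_def mat_im_def)
 qed
 have Iim: "mat_im \<phi> \<subseteq> W" if \<phi>: "\<phi> \<in> I" for \<phi>
 proof (rule ccontr)
  assume nsub: "\<not> mat_im \<phi> \<subseteq> W"
  have \<phi>c: "\<phi> \<in> Mat n d" using Ic[OF \<phi>] .
  define Z where "Z = {v \<in> Vec d. \<phi> *\<^sub>v v \<in> W}"
  have "vsub d Z" using W \<phi>c unfolding vsub_def Z_def
   by (auto simp: mult_add_distrib_mat_vec smult_mult_mat_vec_right)
  moreover have "\<nu> z *\<^sub>v v \<in> Z" if z: "z \<in> M2" and v: "v \<in> Z" for z v
  proof -
   have "\<phi> *\<^sub>v (\<nu> z *\<^sub>v v) = (\<phi> * \<nu> z) *\<^sub>v v" using v \<phi>c s[OF z] by (auto simp: mat_vec_assoc_dim Z_def)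
   also have "\<phi> * \<nu> z = \<eta> z * \<phi>" using \<phi> z by (simp add: I_def)
   also have "(\<eta> z * \<phi>) *\<^sub>v v = \<eta> z *\<^sub>v (\<phi> *\<^sub>v v)" using v \<phi>c c2[OF z] by (auto simp: mat_vec_assoc_dim Z_def)
   finally show ?thesis using Winv2[OF z, of "\<phi> *\<^sub>v v"] v s[OF z] by (auto simp: Z_def)
  qed
  ultimately have "Z = {0\<^sub>v d} \<or> Z = Vec d" by (rule irr_famD(3)[OF Q(1)])
  moreover have "Z ~= Vec d" using nsub \<phi>c by (auto simp: Z_def mat_im_def)
  ultimately have Z: "Z = {0\<^sub>v d}" by simp
  have "mat_inj (adjoin_cols P \<phi>)"
  proof (rule adjoin_cols_inj[OF Pc _ \<phi>c])
   show "mat_inj P" using inj by (simp add: P_def)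
   show "v = 0\<^sub>v d" if "v \<in> Vec d" "\<phi> *\<^sub>v v \<in> mat_im P" for v using that Z by (auto simp: Z_def W_def)
  qed
  moreover have "blk n d (Suc m) (u(m := \<phi>)) = adjoin_cols P \<phi>"
  proof -
   have "blk n d m (u(m := \<phi>)) = P" unfolding P_def blk_def by (intro cong_mat) (auto simp: div_mod_bounds dest: div_mod_bounds)
   thus ?thesis using blk_Suc[of "u(m := \<phi>)" m n d] \<phi>c by simp
  qed
  ultimately have "PP (Suc m)" unfolding PP_def using u \<phi> by (intro exI[of _ "u(m := \<phi>)"]) (auto simp: less_Suc_eq)
  thus False using max by fastforce
 qed
 have Winv1: "\<eta> y *\<^sub>v w \<in> W" if y: "y \<in> M1" and w: "w \<in> W" for y w
 proof -
  have \<eta>u: "\<eta> y * u l \<in> I" if l: "l < m" for l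
  proof -
   have "\<eta> z * (\<eta> y * u l) = (\<eta> y * u l) * \<nu> z" if z: "z \<in> M2" for z
   proof -
    have "\<eta> z * (\<eta> y * u l) = (\<eta> z * \<eta> y) * u l" using c1[OF y] c2[OF z] uc[OF l] by (simp add: mat_assoc_dim)
    also have "... = \<eta> y * (\<eta> z * u l)" unfolding com[OF y z, symmetric] using c1[OF y] c2[OF z] uc[OF l] by (simp add: mat_assoc_dim)
    also have "\<eta> z * u l = u l * \<nu> z" using u[OF l] z by (simp add: I_def)
    finally show ?thesis using c1[OF y] s[OF z] uc[OF l] by (simp add: mat_assoc_dim)
   qed
   thus ?thesis using c1[OF y] uc[OF l] by (auto simp: I_def)
  qed
  have "mat_im (\<eta> y * P) \<subseteq> W"
  proof -
   have "mat_im (blk n d m (\<lambda>l. \<eta> y * u l)) \<subseteq> W" by (rule mat_im_blk[OF W]) (use \<eta>u Ic Iim in auto)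
   moreover have "\<eta> y * P = blk n d m (\<lambda>l. \<eta> y * u l)" unfolding P_def by (rule mult_blk[OF c1[OF y] uc])
   ultimately show ?thesis by simp
  qed
  moreover obtain v where v: "v \<in> Vec (m * d)" "w = P *\<^sub>v v" using w Pc by (auto simp: W_def mat_im_def)
  moreover have "\<eta> y *\<^sub>v w = (\<eta> y * P) *\<^sub>v v" using v Pc c1[OF y] by (simp add: mat_vec_assoc_dim)
  ultimately show ?thesis using Pc by (auto simp: mat_im_def)
 qed
 have "\<eta> x *\<^sub>v w \<in> W" if x: "x \<in> S" and w: "w \<in> W" for x w
 proof -
  obtain y z where yz: "y \<in> M1" "z \<in> M2" "\<eta> x = \<eta> y + \<eta> z" using gen[OF x] by auto
  have "w \<in> Vec n" using w W by (auto simp: vsub_def)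
  hence "\<eta> x *\<^sub>v w = \<eta> y *\<^sub>v w + \<eta> z *\<^sub>v w"
   unfolding yz(3) by (rule add_mult_distrib_mat_vec[OF c1[OF yz(1)] c2[OF yz(2)]])
  thus ?thesis using Winv1[OF yz(1) w] Winv2[OF yz(2) w] W by (auto simp: vsub_def)
 qed
 hence "W = {0\<^sub>v n} \<or> W = Vec n" by (rule irr_famD(3)[OF \<eta> W])
 moreover have "W ~= {0\<^sub>v n}"
 proof
  assume W0: "W = {0\<^sub>v n}"
  have "Q \<in> I" using Q by (simp add: I_def)
  hence "Q *\<^sub>v unit_vec d 0 \<in> W" using Iim[of Q] Q(2) by (auto simp: mat_im_def)
  hence "unit_vec d 0 = (0\<^sub>v d :: 'k vec)" using Q(2,3) W0 by (auto simp: mat_inj_def)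
  thus False using d0 by (metis unit_vec_nonzero)
 qed
 ultimately have Wall: "W = Vec n" by simp
 have "n \<le> m * d"
  by (rule mat_im_inj_eq_dim(1)[of "1\<^sub>m n" n n P "m * d"]) (use Pc inj Wall in "auto simp: mat_im_def mat_inj_def W_def P_def")
 moreover have "m * d \<le> n" using mat_inj_dim_le[OF Pc] inj by (simp add: P_def)
 ultimately have md: "m * d = n" by simp
 have Pc': "P \<in> Mat n n" using Pc md by simp
 obtain Pi where Pi: "Pi \<in> Mat n n" "P * Pi = 1\<^sub>m n" "Pi * P = 1\<^sub>m n"
  using mat_inj_inverse[OF Pc'] inj unfolding P_def by metis
 have A2: "Pi * \<eta> z * P = kron (1\<^sub>m m) (\<nu> z)" if z: "z \<in> M2" for z
 proof -
  have k: "kron (1\<^sub>m m) (\<nu> z) \<in> Mat n n" using kron_carrier[OF one_Mat[of m] s[OF z]] md by simp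
  have "Pi * \<eta> z * P = Pi * (\<eta> z * P)" using Pi(1) Pc' c2[OF z] by (simp add: mat_assoc_dim)
  also have "... = (Pi * P) * kron (1\<^sub>m m) (\<nu> z)" unfolding Pint[OF z] by (rule assoc_mult_mat[OF Pi(1) Pc' k, symmetric])
  finally show ?thesis unfolding Pi(3) left_mult_one_mat[OF k] .
 qed
 have A1: "\<exists>T\<in>Mat m m. Pi * \<eta> y * P = kron T (1\<^sub>m d)" if y: "y \<in> M1" for y
 proof (rule commutant_one_kron[OF Q(1)])
  show "Pi * \<eta> y * P \<in> Mat (m * d) (m * d)"
   using mult_carrier_mat[OF mult_carrier_mat[OF Pi(1) c1[OF y]] Pc'] md by simp
  fix z assume z: "z \<in> M2"
  have mix: "(Pi * a * P) * (Pi * b * P) = Pi * (a * b) * P" if "a \<in> Mat n n" "b \<in> Mat n n" for a b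
  proof -
   have "(Pi * a * P) * (Pi * b * P) = Pi * a * (P * Pi) * b * P" using that Pi(1) Pc' by (simp add: mat_assoc_dim)
   thus ?thesis using that Pi Pc' by (simp add: mat_assoc_dim)
  qed
  show "Pi * \<eta> y * P * kron (1\<^sub>m m) (\<nu> z) = kron (1\<^sub>m m) (\<nu> z) * (Pi * \<eta> y * P)"
   unfolding A2[OF z, symmetric] mix[OF c1[OF y] c2[OF z]] mix[OF c2[OF z] c1[OF y]] com[OF y z] ..
 qed
 then obtain T where "!!y. y \<in> M1 ==> T y \<in> Mat m m" "!!y. y \<in> M1 ==> Pi * \<eta> y * P = kron (T y) (1\<^sub>m d)" by metis
 moreover have "m > 0" using md n0 by (cases m) auto
 ultimately show ?thesis using that[OF Q(1) _ md Pc' Pi A2] by blast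
qed

lemma kron_one_right_inj:
 assumes B: "B \<in> Mat m e" "mat_inj (B :: 'k::field mat)"
 shows "mat_inj (kron B (1\<^sub>m d))"
 unfolding mat_inj_def
proof (intro ballI impI)
 fix v assume v: "v \<in> Vec (dim_col (kron B (1\<^sub>m d)))"
  "kron B (1\<^sub>m d) *\<^sub>v v = 0\<^sub>v (dim_row (kron B (1\<^sub>m d)))"
 hence vc: "v \<in> Vec (e * d)" using B by auto
 define Q where "Q = mat (e * d) 1 (\<lambda>(i,j). v $ i)"
 have Q: "Q \<in> Mat (e * d) 1" by (simp add: Q_def)
 have z: "kron B (1\<^sub>m d) * Q = 0\<^sub>m (m * d) 1"
 proof (rule eq_matI)
  fix i j assume "i < dim_row (0\<^sub>m (m * d) 1 :: 'k mat)" "j < dim_col (0\<^sub>m (m * d) 1 :: 'k mat)"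
  hence ij: "i < m * d" "j = 0" by auto
  have "(kron B (1\<^sub>m d) * Q) $$ (i,j) = (kron B (1\<^sub>m d) *\<^sub>v v) $ i"
   using ij B vc by (simp add: Q_def scalar_prod_def)
  thus "(kron B (1\<^sub>m d) * Q) $$ (i,j) = 0\<^sub>m (m * d) 1 $$ (i,j)" using v(2) ij B by simp
 qed (use B in "auto simp: Q_def")
 have "left_block e d Q l = 0\<^sub>m e 1" if l: "l < d" for l
 proof (rule mat_inj_cancel[OF B])
  show "left_block e d Q l \<in> Mat e 1" using Q by auto
  have "B * left_block e d Q l = left_block m d (0\<^sub>m (m * d) 1) l"
   using left_block_kron[OF B(1) Q l] z by simp
  also have "... = 0\<^sub>m m 1" using l by (intro eq_matI) (auto simp: left_block_def pair_index_less)
  also have "... = B * 0\<^sub>m e 1" using B by auto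
  finally show "B * left_block e d Q l = B * 0\<^sub>m e 1" .
 qed auto
 hence "Q = 0\<^sub>m (e * d) 1" by (rule left_blocks_zero[OF Q])
 have "v $ i = 0" if "i < e * d" for i
 proof -
  have "v $ i = Q $$ (i, 0)" using that by (simp add: Q_def)
  thus ?thesis unfolding \<open>Q = 0\<^sub>m (e * d) 1\<close> using that by simp
 qed
 thus "v = 0\<^sub>v (dim_col (kron B (1\<^sub>m d)))" using vc B by (intro eq_vecI) auto
qed

text \<open>An invariant subspace \<open>W\<close> of the left factor gives the invariant subspace \<open>W \<otimes> k\<^sup>d\<close>.\<close>

lemma irr_fam_ksum_left_factor:
 assumes irr: "irr_fam (m * d) S (\<lambda>x. ksum m d (\<pi> x) (\<tau> x))"
  and car: "!!x. x \<in> S ==> \<pi> x \<in> Mat m m" "!!x. x \<in> S ==> \<tau> x \<in> Mat d d"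
 shows "irr_fam m S (\<pi> :: 'l => 'k::field mat)"
 unfolding irr_fam_def
proof (intro conjI allI impI ballI)
 have md: "m * d > 0" using irr_famD(1)[OF irr] .
 thus "0 < m" by simp
 show "\<pi> x \<in> Mat m m" if "x \<in> S" for x using car that by auto
 fix W assume "vsub m W & (\<forall>x\<in>S. \<forall>w\<in>W. \<pi> x *\<^sub>v w \<in> W)"
 hence W: "vsub m W" "!!x w. x \<in> S ==> w \<in> W ==> \<pi> x *\<^sub>v w \<in> W" by auto
 obtain e B \<beta> where B: "B \<in> Mat m e" "mat_inj B" "mat_im B = W"
  and \<beta>: "!!x. x \<in> S ==> \<beta> x \<in> Mat e e" "!!x. x \<in> S ==> \<pi> x * B = B * \<beta> x"
  using invariant_subspace_matrix[of S \<pi> m W] car(1) W by metis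
 define K where "K = kron B (1\<^sub>m d)"
 have Kc: "K \<in> Mat (m * d) (e * d)" using B by (auto simp: K_def)
 have Ki: "mat_inj K" unfolding K_def by (rule kron_one_right_inj[OF B(1,2)])
 have int: "ksum m d (\<pi> x) (\<tau> x) * K = K * ksum e d (\<beta> x) (\<tau> x)" if x: "x \<in> S" for x
 proof -
  note c = car[OF x] \<beta>(1)[OF x] B(1)
  note k = kron_carrier[OF c(1) one_Mat[of d]] kron_carrier[OF one_Mat[of m] c(2)]
   kron_carrier[OF c(3) one_Mat[of d]] kron_carrier[OF one_Mat[of e] c(2)]
  have "ksum m d (\<pi> x) (\<tau> x) * K = kron (\<pi> x) (1\<^sub>m d) * K + kron (1\<^sub>m m) (\<tau> x) * K"
   unfolding ksum_def by (rule add_mult_distrib_mat[OF k(1,2) Kc])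
  also have "kron (\<pi> x) (1\<^sub>m d) * K = kron (B * \<beta> x) (1\<^sub>m d)"
   unfolding K_def kron_mult[OF c(1) one_Mat c(4) one_Mat] \<beta>(2)[OF x] by simp
  also have "... = K * kron (\<beta> x) (1\<^sub>m d)"
   unfolding K_def kron_mult[OF c(4) one_Mat c(3) one_Mat] by simp
  also have "kron (1\<^sub>m m) (\<tau> x) * K = K * kron (1\<^sub>m e) (\<tau> x)"
   unfolding K_def kron_mult[OF one_Mat c(2) c(4) one_Mat] kron_mult[OF c(4) one_Mat one_Mat c(2)]
   using c by simp
  also have "K * kron (\<beta> x) (1\<^sub>m d) + K * kron (1\<^sub>m e) (\<tau> x) = K * ksum e d (\<beta> x) (\<tau> x)"
   unfolding ksum_def by (rule mult_add_distrib_mat[OF Kc k(3,4), symmetric])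
  finally show ?thesis .
 qed
 have "ksum m d (\<pi> x) (\<tau> x) *\<^sub>v w \<in> mat_im K" if x: "x \<in> S" and w: "w \<in> mat_im K" for x w
 proof -
  obtain v where v: "v \<in> Vec (e * d)" "w = K *\<^sub>v v" using w Kc by (auto simp: mat_im_def)
  note kc = ksum_carrier[OF car[OF x]] ksum_carrier[OF \<beta>(1)[OF x] car(2)[OF x]]
  have "ksum m d (\<pi> x) (\<tau> x) *\<^sub>v w = K *\<^sub>v (ksum e d (\<beta> x) (\<tau> x) *\<^sub>v v)"
   using arg_cong[OF int[OF x], of "\<lambda>M. M *\<^sub>v v"] v Kc kc by (simp add: mat_vec_assoc_dim)
  thus ?thesis using Kc kc v by (auto simp: mat_im_def)
 qed
 hence "mat_im K = {0\<^sub>v (m * d)} \<or> mat_im K = Vec (m * d)"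
  by (rule irr_famD(3)[OF irr vsub_mat_im[OF Kc]])
 thus "W = {0\<^sub>v m} \<or> W = Vec m"
 proof
  assume z: "mat_im K = {0\<^sub>v (m * d)}"
  have "e * d \<le> 0"
   by (rule mat_im_inj_eq_dim(1)[OF Kc Ki, of "0\<^sub>m (m * d) 0"]) (use z mat_im_trivial[of "0\<^sub>m (m * d) 0" "m * d"] in "auto simp: mat_inj_def")
  hence "e = 0" using md by auto
  thus ?thesis using mat_im_trivial[of B m] B by simp
 next
  assume a: "mat_im K = Vec (m * d)"
  have "m * d \<le> e * d"
   by (rule mat_im_inj_eq_dim(1)[of "1\<^sub>m (m * d)" "m * d" "m * d" K]) (use Kc Ki a in "auto simp: mat_im_def mat_inj_def")
  hence "m \<le> e" using md by auto
  hence "e = m" using mat_inj_dim_le[OF B(1,2)] by simp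
  thus ?thesis using mat_im_square_inj[of B m] B by simp
 qed
qed

section \<open>Representations up to isomorphism\<close>

text \<open>The closure properties that the isotropy algebras and the algebra of equivariant maps have in common.\<close>

definition lie_closed :: "('k::field, 'l::ab_group_add) lie_struct => bool" where
 "lie_closed L \<longleftrightarrow> 0 \<in> carr L &
  (\<forall>x\<in>carr L. \<forall>y\<in>carr L. x + y \<in> carr L) &
  (\<forall>c. \<forall>x\<in>carr L. lie_scale L c x \<in> carr L) &
  (\<forall>x. lie_scale L (- 1) x = - x) & (\<forall>c x y. lie_scale L c (x + y) = lie_scale L c x + lie_scale L c y) &
  (\<forall>x\<in>carr L. \<forall>y\<in>carr L. lie_bracket L x y \<in> carr L) &
  (\<forall>x\<in>carr L. \<forall>y\<in>carr L. \<forall>z\<in>carr L. lie_bracket L (x + y) z = lie_bracket L x z + lie_bracket L y z) &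
  (\<forall>x\<in>carr L. \<forall>y\<in>carr L. \<forall>z\<in>carr L. lie_bracket L x (y + z) = lie_bracket L x y + lie_bracket L x z)"

definition lie_ideal :: "('k::field, 'l::ab_group_add) lie_struct => 'l set => bool" where
 "lie_ideal L I \<longleftrightarrow> I \<subseteq> carr L & 0 \<in> I & (\<forall>x\<in>I. \<forall>y\<in>I. x + y \<in> I) &
  (\<forall>c. \<forall>x\<in>I. lie_scale L c x \<in> I) &
  (\<forall>x\<in>carr L. \<forall>y\<in>I. lie_bracket L x y \<in> I & lie_bracket L y x \<in> I)"

lemma lie_closedD:
 assumes "lie_closed L"
 shows "0 \<in> carr L" "x \<in> carr L ==> y \<in> carr L ==> x + y \<in> carr L"
  "x \<in> carr L ==> lie_scale L c x \<in> carr L" "lie_scale L (- 1) x = - x"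
  "x \<in> carr L ==> y \<in> carr L ==> lie_bracket L x y \<in> carr L"
  "x \<in> carr L ==> y \<in> carr L ==> z \<in> carr L ==> lie_bracket L (x + y) z = lie_bracket L x z + lie_bracket L y z"
  "x \<in> carr L ==> y \<in> carr L ==> z \<in> carr L ==> lie_bracket L x (y + z) = lie_bracket L x y + lie_bracket L x z"
 using assms unfolding lie_closed_def by auto

lemma lie_scale_diff:
 assumes "lie_closed L" shows "lie_scale L c (x - y) = lie_scale L c x - lie_scale L c y"
proof -
 have "lie_scale L c (x - y + y) = lie_scale L c (x - y) + lie_scale L c y" using assms unfolding lie_closed_def by blast
 thus ?thesis by simp
qed

lemma lie_closed_uminus: "lie_closed L ==> x \<in> carr L ==> - x \<in> carr L"
 using lie_closedD(3,4) by metis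

lemma lie_closed_diff: "lie_closed L ==> x \<in> carr L ==> y \<in> carr L ==> x - y \<in> carr L"
 using lie_closed_uminus lie_closedD(2) by (metis diff_conv_add_uminus)

lemma lie_bracket_diff:
 assumes "lie_closed L" "x \<in> carr L" "y \<in> carr L" "z \<in> carr L"
 shows "lie_bracket L (x - y) z = lie_bracket L x z - lie_bracket L y z"
  "lie_bracket L z (x - y) = lie_bracket L z x - lie_bracket L z y"
 using lie_closedD(6)[OF assms(1) lie_closed_diff[OF assms(1,2,3)] assms(3,4)]
  lie_closedD(7)[OF assms(1) assms(4) lie_closed_diff[OF assms(1,2,3)] assms(3)] by simp_all

lemma lie_idealD:
 assumes "lie_ideal L I"
 shows "x \<in> I ==> x \<in> carr L" "0 \<in> I" "x \<in> I ==> y \<in> I ==> x + y \<in> I" "x \<in> I ==> lie_scale L c x \<in> I"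
  "x \<in> carr L ==> y \<in> I ==> lie_bracket L x y \<in> I" "x \<in> carr L ==> y \<in> I ==> lie_bracket L y x \<in> I"
 using assms unfolding lie_ideal_def by auto

lemma lie_ideal_diff:
 assumes "lie_closed L" "lie_ideal L I" "x \<in> I" "y \<in> I" shows "x - y \<in> I"
 using lie_idealD(3,4)[OF assms(2)] lie_closedD(4)[OF assms(1)] assms(3,4) by (metis diff_conv_add_uminus)

lemma is_rep_pair:
 "is_rep L (n, \<rho>) \<longleftrightarrow> (\<forall>x\<in>carr L. \<rho> x \<in> Mat n n) &
  (\<forall>x\<in>carr L. \<forall>y\<in>carr L. \<rho> (x + y) = \<rho> x + \<rho> y) &
  (\<forall>c. \<forall>x\<in>carr L. \<rho> (lie_scale L c x) = c \<cdot>\<^sub>m \<rho> x) &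
  (\<forall>x\<in>carr L. \<forall>y\<in>carr L. \<rho> (lie_bracket L x y) = \<rho> x * \<rho> y - \<rho> y * \<rho> x)"
 by (simp add: is_rep_def)

lemma is_repD:
 assumes "is_rep L (n, \<rho>)"
 shows "x \<in> carr L ==> \<rho> x \<in> Mat n n"
  "x \<in> carr L ==> y \<in> carr L ==> \<rho> (x + y) = \<rho> x + \<rho> y"
  "x \<in> carr L ==> \<rho> (lie_scale L c x) = c \<cdot>\<^sub>m \<rho> x"
  "x \<in> carr L ==> y \<in> carr L ==> \<rho> (lie_bracket L x y) = \<rho> x * \<rho> y - \<rho> y * \<rho> x"
 using assms unfolding is_rep_pair by auto

lemma is_rep_diff:
 assumes L: "lie_closed L" and r: "is_rep L (n, \<rho>)" and x: "x \<in> carr L" and y: "y \<in> carr L"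
 shows "\<rho> (x - y) = \<rho> x - \<rho> y"
proof -
 have m: "- y \<in> carr L" by (rule lie_closed_uminus[OF L y])
 have "\<rho> (- y) = (- 1) \<cdot>\<^sub>m \<rho> y" using is_repD(3)[OF r y, of "- 1"] lie_closedD(4)[OF L] by simp
 moreover have "\<rho> (x + - y) = \<rho> x + \<rho> (- y)" by (rule is_repD(2)[OF r x m])
 ultimately show ?thesis using is_repD(1)[OF r x] is_repD(1)[OF r y] by (intro eq_matI) auto
qed

lemma is_rep_zero:
 assumes L: "lie_closed L" and r: "is_rep L (n, \<rho>)" shows "\<rho> 0 = 0\<^sub>m n n"
 using is_rep_diff[OF L r lie_closedD(1)[OF L] lie_closedD(1)[OF L]] is_repD(1)[OF r lie_closedD(1)[OF L]]
 by (auto intro!: eq_matI)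

lemma is_rep_cong:
 assumes "!!x. x \<in> carr L ==> \<rho> x = \<nu> x" "lie_closed L"
 shows "is_rep L (n, \<rho>) \<longleftrightarrow> is_rep L (n, \<nu>)"
 using assms(1) lie_closedD(2,3,5)[OF assms(2)] unfolding is_rep_pair by auto

lemma tensor_rep_pair: "tensor (n, \<pi>) (m, \<tau>) = (n * m, \<lambda>x. ksum n m (\<pi> x) (\<tau> x))"
 by (simp add: tensor_rep_def ksum_def)

lemma is_rep_tensor_pair:
 assumes "is_rep L (n, \<pi>)" "is_rep L (m, \<tau>)"
 shows "is_rep L (n * m, \<lambda>x. ksum n m (\<pi> x) (\<tau> x))"
 unfolding is_rep_pair
 using is_repD[OF assms(1)] is_repD[OF assms(2)]
 by (auto simp: ksum_add ksum_smult ksum_commutator)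

lemma is_rep_tensor: "is_rep L \<pi> ==> is_rep L \<tau> ==> is_rep L (tensor \<pi> \<tau>)"
 by (cases \<pi>; cases \<tau>) (auto simp: tensor_rep_pair is_rep_tensor_pair)

lemma is_rep_trivial: "is_rep L trivial_rep"
 by (auto simp: trivial_rep_def is_rep_pair)

lemma rep_iso_pair:
 "rep_iso L (n, \<rho>) (m, \<nu>) \<longleftrightarrow> n = m & (\<exists>P\<in>Mat n n. \<exists>Pi\<in>Mat n n. P * Pi = 1\<^sub>m n & Pi * P = 1\<^sub>m n &
   (\<forall>x\<in>carr L. P * \<rho> x = \<nu> x * P))"
 unfolding rep_iso_def
 by (auto elim!: invertible_matE intro: invertible_matI)

lemma rep_iso_refl: "is_rep L \<pi> ==> rep_iso L \<pi> \<pi>"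
proof (cases \<pi>)
 case (Pair n \<rho>)
 assume "is_rep L \<pi>"
 hence "1\<^sub>m n * \<rho> x = \<rho> x * 1\<^sub>m n" if "x \<in> carr L" for x
  using that Pair by (metis is_repD(1) left_mult_one_mat right_mult_one_mat)
 thus ?thesis unfolding Pair rep_iso_pair by (auto intro!: bexI[of _ "1\<^sub>m n"])
qed

lemma rep_iso_eqI:
 assumes "is_rep L (n, \<rho>)" "!!x. x \<in> carr L ==> \<rho> x = \<nu> x"
 shows "rep_iso L (n, \<rho>) (n, \<nu>)"
 using rep_iso_refl[OF assms(1)] assms(2) unfolding rep_iso_pair by auto

lemma rep_iso_sym:
 assumes r: "is_rep L \<pi>" "is_rep L \<tau>" and i: "rep_iso L \<pi> \<tau>" shows "rep_iso L \<tau> \<pi>"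
proof -
 obtain n \<rho> m \<nu> where p: "\<pi> = (n, \<rho>)" "\<tau> = (m, \<nu>)" by (cases \<pi>; cases \<tau>) auto
 from i obtain P Pi where nm: "n = m" and P: "P \<in> Mat n n" "Pi \<in> Mat n n" "P * Pi = 1\<^sub>m n" "Pi * P = 1\<^sub>m n"
  and int: "!!x. x \<in> carr L ==> P * \<rho> x = \<nu> x * P" unfolding p rep_iso_pair by auto
 have "Pi * \<nu> x = \<rho> x * Pi" if x: "x \<in> carr L" for x
 proof -
  have c: "\<rho> x \<in> Mat n n" "\<nu> x \<in> Mat n n" using is_repD(1) r x unfolding p nm by auto
  have "Pi * \<nu> x = Pi * (\<nu> x * P) * Pi" using c P by (simp add: mat_assoc_dim)
  also have "... = (Pi * P) * \<rho> x * Pi" unfolding int[OF x, symmetric] using c P(1,2) by (simp add: mat_assoc_dim)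
  finally show ?thesis using c P by simp
 qed
 thus ?thesis unfolding p rep_iso_pair using nm P by auto
qed

lemma rep_iso_trans:
 assumes r: "is_rep L \<pi>" "is_rep L \<tau>" "is_rep L \<kappa>" and i: "rep_iso L \<pi> \<tau>" "rep_iso L \<tau> \<kappa>"
 shows "rep_iso L \<pi> \<kappa>"
proof -
 obtain n \<rho> m \<nu> l k where p: "\<pi> = (n, \<rho>)" "\<tau> = (m, \<nu>)" "\<kappa> = (l, k)" by (cases \<pi>; cases \<tau>; cases \<kappa>) auto
 from i(1) obtain P Pi where nm: "m = n" and P: "P \<in> Mat n n" "Pi \<in> Mat n n" "P * Pi = 1\<^sub>m n" "Pi * P = 1\<^sub>m n"
  and int: "!!x. x \<in> carr L ==> P * \<rho> x = \<nu> x * P" unfolding p rep_iso_pair by auto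
 from i(2) nm obtain Q Qi where lm: "l = n" and Q: "Q \<in> Mat n n" "Qi \<in> Mat n n" "Q * Qi = 1\<^sub>m n" "Qi * Q = 1\<^sub>m n"
  and int2: "!!x. x \<in> carr L ==> Q * \<nu> x = k x * Q" unfolding p rep_iso_pair by auto
 have "Q * P * \<rho> x = k x * (Q * P)" if x: "x \<in> carr L" for x
 proof -
  have c: "\<rho> x \<in> Mat n n" "\<nu> x \<in> Mat n n" "k x \<in> Mat n n" using is_repD(1) r x unfolding p nm lm by auto
  have "Q * P * \<rho> x = Q * (\<nu> x * P)" using c P(1) Q(1) by (simp add: mat_assoc_dim int[OF x])
  also have "... = (k x * Q) * P" unfolding int2[OF x, symmetric] using c P(1) Q(1) by (simp add: mat_assoc_dim)
  finally show ?thesis using c P(1) Q(1) by (simp add: mat_assoc_dim)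
 qed
 moreover have "Q * P * (Pi * Qi) = 1\<^sub>m n"
 proof -
  have "Q * P * (Pi * Qi) = Q * (P * Pi) * Qi" using P(1,2) Q(1,2) by (simp add: mat_assoc_dim)
  thus ?thesis using P Q by simp
 qed
 moreover have "Pi * Qi * (Q * P) = 1\<^sub>m n"
 proof -
  have "Pi * Qi * (Q * P) = Pi * (Qi * Q) * P" using P(1,2) Q(1,2) by (simp add: mat_assoc_dim)
  thus ?thesis using P Q by simp
 qed
 moreover have "Q * P \<in> Mat n n" "Pi * Qi \<in> Mat n n" using P(1,2) Q(1,2) by auto
 ultimately show ?thesis unfolding p rep_iso_pair using nm lm by blast
qed

lemma irreducible_rep_iso:
 assumes \<pi>: "irrep L \<pi>" and \<tau>: "is_rep L \<tau>" and i: "rep_iso L \<pi> \<tau>"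
 shows "irrep L \<tau>"
proof -
 obtain n \<rho> m \<nu> where p: "\<pi> = (n, \<rho>)" "\<tau> = (m, \<nu>)" by (cases \<pi>; cases \<tau>) auto
 have r: "is_rep L (n, \<rho>)" "irr_fam n (carr L) \<rho>" using \<pi> unfolding p irreducible_rep_iff by auto
 from i obtain P Pi where nm: "m = n" and P: "P \<in> Mat n n" "Pi \<in> Mat n n" "P * Pi = 1\<^sub>m n" "Pi * P = 1\<^sub>m n"
  and int: "!!x. x \<in> carr L ==> P * \<rho> x = \<nu> x * P" unfolding p rep_iso_pair by auto
 have "irr_fam n (carr L) \<nu>"
  unfolding irr_fam_def
 proof (intro conjI allI impI ballI)
  show "0 < n" using irr_famD(1)[OF r(2)] .
  show s: "\<nu> x \<in> Mat n n" if "x \<in> carr L" for x using is_repD(1) \<tau> that unfolding p nm by auto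
  fix W assume "vsub n W & (\<forall>x\<in>carr L. \<forall>w\<in>W. \<nu> x *\<^sub>v w \<in> W)"
  hence W: "vsub n W" and inv: "!!x w. x \<in> carr L ==> w \<in> W ==> \<nu> x *\<^sub>v w \<in> W" by auto
  define W' where "W' = {v \<in> Vec n. P *\<^sub>v v \<in> W}"
  have "vsub n W'" using W P unfolding vsub_def W'_def
   by (auto simp: mult_add_distrib_mat_vec smult_mult_mat_vec_right)
  moreover have "\<rho> x *\<^sub>v v \<in> W'" if x: "x \<in> carr L" and v: "v \<in> W'" for x v
  proof -
   have c: "\<rho> x \<in> Mat n n" using irr_famD(2)[OF r(2) x] .
   have vc: "v \<in> Vec n" using v by (simp add: W'_def)
   have "P *\<^sub>v (\<rho> x *\<^sub>v v) = \<nu> x *\<^sub>v (P *\<^sub>v v)"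
    using arg_cong[OF int[OF x], of "\<lambda>M. M *\<^sub>v v"] c s[OF x] P(1) vc by (simp add: mat_vec_assoc_dim)
   thus ?thesis using inv[OF x, of "P *\<^sub>v v"] v c by (auto simp: W'_def)
  qed
  ultimately have "W' = {0\<^sub>v n} \<or> W' = Vec n" by (rule irr_famD(3)[OF r(2)])
  moreover have bk: "Pi *\<^sub>v w \<in> W' & P *\<^sub>v (Pi *\<^sub>v w) = w" if w: "w \<in> W \<or> w \<in> Vec n & W' = Vec n" for w
  proof -
   have wc: "w \<in> Vec n" using w W by (auto simp: vsub_def)
   have "P *\<^sub>v (Pi *\<^sub>v w) = (P * Pi) *\<^sub>v w" using P(1,2) wc by (simp add: mat_vec_assoc_dim)
   hence e: "P *\<^sub>v (Pi *\<^sub>v w) = w" using P wc by simp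
   have c: "Pi *\<^sub>v w \<in> Vec n" using P wc by auto
   have "Pi *\<^sub>v w \<in> W'"
   proof (cases "w \<in> W")
    case True
    thus ?thesis using e c by (simp add: W'_def)
   next
    case False
    hence "W' = Vec n" using w by blast
    thus ?thesis using c by blast
   qed
   thus ?thesis using e by blast
  qed
  ultimately show "W = {0\<^sub>v n} \<or> W = Vec n"
  proof (elim disjE)
   assume W'0: "W' = {0\<^sub>v n}"
   have "w = 0\<^sub>v n" if "w \<in> W" for w
   proof -
    have "Pi *\<^sub>v w = 0\<^sub>v n" "P *\<^sub>v (Pi *\<^sub>v w) = w" using bk[of w] that W'0 by auto
    thus ?thesis using P by auto
   qed
   thus ?thesis using W by (auto simp: vsub_def)
  next
   assume W'1: "W' = Vec n"
   have "w \<in> W" if "w \<in> Vec n" for w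
   proof -
    have b: "Pi *\<^sub>v w \<in> W'" "P *\<^sub>v (Pi *\<^sub>v w) = w" using bk[of w] that W'1 by simp_all
    from b(1) have "P *\<^sub>v (Pi *\<^sub>v w) \<in> W" by (simp add: W'_def)
    thus ?thesis by (simp only: b(2))
   qed
   thus ?thesis using W by (auto simp: vsub_def)
  qed
 qed
 thus ?thesis using \<tau> unfolding p nm irreducible_rep_iff by simp
qed

lemma irr_fam_one:
 assumes "!!x. x \<in> S ==> \<rho> x \<in> Mat 1 1" shows "irr_fam 1 S (\<rho> :: 'l => 'k::field mat)"
 unfolding irr_fam_def
proof (intro conjI allI impI ballI)
 fix W :: "'k vec set" assume W: "vsub 1 W & (\<forall>x\<in>S. \<forall>w\<in>W. \<rho> x *\<^sub>v w \<in> W)"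
 show "W = {0\<^sub>v 1} \<or> W = Vec 1"
 proof (cases "W \<subseteq> {0\<^sub>v 1}")
  case True
  thus ?thesis using W by (auto simp: vsub_def)
 next
  case False
  then obtain w where w: "w \<in> W" "w ~= 0\<^sub>v 1" by auto
  have wc: "w \<in> Vec 1" using w W by (auto simp: vsub_def)
  hence w0: "w $ 0 ~= 0" using w(2) by (auto simp: vec_eq_iff)
  have "v \<in> W" if "v \<in> Vec 1" for v
  proof -
   have "v = (v $ 0 / w $ 0) \<cdot>\<^sub>v w" using that wc w0 by (intro eq_vecI) auto
   thus ?thesis using w W unfolding vsub_def by metis
  qed
  thus ?thesis using W by (auto simp: vsub_def)
 qed
qed (use assms in auto)

lemma irreducible_rep_one: "is_rep L (1, \<rho>) ==> irrep L (1, \<rho>)"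
 unfolding irreducible_rep_iff by (intro conjI irr_fam_one) (simp_all add: is_repD(1))

lemma irrep_is_rep: "irrep L \<pi> ==> is_rep L \<pi>" by (simp add: irreducible_rep_def)

lemma iso_class_eq_iff:
 assumes "is_rep L \<pi>" "is_rep L \<tau>"
 shows "iso_class L \<pi> = iso_class L \<tau> \<longleftrightarrow> rep_iso L \<pi> \<tau>"
proof
 assume "iso_class L \<pi> = iso_class L \<tau>"
 hence "\<tau> \<in> iso_class L \<pi>" using rep_iso_refl[OF assms(2)] assms(2) by (auto simp: iso_class_def)
 thus "rep_iso L \<pi> \<tau>" by (simp add: iso_class_def)
next
 assume i: "rep_iso L \<pi> \<tau>"
 thus "iso_class L \<pi> = iso_class L \<tau>"
  using rep_iso_trans assms rep_iso_sym[OF assms i] unfolding iso_class_def by blast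
qed

lemma iso_class_self: "is_rep L \<pi> ==> \<pi> \<in> iso_class L \<pi>"
 by (simp add: iso_class_def rep_iso_refl)

lemma iso_class_memD: "\<tau> \<in> iso_class L \<pi> ==> is_rep L \<tau> & rep_iso L \<pi> \<tau>"
 by (simp add: iso_class_def)

lemma iso_class_of_mem:
 "is_rep L \<pi> ==> \<tau> \<in> iso_class L \<pi> ==> iso_class L \<tau> = iso_class L \<pi>"
 using iso_class_eq_iff iso_class_memD by metis

lemma rep_iso_fst: "rep_iso L \<pi> \<tau> ==> fst \<pi> = fst \<tau>"
 by (cases \<pi>; cases \<tau>) (auto simp: rep_iso_def)

lemma class_dim_iso_class: "is_rep L \<pi> ==> class_dim (iso_class L \<pi>) = fst \<pi>"
 unfolding class_dim_def
proof (rule the_equality)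
 assume r: "is_rep L \<pi>"
 show "\<exists>\<tau>\<in>iso_class L \<pi>. fst \<tau> = fst \<pi>" using iso_class_self[OF r] by blast
 show "n = fst \<pi>" if "\<exists>\<tau>\<in>iso_class L \<pi>. fst \<tau> = n" for n
  using that iso_class_memD rep_iso_fst by metis
qed

lemma irr_classes_iff: "C \<in> irr_classes L \<longleftrightarrow> (\<exists>\<pi>. irrep L \<pi> & C = iso_class L \<pi>)"
 by (auto simp: irr_classes_def)

lemma irr_classes_mem:
 assumes "C \<in> irr_classes L" "\<pi> \<in> C"
 shows "irrep L \<pi>" "C = iso_class L \<pi>"
proof -
 obtain \<tau> where t: "irrep L \<tau>" "C = iso_class L \<tau>" using assms(1) unfolding irr_classes_iff by auto
 note m = iso_class_memD[OF assms(2)[unfolded t(2)]]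
 show "irrep L \<pi>" using irreducible_rep_iso[OF t(1)] m by auto
 show "C = iso_class L \<pi>" using iso_class_of_mem[OF irrep_is_rep[OF t(1)]] assms(2) t(2) by auto
qed

lemma irr_classes_nonempty: "C \<in> irr_classes L ==> \<exists>\<pi>. \<pi> \<in> C"
 unfolding irr_classes_iff using iso_class_self irrep_is_rep by blast

section \<open>Tensor products up to isomorphism\<close>

lemma rep_iso_tensor:
 assumes r: "is_rep L \<pi>" "is_rep L \<pi>'" "is_rep L \<tau>" "is_rep L \<tau>'"
  and i: "rep_iso L \<pi> \<pi>'" "rep_iso L \<tau> \<tau>'"
 shows "rep_iso L (tensor \<pi> \<tau>) (tensor \<pi>' \<tau>')"
proof -
 obtain n a n' a' m b m' b' where p: "\<pi> = (n, a)" "\<pi>' = (n', a')" "\<tau> = (m, b)" "\<tau>' = (m', b')"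
  by (cases \<pi>; cases \<tau>; cases \<pi>'; cases \<tau>') auto
 from i(1) obtain P Pi where nm: "n' = n" and P: "P \<in> Mat n n" "Pi \<in> Mat n n" "P * Pi = 1\<^sub>m n" "Pi * P = 1\<^sub>m n"
  and int: "!!x. x \<in> carr L ==> P * a x = a' x * P" unfolding p rep_iso_pair by auto
 from i(2) obtain Q Qi where mm: "m' = m" and Q: "Q \<in> Mat m m" "Qi \<in> Mat m m" "Q * Qi = 1\<^sub>m m" "Qi * Q = 1\<^sub>m m"
  and int2: "!!x. x \<in> carr L ==> Q * b x = b' x * Q" unfolding p rep_iso_pair by auto
 have "kron P Q * ksum n m (a x) (b x) = ksum n m (a' x) (b' x) * kron P Q" if x: "x \<in> carr L" for x
 proof -
  have c: "a x \<in> Mat n n" "a' x \<in> Mat n n" "b x \<in> Mat m m" "b' x \<in> Mat m m"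
   using is_repD(1) r x unfolding p nm mm by auto
  note k = kron_carrier[OF c(1) one_Mat[of m]] kron_carrier[OF one_Mat[of n] c(3)]
   kron_carrier[OF c(2) one_Mat[of m]] kron_carrier[OF one_Mat[of n] c(4)] kron_carrier[OF P(1) Q(1)]
  have "kron P Q * ksum n m (a x) (b x) = kron P Q * kron (a x) (1\<^sub>m m) + kron P Q * kron (1\<^sub>m n) (b x)"
   unfolding ksum_def by (rule mult_add_distrib_mat[OF k(5,1,2)])
  also have "... = kron (a' x * P) Q + kron P (b' x * Q)"
   unfolding kron_mult[OF P(1) Q(1) c(1) one_Mat] kron_mult[OF P(1) Q(1) one_Mat c(3)]
    int[OF x] int2[OF x] right_mult_one_mat[OF P(1)] right_mult_one_mat[OF Q(1)] ..
  also have "... = kron (a' x) (1\<^sub>m m) * kron P Q + kron (1\<^sub>m n) (b' x) * kron P Q"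
   unfolding kron_mult[OF c(2) one_Mat P(1) Q(1)] kron_mult[OF one_Mat c(4) P(1) Q(1)]
    left_mult_one_mat[OF P(1)] left_mult_one_mat[OF Q(1)] ..
  also have "... = ksum n m (a' x) (b' x) * kron P Q"
   unfolding ksum_def by (rule add_mult_distrib_mat[OF k(3,4,5), symmetric])
  finally show ?thesis .
 qed
 moreover have "kron P Q * kron Pi Qi = 1\<^sub>m (n * m)" "kron Pi Qi * kron P Q = 1\<^sub>m (n * m)"
  unfolding kron_mult[OF P(1) Q(1) P(2) Q(2)] kron_mult[OF P(2) Q(2) P(1) Q(1)] P Q by (simp_all add: kron_one)
 ultimately show ?thesis unfolding p tensor_rep_pair rep_iso_pair nm mm using P Q by blast
qed

lemma rep_iso_tensor_comm:
 assumes r: "is_rep L \<pi>" "is_rep L \<tau>"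
 shows "rep_iso L (tensor \<pi> \<tau>) (tensor \<tau> \<pi>)"
proof -
 obtain n a m b where p: "\<pi> = (n, a)" "\<tau> = (m, b)" by (cases \<pi>; cases \<tau>) auto
 have "flip n m * ksum n m (a x) (b x) = ksum m n (b x) (a x) * flip n m" if x: "x \<in> carr L" for x
 proof -
  have c: "a x \<in> Mat n n" "b x \<in> Mat m m" using is_repD(1) r x unfolding p by auto
  note k = kron_carrier[OF c(1) one_Mat[of m]] kron_carrier[OF one_Mat[of n] c(2)]
   kron_carrier[OF one_Mat[of m] c(1)] kron_carrier[OF c(2) one_Mat[of n]]
  have "flip n m * ksum n m (a x) (b x) = flip n m * kron (a x) (1\<^sub>m m) + flip n m * kron (1\<^sub>m n) (b x)"
   unfolding ksum_def by (rule mult_add_distrib_mat[OF flip_carrier k(1,2)])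
  also have "... = kron (1\<^sub>m m) (a x) * flip n m + kron (b x) (1\<^sub>m n) * flip n m"
   unfolding flip_kron[OF c(1) one_Mat] flip_kron[OF one_Mat c(2)] ..
  also have "... = kron (b x) (1\<^sub>m n) * flip n m + kron (1\<^sub>m m) (a x) * flip n m"
   by (rule comm_add_mat[OF mult_carrier_mat[OF k(3) flip_carrier] mult_carrier_mat[OF k(4) flip_carrier]])
  also have "... = ksum m n (b x) (a x) * flip n m"
   unfolding ksum_def by (rule add_mult_distrib_mat[OF k(4,3) flip_carrier, symmetric])
  finally show ?thesis .
 qed
 thus ?thesis unfolding p tensor_rep_pair rep_iso_pair
  using flip_flip[of n m] flip_flip[of m n] flip_carrier[of n m] flip_carrier[of m n]
  by (simp add: mult.commute[of n m]) blast
qed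

lemma rep_iso_tensor_assoc:
 assumes r: "is_rep L \<pi>" "is_rep L \<tau>" "is_rep L \<kappa>"
 shows "rep_iso L (tensor \<pi> (tensor \<tau> \<kappa>)) (tensor (tensor \<pi> \<tau>) \<kappa>)"
proof -
 obtain n a m b l c where p: "\<pi> = (n, a)" "\<tau> = (m, b)" "\<kappa> = (l, c)" by (cases \<pi>; cases \<tau>; cases \<kappa>) auto
 have eq: "ksum n (m * l) (a x) (ksum m l (b x) (c x)) = ksum (n * m) l (ksum n m (a x) (b x)) (c x)" if x: "x \<in> carr L" for x
 proof -
  have ca: "a x \<in> Mat n n" "b x \<in> Mat m m" "c x \<in> Mat l l" using is_repD(1) r x unfolding p by auto
  note k = kron_carrier[OF ca(1) one_Mat[of m]] kron_carrier[OF one_Mat[of n] ca(2)]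
   kron_carrier[OF ca(2) one_Mat[of l]] kron_carrier[OF one_Mat[of m] ca(3)]
  have "ksum n (m * l) (a x) (ksum m l (b x) (c x)) = kron (a x) (kron (1\<^sub>m m) (1\<^sub>m l)) +
   (kron (1\<^sub>m n) (kron (b x) (1\<^sub>m l)) + kron (1\<^sub>m n) (kron (1\<^sub>m m) (c x)))"
   unfolding ksum_def kron_one kron_add_right[OF one_Mat k(3,4)] ..
  also have "... = (kron (kron (a x) (1\<^sub>m m)) (1\<^sub>m l) + kron (kron (1\<^sub>m n) (b x)) (1\<^sub>m l)) + kron (kron (1\<^sub>m n) (1\<^sub>m m)) (c x)"
   unfolding kron_assoc by (rule assoc_add_mat[symmetric]) (use k ca in auto)
  also have "... = ksum (n * m) l (ksum n m (a x) (b x)) (c x)"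
   unfolding ksum_def kron_one kron_add_left[OF k(1,2) one_Mat] ..
  finally show ?thesis .
 qed
 have "is_rep L (n * (m * l), \<lambda>x. ksum n (m * l) (a x) (ksum m l (b x) (c x)))"
  using is_rep_tensor_pair r unfolding p by blast
 from rep_iso_eqI[OF this, of "\<lambda>x. ksum (n * m) l (ksum n m (a x) (b x)) (c x)"] eq
 show ?thesis unfolding p tensor_rep_pair by (simp add: mult.assoc)
qed

lemma rep_iso_tensor_swap:
 assumes r: "is_rep L \<pi>" "is_rep L \<tau>" "is_rep L \<kappa>"
 shows "rep_iso L (tensor \<pi> (tensor \<tau> \<kappa>)) (tensor \<tau> (tensor \<pi> \<kappa>))"
proof -
 note t = is_rep_tensor
 have 1: "rep_iso L (tensor \<pi> (tensor \<tau> \<kappa>)) (tensor (tensor \<pi> \<tau>) \<kappa>)" by (rule rep_iso_tensor_assoc[OF r])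
 have 2: "rep_iso L (tensor (tensor \<pi> \<tau>) \<kappa>) (tensor (tensor \<tau> \<pi>) \<kappa>)"
  by (rule rep_iso_tensor; intro r t rep_iso_refl rep_iso_tensor_comm)
 have 3: "rep_iso L (tensor (tensor \<tau> \<pi>) \<kappa>) (tensor \<tau> (tensor \<pi> \<kappa>))"
  by (rule rep_iso_sym[OF _ _ rep_iso_tensor_assoc[OF r(2,1,3)]]; intro r t)
 show ?thesis
  by (rule rep_iso_trans[OF _ _ _ 1 rep_iso_trans[OF _ _ _ 2 3]]; intro r t)
qed

lemma class_tensor_iso_class:
 assumes "is_rep L \<pi>" "is_rep L \<tau>"
 shows "class_tensor L (iso_class L \<pi>) (iso_class L \<tau>) = iso_class L (tensor \<pi> \<tau>)"
proof -
 have "iso_class L (tensor \<pi>' \<tau>') = iso_class L (tensor \<pi> \<tau>)"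
  if "\<pi>' \<in> iso_class L \<pi>" "\<tau>' \<in> iso_class L \<tau>" for \<pi>' \<tau>'
 proof -
  note m = iso_class_memD[OF that(1)] iso_class_memD[OF that(2)]
  have "rep_iso L (tensor \<pi> \<tau>) (tensor \<pi>' \<tau>')" by (rule rep_iso_tensor) (use assms m in auto)
  thus ?thesis using iso_class_eq_iff is_rep_tensor assms m by metis
 qed
 thus ?thesis unfolding class_tensor_def using iso_class_self assms by blast
qed

definition tensor_list :: "('k::field, 'l) rep list => ('k, 'l) rep" where
 "tensor_list \<rho>s = foldr tensor \<rho>s trivial_rep"

lemma tensor_list_simps [simp]:
 "tensor_list [] = trivial_rep" "tensor_list (\<rho> # \<rho>s) = tensor \<rho> (tensor_list \<rho>s)"
 by (simp_all add: tensor_list_def)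

lemma is_rep_tensor_list: "(!!\<rho>. \<rho> \<in> set \<rho>s ==> is_rep L \<rho>) ==> is_rep L (tensor_list \<rho>s)"
 by (induction \<rho>s) (auto simp: is_rep_trivial is_rep_tensor)

lemma tensor_list_cong:
 assumes "list_all2 (rep_iso L) \<rho>s \<nu>s" "!!\<rho>. \<rho> \<in> set \<rho>s \<union> set \<nu>s ==> is_rep L \<rho>"
 shows "rep_iso L (tensor_list \<rho>s) (tensor_list \<nu>s)"
 using assms
proof (induction rule: list_all2_induct)
 case Nil
 thus ?case by (simp add: rep_iso_refl is_rep_trivial)
next
 case (Cons x xs y ys)
 hence "is_rep L x" "is_rep L y" "is_rep L (tensor_list xs)" "is_rep L (tensor_list ys)"
  by (simp_all add: is_rep_tensor_list)
 thus ?case using Cons by (simp add: rep_iso_tensor)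
qed

lemma tensor_list_move:
 assumes "!!\<rho>. \<rho> \<in> insert \<pi> (set xs \<union> set ys) ==> is_rep L \<rho>"
 shows "rep_iso L (tensor_list (\<pi> # xs @ ys)) (tensor_list (xs @ \<pi> # ys))"
 using assms
proof (induction xs)
 case Nil
 thus ?case by (simp add: rep_iso_refl is_rep_tensor is_rep_tensor_list)
next
 case (Cons x xs)
 have l: "is_rep L (tensor_list (xs @ ys))" "is_rep L (tensor_list (xs @ \<pi> # ys))" "is_rep L \<pi>" "is_rep L x"
  by (rule is_rep_tensor_list, rule Cons.prems, force)+ (rule Cons.prems, force)+
 have 1: "rep_iso L (tensor \<pi> (tensor x (tensor_list (xs @ ys)))) (tensor x (tensor \<pi> (tensor_list (xs @ ys))))"
  by (rule rep_iso_tensor_swap; intro l)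
 have 2: "rep_iso L (tensor x (tensor \<pi> (tensor_list (xs @ ys)))) (tensor x (tensor_list (xs @ \<pi> # ys)))"
 proof (intro rep_iso_tensor l is_rep_tensor rep_iso_refl)
  have "rep_iso L (tensor_list (\<pi> # xs @ ys)) (tensor_list (xs @ \<pi> # ys))" by (rule Cons.IH, rule Cons.prems, force)
  thus "rep_iso L (tensor \<pi> (tensor_list (xs @ ys))) (tensor_list (xs @ \<pi> # ys))" by simp
 qed
 show ?case unfolding append_Cons tensor_list_simps
  by (rule rep_iso_trans[OF _ _ _ 1 2]; intro l is_rep_tensor)
qed

lemma tensor_list_perm:
 assumes "mset \<rho>s = mset \<nu>s" "!!\<rho>. \<rho> \<in> set \<rho>s ==> is_rep L \<rho>"
 shows "rep_iso L (tensor_list \<rho>s) (tensor_list \<nu>s)"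
 using assms
proof (induction \<rho>s arbitrary: \<nu>s)
 case Nil
 thus ?case by (simp add: rep_iso_refl is_rep_trivial)
next
 case (Cons \<pi> \<rho>s)
 have "\<pi> \<in> set \<nu>s" using Cons.prems(1) by (metis list.set_intros(1) mset_eq_setD)
 then obtain xs ys where s: "\<nu>s = xs @ \<pi> # ys" by (meson split_list)
 have m: "mset \<rho>s = mset (xs @ ys)" using Cons.prems(1) s by simp
 hence st: "set \<rho>s = set (xs @ ys)" by (metis set_mset_mset)
 have r: "is_rep L \<rho>" if "\<rho> \<in> insert \<pi> (set xs \<union> set ys)" for \<rho> using that Cons.prems(2) st by auto
 have l: "is_rep L (tensor_list \<rho>s)" "is_rep L (tensor_list (xs @ ys))" "is_rep L (tensor_list \<nu>s)" "is_rep L \<pi>"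
  unfolding s by (rule is_rep_tensor_list, rule r, use st in force)+ (rule r, force)
 have "rep_iso L (tensor_list (\<pi> # \<rho>s)) (tensor_list (\<pi> # xs @ ys))"
  unfolding tensor_list_simps using Cons.IH[OF m] Cons.prems(2) by (intro rep_iso_tensor l rep_iso_refl) simp
 moreover have "rep_iso L (tensor_list (\<pi> # xs @ ys)) (tensor_list \<nu>s)" unfolding s by (rule tensor_list_move[OF r])
 moreover have "is_rep L (tensor_list (\<pi> # \<rho>s))" "is_rep L (tensor_list (\<pi> # xs @ ys))" using l by (simp_all add: is_rep_tensor)
 ultimately show ?case using rep_iso_trans l(3) by blast
qed

lemma tensor_list_vanish:
 assumes "!!\<rho>. \<rho> \<in> set \<rho>s ==> snd \<rho> x = 0\<^sub>m (fst \<rho>) (fst \<rho>)"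
 shows "snd (tensor_list \<rho>s) x = 0\<^sub>m (fst (tensor_list \<rho>s)) (fst (tensor_list \<rho>s))"
 using assms
proof (induction \<rho>s)
 case (Cons \<rho> \<rho>s)
 hence "snd \<rho> x = 0\<^sub>m (fst \<rho>) (fst \<rho>)"
  "snd (tensor_list \<rho>s) x = 0\<^sub>m (fst (tensor_list \<rho>s)) (fst (tensor_list \<rho>s))" by simp_all
 thus ?case by (cases \<rho>; cases "tensor_list \<rho>s") (simp add: tensor_rep_pair ksum_zero_zero)
qed (simp add: trivial_rep_def)

lemma tensor_list_carrier:
 assumes "!!\<rho>. \<rho> \<in> set \<rho>s ==> snd \<rho> x \<in> Mat (fst \<rho>) (fst \<rho>)"
 shows "snd (tensor_list \<rho>s) x \<in> Mat (fst (tensor_list \<rho>s)) (fst (tensor_list \<rho>s))"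
 using assms
proof (induction \<rho>s)
 case (Cons \<rho> \<rho>s)
 hence "snd \<rho> x \<in> Mat (fst \<rho>) (fst \<rho>)"
  "snd (tensor_list \<rho>s) x \<in> Mat (fst (tensor_list \<rho>s)) (fst (tensor_list \<rho>s))" by simp_all
 thus ?case by (cases \<rho>; cases "tensor_list \<rho>s") (simp add: tensor_rep_pair ksum_carrier)
qed (simp add: trivial_rep_def)

text \<open>Each factor has to be irreducible already on the elements that act as zero on all other factors.  For evaluation representations
  this comes from the surjectivity of evaluation.\<close>

lemma irr_tensor_list:
 fixes \<rho>s :: "('k::alg_closed_field, 'l) rep list"
 assumes "!!\<rho> x. \<rho> \<in> set \<rho>s ==> x \<in> S ==> snd \<rho> x \<in> Mat (fst \<rho>) (fst \<rho>)"
  and "!!i. i < length \<rho>s ==> irr_fam (fst (\<rho>s ! i))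
   {x \<in> S. \<forall>j<length \<rho>s. j ~= i \<longrightarrow> snd (\<rho>s ! j) x = 0\<^sub>m (fst (\<rho>s ! j)) (fst (\<rho>s ! j))} (snd (\<rho>s ! i))"
 shows "irr_fam (fst (tensor_list \<rho>s)) S (snd (tensor_list \<rho>s))"
 using assms
proof (induction \<rho>s arbitrary: S)
 case Nil
 thus ?case by (auto simp: trivial_rep_def intro!: irr_fam_one[unfolded One_nat_def])
next
 case (Cons \<rho> \<rho>s)
 obtain n \<pi> where \<rho>: "\<rho> = (n, \<pi>)" by (cases \<rho>)
 obtain m \<tau> where T: "tensor_list \<rho>s = (m, \<tau>)" by (cases "tensor_list \<rho>s")
 define M2 where "M2 = {x \<in> S. \<pi> x = 0\<^sub>m n n}"
 define M1 where "M1 = {x \<in> S. \<forall>j<length \<rho>s. snd (\<rho>s ! j) x = 0\<^sub>m (fst (\<rho>s ! j)) (fst (\<rho>s ! j))}"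
 have 1: "irr_fam n M1 \<pi>"
 proof -
  have "{x \<in> S. \<forall>j<length (\<rho> # \<rho>s). j ~= 0 \<longrightarrow> snd ((\<rho> # \<rho>s) ! j) x = 0\<^sub>m (fst ((\<rho> # \<rho>s) ! j)) (fst ((\<rho> # \<rho>s) ! j))} = M1"
   unfolding M1_def by (auto simp: less_Suc_eq_0_disj)
  thus ?thesis using Cons.prems(2)[of 0] \<rho> by simp
 qed
 have 2: "irr_fam (fst (tensor_list \<rho>s)) M2 (snd (tensor_list \<rho>s))"
 proof (rule Cons.IH)
  show "snd \<nu> x \<in> Mat (fst \<nu>) (fst \<nu>)" if "\<nu> \<in> set \<rho>s" "x \<in> M2" for \<nu> x
   using Cons.prems(1)[of \<nu> x] that by (auto simp: M2_def)
  fix i assume i: "i < length \<rho>s"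
  have "{x \<in> S. \<forall>j<length (\<rho> # \<rho>s). j ~= Suc i \<longrightarrow> snd ((\<rho> # \<rho>s) ! j) x = 0\<^sub>m (fst ((\<rho> # \<rho>s) ! j)) (fst ((\<rho> # \<rho>s) ! j))}
   = {x \<in> M2. \<forall>j<length \<rho>s. j ~= i \<longrightarrow> snd (\<rho>s ! j) x = 0\<^sub>m (fst (\<rho>s ! j)) (fst (\<rho>s ! j))}"
   unfolding M2_def \<rho> by (auto simp: less_Suc_eq_0_disj)
  thus "irr_fam (fst (\<rho>s ! i)) {x \<in> M2. \<forall>j<length \<rho>s. j ~= i \<longrightarrow> snd (\<rho>s ! j) x = 0\<^sub>m (fst (\<rho>s ! j)) (fst (\<rho>s ! j))} (snd (\<rho>s ! i))"
   using Cons.prems(2)[of "Suc i"] i by simp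
 qed
 have "irr_fam (n * m) S (\<lambda>x. ksum n m (\<pi> x) (\<tau> x))"
 proof (rule irr_fam_ksum[OF 1 2[unfolded T fst_conv snd_conv]])
  show "M1 \<subseteq> S" "M2 \<subseteq> S" by (auto simp: M1_def M2_def)
  show "\<tau> x = 0\<^sub>m m m" if "x \<in> M1" for x
  proof -
   have "snd \<nu> x = 0\<^sub>m (fst \<nu>) (fst \<nu>)" if "\<nu> \<in> set \<rho>s" for \<nu>
    using that \<open>x \<in> M1\<close> unfolding M1_def in_set_conv_nth by blast
   thus ?thesis using tensor_list_vanish[of \<rho>s x] unfolding T by simp
  qed
  show "\<pi> x = 0\<^sub>m n n" if "x \<in> M2" for x using that by (simp add: M2_def)
  show "\<pi> x \<in> Mat n n" if "x \<in> S" for x using Cons.prems(1)[of \<rho> x] that \<rho> by simp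
  show "\<tau> x \<in> Mat m m" if "x \<in> S" for x
   using tensor_list_carrier[of \<rho>s x] Cons.prems(1) that unfolding T by simp
 qed
 thus ?case by (simp add: \<rho> T tensor_rep_pair)
qed

text \<open>On the elements that act through the factor number \<open>i\<close> alone, a suitable block of \<open>Q\<close> is a nonzero intertwiner between these
  factors.  This is how the factors of a tensor product are recovered.\<close>

lemma tensor_list_intertwiner:
 fixes \<rho>s \<nu>s :: "('k::field, 'l) rep list"
 assumes "length \<rho>s = length \<nu>s" "i < length \<rho>s"
  and "!!\<rho> x. \<rho> \<in> set \<rho>s \<union> set \<nu>s ==> x \<in> S ==> snd \<rho> x \<in> Mat (fst \<rho>) (fst \<rho>)"
  and "!!j x. j < length \<rho>s ==> j ~= i ==> x \<in> S ==> snd (\<rho>s ! j) x = 0\<^sub>m (fst (\<rho>s ! j)) (fst (\<rho>s ! j)) &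
   snd (\<nu>s ! j) x = 0\<^sub>m (fst (\<nu>s ! j)) (fst (\<nu>s ! j))"
  and "Q \<in> Mat (fst (tensor_list \<nu>s)) (fst (tensor_list \<rho>s))"
  and "Q ~= 0\<^sub>m (fst (tensor_list \<nu>s)) (fst (tensor_list \<rho>s))"
  and "!!x. x \<in> S ==> Q * snd (tensor_list \<rho>s) x = snd (tensor_list \<nu>s) x * Q"
 shows "\<exists>R\<in>Mat (fst (\<nu>s ! i)) (fst (\<rho>s ! i)). R ~= 0\<^sub>m (fst (\<nu>s ! i)) (fst (\<rho>s ! i)) &
  (\<forall>x\<in>S. R * snd (\<rho>s ! i) x = snd (\<nu>s ! i) x * R)"
 using assms
proof (induction \<rho>s arbitrary: \<nu>s i Q)
 case (Cons \<rho> \<rho>s)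
 obtain \<nu> ss where ss: "\<nu>s = \<nu> # ss" "length ss = length \<rho>s" using Cons.prems(1) by (cases \<nu>s) auto
 obtain n \<pi> n' \<pi>' where \<rho>: "\<rho> = (n, \<pi>)" "\<nu> = (n', \<pi>')" by (cases \<rho>; cases \<nu>)
 obtain m \<tau> m' \<tau>' where T: "tensor_list \<rho>s = (m, \<tau>)" "tensor_list ss = (m', \<tau>')" by (cases "tensor_list \<rho>s"; cases "tensor_list ss")
 have Q: "Q \<in> Mat (n' * m') (n * m)" "Q ~= 0\<^sub>m (n' * m') (n * m)"
  using Cons.prems(5,6) by (auto simp: \<rho> T ss tensor_rep_pair)
 have int: "Q * ksum n m (\<pi> x) (\<tau> x) = ksum n' m' (\<pi>' x) (\<tau>' x) * Q" if "x \<in> S" for x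
  using Cons.prems(7)[OF that] by (simp add: \<rho> T ss tensor_rep_pair)
 have c\<pi>: "\<pi> x \<in> Mat n n" "\<pi>' x \<in> Mat n' n'" if "x \<in> S" for x
  using Cons.prems(3)[of \<rho> x] Cons.prems(3)[of \<nu> x] that by (auto simp: \<rho> ss)
 have c\<tau>: "\<tau> x \<in> Mat m m" "\<tau>' x \<in> Mat m' m'" if "x \<in> S" for x
  using tensor_list_carrier[of \<rho>s x] tensor_list_carrier[of ss x] Cons.prems(3) that by (auto simp: T ss)
 show ?case
 proof (cases i)
  case 0
  have z: "\<tau> x = 0\<^sub>m m m & \<tau>' x = 0\<^sub>m m' m'" if x: "x \<in> S" for x
  proof -
   have a: "snd (\<rho>s ! j) x = 0\<^sub>m (fst (\<rho>s ! j)) (fst (\<rho>s ! j)) & snd (ss ! j) x = 0\<^sub>m (fst (ss ! j)) (fst (ss ! j))"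
    if "j < length \<rho>s" for j using Cons.prems(4)[of "Suc j" x] that x 0 by (simp add: ss)
   show ?thesis using tensor_list_vanish[of \<rho>s x] tensor_list_vanish[of ss x] a ss(2) unfolding T in_set_conv_nth
    by (metis fst_conv snd_conv)
  qed
  have "Q * kron (\<pi> x) (1\<^sub>m m) = kron (\<pi>' x) (1\<^sub>m m') * Q" if "x \<in> S" for x
   using int[OF that] z[OF that] c\<pi>[OF that] by (simp add: ksum_zero_right)
  then obtain R where "R \<in> Mat n' n" "R ~= 0\<^sub>m n' n" "!!x. x \<in> S ==> R * \<pi> x = \<pi>' x * R"
   using left_factor_intertwiner[OF Q, of S \<pi> \<pi>'] c\<pi> by blast
  thus ?thesis unfolding 0 by (auto simp: \<rho> ss)
 next
  case (Suc i')
  have z: "\<pi> x = 0\<^sub>m n n & \<pi>' x = 0\<^sub>m n' n'" if "x \<in> S" for x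
   using Cons.prems(4)[of 0 x] that Suc by (simp add: ss \<rho>)
  have "Q * kron (1\<^sub>m n) (\<tau> x) = kron (1\<^sub>m n') (\<tau>' x) * Q" if "x \<in> S" for x
   using int[OF that] z[OF that] c\<tau>[OF that] by (simp add: ksum_zero_left)
  then obtain R where R: "R \<in> Mat m' m" "R ~= 0\<^sub>m m' m" "!!x. x \<in> S ==> R * \<tau> x = \<tau>' x * R"
   using right_factor_intertwiner[OF Q, of S \<tau> \<tau>'] c\<tau> by blast
  have "\<exists>R\<in>Mat (fst (ss ! i')) (fst (\<rho>s ! i')). R ~= 0\<^sub>m (fst (ss ! i')) (fst (\<rho>s ! i')) &
   (\<forall>x\<in>S. R * snd (\<rho>s ! i') x = snd (ss ! i') x * R)"
  proof (rule Cons.IH[of ss i' R])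
   show "snd \<kappa> x \<in> Mat (fst \<kappa>) (fst \<kappa>)" if "\<kappa> \<in> set \<rho>s \<union> set ss" "x \<in> S" for \<kappa> x
    using Cons.prems(3)[of \<kappa> x] that by (auto simp: ss)
   show "snd (\<rho>s ! j) x = 0\<^sub>m (fst (\<rho>s ! j)) (fst (\<rho>s ! j)) & snd (ss ! j) x = 0\<^sub>m (fst (ss ! j)) (fst (ss ! j))"
    if "j < length \<rho>s" "j ~= i'" "x \<in> S" for j x
    using Cons.prems(4)[of "Suc j" x] that Suc by (simp add: ss)
  qed (use R ss Suc Cons.prems(2) in "auto simp: T")
  thus ?thesis by (simp add: ss Suc)
 qed
qed simp

section \<open>Irreducible representations of sums of commuting ideals\<close>

lemma mat_eq_of_diff_zero:
 assumes "A \<in> Mat n m" "B \<in> Mat n m" "A - B = 0\<^sub>m n m" shows "A = (B :: 'k::field mat)"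
proof (rule eq_matI)
 fix i j assume ij: "i < dim_row B" "j < dim_col B"
 hence "(A - B) $$ (i,j) = A $$ (i,j) - B $$ (i,j)" by (rule index_minus_mat)
 thus "A $$ (i,j) = B $$ (i,j)" unfolding assms(3) using ij assms by auto
qed (use assms in auto)

lemma is_rep_congI:
 "is_rep L (n, \<rho>) ==> lie_closed L ==> (!!x. x \<in> carr L ==> \<rho> x = \<nu> x) ==> is_rep L (n, \<nu>)"
 using is_rep_cong[of L \<rho> \<nu> n] by blast

lemma is_rep_conj:
 assumes r: "is_rep L (n, \<rho>)" and P: "P \<in> Mat n n" "P' \<in> Mat n n" "P * P' = 1\<^sub>m n"
 shows "is_rep L (n, \<lambda>x. P' * \<rho> x * P)"
proof -
 have add: "P' * (a + b) * P = P' * a * P + P' * b * P" if "a \<in> Mat n n" "b \<in> Mat n n" for a b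
  unfolding mult_add_distrib_mat[OF P(2) that]
  by (rule add_mult_distrib_mat[OF mult_carrier_mat[OF P(2) that(1)] mult_carrier_mat[OF P(2) that(2)] P(1)])
 have diff: "P' * (a - b) * P = P' * a * P - P' * b * P" if "a \<in> Mat n n" "b \<in> Mat n n" for a b
  unfolding mult_minus_distrib_mat[OF P(2) that]
  by (rule minus_mult_distrib_mat[OF mult_carrier_mat[OF P(2) that(1)] mult_carrier_mat[OF P(2) that(2)] P(1)])
 have sm: "P' * (c \<cdot>\<^sub>m a) * P = c \<cdot>\<^sub>m (P' * a * P)" if "a \<in> Mat n n" for a c
  unfolding mult_smult_distrib[OF P(2) that]
  by (rule mult_smult_assoc_mat[OF mult_carrier_mat[OF P(2) that] P(1)])
 have mul: "(P' * a * P) * (P' * b * P) = P' * (a * b) * P" if "a \<in> Mat n n" "b \<in> Mat n n" for a b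
 proof -
  have "(P' * a * P) * (P' * b * P) = P' * a * (P * P') * b * P" using that P(1,2) by (simp add: mat_assoc_dim)
  thus ?thesis using that P by (simp add: mat_assoc_dim)
 qed
 show ?thesis unfolding is_rep_pair
  using is_repD[OF r] P(1,2) by (auto simp: add sm mul diff mult_carrier_mat[of _ n n _ n])
qed

lemma is_rep_kron_left:
 assumes L: "lie_closed L" and r: "is_rep L (m * d, \<lambda>x. kron (t x) (1\<^sub>m d))" and d: "d > 0"
  and t: "!!x. x \<in> carr L ==> t x \<in> Mat m m"
 shows "is_rep L (m, t)"
 unfolding is_rep_pair
proof (intro conjI ballI allI)
 note o = one_Mat[of d]
 fix x assume x: "x \<in> carr L"
 show "t x \<in> Mat m m" using t x .
 show "t (lie_scale L c x) = c \<cdot>\<^sub>m t x" for c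
  by (rule kron_left_inj[of _ m m, OF _ _ d]) (use is_repD(3)[OF r x, of c] t x lie_closedD(3)[OF L x] in "auto simp: kron_smult_left")
 fix y assume y: "y \<in> carr L"
 show "t (x + y) = t x + t y"
  by (rule kron_left_inj[of _ m m, OF _ _ d]) (use is_repD(2)[OF r x y] t x y lie_closedD(2)[OF L x y] in "auto simp: kron_add_left[OF t[OF x] t[OF y] o]")
 have m: "kron (t x) (1\<^sub>m d) * kron (t y) (1\<^sub>m d) = kron (t x * t y) (1\<^sub>m d)"
  "kron (t y) (1\<^sub>m d) * kron (t x) (1\<^sub>m d) = kron (t y * t x) (1\<^sub>m d)"
  unfolding kron_mult[OF t[OF x] o t[OF y] o] kron_mult[OF t[OF y] o t[OF x] o] by simp_all
 have c: "t x * t y \<in> Mat m m" "t y * t x \<in> Mat m m" using t[OF x] t[OF y] by auto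
 show "t (lie_bracket L x y) = t x * t y - t y * t x"
  by (rule kron_left_inj[OF t[OF lie_closedD(5)[OF L x y]] minus_carrier_mat[OF c(2)] d])
   (use is_repD(4)[OF r x y] m kron_diff_left[OF c o] in simp)
qed

lemma is_rep_kron_right:
 assumes L: "lie_closed L" and r: "is_rep L (m * d, \<lambda>x. kron (1\<^sub>m m) (t x))" and m0: "m > 0"
  and t: "!!x. x \<in> carr L ==> t x \<in> Mat d d"
 shows "is_rep L (d, t)"
 unfolding is_rep_pair
proof (intro conjI ballI allI)
 note o = one_Mat[of m]
 fix x assume x: "x \<in> carr L"
 show "t x \<in> Mat d d" using t x .
 show "t (lie_scale L c x) = c \<cdot>\<^sub>m t x" for c
  by (rule kron_right_inj[of _ d d, OF _ _ m0]) (use is_repD(3)[OF r x, of c] t x lie_closedD(3)[OF L x] in "auto simp: kron_smult_right")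
 fix y assume y: "y \<in> carr L"
 show "t (x + y) = t x + t y"
  by (rule kron_right_inj[of _ d d, OF _ _ m0]) (use is_repD(2)[OF r x y] t x y lie_closedD(2)[OF L x y] in "auto simp: kron_add_right[OF o t[OF x] t[OF y]]")
 have m: "kron (1\<^sub>m m) (t x) * kron (1\<^sub>m m) (t y) = kron (1\<^sub>m m) (t x * t y)"
  "kron (1\<^sub>m m) (t y) * kron (1\<^sub>m m) (t x) = kron (1\<^sub>m m) (t y * t x)"
  unfolding kron_mult[OF o t[OF x] o t[OF y]] kron_mult[OF o t[OF y] o t[OF x]] by simp_all
 have c: "t x * t y \<in> Mat d d" "t y * t x \<in> Mat d d" using t[OF x] t[OF y] by auto
 show "t (lie_bracket L x y) = t x * t y - t y * t x"
  by (rule kron_right_inj[OF t[OF lie_closedD(5)[OF L x y]] minus_carrier_mat[OF c(2)] m0])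
   (use is_repD(4)[OF r x y] m kron_diff_right[OF o c] in simp)
qed

lemma splitting_well_defined:
 assumes L: "lie_closed L" and r: "is_rep L (n, \<eta>)" and I: "lie_ideal L M1" "lie_ideal L M2"
  and z: "!!x. x \<in> M1 ==> x \<in> M2 ==> \<eta> x = 0\<^sub>m n n"
  and p: "p \<in> M1" "x - p \<in> M2" and y: "y \<in> M1" "x - y \<in> M2"
 shows "\<eta> p = \<eta> y"
proof -
 have "p - y \<in> M1" by (rule lie_ideal_diff[OF L I(1) p(1) y(1)])
 moreover have "p - y \<in> M2" using lie_ideal_diff[OF L I(2) y(2) p(2)] by simp
 ultimately have "\<eta> (p - y) = 0\<^sub>m n n" using z by blast
 moreover have c: "p \<in> carr L" "y \<in> carr L" using p y lie_idealD(1)[OF I(1)] by auto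
 ultimately have "\<eta> p - \<eta> y = 0\<^sub>m n n" using is_rep_diff[OF L r c] by simp
 thus ?thesis by (rule mat_eq_of_diff_zero[OF is_repD(1)[OF r c(1)] is_repD(1)[OF r c(2)]])
qed

text \<open>The component of \<open>x\<close> in \<open>M1\<close> is determined up to \<open>M1 \<inter> M2\<close>, where \<open>\<eta>\<close> vanishes, and this intersection contains the brackets of
  elements of \<open>M1\<close> with elements of \<open>M2\<close>.\<close>

lemma splitting_rep:
 assumes L: "lie_closed L" and r: "is_rep L (n, \<eta>)" and I: "lie_ideal L M1" "lie_ideal L M2"
  and z: "!!x. x \<in> M1 ==> x \<in> M2 ==> \<eta> x = 0\<^sub>m n n"
  and p: "!!x. x \<in> carr L ==> p x \<in> M1" "!!x. x \<in> carr L ==> x - p x \<in> M2"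
 shows "is_rep L (n, \<lambda>x. \<eta> (p x))"
 unfolding is_rep_pair
proof (intro conjI ballI allI)
 note wd = splitting_well_defined[OF L r I z]
 note D1 = lie_idealD[OF I(1)] and D2 = lie_idealD[OF I(2)]
 fix x assume x: "x \<in> carr L"
 have pc: "p x \<in> carr L" using D1(1) p(1)[OF x] .
 show "\<eta> (p x) \<in> Mat n n" using is_repD(1)[OF r pc] .
 show "\<eta> (p (lie_scale L c x)) = c \<cdot>\<^sub>m \<eta> (p x)" for c
 proof -
  have cx: "lie_scale L c x \<in> carr L" by (rule lie_closedD(3)[OF L x])
  have "lie_scale L c x - lie_scale L c (p x) = lie_scale L c (x - p x)" by (simp add: lie_scale_diff[OF L])
  hence "\<eta> (p (lie_scale L c x)) = \<eta> (lie_scale L c (p x))"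
   using D1(4)[OF p(1)[OF x]] D2(4)[OF p(2)[OF x]] p[OF cx] by (intro wd[of _ "lie_scale L c x"]) auto
  thus ?thesis using is_repD(3)[OF r pc] by simp
 qed
 fix y assume y: "y \<in> carr L"
 have pc': "p y \<in> carr L" using D1(1) p(1)[OF y] .
 show "\<eta> (p (x + y)) = \<eta> (p x) + \<eta> (p y)"
 proof -
  have xy: "x + y \<in> carr L" by (rule lie_closedD(2)[OF L x y])
  have "x + y - (p x + p y) \<in> M2" using D2(3)[OF p(2)[OF x] p(2)[OF y]] by (simp add: algebra_simps)
  hence "\<eta> (p (x + y)) = \<eta> (p x + p y)"
   using D1(3)[OF p(1)[OF x] p(1)[OF y]] p[OF xy] by (intro wd[of _ "x + y"]) auto
  thus ?thesis using is_repD(2)[OF r pc pc'] by simp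
 qed
 show "\<eta> (p (lie_bracket L x y)) = \<eta> (p x) * \<eta> (p y) - \<eta> (p y) * \<eta> (p x)"
 proof -
  have xy: "lie_bracket L x y \<in> carr L" by (rule lie_closedD(5)[OF L x y])
  have "lie_bracket L x y - lie_bracket L (p x) (p y) = lie_bracket L (x - p x) y + lie_bracket L (p x) (y - p y)"
   by (simp add: lie_bracket_diff[OF L] x y pc pc')
  hence "lie_bracket L x y - lie_bracket L (p x) (p y) \<in> M2"
   using D2(3)[OF D2(6)[OF y p(2)[OF x]] D2(5)[OF pc p(2)[OF y]]] by simp
  moreover have "lie_bracket L (p x) (p y) \<in> M1" using D1(5)[OF pc p(1)[OF y]] .
  ultimately have "\<eta> (p (lie_bracket L x y)) = \<eta> (lie_bracket L (p x) (p y))"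
   using p[OF xy] by (intro wd[of _ "lie_bracket L x y"]) auto
  thus ?thesis using is_repD(4)[OF r pc pc'] by simp
 qed
qed

lemma irr_fam_extend:
 assumes i: "irr_fam n M \<nu>" and sub: "M \<subseteq> S" and c: "!!x. x \<in> S ==> \<tau> x \<in> Mat n n"
  and eq: "!!x. x \<in> M ==> \<tau> x = \<nu> x"
 shows "irr_fam n S \<tau>"
 unfolding irr_fam_def
proof (intro conjI allI impI)
 show "0 < n" using irr_famD(1)[OF i] .
 show "\<forall>x\<in>S. \<tau> x \<in> Mat n n" using c by blast
 fix W assume "vsub n W & (\<forall>x\<in>S. \<forall>w\<in>W. \<tau> x *\<^sub>v w \<in> W)"
 thus "W = {0\<^sub>v n} \<or> W = Vec n"
  using sub eq by (intro irr_famD(3)[OF i]) (metis subsetD)+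
qed

text \<open>The bracket of \<open>M1\<close> and \<open>M2\<close> lies in \<open>M1 \<inter> M2\<close>, so the two ideals act by commuting operators.  The factors found by
  \<open>commuting_decomposition\<close> become representations of \<open>L\<close> by means of the components in \<open>M1\<close> and \<open>M2\<close>.\<close>

lemma decompose_rep:
 fixes \<eta> :: "'l::ab_group_add => 'k::alg_closed_field mat"
 assumes L: "lie_closed L" and irr: "irrep L (n, \<eta>)" and I: "lie_ideal L M1" "lie_ideal L M2"
  and gen: "!!x. x \<in> carr L ==> \<exists>y\<in>M1. x - y \<in> M2"
  and z: "!!x. x \<in> M1 ==> x \<in> M2 ==> \<eta> x = 0\<^sub>m n n"
 obtains m \<pi> d \<tau> where "irrep L (m, \<pi>)" "irrep L (d, \<tau>)" "rep_iso L (n, \<eta>) (tensor (m, \<pi>) (d, \<tau>))"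
  "!!x. x \<in> M2 ==> \<pi> x = 0\<^sub>m m m" "!!x. x \<in> M1 ==> \<tau> x = 0\<^sub>m d d"
proof -
 have r: "is_rep L (n, \<eta>)" and ir: "irr_fam n (carr L) \<eta>" using irr by (auto simp: irreducible_rep_iff)
 note D1 = lie_idealD[OF I(1)] and D2 = lie_idealD[OF I(2)]
 obtain p where p: "!!x. x \<in> carr L ==> p x \<in> M1" "!!x. x \<in> carr L ==> x - p x \<in> M2" using gen by metis
 define q where "q x = x - p x" for x
 have q: "!!x. x \<in> carr L ==> q x \<in> M2" "!!x. x \<in> carr L ==> x - q x \<in> M1" using p by (auto simp: q_def)
 have pq: "p x + q x = x" for x by (simp add: q_def)
 have th: "\<eta> x = \<eta> (p x) + \<eta> (q x)" if "x \<in> carr L" for x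
  using is_repD(2)[OF r D1(1)[OF p(1)[OF that]] D2(1)[OF q(1)[OF that]]] by (simp add: pq)
 have com: "\<eta> y * \<eta> z = \<eta> z * \<eta> y" if "y \<in> M1" "z \<in> M2" for y z
 proof -
  have c: "y \<in> carr L" "z \<in> carr L" using that D1(1) D2(1) by auto
  have "\<eta> (lie_bracket L y z) = 0\<^sub>m n n" using z D1(6)[OF c(2) that(1)] D2(5)[OF c(1) that(2)] by blast
  hence e: "\<eta> y * \<eta> z - \<eta> z * \<eta> y = 0\<^sub>m n n" using is_repD(4)[OF r c] by simp
  have cc: "\<eta> y * \<eta> z \<in> Mat n n" "\<eta> z * \<eta> y \<in> Mat n n"
   using is_repD(1)[OF r c(1)] is_repD(1)[OF r c(2)] by auto
  show ?thesis by (rule mat_eq_of_diff_zero[OF cc e])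
 qed
 have gen': "\<exists>y\<in>M1. \<exists>z\<in>M2. \<eta> x = \<eta> y + \<eta> z" if "x \<in> carr L" for x using th p(1) q(1) that by blast
 have sub: "M1 \<subseteq> carr L" "M2 \<subseteq> carr L" using D1(1) D2(1) by auto
 obtain m d \<nu> T P P' where C: "irr_fam d M2 \<nu>" "m > 0" "m * d = n" "P \<in> Mat n n" "P' \<in> Mat n n"
  "P * P' = 1\<^sub>m n" "P' * P = 1\<^sub>m n" "!!z. z \<in> M2 ==> P' * \<eta> z * P = kron (1\<^sub>m m) (\<nu> z)"
  "!!y. y \<in> M1 ==> T y \<in> Mat m m" "!!y. y \<in> M1 ==> P' * \<eta> y * P = kron (T y) (1\<^sub>m d)"
  apply (rule commuting_decomposition[OF ir sub, of thesis])
  apply (rule com, assumption, assumption)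
  apply (rule gen', assumption)
  subgoal premises prems by (rule prems(1)[OF prems(2-)])
  done
 define \<pi> where "\<pi> x = T (p x)" for x
 define \<tau> where "\<tau> x = \<nu> (q x)" for x
 have d0: "d > 0" using irr_famD(1)[OF C(1)] .
 have \<pi>c: "\<pi> x \<in> Mat m m" if "x \<in> carr L" for x using C(9) p(1) that by (simp add: \<pi>_def)
 have \<tau>c: "\<tau> x \<in> Mat d d" if "x \<in> carr L" for x using irr_famD(2)[OF C(1)] q(1) that by (simp add: \<tau>_def)
 have k\<pi>: "P' * \<eta> (p x) * P = kron (\<pi> x) (1\<^sub>m d)" if "x \<in> carr L" for x using C(10) p(1) that by (simp add: \<pi>_def)
 have k\<tau>: "P' * \<eta> (q x) * P = kron (1\<^sub>m m) (\<tau> x)" if "x \<in> carr L" for x using C(8) q(1) that by (simp add: \<tau>_def)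
 have "is_rep L (n, \<lambda>x. P' * \<eta> (p x) * P)"
  by (rule is_rep_conj[OF splitting_rep[OF L r I z p] C(4,5,6)])
 hence "is_rep L (m * d, \<lambda>x. kron (\<pi> x) (1\<^sub>m d))" unfolding C(3) by (rule is_rep_congI[OF _ L k\<pi>])
 hence r\<pi>: "is_rep L (m, \<pi>)" by (rule is_rep_kron_left[OF L _ d0 \<pi>c])
 have "is_rep L (n, \<lambda>x. \<eta> (q x))" by (rule splitting_rep[OF L r I(2,1) _ q]) (use z in auto)
 hence "is_rep L (n, \<lambda>x. P' * \<eta> (q x) * P)" by (rule is_rep_conj[OF _ C(4,5,6)])
 hence "is_rep L (m * d, \<lambda>x. kron (1\<^sub>m m) (\<tau> x))" unfolding C(3) by (rule is_rep_congI[OF _ L k\<tau>])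
 hence r\<tau>: "is_rep L (d, \<tau>)" by (rule is_rep_kron_right[OF L _ C(2) \<tau>c])
 have rt: "is_rep L (n, \<lambda>x. ksum m d (\<pi> x) (\<tau> x))" using is_rep_tensor_pair[OF r\<pi> r\<tau>] C(3) by simp
 have conj: "P' * \<eta> x * P = ksum m d (\<pi> x) (\<tau> x)" if x: "x \<in> carr L" for x
 proof -
  have c: "\<eta> (p x) \<in> Mat n n" "\<eta> (q x) \<in> Mat n n" using is_repD(1)[OF r] D1(1)[OF p(1)[OF x]] D2(1)[OF q(1)[OF x]] by auto
  have "P' * \<eta> x * P = P' * \<eta> (p x) * P + P' * \<eta> (q x) * P"
   unfolding th[OF x] mult_add_distrib_mat[OF C(5) c]
   by (rule add_mult_distrib_mat[OF mult_carrier_mat[OF C(5) c(1)] mult_carrier_mat[OF C(5) c(2)] C(4)])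
  thus ?thesis unfolding k\<pi>[OF x] k\<tau>[OF x] ksum_def .
 qed
 have "P' * \<eta> x = ksum m d (\<pi> x) (\<tau> x) * P'" if x: "x \<in> carr L" for x
 proof -
  have "ksum m d (\<pi> x) (\<tau> x) * P' = P' * \<eta> x * (P * P')"
   unfolding conj[OF x, symmetric] using is_repD(1)[OF r x] C(4,5) by (simp add: mat_assoc_dim)
  thus ?thesis using is_repD(1)[OF r x] C(4,5,6) by simp
 qed
 hence iso: "rep_iso L (n, \<eta>) (tensor (m, \<pi>) (d, \<tau>))"
  unfolding tensor_rep_pair rep_iso_pair using C(3-7) by auto
 have irt: "irr_fam (m * d) (carr L) (\<lambda>x. ksum m d (\<pi> x) (\<tau> x))"
  using irreducible_rep_iso[OF irr _ iso] is_rep_tensor_pair[OF r\<pi> r\<tau>] unfolding tensor_rep_pair irreducible_rep_iff by auto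
 have i\<pi>: "irr_fam m (carr L) \<pi>" by (rule irr_fam_ksum_left_factor[OF irt \<pi>c \<tau>c])
 have \<tau>M2: "\<tau> x = \<nu> x" if x: "x \<in> M2" for x
 proof (rule kron_right_inj[OF \<tau>c irr_famD(2)[OF C(1) x] C(2)])
  show xc: "x \<in> carr L" using D2(1) x .
  have "\<eta> (q x) = \<eta> x"
   by (rule splitting_well_defined[OF L r I(2,1) _ q(1)[OF xc] q(2)[OF xc] x]) (use z D1(2) in auto)
  thus "kron (1\<^sub>m m) (\<tau> x) = kron (1\<^sub>m m) (\<nu> x)" using k\<tau>[OF xc] C(8)[OF x] by simp
 qed
 have i\<tau>: "irr_fam d (carr L) \<tau>"
  by (rule irr_fam_extend[OF C(1) _ \<tau>c \<tau>M2]) (use D2(1) in auto)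
 have v\<pi>: "\<pi> x = 0\<^sub>m m m" if x: "x \<in> M2" for x
 proof (rule kron_left_inj[OF \<pi>c _ d0])
  show xc: "x \<in> carr L" using D2(1) x .
  have "\<eta> (p x) = \<eta> 0"
   by (rule splitting_well_defined[OF L r I z p(1)[OF xc] p(2)[OF xc] D1(2)]) (use x in auto)
  hence "P' * \<eta> (p x) * P = 0\<^sub>m n n" using is_rep_zero[OF L r] C(4,5) by simp
  thus "kron (\<pi> x) (1\<^sub>m d) = kron (0\<^sub>m m m) (1\<^sub>m d)" using k\<pi>[OF xc] C(3) by simp
 qed auto
 have v\<tau>: "\<tau> x = 0\<^sub>m d d" if x: "x \<in> M1" for x
 proof (rule kron_right_inj[OF \<tau>c _ C(2)])
  show xc: "x \<in> carr L" using D1(1) x .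
  have "\<eta> (q x) = \<eta> 0"
   by (rule splitting_well_defined[OF L r I(2,1) _ q(1)[OF xc] q(2)[OF xc] D2(2)]) (use x z in auto)
  hence "P' * \<eta> (q x) * P = 0\<^sub>m n n" using is_rep_zero[OF L r] C(4,5) by simp
  thus "kron (1\<^sub>m m) (\<tau> x) = kron (1\<^sub>m m) (0\<^sub>m d d)" using k\<tau>[OF xc] C(3) by simp
 qed auto
 show ?thesis
  by (rule that[of m \<pi> d \<tau>]) (use i\<pi> i\<tau> r\<pi> r\<tau> iso v\<pi> v\<tau> in "auto simp: irreducible_rep_iff")
qed

section \<open>Traces and abelian ideals\<close>

definition mtrace :: "'k::field mat => 'k" where "mtrace A = (\<Sum>i = 0..<dim_row A. A $$ (i,i))"

lemma mtrace_mult_commute: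
 assumes "A \<in> Mat n m" "B \<in> Mat m n" shows "mtrace (A * B) = mtrace (B * A)"
proof -
 have "mtrace (A * B) = (\<Sum>i = 0..<n. \<Sum>j = 0..<m. A $$ (i,j) * B $$ (j,i))"
  using assms by (simp add: mtrace_def scalar_prod_def)
 also have "... = (\<Sum>j = 0..<m. \<Sum>i = 0..<n. A $$ (i,j) * B $$ (j,i))" by (rule sum.swap)
 also have "... = mtrace (B * A)" using assms by (simp add: mtrace_def scalar_prod_def mult.commute)
 finally show ?thesis .
qed

lemma mtrace_add: "A \<in> Mat n n ==> B \<in> Mat n n ==> mtrace (A + B) = mtrace A + mtrace B"
 by (simp add: mtrace_def sum.distrib)

lemma mtrace_diff: "A \<in> Mat n n ==> B \<in> Mat n n ==> mtrace (A - B) = mtrace A - mtrace B"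
 by (simp add: mtrace_def sum_subtractf)

lemma mtrace_smult: "A \<in> Mat n n ==> mtrace (c \<cdot>\<^sub>m A) = c * mtrace A"
 by (simp add: mtrace_def sum_distrib_left)

lemma mtrace_one: "mtrace (1\<^sub>m n) = of_nat n"
 by (simp add: mtrace_def)

lemma pow_mat_Suc_vec:
 assumes "A \<in> Mat n n" "v \<in> Vec n"
 shows "(A ^\<^sub>m Suc k) *\<^sub>v v = (A ^\<^sub>m k) *\<^sub>v (A *\<^sub>v v)"
 using assoc_mult_mat_vec[OF pow_carrier_mat[OF assms(1)] assms] by simp

lemma pow_mat_shift:
 assumes "B \<in> Mat n e" "X \<in> Mat e n"
 shows "(X * B) ^\<^sub>m Suc k = (X :: 'k::field mat) * ((B * X) ^\<^sub>m k) * B"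
proof (induction k)
 case 0
 thus ?case using assms by simp
next
 case (Suc k)
 define M where "M = (B * X) ^\<^sub>m k"
 have c: "M \<in> Mat n n" unfolding M_def using assms by (intro pow_carrier_mat) auto
 have "(X * B) ^\<^sub>m Suc (Suc k) = (X * M * B) * (X * B)" unfolding M_def Suc[symmetric] by simp
 also have "... = X * (M * (B * X)) * B" using assms c by (simp add: mat_assoc_dim)
 finally show ?case by (simp add: M_def)
qed

text \<open>Induction on the size: if \<open>A = B X\<close> with \<open>B\<close> a basis of the image of \<open>A\<close>, then \<open>X B\<close> is nilpotent, smaller, and has the same trace.\<close>

lemma mtrace_nilpotent:
 "A \<in> Mat n n ==> A ^\<^sub>m k = 0\<^sub>m n n ==> mtrace (A :: 'k::field mat) = 0"
proof (induction n arbitrary: A k rule: less_induct)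
 case (less n)
 show ?case
 proof (cases "n = 0")
  case True
  thus ?thesis using less.prems by (simp add: mtrace_def)
 next
  case False
  obtain e B where B: "B \<in> Mat n e" "mat_inj B" "mat_im B = mat_im A"
   using vsub_basis[OF vsub_mat_im[OF less.prems(1)]] by metis
  obtain X where X: "X \<in> Mat e n" "A = B * X"
   by (rule factor_through_mat_im[OF B(1) less.prems(1)]) (use B(3) less.prems(1) in "auto simp: mat_im_def")
  have "e ~= n"
  proof
   assume "e = n"
   hence im: "mat_im A = Vec n" using mat_im_square_inj[of B n] B by simp
   have "\<exists>w\<in>Vec n. (A ^\<^sub>m j) *\<^sub>v w = v" if "v \<in> Vec n" for v j
    using that
   proof (induction j)
    case 0
    thus ?case using less.prems(1) by (intro bexI[of _ v]) auto
   next
    case (Suc j)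
    then obtain w where w: "w \<in> Vec n" "(A ^\<^sub>m j) *\<^sub>v w = v" by auto
    hence "w \<in> mat_im A" using im by simp
    then obtain w' where "w' \<in> Vec n" "w = A *\<^sub>v w'" using less.prems(1) by (auto simp: mat_im_def)
    thus ?case using w pow_mat_Suc_vec[OF less.prems(1)] by metis
   qed
   from this[of "unit_vec n 0" k] have "unit_vec n 0 = (0\<^sub>v n :: 'k vec)" unfolding less.prems(2) by auto
   thus False using False by (metis unit_vec_nonzero not_gr_zero)
  qed
  hence en: "e < n" using mat_inj_dim_le[OF B(1,2)] by simp
  have "(X * B) ^\<^sub>m Suc k = 0\<^sub>m e e"
   unfolding pow_mat_shift[OF B(1) X(1)] X(2)[symmetric] less.prems(2) using X B by auto
  hence "mtrace (X * B) = 0" using less.IH[OF en, of "X * B" "Suc k"] X B by auto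
  thus ?thesis using mtrace_mult_commute[OF B(1) X(1)] X(2) by simp
 qed
qed

lemma smult_zero_vec_right [simp]: "c \<cdot>\<^sub>v 0\<^sub>v n = (0\<^sub>v n :: 'k::field vec)"
 by (intro eq_vecI) auto

lemma vsub_kernel:
 assumes "A \<in> Mat m n" shows "vsub n {v \<in> Vec n. A *\<^sub>v v = (0\<^sub>v m :: 'k::field vec)}"
 using assms unfolding vsub_def by (auto simp: mult_add_distrib_mat_vec smult_mult_mat_vec_right)

lemma pow_mat_commute_vec:
 assumes D: "D \<in> Mat n n" and Z: "Z \<in> Mat n n"
  and com: "!!v. v \<in> Vec n ==> D *\<^sub>v (Z *\<^sub>v v) = Z *\<^sub>v (D *\<^sub>v (v :: 'k::field vec))"
  and v: "v \<in> Vec n"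
 shows "(D ^\<^sub>m k) *\<^sub>v (Z *\<^sub>v v) = Z *\<^sub>v ((D ^\<^sub>m k) *\<^sub>v v)"
 using v
proof (induction k arbitrary: v)
 case 0
 thus ?case using D Z by auto
next
 case (Suc k)
 have Dv: "D *\<^sub>v v \<in> Vec n" using D Suc.prems by auto
 have "(D ^\<^sub>m Suc k) *\<^sub>v (Z *\<^sub>v v) = (D ^\<^sub>m k) *\<^sub>v (Z *\<^sub>v (D *\<^sub>v v))"
  using pow_mat_Suc_vec[OF D, of "Z *\<^sub>v v" k] com[OF Suc.prems] Z Suc.prems by auto
 also have "... = Z *\<^sub>v ((D ^\<^sub>m k) *\<^sub>v (D *\<^sub>v v))" by (rule Suc.IH[OF Dv])
 finally show ?case using pow_mat_Suc_vec[OF D Suc.prems, of k] by simp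
qed

lemma pow_mat_vec_mono:
 assumes D: "D \<in> Mat n n" and v: "v \<in> Vec n" and 0: "(D ^\<^sub>m k) *\<^sub>v v = (0\<^sub>v n :: 'k::field vec)" and kl: "k \<le> l"
 shows "(D ^\<^sub>m l) *\<^sub>v v = 0\<^sub>v n"
 using kl
proof (induction l rule: dec_induct)
 case base
 thus ?case using 0 .
next
 case (step l)
 have "(D ^\<^sub>m Suc l) *\<^sub>v v = D *\<^sub>v ((D ^\<^sub>m l) *\<^sub>v v)"
  unfolding pow_mat_Suc_vec[OF D v] by (rule pow_mat_commute_vec[OF D D _ v]) simp
 thus ?case using step D by simp
qed

lemma pow_mat_nilpotent_commutator:
 fixes D Y Z :: "'k::field mat"
 assumes c: "D \<in> Mat n n" "Y \<in> Mat n n" "Z \<in> Mat n n"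
  and DY: "!!v. v \<in> Vec n ==> D *\<^sub>v (Y *\<^sub>v v) = Y *\<^sub>v (D *\<^sub>v v) + Z *\<^sub>v v"
  and DZ: "!!v. v \<in> Vec n ==> D *\<^sub>v (Z *\<^sub>v v) = Z *\<^sub>v (D *\<^sub>v v)"
  and v: "v \<in> Vec n" "(D ^\<^sub>m k) *\<^sub>v v = 0\<^sub>v n"
 shows "(D ^\<^sub>m Suc k) *\<^sub>v (Y *\<^sub>v v) = 0\<^sub>v n"
 using v
proof (induction k arbitrary: v)
 case 0
 hence "v = 0\<^sub>v n" using c by simp
 thus ?case using c by simp
next
 case (Suc k)
 have Dv: "D *\<^sub>v v \<in> Vec n" using c Suc.prems by auto
 have "(D ^\<^sub>m k) *\<^sub>v (D *\<^sub>v v) = 0\<^sub>v n" using Suc.prems pow_mat_Suc_vec[OF c(1) Suc.prems(1)] by metis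
 hence 1: "(D ^\<^sub>m Suc k) *\<^sub>v (Y *\<^sub>v (D *\<^sub>v v)) = 0\<^sub>v n" by (rule Suc.IH[OF Dv])
 have 2: "(D ^\<^sub>m Suc k) *\<^sub>v (Z *\<^sub>v v) = 0\<^sub>v n"
 proof -
  have "(D ^\<^sub>m Suc k) *\<^sub>v (Z *\<^sub>v v) = Z *\<^sub>v ((D ^\<^sub>m Suc k) *\<^sub>v v)" by (rule pow_mat_commute_vec[OF c(1,3) DZ Suc.prems(1)])
  also have "... = Z *\<^sub>v 0\<^sub>v n" by (simp only: Suc.prems(2))
  finally show ?thesis using c by (simp del: pow_mat.simps)
 qed
 have "(D ^\<^sub>m Suc (Suc k)) *\<^sub>v (Y *\<^sub>v v) = (D ^\<^sub>m Suc k) *\<^sub>v (Y *\<^sub>v (D *\<^sub>v v) + Z *\<^sub>v v)"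
  using pow_mat_Suc_vec[OF c(1), of "Y *\<^sub>v v" "Suc k"] DY[OF Suc.prems(1)] c Suc.prems(1) by auto
 also have "... = (D ^\<^sub>m Suc k) *\<^sub>v (Y *\<^sub>v (D *\<^sub>v v)) + (D ^\<^sub>m Suc k) *\<^sub>v (Z *\<^sub>v v)"
  by (rule mult_add_distrib_mat_vec[OF pow_carrier_mat[OF c(1)]]) (use c Dv Suc.prems in auto)
 finally show ?case unfolding 1 2 by simp
qed

text \<open>Let \<open>e\<close> be in \<open>E\<close>.  The commutator of \<open>\<rho> e\<close> with any \<open>\<rho> x\<close> commutes with \<open>\<rho> e\<close>, so the generalised eigenspaces of \<open>\<rho> e\<close> are
  invariant.  Hence there is just one eigenvalue, and the vanishing trace makes it \<open>0\<close> in characteristic zero.  So \<open>E\<close> acts by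
  commuting nilpotent matrices.  These have a common kernel, which is invariant because \<open>E\<close> is an ideal, and is therefore everything.\<close>

lemma irr_no_abelian_ideal:
 fixes \<rho> :: "'l::ab_group_add => 'k::{alg_closed_field, field_char_0} mat"
 assumes r: "is_rep L (n, \<rho>)" and ir: "irr_fam n (carr L) \<rho>"
  and tr0: "!!x. x \<in> carr L ==> mtrace (\<rho> x) = 0"
  and E: "E \<subseteq> carr L" "!!e x. e \<in> E ==> x \<in> carr L ==> lie_bracket L e x \<in> E"
  and ab: "!!e e'. e \<in> E ==> e' \<in> E ==> \<rho> (lie_bracket L e e') = 0\<^sub>m n n"
  and e: "e \<in> E"
 shows "\<rho> e = 0\<^sub>m n n"
proof -
 note n0 = irr_famD(1)[OF ir]
 have Ec: "!!e. e \<in> E ==> e \<in> carr L" using E by auto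
 have rc: "!!x. x \<in> carr L ==> \<rho> x \<in> Mat n n" using is_repD(1)[OF r] .
 have com: "\<rho> e * \<rho> e' = \<rho> e' * \<rho> e" if "e \<in> E" "e' \<in> E" for e e'
  by (rule mat_eq_of_diff_zero[of _ n n])
   (use ab[OF that] is_repD(4)[OF r Ec[OF that(1)] Ec[OF that(2)]] rc[OF Ec[OF that(1)]] rc[OF Ec[OF that(2)]] in auto)
 have brv: "\<rho> e *\<^sub>v (\<rho> x *\<^sub>v v) = \<rho> x *\<^sub>v (\<rho> e *\<^sub>v v) + \<rho> (lie_bracket L e x) *\<^sub>v v"
  if "e \<in> E" "x \<in> carr L" "v \<in> Vec n" for e x v
 proof -
  note c = rc[OF Ec[OF that(1)]] rc[OF that(2)]
  have "\<rho> (lie_bracket L e x) *\<^sub>v v = (\<rho> e * \<rho> x) *\<^sub>v v - (\<rho> x * \<rho> e) *\<^sub>v v"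
   unfolding is_repD(4)[OF r Ec[OF that(1)] that(2)]
   by (rule minus_mult_distrib_mat_vec[OF mult_carrier_mat[OF c] mult_carrier_mat[OF c(2,1)] that(3)])
  thus ?thesis using c that(3)
   by (intro eq_vecI) (auto simp: mat_vec_assoc_dim)
 qed
 have nil: "\<exists>K. \<rho> e ^\<^sub>m K = 0\<^sub>m n n" if e: "e \<in> E" for e
 proof -
  define N where "N = \<rho> e"
  have Nc: "N \<in> Mat n n" using rc Ec e by (simp add: N_def)
  have "degree (char_poly N) = n" using degree_monic_char_poly[OF Nc] by auto
  then obtain c where "poly (char_poly N) c = 0" using alg_closed_imp_poly_has_root n0 by metis
  then obtain w where w: "w \<in> Vec n" "w ~= 0\<^sub>v n" "N *\<^sub>v w = c \<cdot>\<^sub>v w"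
   using eigenvalue_root_char_poly[OF Nc] Nc unfolding eigenvalue_def eigenvector_def by auto
  define D where "D = N - c \<cdot>\<^sub>m 1\<^sub>m n"
  have Dc: "D \<in> Mat n n" using Nc by (auto simp: D_def)
  have Dv: "D *\<^sub>v v = N *\<^sub>v v - c \<cdot>\<^sub>v v" if "v \<in> Vec n" for v
   using minus_mult_distrib_mat_vec[OF Nc smult_carrier_mat[OF one_Mat] that] that
    smult_mult_mat_vec_left[OF one_Mat that] unfolding D_def by simp
  \<comment> \<open>the generalised eigenspace of \<open>\<rho> e\<close> for \<open>c\<close>\<close>
  define G where "G = {v \<in> Vec n. \<exists>k. (D ^\<^sub>m k) *\<^sub>v v = 0\<^sub>v n}"
  note pc = pow_carrier_mat[OF Dc]
  have Gsub: "vsub n G"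
   unfolding vsub_def
  proof (intro conjI ballI allI)
   show "G \<subseteq> Vec n" by (auto simp: G_def)
   show "0\<^sub>v n \<in> G" using Dc by (auto simp: G_def intro!: exI[of _ 0])
   show "u + v \<in> G" if uv: "u \<in> G" "v \<in> G" for u v
   proof -
    obtain k l where kl: "(D ^\<^sub>m k) *\<^sub>v u = 0\<^sub>v n" "(D ^\<^sub>m l) *\<^sub>v v = 0\<^sub>v n" and c: "u \<in> Vec n" "v \<in> Vec n"
     using uv by (auto simp: G_def)
    have "(D ^\<^sub>m (k + l)) *\<^sub>v (u + v) = 0\<^sub>v n"
     unfolding mult_add_distrib_mat_vec[OF pc c]
     using pow_mat_vec_mono[OF Dc c(1) kl(1), of "k + l"] pow_mat_vec_mono[OF Dc c(2) kl(2), of "k + l"] by simp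
    thus ?thesis using c by (auto simp: G_def)
   qed
   show "a \<cdot>\<^sub>v v \<in> G" if v: "v \<in> G" for a v
   proof -
    obtain k where k: "(D ^\<^sub>m k) *\<^sub>v v = 0\<^sub>v n" and c: "v \<in> Vec n" using v by (auto simp: G_def)
    have "(D ^\<^sub>m k) *\<^sub>v (a \<cdot>\<^sub>v v) = 0\<^sub>v n" using smult_mult_mat_vec_right[OF pc c, of k a] k by (auto intro!: eq_vecI)
    thus ?thesis using c by (auto simp: G_def)
   qed
  qed
  have Ginv: "\<rho> x *\<^sub>v v \<in> G" if x: "x \<in> carr L" and v: "v \<in> G" for x v
  proof -
   have vc: "v \<in> Vec n" using v by (simp add: G_def)
   obtain k where k: "(D ^\<^sub>m k) *\<^sub>v v = 0\<^sub>v n" using v by (auto simp: G_def)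
   define Z where "Z = \<rho> (lie_bracket L e x)"
   have Zc: "Z \<in> Mat n n" using rc Ec E(2)[OF e x] by (simp add: Z_def)
   have yc: "\<rho> x \<in> Mat n n" by (rule rc[OF x])
   have "(D ^\<^sub>m Suc k) *\<^sub>v (\<rho> x *\<^sub>v v) = 0\<^sub>v n"
   proof (rule pow_mat_nilpotent_commutator[OF Dc yc Zc _ _ vc k])
    fix u :: "'k vec" assume u: "u \<in> Vec n"
    have uu: "\<rho> x *\<^sub>v u \<in> Vec n" "Z *\<^sub>v u \<in> Vec n" "N *\<^sub>v u \<in> Vec n" using yc Zc Nc u by auto
    have "\<rho> x *\<^sub>v (D *\<^sub>v u) = \<rho> x *\<^sub>v (N *\<^sub>v u) - c \<cdot>\<^sub>v (\<rho> x *\<^sub>v u)"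
     unfolding Dv[OF u] using yc uu u by (simp add: mult_minus_distrib_mat_vec smult_mult_mat_vec_right)
    thus "D *\<^sub>v (\<rho> x *\<^sub>v u) = \<rho> x *\<^sub>v (D *\<^sub>v u) + Z *\<^sub>v u"
     using Dv[OF uu(1)] brv[OF e x u] uu yc Zc by (intro eq_vecI) (auto simp: N_def Z_def)
    have "N *\<^sub>v (Z *\<^sub>v u) = Z *\<^sub>v (N *\<^sub>v u)"
     using arg_cong[OF com[OF e E(2)[OF e x]], of "\<lambda>M. M *\<^sub>v u"] Nc Zc u by (simp add: N_def Z_def mat_vec_assoc_dim)
    moreover have "Z *\<^sub>v (D *\<^sub>v u) = Z *\<^sub>v (N *\<^sub>v u) - c \<cdot>\<^sub>v (Z *\<^sub>v u)"
     unfolding Dv[OF u] using Zc uu u by (simp add: mult_minus_distrib_mat_vec smult_mult_mat_vec_right)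
    ultimately show "D *\<^sub>v (Z *\<^sub>v u) = Z *\<^sub>v (D *\<^sub>v u)" using Dv[OF uu(2)] by simp
   qed
   moreover have "\<rho> x *\<^sub>v v \<in> Vec n" using yc vc by auto
   ultimately show ?thesis unfolding G_def by blast
  qed
  have "w \<in> G"
  proof -
   have "(D ^\<^sub>m Suc 0) *\<^sub>v w = 0\<^sub>v n" using pow_mat_Suc_vec[OF Dc w(1), of 0] Dv[OF w(1)] w Dc by auto
   thus ?thesis using w unfolding G_def by blast
  qed
  hence "G = Vec n" using irr_famD(3)[OF ir Gsub Ginv] w by auto
  hence "\<exists>k. (D ^\<^sub>m k) *\<^sub>v unit_vec n i = 0\<^sub>v n" for i
   using unit_vec_carrier[of n i] unfolding G_def by blast
  then obtain k where k: "!!i. (D ^\<^sub>m k i) *\<^sub>v unit_vec n i = 0\<^sub>v n" by metis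
  define K where "K = (\<Sum>i<n. k i)"
  have kK: "k i \<le> K" if "i < n" for i unfolding K_def using that by (intro member_le_sum) auto
  have "{v \<in> Vec n. (D ^\<^sub>m K) *\<^sub>v v = 0\<^sub>v n} = Vec n"
  proof (rule vsub_units)
   show "vsub n {v \<in> Vec n. (D ^\<^sub>m K) *\<^sub>v v = 0\<^sub>v n}"
    by (rule vsub_kernel[OF pc])
   show "unit_vec n i \<in> {v \<in> Vec n. (D ^\<^sub>m K) *\<^sub>v v = 0\<^sub>v n}" if "i < n" for i
    using pow_mat_vec_mono[OF Dc unit_vec_carrier k[of i] kK[OF that]] by simp
  qed
  hence "(D ^\<^sub>m K) *\<^sub>v v = 0\<^sub>v n" if "v \<in> Vec n" for v using that by blast
  hence DK: "D ^\<^sub>m K = 0\<^sub>m n n" by (intro mat_eq_by_vec[OF pc]) auto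
  have "mtrace D = 0" by (rule mtrace_nilpotent[OF Dc DK])
  moreover have "mtrace D = mtrace N - c * of_nat n"
   unfolding D_def using mtrace_diff[OF Nc, of "c \<cdot>\<^sub>m 1\<^sub>m n"] mtrace_smult[of "1\<^sub>m n" n c] by (simp add: mtrace_one)
  moreover have "mtrace N = 0" unfolding N_def by (rule tr0[OF Ec[OF e]])
  ultimately have "c = 0" using n0 by simp
  hence "D = N" using Nc by (intro eq_matI) (auto simp: D_def)
  thus ?thesis using DK by (auto simp: N_def)
 qed
 obtain d \<nu> Q where Q: "irr_fam d E \<nu>" "Q \<in> Mat n d" "mat_inj Q" "!!e. e \<in> E ==> \<rho> e * Q = Q * \<nu> e"
  using irr_subfamily[OF n0, of E \<rho>] rc Ec by blast
 define w where "w = Q *\<^sub>v unit_vec d 0"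
 have wc: "w \<in> Vec n" using Q by (auto simp: w_def)
 have w0: "w ~= 0\<^sub>v n"
 proof
  assume "w = 0\<^sub>v n"
  hence "unit_vec d 0 = (0\<^sub>v d :: 'k vec)" using Q(2,3) by (auto simp: mat_inj_def w_def)
  thus False using irr_famD(1)[OF Q(1)] by (metis unit_vec_nonzero)
 qed
 have wE: "\<rho> e *\<^sub>v w = 0\<^sub>v n" if e: "e \<in> E" for e
 proof -
  have s: "!!e. e \<in> E ==> \<nu> e \<in> Mat d d" using irr_famD(2)[OF Q(1)] .
  have "\<nu> e * \<nu> e' = \<nu> e' * \<nu> e" if e': "e' \<in> E" for e'
  proof (rule mat_inj_cancel[OF Q(2,3)])
   note c = s[OF e] s[OF e'] rc[OF Ec[OF e]] rc[OF Ec[OF e']] Q(2)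
   have "Q * (\<nu> e * \<nu> e') = (\<rho> e * \<rho> e') * Q"
   proof -
    have "Q * (\<nu> e * \<nu> e') = (Q * \<nu> e) * \<nu> e'" using c by (simp add: mat_assoc_dim)
    also have "... = \<rho> e * (Q * \<nu> e')" unfolding Q(4)[OF e, symmetric] using c by (simp add: mat_assoc_dim)
    finally show ?thesis unfolding Q(4)[OF e', symmetric] using c by (simp add: mat_assoc_dim)
   qed
   moreover have "Q * (\<nu> e' * \<nu> e) = (\<rho> e' * \<rho> e) * Q"
   proof -
    have "Q * (\<nu> e' * \<nu> e) = (Q * \<nu> e') * \<nu> e" using c by (simp add: mat_assoc_dim)
    also have "... = \<rho> e' * (Q * \<nu> e)" unfolding Q(4)[OF e', symmetric] using c by (simp add: mat_assoc_dim)
    finally show ?thesis unfolding Q(4)[OF e, symmetric] using c by (simp add: mat_assoc_dim)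
   qed
   ultimately show "Q * (\<nu> e * \<nu> e') = Q * (\<nu> e' * \<nu> e)" using com[OF e e'] by simp
   show "\<nu> e * \<nu> e' \<in> Mat d d" "\<nu> e' * \<nu> e \<in> Mat d d" using s[OF e] s[OF e'] by auto
  qed
  then obtain c where c: "\<nu> e = c \<cdot>\<^sub>m 1\<^sub>m d" using schur_scalar[OF Q(1) s[OF e]] by blast
  have ew: "\<rho> e *\<^sub>v w = c \<cdot>\<^sub>v w"
  proof -
   have "\<rho> e *\<^sub>v w = (\<rho> e * Q) *\<^sub>v unit_vec d 0" using rc[OF Ec[OF e]] Q(2) by (simp add: w_def mat_vec_assoc_dim)
   also have "... = Q *\<^sub>v (\<nu> e *\<^sub>v unit_vec d 0)" unfolding Q(4)[OF e] using Q(2) s[OF e] by (simp add: mat_vec_assoc_dim)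
   also have "\<nu> e *\<^sub>v unit_vec d 0 = c \<cdot>\<^sub>v unit_vec d 0" unfolding c using smult_mult_mat_vec_left[OF one_Mat unit_vec_carrier] by simp
   finally show ?thesis using smult_mult_mat_vec_right[OF Q(2) unit_vec_carrier] by (simp add: w_def)
  qed
  obtain K where K: "\<rho> e ^\<^sub>m K = 0\<^sub>m n n" using nil[OF e] by auto
  have "(\<rho> e ^\<^sub>m k) *\<^sub>v w = c ^ k \<cdot>\<^sub>v w" for k
  proof (induction k)
   case 0
   thus ?case using wc rc[OF Ec[OF e]] by simp
  next
   case (Suc k)
   have "(\<rho> e ^\<^sub>m Suc k) *\<^sub>v w = (\<rho> e ^\<^sub>m k) *\<^sub>v (c \<cdot>\<^sub>v w)" using pow_mat_Suc_vec[OF rc[OF Ec[OF e]] wc] ew by simp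
   also have "... = c \<cdot>\<^sub>v ((\<rho> e ^\<^sub>m k) *\<^sub>v w)" by (rule smult_mult_mat_vec_right[OF pow_carrier_mat[OF rc[OF Ec[OF e]]] wc])
   finally show ?case using Suc by (simp add: smult_smult_assoc)
  qed
  from this[of K] have kw: "c ^ K \<cdot>\<^sub>v w = 0\<^sub>v n" unfolding K using wc by simp
  have "c = 0"
  proof (rule ccontr)
   assume "c ~= 0"
   hence "w = (1 / c ^ K) \<cdot>\<^sub>v (c ^ K \<cdot>\<^sub>v w)" by (simp add: smult_smult_assoc)
   thus False unfolding kw using w0 by simp
  qed
  thus ?thesis using ew wc by (auto intro!: eq_vecI)
 qed
 \<comment> \<open>the common kernel of \<open>E\<close>\<close>
 define V0 where "V0 = {v \<in> Vec n. \<forall>e\<in>E. \<rho> e *\<^sub>v v = 0\<^sub>v n}"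
 have V0sub: "vsub n V0"
  unfolding vsub_def
 proof (intro conjI ballI allI)
  show "u + v \<in> V0" if "u \<in> V0" "v \<in> V0" for u v
   using that mult_add_distrib_mat_vec[OF rc[OF Ec]] by (auto simp: V0_def)
  show "a \<cdot>\<^sub>v v \<in> V0" if "v \<in> V0" for a v
   using that smult_mult_mat_vec_right[OF rc[OF Ec]] by (auto simp: V0_def)
  have "\<rho> e *\<^sub>v 0\<^sub>v n = 0\<^sub>v n" if "e \<in> E" for e using rc[OF Ec[OF that]] by simp
  thus "0\<^sub>v n \<in> V0" by (simp add: V0_def)
 qed (auto simp: V0_def)
 have "\<rho> x *\<^sub>v v \<in> V0" if x: "x \<in> carr L" and v: "v \<in> V0" for x v
 proof -
  have vc: "v \<in> Vec n" using v by (simp add: V0_def)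
  have "\<rho> e *\<^sub>v (\<rho> x *\<^sub>v v) = 0\<^sub>v n" if e: "e \<in> E" for e
   using brv[OF e x vc] v e E(2)[OF e x] rc[OF x] by (simp add: V0_def)
  thus ?thesis using rc[OF x] vc by (auto simp: V0_def)
 qed
 hence "V0 = {0\<^sub>v n} \<or> V0 = Vec n" by (rule irr_famD(3)[OF ir V0sub])
 moreover have "w \<in> V0" using wc wE by (simp add: V0_def)
 ultimately have "V0 = Vec n" using w0 by auto
 hence "\<rho> e *\<^sub>v v = 0\<^sub>v n" if "v \<in> Vec n" for v using e that unfolding V0_def by blast
 thus ?thesis by (intro mat_eq_by_vec[OF rc[OF Ec[OF e]]]) auto
qed

section \<open>One-dimensional twists\<close>

definition form_mat :: "'k => 'k::field mat" where "form_mat c = mat 1 1 (\<lambda>_. c)"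

lemma form_mat_carrier [simp, intro]: "form_mat c \<in> Mat 1 1" by (simp add: form_mat_def)

lemma form_mat_index [simp]: "form_mat c $$ (0,0) = c" by (simp add: form_mat_def)

lemma ksum_form_left: "A \<in> Mat n n ==> ksum 1 n (form_mat c) A = c \<cdot>\<^sub>m 1\<^sub>m n + A"
proof -
 have "kron (1\<^sub>m 1) A = A" by (subst kron_one_dim_left) (auto intro!: eq_matI)
 thus ?thesis unfolding ksum_def kron_one_dim_left[OF form_mat_carrier] by simp
qed

lemma is_rep_form:
 assumes L: "lie_closed L"
  and l: "!!x y. x \<in> carr L ==> y \<in> carr L ==> l (x + y) = l x + l y"
  "!!c x. x \<in> carr L ==> l (lie_scale L c x) = c * l x"
  "!!x y. x \<in> carr L ==> y \<in> carr L ==> l (lie_bracket L x y) = 0"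
 shows "is_rep L (1, \<lambda>x. form_mat (l x))"
 unfolding is_rep_pair
 using l by (auto intro!: eq_matI simp: form_mat_def scalar_prod_def mult.commute)

lemma is_rep_formD:
 assumes r: "is_rep L (1, \<rho>)"
 defines "l \<equiv> \<lambda>x. \<rho> x $$ (0,0)"
 shows "x \<in> carr L ==> \<rho> x = form_mat (l x)"
  "x \<in> carr L ==> y \<in> carr L ==> l (x + y) = l x + l y"
  "x \<in> carr L ==> l (lie_scale L c x) = c * l x"
  "x \<in> carr L ==> y \<in> carr L ==> l (lie_bracket L x y) = 0"
proof -
 note D = is_repD[OF r]
 show "x \<in> carr L ==> \<rho> x = form_mat (l x)"
  using D(1)[of x] by (intro eq_matI) (auto simp: l_def form_mat_def)
 show "x \<in> carr L ==> y \<in> carr L ==> l (x + y) = l x + l y"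
  using D(1)[of x] D(1)[of y] D(2)[of x y] by (auto simp: l_def)
 show "x \<in> carr L ==> l (lie_scale L c x) = c * l x"
  using D(1)[of x] D(3)[of x c] by (auto simp: l_def)
 show "x \<in> carr L ==> y \<in> carr L ==> l (lie_bracket L x y) = 0"
  using D(1)[of x] D(1)[of y] D(4)[of x y] by (auto simp: l_def scalar_prod_def)
qed

lemma irr_fam_shift:
 assumes ir: "irr_fam n S \<rho>" and eq: "!!x. x \<in> S ==> \<rho>' x = c x \<cdot>\<^sub>m 1\<^sub>m n + \<rho> x"
 shows "irr_fam n S \<rho>'"
 unfolding irr_fam_def
proof (intro conjI allI impI)
 show "0 < n" using irr_famD(1)[OF ir] .
 show "\<forall>x\<in>S. \<rho>' x \<in> Mat n n" using eq irr_famD(2)[OF ir] by auto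
 fix W assume W: "vsub n W & (\<forall>x\<in>S. \<forall>w\<in>W. \<rho>' x *\<^sub>v w \<in> W)"
 show "W = {0\<^sub>v n} \<or> W = Vec n"
 proof (rule irr_famD(3)[OF ir])
  show "vsub n W" using W by simp
  fix x w assume x: "x \<in> S" and w: "w \<in> W"
  have wc: "w \<in> Vec n" using W w by (auto simp: vsub_def)
  have "\<rho>' x *\<^sub>v w = c x \<cdot>\<^sub>v w + \<rho> x *\<^sub>v w"
   unfolding eq[OF x] using add_mult_distrib_mat_vec[OF smult_carrier_mat[OF one_Mat] irr_famD(2)[OF ir x] wc]
    smult_mult_mat_vec_left[OF one_Mat wc] wc by simp
  hence "\<rho> x *\<^sub>v w = \<rho>' x *\<^sub>v w + (- c x) \<cdot>\<^sub>v w"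
   using wc irr_famD(2)[OF ir x] by (intro eq_vecI) auto
  thus "\<rho> x *\<^sub>v w \<in> W" using W x w by (auto simp: vsub_def)
 qed
qed

text \<open>The form \<open>trace / n\<close> vanishes on brackets, so it is a one-dimensional representation that can be split off.\<close>

lemma traceless_twist:
 fixes \<rho> :: "'l::ab_group_add => 'k::field_char_0 mat"
 assumes L: "lie_closed L" and irr: "irrep L (n, \<rho>)"
 obtains l \<rho>' where "is_rep L (1, \<lambda>x. form_mat (l x))" "irrep L (n, \<rho>')"
  "!!x. x \<in> carr L ==> mtrace (\<rho>' x) = 0"
  "!!x. x \<in> carr L ==> \<rho> x = l x \<cdot>\<^sub>m 1\<^sub>m n + \<rho>' x"
proof -
 have r: "is_rep L (n, \<rho>)" and ir: "irr_fam n (carr L) \<rho>" using irr by (auto simp: irreducible_rep_iff)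
 note D = is_repD[OF r]
 define l where "l x = mtrace (\<rho> x) / of_nat n" for x
 have l: "l (x + y) = l x + l y" "l (lie_scale L c x) = c * l x" "l (lie_bracket L x y) = 0"
  if "x \<in> carr L" "y \<in> carr L" for x y c
  using D(1)[OF that(1)] D(1)[OF that(2)] mtrace_mult_commute[OF D(1)[OF that(1)] D(1)[OF that(2)]]
   mtrace_add[OF D(1)[OF that(1)] D(1)[OF that(2)]]
   mtrace_diff[OF mult_carrier_mat[OF D(1)[OF that(1)] D(1)[OF that(2)]] mult_carrier_mat[OF D(1)[OF that(2)] D(1)[OF that(1)]]]
  by (auto simp: l_def D that mtrace_smult[of _ n] add_divide_distrib)
 have rl: "is_rep L (1, \<lambda>x. form_mat (l x))" by (rule is_rep_form[OF L]) (use l in auto)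
 have rl': "is_rep L (1, \<lambda>x. form_mat (- l x))" by (rule is_rep_form[OF L]) (use l in auto)
 define \<rho>' where "\<rho>' x = (- l x) \<cdot>\<^sub>m 1\<^sub>m n + \<rho> x" for x
 have "is_rep L (1 * n, \<lambda>x. ksum 1 n (form_mat (- l x)) (\<rho> x))" by (rule is_rep_tensor_pair[OF rl' r])
 hence r': "is_rep L (n, \<rho>')" unfolding mult_1
  by (rule is_rep_congI[OF _ L]) (simp add: ksum_form_left[unfolded One_nat_def] D(1) \<rho>'_def)
 have "irr_fam n (carr L) \<rho>'" by (rule irr_fam_shift[OF ir \<rho>'_def])
 hence irr': "irrep L (n, \<rho>')" using r' by (simp add: irreducible_rep_iff)
 have "mtrace (\<rho>' x) = 0" if "x \<in> carr L" for x
  using irr_famD(1)[OF ir] mtrace_add[OF smult_carrier_mat[OF one_Mat] D(1)[OF that], of "- l x"]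
   mtrace_smult[OF one_Mat[of n], of "- l x"]
  by (simp add: \<rho>'_def mtrace_one l_def)
 moreover have "\<rho> x = l x \<cdot>\<^sub>m 1\<^sub>m n + \<rho>' x" if "x \<in> carr L" for x
  using D(1)[OF that] by (intro eq_matI) (auto simp: \<rho>'_def)
 ultimately show ?thesis using that rl irr' by blast
qed

section \<open>The equivariant map algebra\<close>

declare zero_fun_apply [simp del] plus_fun_apply [simp del]

locale equivariant_map_algebra =
 fixes D :: "('c, 'k::{alg_closed_field, field_char_0}, 'a::comm_ring, 'g::ab_group_add) equivariant_data"
 assumes setting: "equivariant_setting D"
begin

abbreviation "\<Gamma> \<equiv> carrier (grp D)"
abbreviation "gmult \<equiv> monoid.mult (grp D)"
abbreviation "ginv \<equiv> m_inv (grp D)"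
abbreviation "TT \<equiv> tensor_space (scaleg D) (scaleA D)"

lemma grp_group: "group (grp D)" and grp_finite: "finite \<Gamma>"
 using setting unfolding equivariant_setting_def by blast+

sublocale \<Gamma>: group "grp D" by (rule grp_group)

lemma actions: "group_action (grp D) UNIV (actA D)" "group_action (grp D) UNIV (actg D)"
 using setting unfolding equivariant_setting_def by blast+

lemma card_\<Gamma>: "of_nat (card \<Gamma>) ~= (0 :: 'k)"
 using grp_finite \<Gamma>.one_closed by (auto simp: card_eq_0_iff)

sublocale g: vector_space "scaleg D" by (rule equivariant_setting_vs[OF setting])
sublocale A: vector_space "scaleA D" by (rule equivariant_setting_vs[OF setting])

lemma brg_bilinear: "bilinear_map (scaleg D) (scaleg D) (scaleg D) (brg D)"
 and timesA_bilinear: "bilinear_map (scaleA D) (scaleA D) (scaleA D) (*)"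
 using setting unfolding equivariant_setting_def lie_algebra_def by blast+

lemma unitA_left [simp]: "unitA D * f = f"
 using setting unfolding equivariant_setting_def by blast

lemma unitA_right [simp]: "f * unitA D = f"
 by (simp add: mult.commute[of f])

lemma scaleA_mult: "scaleA D c f * h = scaleA D c (f * h)" "f * scaleA D c h = scaleA D c (f * h)"
 using bilinear_mapD(3,4)[OF timesA_bilinear] by auto

lemma actA_hom:
 assumes "g \<in> \<Gamma>"
 shows "actA D g (f + h) = actA D g f + actA D g h" "actA D g (scaleA D c f) = scaleA D c (actA D g f)"
  "actA D g (f * h) = actA D g f * actA D g h" "actA D g (unitA D) = unitA D"
 using setting assms unfolding equivariant_setting_def Vector_Spaces.linear_iff by auto

lemma actg_hom:
 assumes "g \<in> \<Gamma>"
 shows "actg D g (u + v) = actg D g u + actg D g v" "actg D g (scaleg D c u) = scaleg D c (actg D g u)"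
  "actg D g (brg D u v) = brg D (actg D g u) (actg D g v)"
 using setting assms unfolding equivariant_setting_def Vector_Spaces.linear_iff by auto

lemma actA_zero: "g \<in> \<Gamma> ==> actA D g 0 = 0"
 using actA_hom(1)[of g 0 0] by simp

lemma actA_uminus: "g \<in> \<Gamma> ==> actA D g (- f) = - actA D g f"
 using actA_hom(1)[of g f "- f"] actA_zero by (simp add: eq_neg_iff_add_eq_0 add.commute)

lemma act_mult:
 assumes "g \<in> \<Gamma>" "h \<in> \<Gamma>"
 shows "actA D (gmult g h) f = actA D g (actA D h f)" "actg D (gmult g h) u = actg D g (actg D h u)"
 using group_action.composition_rule[OF actions(1) UNIV_I assms] group_action.composition_rule[OF actions(2) UNIV_I assms] by auto

lemma act_one: "actA D \<one>\<^bsub>grp D\<^esub> f = f" "actg D \<one>\<^bsub>grp D\<^esub> u = u"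
 using fun_cong[OF group_action.id_eq_one[OF actions(1)], of f] fun_cong[OF group_action.id_eq_one[OF actions(2)], of u] by auto

lemma act_inv:
 assumes "g \<in> \<Gamma>"
 shows "actA D (ginv g) (actA D g f) = f" "actA D g (actA D (ginv g) f) = f"
  "actg D (ginv g) (actg D g u) = u" "actg D g (actg D (ginv g) u) = u"
 using assms act_mult[of "ginv g" g] act_mult[of g "ginv g"] act_one by simp_all

subsection \<open>Rational points\<close>

abbreviation "X \<equiv> rat_points D"

lemma pointD:
 assumes "x \<in> X"
 shows "x (f + h) = x f + x h" "x (scaleA D c f) = c * x f" "x (f * h) = x f * x h" "x (unitA D) = 1"
  "x 0 = 0" "x (- f) = - x f" "x (f - h) = x f - x h"
proof -
 show a: "x (f + h) = x f + x h" for f h using assms unfolding rat_points_def Vector_Spaces.linear_iff by auto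
 show "x (scaleA D c f) = c * x f" "x (f * h) = x f * x h" "x (unitA D) = 1"
  using assms unfolding rat_points_def Vector_Spaces.linear_iff by auto
 show z: "x 0 = 0" using a[of 0 0] by simp
 show m: "x (- f) = - x f" for f using a[of f "- f"] z by (simp add: eq_neg_iff_add_eq_0 add.commute)
 show "x (f - h) = x f - x h" using a[of f "- h"] m by simp
qed

lemma pointI:
 assumes "!!f h. x (f + h) = x f + x h" "!!c f. x (scaleA D c f) = c * x f" "!!f h. x (f * h) = x f * x h" "x (unitA D) = 1"
 shows "x \<in> X"
proof -
 have "vector_space ((*) :: 'k => 'k => 'k)" by unfold_locales (auto simp: algebra_simps)
 thus ?thesis using assms A.vector_space_axioms unfolding rat_points_def Vector_Spaces.linear_iff by auto
qed

abbreviation "pact \<equiv> point_act D"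

lemma point_act_in: "g \<in> \<Gamma> ==> x \<in> X ==> pact g x \<in> X"
 unfolding point_act_def by (intro pointI) (auto simp: pointD actA_hom)

lemma point_act_mult: "g \<in> \<Gamma> ==> h \<in> \<Gamma> ==> pact (gmult g h) x = pact g (pact h x)"
 unfolding point_act_def by (auto simp: \<Gamma>.inv_mult_group act_mult fun_eq_iff)

lemma point_act_one: "pact \<one>\<^bsub>grp D\<^esub> x = x"
 unfolding point_act_def by (auto simp: act_one fun_eq_iff)

lemma point_act_inv: "g \<in> \<Gamma> ==> pact (ginv g) (pact g x) = x"
 "g \<in> \<Gamma> ==> pact g (pact (ginv g) x) = x"
 using point_act_mult[of "ginv g" g x] point_act_mult[of g "ginv g" x] point_act_one by simp_all

lemma point_act_apply: "g \<in> \<Gamma> ==> x (actA D g f) = pact (ginv g) x f"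
 by (simp add: point_act_def)

abbreviation "orb x \<equiv> orbit (grp D) (pact) x"

lemma orb_iff: "y \<in> orb x \<longleftrightarrow> (\<exists>g\<in>\<Gamma>. y = pact g x)" by (auto simp: orbit_def)

lemma orb_refl: "x \<in> orb x"
 unfolding orb_iff using point_act_one \<Gamma>.one_closed by metis

lemma orb_sym: "y \<in> orb x ==> x \<in> orb y"
 unfolding orb_iff using point_act_inv \<Gamma>.inv_closed by metis

lemma orb_trans: "y \<in> orb x ==> z \<in> orb y ==> z \<in> orb x"
 unfolding orb_iff using point_act_mult \<Gamma>.m_closed by metis

lemma orb_finite: "finite (orb x)" unfolding orbit_def using grp_finite by simp

lemma orb_in_X: "x \<in> X ==> y \<in> orb x ==> y \<in> X" unfolding orb_iff using point_act_in by auto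

text \<open>The product of functions that separate \<open>x\<close> from one point of \<open>Z\<close> each.\<close>

lemma separating_function:
 assumes "finite Z" "Z \<subseteq> X" "x \<in> X" "x \<notin> Z"
 shows "\<exists>f. x f = 1 & (\<forall>z\<in>Z. z f = 0)"
 using assms
proof (induction Z rule: finite_induct)
 case empty
 thus ?case using pointD(4) by blast
next
 case (insert z Z)
 then obtain f where f: "x f = 1" "!!z. z \<in> Z ==> z f = 0" by auto
 from insert obtain h where h: "x h ~= z h" by (auto simp: fun_eq_iff)
 define h' where "h' = scaleA D (1 / (x h - z h)) (h - scaleA D (z h) (unitA D))"
 have "x h' = 1" "z h' = 0" using h insert.prems by (simp_all add: h'_def pointD)
 thus ?case using f insert.prems by (intro exI[of _ "h' * f"]) (auto simp: pointD)
qed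

subsection \<open>Linear maps out of the tensor product\<close>

abbreviation "pt \<equiv> ptens D"

lemmas pt_bilinear = bilinear_pure_tensor[OF g.vector_space_axioms A.vector_space_axioms]

lemma vs_tens: "vector_space (tens_scale :: 'k => ('k, 'g, 'a) tens => _)"
 using pt_bilinear by (auto simp: bilinear_map_def Vector_Spaces.linear_iff)

sublocale T: vector_space "tens_scale :: 'k => ('k, 'g, 'a) tens => _" by (rule vs_tens)

lemmas pt_simps = bilinear_mapD[OF pt_bilinear]

lemma bilinearI:
 fixes sW :: "'k => 'w::ab_group_add => 'w"
 assumes "vector_space sW" "!!u u' f. F (u + u') f = F u f + F u' f" "!!u f f'. F u (f + f') = F u f + F u f'"
  "!!c u f. F (scaleg D c u) f = sW c (F u f)" "!!c u f. F u (scaleA D c f) = sW c (F u f)"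
 shows "bilinear_map (scaleg D) (scaleA D) sW F"
 using assms g.vector_space_axioms A.vector_space_axioms unfolding bilinear_map_def Vector_Spaces.linear_iff by auto

lemma TT_zero: "0 \<in> TT" unfolding tensor_space_def by (auto intro!: exI[of _ "[]"])

lemma TT_pt: "pt u f \<in> TT" unfolding tensor_space_def by (auto intro!: exI[of _ "[(u,f)]"])

lemma TT_add: "s \<in> TT ==> t \<in> TT ==> s + t \<in> TT"
 unfolding tensor_space_def
proof clarsimp
 fix ps qs
 show "\<exists>rs. sum_list (map (\<lambda>(u,v). pt u v) ps) + sum_list (map (\<lambda>(u,v). pt u v) qs) = sum_list (map (\<lambda>(u,v). pt u v) rs)"
  by (rule exI[of _ "ps @ qs"]) simp
qed

lemma TT_induct [consumes 1, case_names zero add]: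
 assumes "t \<in> TT" "P 0" "!!u f s. s \<in> TT ==> P s ==> P (pt u f + s)"
 shows "P t"
proof -
 obtain ps where t: "t = (\<Sum>(u, v)\<leftarrow>ps. pt u v)" using assms(1) by (auto simp: tensor_space_def)
 show ?thesis unfolding t
 proof (induction ps)
  case (Cons p ps)
  moreover have "(\<Sum>(u, v)\<leftarrow>ps. pt u v) \<in> TT" by (auto simp: tensor_space_def)
  ultimately show ?case using assms(3) by (cases p) simp
 qed (simp add: assms(2))
qed

lemma TT_scale: "t \<in> TT ==> tens_scale c t \<in> TT"
proof (induction t rule: TT_induct)
 case zero
 thus ?case using TT_zero by simp
next
 case (add u f s)
 have "tens_scale c (pt u f + s) = pt (scaleg D c u) f + tens_scale c s" by (simp add: T.scale_right_distrib pt_simps)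
 thus ?case using add TT_add TT_pt by simp
qed

lemma TT_sum: "(!!i. i \<in> I ==> t i \<in> TT) ==> (\<Sum>i\<in>I. t i) \<in> TT"
 by (induction I rule: infinite_finite_induct) (auto intro: TT_zero TT_add)

context
 fixes sW :: "'k => 'w::ab_group_add => 'w" and F
 assumes F: "bilinear_map (scaleg D) (scaleA D) sW F"
begin

lemma tlift_pt: "tlift D F (pt u f) = F u f" by (rule tensor_lift_pure[OF F])

lemma tlift_zero: "tlift D F 0 = 0" using tensor_lift_sum[OF F, of "[]"] by simp

lemma tlift_add: "s \<in> TT ==> t \<in> TT ==> tlift D F (s + t) = tlift D F s + tlift D F t"
proof -
 assume "s \<in> TT" "t \<in> TT"
 then obtain ps qs where st: "s = (\<Sum>(u, v)\<leftarrow>ps. pt u v)" "t = (\<Sum>(u, v)\<leftarrow>qs. pt u v)" by (auto simp: tensor_space_def)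
 have "s + t = (\<Sum>(u, v)\<leftarrow>ps @ qs. pt u v)" by (simp add: st)
 thus ?thesis using tensor_lift_sum[OF F, of ps] tensor_lift_sum[OF F, of qs] tensor_lift_sum[OF F, of "ps @ qs"] st by simp
qed

lemma tlift_scale: "t \<in> TT ==> tlift D F (tens_scale c t) = sW c (tlift D F t)"
proof (induction t rule: TT_induct)
 case zero
 interpret W: vector_space sW using F unfolding bilinear_map_def Vector_Spaces.linear_iff by auto
 show ?case by (simp add: tlift_zero)
next
 case (add u f s)
 interpret W: vector_space sW using F unfolding bilinear_map_def Vector_Spaces.linear_iff by auto
 have "tens_scale c (pt u f + s) = pt (scaleg D c u) f + tens_scale c s" by (simp add: T.scale_right_distrib pt_simps)
 thus ?case using add by (simp add: tlift_add TT_pt TT_scale tlift_pt bilinear_mapD[OF F] W.scale_right_distrib)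
qed

end

subsection \<open>Module structure, action and bracket\<close>

definition amul :: "'a => ('k, 'g, 'a) tens => ('k, 'g, 'a) tens" where
 "amul f = tlift D (\<lambda>u h. pt u (f * h))"

lemma amul_bilinear: "bilinear_map (scaleg D) (scaleA D) tens_scale (\<lambda>u h. pt u (f * h))"
 by (rule bilinearI[OF vs_tens]) (simp_all add: pt_simps distrib_left scaleA_mult)

lemmas amul_simps = tlift_pt[OF amul_bilinear, folded amul_def] tlift_zero[OF amul_bilinear, folded amul_def]
 tlift_add[OF amul_bilinear, folded amul_def] tlift_scale[OF amul_bilinear, folded amul_def]

lemma amul_TT: "t \<in> TT ==> amul f t \<in> TT"
 by (induction t rule: TT_induct) (auto simp: amul_simps TT_zero TT_pt intro!: TT_add)

lemma amul_amul: "t \<in> TT ==> amul f (amul h t) = amul (f * h) t"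
 by (induction t rule: TT_induct) (auto simp: amul_simps TT_pt amul_TT mult.assoc)

lemma amul_add_left: "t \<in> TT ==> amul (f + h) t = amul f t + amul h t"
 by (induction t rule: TT_induct) (auto simp: amul_simps TT_pt amul_TT distrib_right pt_simps)

lemma amul_scale_left: "t \<in> TT ==> amul (scaleA D c f) t = tens_scale c (amul f t)"
 by (induction t rule: TT_induct) (auto simp: amul_simps TT_pt amul_TT scaleA_mult pt_simps T.scale_right_distrib)

lemma amul_unit: "t \<in> TT ==> amul (unitA D) t = t"
 by (induction t rule: TT_induct) (auto simp: amul_simps TT_pt)

lemma tens_act_bilinear: "g \<in> \<Gamma> ==> bilinear_map (scaleg D) (scaleA D) tens_scale (\<lambda>u f. pt (actg D g u) (actA D g f))"
 by (rule bilinearI[OF vs_tens]) (simp_all add: pt_simps actA_hom actg_hom)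

lemmas tens_act_simps = tlift_pt[OF tens_act_bilinear, folded tens_act_def] tlift_zero[OF tens_act_bilinear, folded tens_act_def]
 tlift_add[OF tens_act_bilinear, folded tens_act_def] tlift_scale[OF tens_act_bilinear, folded tens_act_def]

lemma tens_act_TT: "t \<in> TT ==> g \<in> \<Gamma> ==> tens_act D g t \<in> TT"
 by (induction t rule: TT_induct) (auto simp: tens_act_simps TT_zero TT_pt intro!: TT_add)

lemma tens_act_mult: "t \<in> TT ==> g \<in> \<Gamma> ==> h \<in> \<Gamma> ==> tens_act D (gmult g h) t = tens_act D g (tens_act D h t)"
 by (induction t rule: TT_induct) (auto simp: tens_act_simps TT_pt tens_act_TT act_mult)

lemma tens_act_amul: "t \<in> TT ==> g \<in> \<Gamma> ==> tens_act D g (amul f t) = amul (actA D g f) (tens_act D g t)"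
 by (induction t rule: TT_induct) (auto simp: tens_act_simps amul_simps TT_pt tens_act_TT amul_TT actA_hom)

lemma tens_act_sum: "g \<in> \<Gamma> ==> (!!i. i \<in> I ==> t i \<in> TT) ==> tens_act D g (\<Sum>i\<in>I. t i) = (\<Sum>i\<in>I. tens_act D g (t i))"
 by (induction I rule: infinite_finite_induct) (auto simp: tens_act_simps TT_sum)

abbreviation "tb \<equiv> tens_bracket D"

definition tb_pt :: "'g => 'a => ('k, 'g, 'a) tens => ('k, 'g, 'a) tens" where
 "tb_pt u f = tlift D (\<lambda>v h. pt (brg D u v) (f * h))"

lemmas brg_simps = bilinear_mapD[OF brg_bilinear]

lemma tb_pt_bilinear: "bilinear_map (scaleg D) (scaleA D) tens_scale (\<lambda>v h. pt (brg D u v) (f * h))"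
 by (rule bilinearI[OF vs_tens]) (simp_all add: pt_simps distrib_left scaleA_mult brg_simps)

lemmas tb_pt_simps = tlift_pt[OF tb_pt_bilinear, folded tb_pt_def] tlift_zero[OF tb_pt_bilinear, folded tb_pt_def]
 tlift_add[OF tb_pt_bilinear, folded tb_pt_def] tlift_scale[OF tb_pt_bilinear, folded tb_pt_def]

lemma tb_pt_left:
 assumes "t \<in> TT"
 shows "tb_pt (u + u') f t = tb_pt u f t + tb_pt u' f t" "tb_pt u (f + f') t = tb_pt u f t + tb_pt u f' t"
  "tb_pt (scaleg D c u) f t = tens_scale c (tb_pt u f t)" "tb_pt u (scaleA D c f) t = tens_scale c (tb_pt u f t)"
 using assms
 by (induction t rule: TT_induct)
  (simp_all add: tb_pt_simps TT_pt pt_simps distrib_right scaleA_mult brg_simps T.scale_right_distrib)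

lemma tb_pt_TT [simp]: "t \<in> TT ==> tb_pt u f t \<in> TT"
 by (induction t rule: TT_induct) (simp_all add: tb_pt_simps TT_pt TT_zero TT_add)

lemma tb_bilinear: "t \<in> TT ==> bilinear_map (scaleg D) (scaleA D) tens_scale (\<lambda>u f. tb_pt u f t)"
 by (rule bilinearI[OF vs_tens]) (simp_all add: tb_pt_left)

lemma tb_eq: "tb s t = tlift D (\<lambda>u f. tb_pt u f t) s"
 by (simp add: tens_bracket_def tb_pt_def)

lemma tb_left:
 assumes "t \<in> TT"
 shows "tb (pt u f) t = tb_pt u f t" "tb 0 t = 0" "s \<in> TT ==> s' \<in> TT ==> tb (s + s') t = tb s t + tb s' t"
  "s \<in> TT ==> tb (tens_scale c s) t = tens_scale c (tb s t)"
 unfolding tb_eq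
 using tlift_pt[OF tb_bilinear[OF assms]] tlift_zero[OF tb_bilinear[OF assms]] tlift_add[OF tb_bilinear[OF assms]]
  tlift_scale[OF tb_bilinear[OF assms]] by auto

lemma tb_right:
 assumes "s \<in> TT"
 shows "tb s 0 = 0" "t \<in> TT ==> t' \<in> TT ==> tb s (t + t') = tb s t + tb s t'"
  "t \<in> TT ==> tb s (tens_scale c t) = tens_scale c (tb s t)"
 using assms
 by (induction s rule: TT_induct)
  (simp_all add: tb_left TT_zero TT_pt TT_add TT_scale tb_pt_simps T.scale_right_distrib)

lemma tb_pure: "tb (pt u f) (pt v h) = pt (brg D u v) (f * h)"
 by (rule tens_bracket_pure[OF setting])

lemma tb_TT: "s \<in> TT ==> t \<in> TT ==> tb s t \<in> TT"
proof (induction s rule: TT_induct)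
 case (add u f s)
 have "tb (pt u f) t \<in> TT" using \<open>t \<in> TT\<close>
  by (induction t rule: TT_induct) (simp_all add: tb_right TT_zero TT_pt TT_add tb_pure)
 thus ?case using add by (simp add: tb_left TT_pt TT_add)
qed (simp add: tb_left TT_zero)

lemma tb_amul_left: "s \<in> TT ==> t \<in> TT ==> tb (amul f s) t = amul f (tb s t)"
proof (induction s rule: TT_induct)
 case (add u h s)
 have "tb (pt u (f * h)) t = amul f (tb (pt u h) t)" using \<open>t \<in> TT\<close>
  by (induction t rule: TT_induct) (simp_all add: tb_right TT_zero TT_pt TT_add tb_pure tb_TT amul_simps mult.assoc)
 thus ?case using add by (simp add: tb_left TT_pt amul_TT tb_TT amul_simps)
qed (simp add: tb_left amul_simps)

lemma tb_amul_right: "s \<in> TT ==> t \<in> TT ==> tb s (amul f t) = amul f (tb s t)"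
proof (induction s rule: TT_induct)
 case (add u h s)
 have "tb (pt u h) (amul f t) = amul f (tb (pt u h) t)" using \<open>t \<in> TT\<close>
  by (induction t rule: TT_induct) (simp_all add: tb_right TT_zero TT_pt TT_add tb_pure tb_TT amul_simps amul_TT mult.left_commute)
 thus ?case using add by (simp add: tb_left TT_pt amul_TT tb_TT amul_simps)
qed (simp add: tb_left amul_simps amul_TT)

lemma tens_act_tb: "s \<in> TT ==> t \<in> TT ==> g \<in> \<Gamma> ==> tens_act D g (tb s t) = tb (tens_act D g s) (tens_act D g t)"
proof (induction s rule: TT_induct)
 case (add u h s)
 have "tens_act D g (tb (pt u h) t) = tb (tens_act D g (pt u h)) (tens_act D g t)" using \<open>t \<in> TT\<close>
  by (induction t rule: TT_induct)
   (simp_all add: tb_right TT_zero TT_pt TT_add tb_pure tb_TT tens_act_simps tens_act_TT actA_hom actg_hom \<open>g \<in> \<Gamma>\<close>)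
 thus ?case using add by (simp add: tb_left TT_pt tens_act_TT tb_TT tens_act_simps)
qed (simp add: tb_left tens_act_simps tens_act_TT)

subsection \<open>Evaluation\<close>

abbreviation "val \<equiv> value_at D"

lemma value_bilinear: "x \<in> X ==> bilinear_map (scaleg D) (scaleA D) (scaleg D) (\<lambda>u f. scaleg D (x f) u)"
 by (rule bilinearI[OF g.vector_space_axioms])
  (simp_all add: pointD g.scale_right_distrib g.scale_left_distrib mult.commute)

lemma val_simps:
 assumes "x \<in> X"
 shows "val x (pt u f) = scaleg D (x f) u" "val x 0 = 0"
  "s \<in> TT ==> t \<in> TT ==> val x (s + t) = val x s + val x t" "t \<in> TT ==> val x (tens_scale c t) = scaleg D c (val x t)"
 unfolding value_at_def
 using tlift_pt[OF value_bilinear[OF assms]] tlift_zero[OF value_bilinear[OF assms]] tlift_add[OF value_bilinear[OF assms]]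
  tlift_scale[OF value_bilinear[OF assms]] by auto

lemma val_sum: "x \<in> X ==> (!!i. i \<in> I ==> t i \<in> TT) ==> val x (\<Sum>i\<in>I. t i) = (\<Sum>i\<in>I. val x (t i))"
 by (induction I rule: infinite_finite_induct) (auto simp: val_simps TT_sum)

lemma val_tb: "s \<in> TT ==> t \<in> TT ==> x \<in> X ==> val x (tb s t) = brg D (val x s) (val x t)"
proof (induction s rule: TT_induct)
 case zero
 have "brg D 0 v = 0" for v using brg_simps(1)[of 0 0 v] by simp
 thus ?case using zero by (simp add: tb_left val_simps)
next
 case (add u h s)
 have z: "brg D v 0 = 0" for v using brg_simps(2)[of v 0 0] by simp
 have "val x (tb (pt u h) t) = brg D (val x (pt u h)) (val x t)" using \<open>t \<in> TT\<close>
  by (induction t rule: TT_induct)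
   (simp_all add: tb_right TT_zero TT_pt TT_add tb_pure tb_TT val_simps \<open>x \<in> X\<close> z pointD brg_simps mult.commute)
 thus ?case using add by (simp add: tb_left TT_pt tb_TT val_simps brg_simps)
qed

lemma val_act: "t \<in> TT ==> x \<in> X ==> g \<in> \<Gamma> ==> val (pact g x) (tens_act D g t) = actg D g (val x t)"
proof (induction t rule: TT_induct)
 case zero
 have "actg D g 0 = 0" using actg_hom(1)[OF \<open>g \<in> \<Gamma>\<close>, of 0 0] by simp
 thus ?case using zero by (simp add: val_simps tens_act_simps point_act_in)
next
 case (add u f s)
 thus ?case
  by (simp add: val_simps tens_act_simps point_act_in TT_pt tens_act_TT actg_hom) (simp add: point_act_def act_inv)
qed

subsection \<open>The invariants\<close>

abbreviation "MM \<equiv> map_alg D"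
abbreviation "M \<equiv> carr MM"

lemma M_iff: "t \<in> M \<longleftrightarrow> t \<in> TT & (\<forall>g\<in>\<Gamma>. tens_act D g t = t)"
 by (auto simp: map_alg_def)

lemma MM_simps [simp]: "lie_scale MM = tens_scale" "lie_bracket MM = tb"
 by (auto simp: map_alg_def)

lemma M_TT: "t \<in> M ==> t \<in> TT" by (simp add: M_iff)

lemma MM_closed: "lie_closed MM"
 unfolding lie_closed_def MM_simps
 by (auto simp: M_iff TT_zero TT_add TT_scale tb_TT tens_act_simps tens_act_tb tb_left tb_right T.scale_right_distrib)

lemmas M_closed = lie_closedD[OF MM_closed, unfolded MM_simps]

lemma M_diff: "s \<in> M ==> t \<in> M ==> s - t \<in> M" by (rule lie_closed_diff[OF MM_closed])

lemma M_sum: "(!!i. i \<in> I ==> t i \<in> M) ==> (\<Sum>i\<in>I. t i) \<in> M"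
 by (induction I rule: infinite_finite_induct) (auto intro: M_closed)

definition R :: "'a set" where "R = {f. \<forall>g\<in>\<Gamma>. actA D g f = f}"

lemma amul_M: "f \<in> R ==> t \<in> M ==> amul f t \<in> M"
 by (auto simp: M_iff R_def amul_TT tens_act_amul)

lemma val_diff: "x \<in> X ==> s \<in> TT ==> t \<in> TT ==> val x (s - t) = val x s - val x t"
proof -
 assume a: "x \<in> X" "s \<in> TT" "t \<in> TT"
 have "- t = tens_scale (- 1) t" by simp
 thus ?thesis using val_simps(3)[OF a(1,2), of "- t"] val_simps(4)[OF a(1,3), of "- 1"] TT_scale[OF a(3), of "- 1"] by simp
qed

text \<open>The Reynolds operator.\<close>

definition avg :: "('k, 'g, 'a) tens => ('k, 'g, 'a) tens" where
 "avg t = tens_scale (1 / of_nat (card \<Gamma>)) (\<Sum>g\<in>\<Gamma>. tens_act D g t)"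

lemma sum_translate: "h \<in> \<Gamma> ==> (\<Sum>g\<in>\<Gamma>. F (gmult h g)) = (\<Sum>g\<in>\<Gamma>. F g)"
proof (rule sum.reindex_bij_betw)
 assume h: "h \<in> \<Gamma>"
 show "bij_betw (gmult h) \<Gamma> \<Gamma>"
  by (rule bij_betwI[of _ _ _ "gmult (ginv h)"]) (use h in "auto simp: \<Gamma>.m_assoc[symmetric]")
qed

lemma avg_M: "t \<in> TT ==> avg t \<in> M"
proof -
 assume t: "t \<in> TT"
 have c: "(\<Sum>g\<in>\<Gamma>. tens_act D g t) \<in> TT" by (rule TT_sum) (simp add: tens_act_TT t)
 have "tens_act D h (\<Sum>g\<in>\<Gamma>. tens_act D g t) = (\<Sum>g\<in>\<Gamma>. tens_act D g t)" if h: "h \<in> \<Gamma>" for h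
 proof -
  have "tens_act D h (\<Sum>g\<in>\<Gamma>. tens_act D g t) = (\<Sum>g\<in>\<Gamma>. tens_act D (gmult h g) t)"
   by (subst tens_act_sum[OF h]) (auto simp: tens_act_TT t tens_act_mult h)
  thus ?thesis using sum_translate[OF h] by simp
 qed
 thus ?thesis unfolding M_iff avg_def by (simp add: TT_scale c tens_act_simps)
qed

lemma avg_id: "t \<in> M ==> avg t = t"
 using card_\<Gamma> by (simp add: avg_def M_iff T.sum_constant_scale del: sum_constant)

lemma avg_zero: "avg 0 = 0" by (simp add: avg_def tens_act_simps)

lemma avg_add: "s \<in> TT ==> t \<in> TT ==> avg (s + t) = avg s + avg t"
 by (simp add: avg_def tens_act_simps sum.distrib T.scale_right_distrib)

lemma amul_sum: "(!!i. i \<in> I ==> t i \<in> TT) ==> amul f (\<Sum>i\<in>I. t i) = (\<Sum>i\<in>I. amul f (t i))"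
 by (induction I rule: infinite_finite_induct) (auto simp: amul_simps TT_sum)

lemma avg_amul: "f \<in> R ==> t \<in> TT ==> avg (amul f t) = amul f (avg t)"
 unfolding avg_def
 by (simp add: amul_simps TT_sum tens_act_TT amul_sum tens_act_amul R_def)

subsection \<open>The isotropy algebras\<close>

abbreviation "FA x \<equiv> fix_alg D x"
abbreviation "stab x \<equiv> stabilizer (grp D) (pact) x"

lemma FA_simps [simp]: "lie_scale (FA x) = scaleg D" "lie_bracket (FA x) = brg D"
 by (auto simp: fix_alg_def)

lemma FA_iff: "u \<in> carr (FA x) \<longleftrightarrow> (\<forall>g\<in>\<Gamma>. pact g x = x \<longrightarrow> actg D g u = u)"
 by (auto simp: fix_alg_def stabilizer_def)

lemma actg_zero: "g \<in> \<Gamma> ==> actg D g 0 = 0"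
 using actg_hom(1)[of g 0 0] by simp

lemma FA_closed: "lie_closed (FA x)"
 unfolding lie_closed_def FA_simps
 by (auto simp: FA_iff actg_hom actg_zero brg_simps g.scale_right_distrib)

lemma val_in_FA: "t \<in> M ==> x \<in> X ==> val x t \<in> carr (FA x)"
 unfolding FA_iff M_iff using val_act by metis

lemma val_point_act: "t \<in> M ==> x \<in> X ==> g \<in> \<Gamma> ==> val (pact g x) t = actg D g (val x t)"
 unfolding M_iff using val_act by metis

lemma val_avg_pt:
 assumes "x \<in> X"
 shows "val x (avg (pt u f)) = scaleg D (1 / of_nat (card \<Gamma>)) (\<Sum>g\<in>\<Gamma>. scaleg D (x (actA D g f)) (actg D g u))"
 unfolding avg_def
 by (simp add: val_simps[OF assms] TT_sum tens_act_TT TT_pt val_sum[OF assms] tens_act_simps)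

text \<open>Let \<open>f\<close> be \<open>1\<close> at \<open>x\<close> and \<open>0\<close> at the other points of its orbit and on the orbits of \<open>Y\<close>.  In the value at \<open>x\<close> of the average of
  \<open>u \<otimes> f\<close> only the stabiliser of \<open>x\<close> contributes, and it fixes \<open>u\<close>; the value is a nonzero multiple of \<open>u\<close>.\<close>

lemma eval_surjective_at:
 assumes x: "x \<in> X" and Y: "finite Y" "Y \<subseteq> X" "!!y. y \<in> Y ==> y \<notin> orb x" and u: "u \<in> carr (FA x)"
 obtains \<xi> where "\<xi> \<in> M" "val x \<xi> = u" "!!y. y \<in> Y ==> val y \<xi> = 0"
proof -
 define Z where "Z = (orb x - {x}) \<union> (\<Union>y\<in>Y. orb y)"
 have "finite Z" using orb_finite Y by (simp add: Z_def)
 moreover have "Z \<subseteq> X" using orb_in_X[OF x] orb_in_X Y(2) unfolding Z_def by blast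
 moreover have "x \<notin> Z"
 proof -
  have "x \<notin> orb y" if "y \<in> Y" for y using Y(3)[OF that] orb_sym by blast
  thus ?thesis unfolding Z_def by blast
 qed
 ultimately have "\<exists>f. x f = 1 & (\<forall>z\<in>Z. z f = 0)" by (intro separating_function x)
 then obtain f where f: "x f = 1" "!!z. z \<in> Z ==> z f = 0" by (elim exE conjE) simp
 have xg: "scaleg D (x (actA D g f)) (actg D g u) = (if g \<in> stab x then u else 0)" if g: "g \<in> \<Gamma>" for g
 proof (cases "pact g x = x")
  case True
  hence "x (actA D g f) = 1" using f point_act_apply[OF g] point_act_inv(1)[OF g] by metis
  thus ?thesis using u True g unfolding FA_iff by (auto simp: stabilizer_def)
 next
  case False
  hence "pact (ginv g) x ~= x" using point_act_inv(2)[OF g] by metis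
  hence "pact (ginv g) x \<in> Z" using g by (auto simp: Z_def orb_iff)
  hence "x (actA D g f) = 0" using f point_act_apply[OF g] by metis
  thus ?thesis using False by (simp add: stabilizer_def)
 qed
 have st: "finite (stab x)" "stab x \<subseteq> \<Gamma>" "\<one>\<^bsub>grp D\<^esub> \<in> stab x" using grp_finite point_act_one by (auto simp: stabilizer_def)
 \<comment> \<open>the proportion of the group that fixes \<open>x\<close>; the value of the average at \<open>x\<close> is \<open>c u\<close>\<close>
 define c :: 'k where "c = of_nat (card (stab x)) / of_nat (card \<Gamma>)"
 have c: "c ~= 0" using st card_\<Gamma> by (auto simp: c_def card_eq_0_iff)
 have "(\<Sum>g\<in>\<Gamma>. scaleg D (x (actA D g f)) (actg D g u)) = (\<Sum>g\<in>\<Gamma>. if g \<in> stab x then u else 0)"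
  by (rule sum.cong) (auto simp: xg)
 also have "... = scaleg D (of_nat (card (stab x))) u"
  using st grp_finite by (simp add: sum.If_cases Int_absorb1 g.sum_constant_scale)
 finally have vx: "val x (avg (pt u f)) = scaleg D c u"
  by (simp add: val_avg_pt[OF x] c_def)
 have vy: "val y (avg (pt u f)) = 0" if y: "y \<in> Y" for y
 proof -
  have "y (actA D g f) = 0" if g: "g \<in> \<Gamma>" for g
  proof -
   have "pact (ginv g) y \<in> Z" using g y by (auto simp: Z_def orb_iff)
   thus ?thesis using f point_act_apply[OF g] by metis
  qed
  moreover have "y \<in> X" using y Y by auto
  ultimately show ?thesis by (simp add: val_avg_pt)
 qed
 define \<xi> where "\<xi> = tens_scale (1 / c) (avg (pt u f))"
 have aM: "avg (pt u f) \<in> M" by (rule avg_M[OF TT_pt])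
 show ?thesis
 proof (rule that[of \<xi>])
  show "\<xi> \<in> M" using aM by (simp add: \<xi>_def M_closed)
  show "val x \<xi> = u" using c by (simp add: \<xi>_def val_simps[OF x] M_TT[OF aM] vx)
  show "val y \<xi> = 0" if "y \<in> Y" for y
  proof -
   have "y \<in> X" using that Y by auto
   thus ?thesis using vy[OF that] by (simp add: \<xi>_def val_simps M_TT[OF aM])
  qed
 qed
qed

subsection \<open>Coefficients\<close>

text \<open>The image of \<open>\<gg> \<otimes> I\<close>, for a set \<open>I\<close> of functions.\<close>

definition gtens :: "'a set => ('k, 'g, 'a) tens set" where
 "gtens I = {t. \<exists>ps. t = (\<Sum>(u, f)\<leftarrow>ps. pt u f) & (\<forall>(u, f)\<in>set ps. f \<in> I)}"

lemma gtens_induct [consumes 1, case_names zero add]: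
 assumes "t \<in> gtens I" "P 0" "!!u f s. f \<in> I ==> s \<in> gtens I ==> P s ==> P (pt u f + s)"
 shows "P t"
proof -
 obtain ps where t: "t = (\<Sum>(u, v)\<leftarrow>ps. pt u v)" "\<forall>(u, f)\<in>set ps. f \<in> I" using assms(1) by (auto simp: gtens_def)
 show ?thesis unfolding t(1) using t(2)
 proof (induction ps)
  case (Cons p ps)
  hence "(\<Sum>(u, v)\<leftarrow>ps. pt u v) \<in> gtens I" by (auto simp: gtens_def)
  thus ?case using Cons assms(3) by (cases p) simp
 qed (simp add: assms(2))
qed

lemma gtens_zero: "0 \<in> gtens I" by (auto simp: gtens_def intro!: exI[of _ "[]"])

lemma gtens_pt: "f \<in> I ==> pt u f \<in> gtens I" by (auto simp: gtens_def intro!: exI[of _ "[(u,f)]"])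

lemma gtens_add: "s \<in> gtens I ==> t \<in> gtens I ==> s + t \<in> gtens I"
proof -
 assume "s \<in> gtens I" "t \<in> gtens I"
 then obtain ps qs where "s = (\<Sum>(u, v)\<leftarrow>ps. pt u v)" "\<forall>(u, f)\<in>set ps. f \<in> I"
  "t = (\<Sum>(u, v)\<leftarrow>qs. pt u v)" "\<forall>(u, f)\<in>set qs. f \<in> I" by (auto simp: gtens_def)
 thus ?thesis unfolding gtens_def by (auto intro!: exI[of _ "ps @ qs"])
qed

lemma gtens_TT: "t \<in> gtens I ==> t \<in> TT" by (auto simp: gtens_def tensor_space_def)

lemma gtens_mono: "I \<subseteq> J ==> gtens I \<subseteq> gtens J" unfolding gtens_def by blast

lemma gtens_scale: "t \<in> gtens I ==> tens_scale c t \<in> gtens I"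
proof (induction t rule: gtens_induct)
 case zero
 thus ?case by (simp add: gtens_zero)
next
 case (add u f s)
 have "tens_scale c (pt u f + s) = pt (scaleg D c u) f + tens_scale c s" by (simp add: T.scale_right_distrib pt_simps)
 thus ?case using add gtens_add gtens_pt by simp
qed

lemma gtens_sum: "(!!i. i \<in> J ==> t i \<in> gtens I) ==> (\<Sum>i\<in>J. t i) \<in> gtens I"
 by (induction J rule: infinite_finite_induct) (auto intro: gtens_zero gtens_add)

lemma gtens_bracket:
 assumes "!!f h. f \<in> I ==> h \<in> J ==> f * h \<in> K" "s \<in> gtens I" "t \<in> gtens J"
 shows "tb s t \<in> gtens K"
 using assms(2)
proof (induction s rule: gtens_induct)
 case zero
 thus ?case using gtens_TT[OF assms(3)] by (simp add: tb_left gtens_zero)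
next
 case (add u f s)
 have "tb (pt u f) t \<in> gtens K" using assms(3)
 proof (induction t rule: gtens_induct)
  case zero
  thus ?case by (simp add: tb_right TT_pt gtens_zero)
 next
  case (add v h t)
  thus ?case using assms(1) \<open>f \<in> I\<close> by (simp add: tb_right TT_pt gtens_TT tb_pure gtens_add gtens_pt)
 qed
 thus ?case using add gtens_TT[OF assms(3)] by (simp add: tb_left TT_pt gtens_TT gtens_add)
qed

text \<open>The coefficients with respect to a basis of \<open>\<gg>\<close> vanish at \<open>y\<close> if the tensor does.\<close>

lemma vanishing_coefficients:
 assumes t: "t \<in> TT" and Y: "Y \<subseteq> X" "!!y. y \<in> Y ==> val y t = 0"
 shows "t \<in> gtens {f. \<forall>y\<in>Y. y f = 0}"
proof -
 obtain B where "finite_dimensional_vector_space (scaleg D) B"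
  using setting unfolding equivariant_setting_def by blast
 then interpret fd: finite_dimensional_vector_space "scaleg D" B .
 have "\<exists>c. t = (\<Sum>b\<in>B. pt b (c b))" using t
 proof (induction t rule: TT_induct)
  case zero
  have "pt u 0 = 0" for u using pt_simps(2)[of u 0 0] by simp
  thus ?case by (intro exI[of _ "\<lambda>_. 0"]) simp
 next
  case (add u f s)
  then obtain c where c: "s = (\<Sum>b\<in>B. pt b (c b))" by auto
  have lin: "pt (\<Sum>b\<in>S. scaleg D (r b) b) f = (\<Sum>b\<in>S. pt b (scaleA D (r b) f))" if "finite S" for S r
   using that
  proof (induction S rule: finite_induct)
   case empty
   have "pt 0 f = 0" using pt_simps(1)[of 0 0 f] by simp
   thus ?case by simp
  qed (simp add: pt_simps)
  have "u = (\<Sum>b\<in>B. scaleg D (g.representation B u b) b)"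
   using g.sum_representation_eq[OF fd.independent_Basis _ fd.finite_Basis order_refl, of u] fd.span_Basis by simp
  hence "pt u f = (\<Sum>b\<in>B. pt b (scaleA D (g.representation B u b) f))" using lin[OF fd.finite_Basis] by metis
  thus ?case by (intro exI[of _ "\<lambda>b. scaleA D (g.representation B u b) f + c b"]) (simp add: c sum.distrib pt_simps)
 qed
 then obtain c where c: "t = (\<Sum>b\<in>B. pt b (c b))" by auto
 have "y (c b) = 0" if "y \<in> Y" "b \<in> B" for y b
 proof -
  have yX: "y \<in> X" using that Y by auto
  have "(\<Sum>b\<in>B. scaleg D (y (c b)) b) = 0"
   using Y(2)[OF that(1)] unfolding c by (simp add: val_sum[OF yX] TT_pt val_simps[OF yX])
  thus ?thesis using g.independentD[OF fd.independent_Basis fd.finite_Basis order_refl, of "\<lambda>b. y (c b)"] that by simp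
 qed
 thus ?thesis unfolding c by (intro gtens_sum gtens_pt) auto
qed

end

section \<open>Points over the invariant ring\<close>

context equivariant_map_algebra
begin

definition idealA :: "'a set => bool" where
 "idealA I \<longleftrightarrow> 0 \<in> I & (\<forall>f\<in>I. \<forall>h\<in>I. f + h \<in> I) & (\<forall>f\<in>I. \<forall>h. h * f \<in> I)"

lemma idealAD:
 assumes "idealA I"
 shows "0 \<in> I" "f \<in> I ==> h \<in> I ==> f + h \<in> I" "f \<in> I ==> h * f \<in> I" "f \<in> I ==> f * h \<in> I"
  "f \<in> I ==> - f \<in> I" "f \<in> I ==> h \<in> I ==> f - h \<in> I" "f \<in> I ==> scaleA D c f \<in> I"
proof -
 note a = assms[unfolded idealA_def]
 show "0 \<in> I" and add: "f \<in> I ==> h \<in> I ==> f + h \<in> I" and m: "f \<in> I ==> h * f \<in> I" for f h using a by auto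
 show "f \<in> I ==> f * h \<in> I" using m by (simp add: mult.commute)
 show n: "f \<in> I ==> - f \<in> I" for f
  using m[of f "- unitA D"] by simp
 show "f \<in> I ==> h \<in> I ==> f - h \<in> I" using add[of f "- h"] n by simp
 show "f \<in> I ==> scaleA D c f \<in> I" using m[of f "scaleA D c (unitA D)"] by (simp add: scaleA_mult)
qed

lemma R_closed: "f \<in> R ==> h \<in> R ==> f + h \<in> R" "f \<in> R ==> h \<in> R ==> f * h \<in> R"
 "f \<in> R ==> scaleA D c f \<in> R" "unitA D \<in> R" "0 \<in> R" "f \<in> R ==> - f \<in> R" "f \<in> R ==> h \<in> R ==> f - h \<in> R"
proof -
 show a: "f \<in> R ==> h \<in> R ==> f + h \<in> R" for f h by (auto simp: R_def actA_hom)
 show "f \<in> R ==> h \<in> R ==> f * h \<in> R" "f \<in> R ==> scaleA D c f \<in> R" "unitA D \<in> R" "0 \<in> R"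
  by (auto simp: R_def actA_hom actA_zero)
 show n: "f \<in> R ==> - f \<in> R" for f by (auto simp: R_def actA_uminus)
 show "f \<in> R ==> h \<in> R ==> f - h \<in> R" using a[of f "- h"] n[of h] by simp
qed

definition charR :: "('a => 'k) => bool" where
 "charR \<chi> \<longleftrightarrow> (\<forall>f\<in>R. \<forall>h\<in>R. \<chi> (f + h) = \<chi> f + \<chi> h & \<chi> (f * h) = \<chi> f * \<chi> h) &
  (\<forall>c. \<forall>f\<in>R. \<chi> (scaleA D c f) = c * \<chi> f) & \<chi> (unitA D) = 1"

lemma charRD:
 assumes "charR \<chi>"
 shows "f \<in> R ==> h \<in> R ==> \<chi> (f + h) = \<chi> f + \<chi> h" "f \<in> R ==> h \<in> R ==> \<chi> (f * h) = \<chi> f * \<chi> h"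
  "f \<in> R ==> \<chi> (scaleA D c f) = c * \<chi> f" "\<chi> (unitA D) = 1" "\<chi> 0 = 0" "f \<in> R ==> h \<in> R ==> \<chi> (f - h) = \<chi> f - \<chi> h"
proof -
 note a = assms[unfolded charR_def]
 show add: "f \<in> R ==> h \<in> R ==> \<chi> (f + h) = \<chi> f + \<chi> h" for f h using a by auto
 show "f \<in> R ==> h \<in> R ==> \<chi> (f * h) = \<chi> f * \<chi> h" "f \<in> R ==> \<chi> (scaleA D c f) = c * \<chi> f" "\<chi> (unitA D) = 1" using a by auto
 show "\<chi> 0 = 0" using add[OF R_closed(5,5)] by simp
 show "f \<in> R ==> h \<in> R ==> \<chi> (f - h) = \<chi> f - \<chi> h" using add[of "f - h" h] R_closed(7)[of f h] by simp
qed

text \<open>The ideal of \<open>A\<close> that is generated by the kernel of \<open>\<chi>\<close> in \<open>R\<close>.\<close>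

definition ext_ideal :: "('a => 'k) => 'a set" where
 "ext_ideal \<chi> = {t. \<exists>ps. t = (\<Sum>(r, a)\<leftarrow>ps. r * a) & (\<forall>(r, a)\<in>set ps. r \<in> R & \<chi> r = 0)}"

lemma ext_ideal_induct [consumes 1, case_names zero add]:
 assumes "t \<in> ext_ideal \<chi>" "P 0" "!!r a s. r \<in> R ==> \<chi> r = 0 ==> s \<in> ext_ideal \<chi> ==> P s ==> P (r * a + s)"
 shows "P t"
proof -
 obtain ps where t: "t = (\<Sum>(r, a)\<leftarrow>ps. r * a)" "\<forall>(r, a)\<in>set ps. r \<in> R & \<chi> r = 0" using assms(1) by (auto simp: ext_ideal_def)
 show ?thesis unfolding t(1) using t(2)
 proof (induction ps)
  case (Cons p ps)
  hence "(\<Sum>(r, a)\<leftarrow>ps. r * a) \<in> ext_ideal \<chi>" by (auto simp: ext_ideal_def)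
  thus ?case using Cons assms(3) by (cases p) simp
 qed (simp add: assms(2))
qed

lemma ext_ideal_mem: "r \<in> R ==> \<chi> r = 0 ==> r * a \<in> ext_ideal \<chi>"
 by (auto simp: ext_ideal_def intro!: exI[of _ "[(r, a)]"])

lemma ext_ideal_add: "s \<in> ext_ideal \<chi> ==> t \<in> ext_ideal \<chi> ==> s + t \<in> ext_ideal \<chi>"
proof -
 assume "s \<in> ext_ideal \<chi>" "t \<in> ext_ideal \<chi>"
 then obtain ps qs where "s = (\<Sum>(r, a)\<leftarrow>ps. r * a)" "\<forall>(r, a)\<in>set ps. r \<in> R & \<chi> r = 0"
  "t = (\<Sum>(r, a)\<leftarrow>qs. r * a)" "\<forall>(r, a)\<in>set qs. r \<in> R & \<chi> r = 0" by (auto simp: ext_ideal_def)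
 thus ?thesis unfolding ext_ideal_def by (auto intro!: exI[of _ "ps @ qs"])
qed

lemma ext_ideal_zero: "0 \<in> ext_ideal \<chi>" by (auto simp: ext_ideal_def intro!: exI[of _ "[]"])

lemma ext_ideal_ideal: "idealA (ext_ideal \<chi>)"
proof -
 have "h * f \<in> ext_ideal \<chi>" if "f \<in> ext_ideal \<chi>" for f h
  using that
 proof (induction f rule: ext_ideal_induct)
  case (add r a s)
  thus ?case using ext_ideal_add ext_ideal_mem[of r \<chi> "h * a", OF add(1,2)] by (simp add: distrib_left mult.left_commute)
 qed (simp add: ext_ideal_zero)
 thus ?thesis by (auto simp: idealA_def ext_ideal_zero ext_ideal_add)
qed

lemma ext_ideal_R: "r \<in> R ==> \<chi> r = 0 ==> r \<in> ext_ideal \<chi>"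
 using ext_ideal_mem[of r \<chi> "unitA D"] by simp

text \<open>The Reynolds operator on functions.\<close>

definition avgA :: "'a => 'a" where
 "avgA f = scaleA D (1 / of_nat (card \<Gamma>)) (\<Sum>g\<in>\<Gamma>. actA D g f)"

lemma actA_sum: "g \<in> \<Gamma> ==> actA D g (\<Sum>i\<in>I. f i) = (\<Sum>i\<in>I. actA D g (f i))"
 by (induction I rule: infinite_finite_induct) (auto simp: actA_hom actA_zero)

lemma avgA_R: "avgA f \<in> R"
proof -
 have "actA D h (\<Sum>g\<in>\<Gamma>. actA D g f) = (\<Sum>g\<in>\<Gamma>. actA D g f)" if h: "h \<in> \<Gamma>" for h
 proof -
  have "actA D h (\<Sum>g\<in>\<Gamma>. actA D g f) = (\<Sum>g\<in>\<Gamma>. actA D (gmult h g) f)"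
   unfolding actA_sum[OF h] by (intro sum.cong refl) (simp add: act_mult h)
  thus ?thesis using sum_translate[OF h, of "\<lambda>g. actA D g f"] by simp
 qed
 thus ?thesis by (auto simp: R_def avgA_def actA_hom)
qed

lemma avgA_id: "f \<in> R ==> avgA f = f"
 using card_\<Gamma> by (simp add: avgA_def R_def A.sum_constant_scale)

lemma avgA_add: "avgA (f + h) = avgA f + avgA h"
 by (simp add: avgA_def actA_hom sum.distrib A.scale_right_distrib)

lemma avgA_mult: "r \<in> R ==> avgA (r * f) = r * avgA f"
 by (simp add: avgA_def actA_hom R_def scaleA_mult sum_distrib_left)

text \<open>The Reynolds operator maps the ideal into the kernel of \<open>\<chi>\<close> and fixes the unit.\<close>

lemma unit_notin_ext_ideal:
 assumes "charR \<chi>" shows "unitA D \<notin> ext_ideal \<chi>"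
proof
 have z: "\<chi> (avgA t) = 0" if "t \<in> ext_ideal \<chi>" for t
  using that
 proof (induction t rule: ext_ideal_induct)
  case zero
  thus ?case using avgA_id[OF R_closed(5)] charRD(5)[OF assms] by simp
 next
  case (add r a s)
  thus ?case by (simp add: avgA_add avgA_mult charRD[OF assms] avgA_R R_closed)
 qed
 assume "unitA D \<in> ext_ideal \<chi>"
 hence "\<chi> (unitA D) = 0" using z avgA_id[OF R_closed(4)] by metis
 thus False using charRD(4)[OF assms] by simp
qed

subsection \<open>The characteristic polynomial of an orbit\<close>

text \<open>The product of \<open>T - a\<close> and \<open>p\<close>.  The polynomial \<open>T - a\<close> itself is avoided because the unit of \<open>A\<close> is not the one of a type class.\<close>

definition lin_step :: "'a => 'a poly => 'a poly" where
 "lin_step a p = pCons 0 p - smult a p"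

lemma lin_step_coeff: "coeff (lin_step a p) i = (if i = 0 then 0 else coeff p (i - 1)) - a * coeff p i"
 by (cases i) (simp_all add: lin_step_def)

lemma lin_step_commute: "lin_step a (lin_step b p) = lin_step b (lin_step a p)"
proof (rule poly_eqI)
 fix i
 show "coeff (lin_step a (lin_step b p)) i = coeff (lin_step b (lin_step a p)) i"
 proof (cases i)
  case (Suc j)
  thus ?thesis by (cases j) (simp_all add: lin_step_coeff algebra_simps)
 qed (simp add: lin_step_coeff algebra_simps)
qed

lemma lin_step_poly: "poly (lin_step a p) f = f * poly p f - a * poly p f"
 by (simp add: lin_step_def)

text \<open>The product of the polynomials \<open>T - a g\<close> for \<open>g\<close> in \<open>S\<close>.\<close>

definition orbit_poly :: "('c => 'a) => 'c set => 'a poly" where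
 "orbit_poly a S = Finite_Set.fold (\<lambda>g. lin_step (a g)) [:unitA D:] S"

lemma orbit_poly_insert: "finite S ==> g \<notin> S ==> orbit_poly a (insert g S) = lin_step (a g) (orbit_poly a S)"
 and orbit_poly_rec: "finite S ==> g \<in> S ==> orbit_poly a S = lin_step (a g) (orbit_poly a (S - {g}))"
proof -
 interpret comp_fun_commute "\<lambda>g. lin_step (a g)"
  by unfold_locales (auto simp: fun_eq_iff lin_step_commute)
 show "finite S ==> g \<notin> S ==> orbit_poly a (insert g S) = lin_step (a g) (orbit_poly a S)"
  unfolding orbit_poly_def by (rule fold_insert)
 show "finite S ==> g \<in> S ==> orbit_poly a S = lin_step (a g) (orbit_poly a (S - {g}))"
  unfolding orbit_poly_def by (rule fold_rec)
qed

lemma orbit_poly_empty: "orbit_poly a {} = [:unitA D:]" by (simp add: orbit_poly_def)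

lemma orbit_poly_monic:
 assumes "finite S"
 shows "coeff (orbit_poly a S) (card S) = unitA D & (\<forall>i>card S. coeff (orbit_poly a S) i = 0)"
 using assms
proof (induction S rule: finite_induct)
 case (insert g S)
 thus ?case by (simp add: orbit_poly_insert lin_step_coeff)
next
 case empty
 have "coeff [:unitA D:] i = 0" if "i > 0" for i using that by (cases i) auto
 thus ?case by (simp add: orbit_poly_empty)
qed

lemma orbit_poly_act:
 assumes "h \<in> \<Gamma>" "finite S"
 shows "actA D h (coeff (orbit_poly a S) i) = coeff (orbit_poly (\<lambda>g. actA D h (a g)) S) i"
 using assms(2)
proof (induction S arbitrary: i rule: finite_induct)
 case empty
 thus ?case using assms(1) by (cases i) (simp_all add: orbit_poly_empty actA_hom actA_zero)
next
 case (insert g S)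
 have "actA D h (f - f') = actA D h f - actA D h f'" for f f'
  using actA_hom(1)[OF assms(1), of f "- f'"] actA_uminus[OF assms(1)] by simp
 thus ?case using insert assms(1) by (simp add: orbit_poly_insert lin_step_coeff actA_hom actA_zero)
qed

text \<open>The group permutes the linear factors.\<close>

lemma orbit_poly_R: "coeff (orbit_poly (\<lambda>g. actA D g f) \<Gamma>) i \<in> R"
 unfolding R_def
proof (clarify)
 fix h assume h: "h \<in> \<Gamma>"
 have bij: "gmult h ` \<Gamma> = \<Gamma>" by (rule \<Gamma>.surj_const_mult[OF h])
 have inj: "inj_on (gmult h) \<Gamma>" using h by (intro inj_onI) auto
 have "orbit_poly (\<lambda>g. actA D h (actA D g f)) \<Gamma> = Finite_Set.fold ((\<lambda>g. lin_step (actA D g f)) \<circ> gmult h) [:unitA D:] \<Gamma>"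
  unfolding orbit_poly_def
 proof (rule Finite_Set.fold_cong[of UNIV])
  show "Finite_Set.comp_fun_commute_on UNIV (\<lambda>g. lin_step (actA D h (actA D g f)))"
   by unfold_locales (auto simp: fun_eq_iff lin_step_commute)
  show "Finite_Set.comp_fun_commute_on UNIV ((\<lambda>g. lin_step (actA D g f)) \<circ> gmult h)"
   by unfold_locales (auto simp: fun_eq_iff lin_step_commute)
 qed (auto simp: grp_finite act_mult h)
 also have "... = orbit_poly (\<lambda>g. actA D g f) \<Gamma>"
  unfolding orbit_poly_def using fold_image[OF inj, of "\<lambda>g. lin_step (actA D g f)" "[:unitA D:]"] bij by simp
 finally show "actA D h (coeff (orbit_poly (\<lambda>g. actA D g f) \<Gamma>) i) = coeff (orbit_poly (\<lambda>g. actA D g f) \<Gamma>) i"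
  using orbit_poly_act[OF h grp_finite] by simp
qed

lemma orbit_poly_root: "poly (orbit_poly (\<lambda>g. actA D g f) \<Gamma>) f = 0"
 unfolding orbit_poly_rec[OF grp_finite \<Gamma>.one_closed] lin_step_poly by (simp add: act_one)

lemma orbit_poly_vanish:
 assumes x: "x \<in> X" and "finite S" "!!g. g \<in> S ==> x (a g) = 0" "i ~= card S"
 shows "x (coeff (orbit_poly a S) i) = 0"
 using assms(2-)
proof (induction S arbitrary: i rule: finite_induct)
 case empty
 thus ?case using pointD(5)[OF x] by (cases i) (simp_all add: orbit_poly_empty)
next
 case (insert g S)
 thus ?case by (simp add: orbit_poly_insert lin_step_coeff pointD[OF x])
qed

lemma poly_in_ideal:
 assumes I: "idealA I" and "!!i. coeff p i \<in> I"
 shows "poly p f \<in> I"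
 using assms(2)
proof (induction p)
 case 0
 thus ?case using idealAD(1)[OF I] by simp
next
 case (pCons a p)
 have "a \<in> I" using pCons.prems[of 0] by simp
 moreover have "coeff p i \<in> I" for i using pCons.prems[of "Suc i"] by simp
 ultimately show ?case using pCons.IH idealAD[OF I] by simp
qed

definition powA :: "'a => nat => 'a" where "powA f n = (((*) f) ^^ n) (unitA D)"

lemma powA_simps [simp]: "powA f 0 = unitA D" "powA f (Suc n) = f * powA f n"
 by (simp_all add: powA_def)

text \<open>The orbit polynomial of \<open>f\<close> is monic, has \<open>f\<close> as a root, and its other coefficients are invariants that vanish at \<open>x\<close>.\<close>

lemma orbit_vanishing_nilpotent:
 assumes x: "x \<in> X" and f: "!!g. g \<in> \<Gamma> ==> x (actA D g f) = 0"
 shows "\<exists>n. powA f n \<in> ext_ideal x"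
proof -
 define q where "q = orbit_poly (\<lambda>g. actA D g f) \<Gamma>"
 define n where "n = card \<Gamma>"
 \<comment> \<open>the monomial \<open>T\<^sup>k\<close>, with the unit of \<open>A\<close> as its coefficient\<close>
 define m where "m k = ((pCons 0) ^^ k) [:unitA D:]" for k
 have pm: "poly (m k) f = powA f k" for k by (induction k) (simp_all add: m_def)
 have cm: "coeff (m k) i = (if i = k then unitA D else 0)" for k i
 proof (induction k arbitrary: i)
  case 0
  thus ?case by (cases i) (simp_all add: m_def)
 next
  case (Suc k)
  thus ?case by (cases i) (simp_all add: m_def)
 qed
 note I = ext_ideal_ideal[of x]
 have "coeff (q - m n) i \<in> ext_ideal x" for i
 proof (cases "i = n")
  case True
  thus ?thesis using orbit_poly_monic[OF grp_finite] by (simp add: cm q_def n_def ext_ideal_zero)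
 next
  case False
  hence "x (coeff q i) = 0" unfolding q_def n_def by (intro orbit_poly_vanish[OF x grp_finite f]) auto
  thus ?thesis using False orbit_poly_R[of f i] by (simp add: cm q_def ext_ideal_R)
 qed
 hence "poly (q - m n) f \<in> ext_ideal x" by (rule poly_in_ideal[OF I])
 hence "- powA f n \<in> ext_ideal x" using orbit_poly_root[of f] by (simp add: pm q_def)
 thus ?thesis using idealAD(5)[OF I, of "- powA f n"] by auto
qed

definition adjoin :: "'a set => 'a => 'a set" where
 "adjoin I f = {a + h * f | a h. a \<in> I}"

lemma adjoin_ideal:
 assumes I: "idealA I"
 shows "idealA (adjoin I f)" "I \<subseteq> adjoin I f" "f \<in> adjoin I f"
proof -
 note ID = idealAD[OF I]
 show sub: "I \<subseteq> adjoin I f"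
 proof
  fix a assume "a \<in> I"
  thus "a \<in> adjoin I f" unfolding adjoin_def by (intro CollectI exI[of _ a] exI[of _ 0]) simp
 qed
 have "0 + unitA D * f \<in> adjoin I f" unfolding adjoin_def using ID(1) by blast
 thus "f \<in> adjoin I f" by simp
 show "idealA (adjoin I f)"
  unfolding idealA_def
 proof (intro conjI ballI allI)
  show "0 \<in> adjoin I f" using sub ID(1) by blast
  fix p assume "p \<in> adjoin I f"
  then obtain a h where p: "a \<in> I" "p = a + h * f" by (auto simp: adjoin_def)
  show "r * p \<in> adjoin I f" for r
  proof -
   have "r * p = r * a + (r * h) * f" by (simp add: p algebra_simps)
   thus ?thesis using ID(3)[OF p(1)] unfolding adjoin_def by blast
  qed
  fix q assume "q \<in> adjoin I f"
  then obtain b k where q: "b \<in> I" "q = b + k * f" by (auto simp: adjoin_def)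
  have "p + q = (a + b) + (h + k) * f" by (simp add: p q algebra_simps)
  thus "p + q \<in> adjoin I f" using ID(2)[OF p(1) q(1)] unfolding adjoin_def by blast
 qed
qed

text \<open>By Zorn's lemma: an ideal that is maximal among those without the unit is prime.\<close>

lemma exists_prime_over:
 assumes \<chi>: "charR \<chi>"
 obtains m where "idealA m" "ext_ideal \<chi> \<subseteq> m" "unitA D \<notin> m" "\<forall>f h. f * h \<in> m \<longrightarrow> f \<in> m \<or> h \<in> m"
proof -
 define \<A> where "\<A> = {I. idealA I & ext_ideal \<chi> \<subseteq> I & unitA D \<notin> I}"
 have "\<exists>m\<in>\<A>. \<forall>X\<in>\<A>. m \<subseteq> X \<longrightarrow> X = m"
 proof (rule subset_Zorn_nonempty)
  show "\<A> ~= {}" using ext_ideal_ideal unit_notin_ext_ideal[OF \<chi>] by (auto simp: \<A>_def)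
  fix C assume C: "C ~= {}" "subset.chain \<A> C"
  have CA: "C \<subseteq> \<A>" and tot: "!!I J. I \<in> C ==> J \<in> C ==> I \<subseteq> J \<or> J \<subseteq> I" using C(2) by (auto simp: subset_chain_def)
  have CI: "!!I. I \<in> C ==> idealA I" using CA by (auto simp: \<A>_def)
  have "idealA (\<Union>C)"
   unfolding idealA_def
  proof (intro conjI ballI allI)
   show "0 \<in> \<Union>C" using C(1) CI idealAD(1) by blast
   show "h * f \<in> \<Union>C" if "f \<in> \<Union>C" for f h using that CI idealAD(3) by blast
   show "f + h \<in> \<Union>C" if "f \<in> \<Union>C" "h \<in> \<Union>C" for f h
   proof -
    obtain I J where IJ: "I \<in> C" "J \<in> C" "f \<in> I" "h \<in> J" using \<open>f \<in> \<Union>C\<close> \<open>h \<in> \<Union>C\<close> by blast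
    consider "I \<subseteq> J" | "J \<subseteq> I" using tot[OF IJ(1,2)] by blast
    thus ?thesis using IJ CI idealAD(2) by cases blast+
   qed
  qed
  moreover have "ext_ideal \<chi> \<subseteq> \<Union>C" using C(1) CA by (auto simp: \<A>_def)
  moreover have "unitA D \<notin> \<Union>C" using CA by (auto simp: \<A>_def)
  ultimately show "\<Union>C \<in> \<A>" by (simp add: \<A>_def)
 qed
 then obtain m where m: "idealA m" "ext_ideal \<chi> \<subseteq> m" "unitA D \<notin> m"
  and max: "!!J. J \<in> \<A> ==> m \<subseteq> J ==> J = m" by (auto simp: \<A>_def)
 note D = idealAD[OF m(1)]
 have "f \<in> m \<or> h \<in> m" if fh: "f * h \<in> m" for f h
 proof (rule ccontr)
  assume n: "\<not> (f \<in> m \<or> h \<in> m)"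
  note J = adjoin_ideal[OF m(1), of f]
  have "unitA D \<in> adjoin m f" using max[of "adjoin m f"] J m n by (auto simp: \<A>_def)
  then obtain a b where ab: "unitA D = a + b * f" "a \<in> m" by (auto simp: adjoin_def)
  have "h = unitA D * h" by simp
  also have "... = a * h + b * (f * h)" unfolding ab by (simp add: algebra_simps)
  finally have "h \<in> m" using D(2)[OF D(4)[OF ab(2)] D(3)[OF fh]] by metis
  thus False using n by simp
 qed
 thus ?thesis using that m by blast
qed

text \<open>A polynomial over \<open>k\<close>, regarded as a polynomial over \<open>A\<close>.\<close>

definition lift_poly :: "'k poly => 'a poly" where "lift_poly p = map_poly (\<lambda>c. scaleA D c (unitA D)) p"

lemma lift_poly_coeff: "coeff (lift_poly p) i = scaleA D (coeff p i) (unitA D)"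
 by (simp add: lift_poly_def coeff_map_poly)

lemma lift_poly_linear_factor: "lift_poly ([:- c, 1:] * q) = lin_step (scaleA D c (unitA D)) (lift_poly q)"
proof (rule poly_eqI)
 fix i
 show "coeff (lift_poly ([:- c, 1:] * q)) i = coeff (lin_step (scaleA D c (unitA D)) (lift_poly q)) i"
  by (cases i) (simp_all add: lift_poly_coeff lin_step_coeff scaleA_mult A.scale_left_diff_distrib)
qed

text \<open>The polynomial \<open>p\<close> splits into linear factors over \<open>k\<close>, and \<open>m\<close> is prime.\<close>

lemma prime_contains_linear:
 assumes m: "idealA m" "unitA D \<notin> m" "!!f h. f * h \<in> m ==> f \<in> m \<or> h \<in> m"
  and "p ~= 0" "poly (lift_poly p) f \<in> m"
 shows "\<exists>c. f - scaleA D c (unitA D) \<in> m"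
 using assms(4,5)
proof (induction "degree p" arbitrary: p rule: less_induct)
 case less
 show ?case
 proof (cases "degree p = 0")
  case True
  then obtain a where p: "p = [:a:]" by (metis degree_eq_zeroE)
  have "lift_poly p = [:scaleA D a (unitA D):]"
   unfolding p by (rule poly_eqI, rename_tac i, case_tac i) (simp_all add: lift_poly_coeff)
  hence "scaleA D a (unitA D) \<in> m" using less.prems(2) by simp
  hence "scaleA D (1 / a) (scaleA D a (unitA D)) \<in> m" by (rule idealAD(7)[OF m(1)])
  thus ?thesis using less.prems(1) m(2) by (simp add: p)
 next
  case False
  then obtain c where "poly p c = 0" using alg_closed_imp_poly_has_root[of p] by auto
  then obtain q where q: "p = [:- c, 1:] * q" unfolding poly_eq_0_iff_dvd by (elim dvdE)
  have "poly (lift_poly p) f = (f - scaleA D c (unitA D)) * poly (lift_poly q) f"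
   unfolding q lift_poly_linear_factor lin_step_poly by (simp add: left_diff_distrib)
  hence "f - scaleA D c (unitA D) \<in> m \<or> poly (lift_poly q) f \<in> m" using less.prems(2) m(3) by simp
  moreover have "q ~= 0" using less.prems(1) q by auto
  moreover have "degree q < degree p" using \<open>q ~= 0\<close> unfolding q by (subst degree_mult_eq) auto
  ultimately show ?thesis using less.hyps by blast
 qed
qed

text \<open>Let \<open>m\<close> be a prime ideal over the kernel of \<open>\<chi>\<close>.  Modulo \<open>m\<close> the invariants are scalars, so a function \<open>f\<close> is a root of its orbit
  polynomial with coefficients in \<open>k\<close>, and thus congruent to a scalar; this scalar is \<open>x f\<close>.\<close>

lemma lying_over:
 assumes \<chi>: "charR \<chi>"
 obtains x where "x \<in> X" "!!r. r \<in> R ==> x r = \<chi> r"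
proof -
 obtain m where m: "idealA m" "ext_ideal \<chi> \<subseteq> m" "unitA D \<notin> m" "\<forall>f h. f * h \<in> m \<longrightarrow> f \<in> m \<or> h \<in> m"
  by (rule exists_prime_over[OF \<chi>])
 note D = idealAD[OF m(1)]
 let ?u = "unitA D"
 have ex: "\<exists>c. f - scaleA D c ?u \<in> m" for f
 proof -
  define q where "q = orbit_poly (\<lambda>g. actA D g f) \<Gamma>"
  define p where "p = map_poly \<chi> q"
  have cp: "coeff p i = \<chi> (coeff q i)" for i by (simp add: p_def coeff_map_poly charRD[OF \<chi>])
  have "coeff p (card \<Gamma>) = 1" using orbit_poly_monic[OF grp_finite] by (simp add: cp q_def charRD[OF \<chi>])
  hence p0: "p ~= 0" by auto
  have "coeff (lift_poly p - q) i \<in> ext_ideal \<chi>" for i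
  proof (rule ext_ideal_R)
   have r: "coeff q i \<in> R" unfolding q_def by (rule orbit_poly_R)
   show "coeff (lift_poly p - q) i \<in> R" using r by (simp add: lift_poly_coeff R_closed)
   show "\<chi> (coeff (lift_poly p - q) i) = 0" using r by (simp add: lift_poly_coeff cp charRD[OF \<chi>] R_closed)
  qed
  hence "poly (lift_poly p - q) f \<in> ext_ideal \<chi>" by (rule poly_in_ideal[OF ext_ideal_ideal])
  hence "poly (lift_poly p) f \<in> m" using m(2) orbit_poly_root[of f] by (auto simp: q_def)
  thus ?thesis using prime_contains_linear[OF m(1,3) m(4)[rule_format] p0] by blast
 qed
 define x where "x f = (SOME c. f - scaleA D c ?u \<in> m)" for f
 have x: "f - scaleA D (x f) ?u \<in> m" for f unfolding x_def by (rule someI_ex[OF ex])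
 have uniq: "x f = c" if "f - scaleA D c ?u \<in> m" for f c
 proof (rule ccontr)
  assume ne: "x f ~= c"
  have "(f - scaleA D c ?u) - (f - scaleA D (x f) ?u) \<in> m" by (rule D(6)[OF that x])
  hence "scaleA D (x f - c) ?u \<in> m" by (simp add: A.scale_left_diff_distrib)
  hence "scaleA D (1 / (x f - c)) (scaleA D (x f - c) ?u) \<in> m" by (rule D(7))
  thus False using ne m(3) by simp
 qed
 have "x \<in> X"
 proof (rule pointI)
  show "x (f + h) = x f + x h" for f h
   by (rule uniq) (use D(2)[OF x[of f] x[of h]] in "simp add: algebra_simps A.scale_left_distrib")
  show "x (scaleA D c f) = c * x f" for c f
   by (rule uniq) (use D(7)[OF x[of f], of c] in "simp add: A.scale_right_diff_distrib")
  show "x (f * h) = x f * x h" for f h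
  proof (rule uniq)
   have "f * h - scaleA D (x f * x h) ?u = (f - scaleA D (x f) ?u) * h + scaleA D (x f) (h - scaleA D (x h) ?u)"
    by (simp add: left_diff_distrib scaleA_mult A.scale_right_diff_distrib)
   thus "f * h - scaleA D (x f * x h) ?u \<in> m" using D(2)[OF D(4)[OF x] D(7)[OF x]] by simp
  qed
  show "x ?u = 1" by (rule uniq) (simp add: D(1))
 qed
 moreover have "x r = \<chi> r" if r: "r \<in> R" for r
 proof (rule uniq)
  have "r - scaleA D (\<chi> r) ?u \<in> ext_ideal \<chi>" by (rule ext_ideal_R) (simp_all add: R_closed r charRD[OF \<chi>])
  thus "r - scaleA D (\<chi> r) ?u \<in> m" using m(2) by blast
 qed
 ultimately show ?thesis using that by blast
qed

end

section \<open>Minimal ideals modulo the kernel of a traceless representation\<close>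

lemma linear_is_matrix:
 fixes F :: "'k::field vec => 'k vec"
 assumes c: "!!v. v \<in> Vec e ==> F v \<in> Vec N"
  and add: "!!u v. u \<in> Vec e ==> v \<in> Vec e ==> F (u + v) = F u + F v"
  and sc: "!!c v. v \<in> Vec e ==> F (c \<cdot>\<^sub>v v) = c \<cdot>\<^sub>v F v"
 obtains C where "C \<in> Mat N e" "!!v. v \<in> Vec e ==> F v = C *\<^sub>v v"
proof -
 define C where "C = mat N e (\<lambda>(i,j). F (unit_vec e j) $ i)"
 have C: "C \<in> Mat N e" by (simp add: C_def)
 have F0: "F (0\<^sub>v e) = 0\<^sub>v N"
 proof -
  have "F (0 \<cdot>\<^sub>v 0\<^sub>v e) = 0 \<cdot>\<^sub>v F (0\<^sub>v e)" by (rule sc) simp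
  hence "F (0\<^sub>v e) = 0 \<cdot>\<^sub>v F (0\<^sub>v e)" by simp
  also have "... = 0\<^sub>v N" using c[of "0\<^sub>v e"] by (intro eq_vecI) auto
  finally show ?thesis .
 qed
 have "{v \<in> Vec e. F v = C *\<^sub>v v} = Vec e"
 proof (rule vsub_units)
  show "vsub e {v \<in> Vec e. F v = C *\<^sub>v v}"
   unfolding vsub_def using C F0 by (auto simp: add sc mult_add_distrib_mat_vec smult_mult_mat_vec_right)
  show "unit_vec e j \<in> {v \<in> Vec e. F v = C *\<^sub>v v}" if j: "j < e" for j
  proof -
   have "F (unit_vec e j) = C *\<^sub>v unit_vec e j"
   proof (rule eq_vecI)
    fix i assume "i < dim_vec (C *\<^sub>v unit_vec e j)"
    thus "F (unit_vec e j) $ i = (C *\<^sub>v unit_vec e j) $ i" using j by (simp add: C_def)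
   qed (use c[of "unit_vec e j"] C in auto)
   thus ?thesis by simp
  qed
 qed
 thus ?thesis using that[OF C] by blast
qed

definition vdim :: "nat => 'k::field vec set => nat" where
 "vdim n W = (SOME e. \<exists>B\<in>Mat n e. mat_inj B & mat_im B = W)"

lemma vdim_psubset:
 assumes "vsub n W" "vsub n W'" "W \<subset> W'" shows "vdim n W < vdim n W'"
proof -
 have ex: "\<exists>B\<in>Mat n (vdim n W). mat_inj B & mat_im B = W" if "vsub n W" for W :: "'a vec set"
  unfolding vdim_def by (rule someI_ex) (use vsub_basis[OF that] in metis)
 obtain B B' where B: "B \<in> Mat n (vdim n W)" "mat_inj B" "mat_im B = W"
  "B' \<in> Mat n (vdim n W')" "mat_inj B'" "mat_im B' = W'" using ex[OF assms(1)] ex[OF assms(2)] by blast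
 thus ?thesis
  using mat_im_inj_eq_dim[OF B(1,2,4,5)] assms(3) by (auto simp: order_less_le)
qed

context equivariant_map_algebra
begin

definition separated :: "('a => 'k) list => bool" where
 "separated xs \<longleftrightarrow> distinct xs & set xs \<subseteq> X & (\<forall>x\<in>set xs. \<forall>y\<in>set xs. y ~= x \<longrightarrow> y \<notin> orb x)"

definition ker_eval :: "('a => 'k) list => ('k, 'g, 'a) tens set" where
 "ker_eval xs = {\<xi> \<in> M. \<forall>x\<in>set xs. val x \<xi> = 0}"

lemma brg_zero: "brg D u 0 = 0" "brg D 0 u = 0"
 using brg_simps(1)[of 0 0 u] brg_simps(2)[of u 0 0] by simp_all

lemma ker_eval_ideal: "set xs \<subseteq> X ==> lie_ideal MM (ker_eval xs)"
proof -
 assume s: "set xs \<subseteq> X"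
 have sX: "x \<in> X" if "x \<in> set xs" for x using s that by auto
 show ?thesis
  unfolding lie_ideal_def MM_simps ker_eval_def
  using sX by (auto simp: M_closed M_TT val_simps val_tb brg_zero)
qed

end

locale traceless_irreducible = equivariant_map_algebra D
 for D :: "('c, 'k::{alg_closed_field, field_char_0}, 'a::comm_ring, 'g::ab_group_add) equivariant_data" +
 fixes n :: nat and \<rho> :: "('k, 'g, 'a) tens => 'k mat"
 assumes irrep: "irrep MM (n, \<rho>)"
  and trace0: "!!\<xi>. \<xi> \<in> M ==> mtrace (\<rho> \<xi>) = 0"
begin

lemma rep: "is_rep MM (n, \<rho>)" and irr: "irr_fam n M \<rho>"
 using irrep by (auto simp: irreducible_rep_iff)

lemmas repD = is_repD[OF rep, unfolded MM_simps]
lemmas rep_diff = is_rep_diff[OF MM_closed rep]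
lemmas rep_zero = is_rep_zero[OF MM_closed rep]

definition K :: "('k, 'g, 'a) tens set" where "K = {\<xi> \<in> M. \<rho> \<xi> = 0\<^sub>m n n}"

lemma K_M: "\<xi> \<in> K ==> \<xi> \<in> M" by (simp add: K_def)

lemma rep_tb_zero:
 assumes "\<xi> \<in> M" "\<beta> \<in> M" "\<rho> \<xi> = 0\<^sub>m n n \<or> \<rho> \<beta> = 0\<^sub>m n n"
 shows "\<rho> (tb \<xi> \<beta>) = 0\<^sub>m n n"
 using left_mult_zero_mat[OF repD(1)[OF assms(1)]] right_mult_zero_mat[OF repD(1)[OF assms(1)]]
  left_mult_zero_mat[OF repD(1)[OF assms(2)]] right_mult_zero_mat[OF repD(1)[OF assms(2)]]
  assms(3) repD(4)[OF assms(1,2)] by auto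

lemma K_ideal: "lie_ideal MM K"
 unfolding lie_ideal_def MM_simps K_def
 by (auto simp: M_closed repD(2,3) rep_zero rep_tb_zero)

lemma no_abelian:
 assumes "E \<subseteq> M" "!!e x. e \<in> E ==> x \<in> M ==> tb e x \<in> E"
  and "!!e e'. e \<in> E ==> e' \<in> E ==> \<rho> (tb e e') = 0\<^sub>m n n"
 shows "E \<subseteq> K"
 using irr_no_abelian_ideal[OF rep irr trace0, of E] assms unfolding K_def by auto

text \<open>Brackets in the ideal of all \<open>\<xi>\<close> with \<open>\<rho> [\<xi>, M] = 0\<close> lie in \<open>K\<close>, so the ideal itself does.  It contains \<open>f \<kappa>\<close> because
  \<open>[f \<kappa>, \<beta>] = [\<kappa>, f \<beta>]\<close>.\<close>

lemma K_amul:
 assumes f: "f \<in> R" and \<kappa>: "\<kappa> \<in> K" shows "amul f \<kappa> \<in> K"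
proof -
 define E where "E = {\<xi> \<in> M. \<forall>\<beta>\<in>M. \<rho> (tb \<xi> \<beta>) = 0\<^sub>m n n}"
 have "E \<subseteq> K"
  by (rule no_abelian) (auto simp: E_def M_closed rep_tb_zero)
 moreover have "amul f \<kappa> \<in> E"
 proof -
  have "\<rho> (tb (amul f \<kappa>) \<beta>) = 0\<^sub>m n n" if \<beta>: "\<beta> \<in> M" for \<beta>
  proof -
   have "tb (amul f \<kappa>) \<beta> = tb \<kappa> (amul f \<beta>)"
    using tb_amul_left tb_amul_right M_TT K_M[OF \<kappa>] \<beta> by metis
   thus ?thesis using rep_tb_zero[OF K_M[OF \<kappa>] amul_M[OF f \<beta>]] \<kappa> by (simp add: K_def)
  qed
  thus ?thesis using amul_M[OF f K_M[OF \<kappa>]] by (simp add: E_def)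
 qed
 ultimately show ?thesis by blast
qed

text \<open>The matrix \<open>\<rho> \<xi>\<close> as a vector.  Its image is a copy of \<open>M / K\<close> inside a coordinate space, where dimensions are available.\<close>

definition \<phi> :: "('k, 'g, 'a) tens => 'k vec" where
 "\<phi> \<xi> = vec (n * n) (\<lambda>i. \<rho> \<xi> $$ (i div n, i mod n))"

lemma \<phi>_carrier [simp]: "\<phi> \<xi> \<in> Vec (n * n)" by (simp add: \<phi>_def)

lemma \<phi>_add: "\<xi> \<in> M ==> \<beta> \<in> M ==> \<phi> (\<xi> + \<beta>) = \<phi> \<xi> + \<phi> \<beta>"
 using repD(1)[of \<xi>] repD(1)[of \<beta>] by (intro eq_vecI) (auto simp: \<phi>_def repD(2) div_mod_bounds)

lemma \<phi>_scale: "\<xi> \<in> M ==> \<phi> (tens_scale c \<xi>) = c \<cdot>\<^sub>v \<phi> \<xi>"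
 using repD(1)[of \<xi>] by (intro eq_vecI) (auto simp: \<phi>_def repD(3) div_mod_bounds)

lemma \<phi>_eq_iff:
 assumes "\<xi> \<in> M" "\<beta> \<in> M" shows "\<phi> \<xi> = \<phi> \<beta> \<longleftrightarrow> \<xi> - \<beta> \<in> K"
proof -
 have "\<phi> \<xi> = \<phi> \<beta> \<longleftrightarrow> \<rho> \<xi> = \<rho> \<beta>"
 proof
  assume e: "\<phi> \<xi> = \<phi> \<beta>"
  show "\<rho> \<xi> = \<rho> \<beta>"
  proof (rule eq_matI)
   fix i j assume "i < dim_row (\<rho> \<beta>)" "j < dim_col (\<rho> \<beta>)"
   hence ij: "i < n" "j < n" using repD(1)[OF assms(2)] by auto
   have "i * n + j < n * n" "(i * n + j) div n = i" "(i * n + j) mod n = j" using ij by (auto intro: pair_index_less)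
   thus "\<rho> \<xi> $$ (i,j) = \<rho> \<beta> $$ (i,j)" using arg_cong[OF e, of "\<lambda>v. v $ (i * n + j)"] by (simp add: \<phi>_def)
  qed (use repD(1)[OF assms(1)] repD(1)[OF assms(2)] in auto)
 qed (simp add: \<phi>_def)
 also have "... \<longleftrightarrow> \<xi> - \<beta> \<in> K"
 proof
  assume "\<rho> \<xi> = \<rho> \<beta>"
  thus "\<xi> - \<beta> \<in> K" using rep_diff[OF assms] repD(1)[OF assms(2)] M_diff[OF assms] by (auto simp: K_def)
 next
  assume "\<xi> - \<beta> \<in> K"
  hence "\<rho> \<xi> - \<rho> \<beta> = 0\<^sub>m n n" using rep_diff[OF assms] by (simp add: K_def)
  thus "\<rho> \<xi> = \<rho> \<beta>" by (rule mat_eq_of_diff_zero[OF repD(1)[OF assms(1)] repD(1)[OF assms(2)]])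
 qed
 finally show ?thesis .
qed

text \<open>The ideals of \<open>M / K\<close>, as ideals of \<open>M\<close>.\<close>

definition mod_ideal :: "('k, 'g, 'a) tens set => bool" where
 "mod_ideal E \<longleftrightarrow> lie_ideal MM E & K \<subseteq> E"

lemmas mod_idealD = lie_idealD[of MM, unfolded MM_simps]

lemma vsub_\<phi>:
 assumes "lie_ideal MM E" shows "vsub (n * n) (\<phi> ` E)"
 unfolding vsub_def
proof (intro conjI ballI allI)
 note D = mod_idealD[OF assms]
 show "\<phi> ` E \<subseteq> Vec (n * n)" by auto
 have "\<phi> 0 = 0\<^sub>v (n * n)" by (intro eq_vecI) (auto simp: \<phi>_def rep_zero div_mod_bounds)
 thus "0\<^sub>v (n * n) \<in> \<phi> ` E" using D(2) by (metis imageI)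
 show "u + v \<in> \<phi> ` E" if uv: "u \<in> \<phi> ` E" "v \<in> \<phi> ` E" for u v
 proof -
  obtain a b where "u = \<phi> a" "v = \<phi> b" "a \<in> E" "b \<in> E" using uv by blast
  hence "u + v = \<phi> (a + b)" "a + b \<in> E" using \<phi>_add D(1,3) by auto
  thus ?thesis by blast
 qed
 show "c \<cdot>\<^sub>v v \<in> \<phi> ` E" if v: "v \<in> \<phi> ` E" for c v
 proof -
  obtain b where "v = \<phi> b" "b \<in> E" using v by blast
  hence "c \<cdot>\<^sub>v v = \<phi> (tens_scale c b)" "tens_scale c b \<in> E" using \<phi>_scale D(1,4) by auto
  thus ?thesis by blast
 qed
qed

lemma \<phi>_image_psubset:
 assumes E: "mod_ideal E" "mod_ideal E'" "E \<subset> E'"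
 shows "\<phi> ` E \<subset> \<phi> ` E'"
proof -
 obtain a where a: "a \<in> E'" "a \<notin> E" using E by auto
 have i: "lie_ideal MM E" "lie_ideal MM E'" using E by (auto simp: mod_ideal_def)
 have "\<phi> a \<notin> \<phi> ` E"
 proof
  assume "\<phi> a \<in> \<phi> ` E"
  then obtain b where b: "b \<in> E" "\<phi> a = \<phi> b" by auto
  hence "a - b \<in> K" using \<phi>_eq_iff mod_idealD(1)[OF i(1)] mod_idealD(1)[OF i(2)] a by metis
  hence "a - b + b \<in> E" using E(1) mod_idealD(3)[OF i(1) _ b(1)] unfolding mod_ideal_def by blast
  thus False using a by simp
 qed
 thus ?thesis using a E(3) by blast
qed

lemma mod_ideal_measure:
 assumes "mod_ideal E" "mod_ideal E'" "E \<subset> E'"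
 shows "vdim (n * n) (\<phi> ` E) < vdim (n * n) (\<phi> ` E')"
 by (rule vdim_psubset[OF vsub_\<phi> vsub_\<phi> \<phi>_image_psubset]) (use assms in "auto simp: mod_ideal_def")

lemma minimal_ideal_exists:
 assumes N: "mod_ideal N" "N ~= K"
 obtains E where "mod_ideal E" "E ~= K" "E \<subseteq> N" "!!E'. mod_ideal E' ==> E' \<subseteq> E ==> E' = K \<or> E' = E"
proof -
 define P where "P E \<longleftrightarrow> mod_ideal E & E ~= K & E \<subseteq> N" for E
 define E where "E = arg_min (\<lambda>E. vdim (n * n) (\<phi> ` E)) P"
 have "P N" using N by (simp add: P_def)
 hence PE: "P E" unfolding E_def by (rule arg_min_natI)
 have min: "vdim (n * n) (\<phi> ` E) \<le> vdim (n * n) (\<phi> ` E')" if "P E'" for E'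
  unfolding E_def using that by (rule arg_min_nat_le)
 show ?thesis
 proof (rule that[of E])
  show "E' = K \<or> E' = E" if "mod_ideal E'" "E' \<subseteq> E" for E'
  proof (rule ccontr)
   assume "\<not> (E' = K \<or> E' = E)"
   hence "P E'" "E' \<subset> E" using that PE unfolding P_def by blast+
   thus False using min[of E'] mod_ideal_measure[of E' E] that PE unfolding P_def by simp
  qed
 qed (use PE in "auto simp: P_def")
qed

end

text \<open>In the following context \<open>E / K\<close> is a minimal nonzero ideal of \<open>M / K\<close>.\<close>

locale minimal_ideal = traceless_irreducible D n \<rho>
 for D :: "('c, 'k::{alg_closed_field, field_char_0}, 'a::comm_ring, 'g::ab_group_add) equivariant_data" and n \<rho> +
 fixes E :: "('k, 'g, 'a) tens set"
 assumes E: "mod_ideal E" "E ~= K" and minimal: "!!E'. mod_ideal E' ==> E' \<subseteq> E ==> E' = K \<or> E' = E"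
begin

lemma E_ideal: "lie_ideal MM E" and K_sub: "K \<subseteq> E" using E by (auto simp: mod_ideal_def)

lemmas ED = mod_idealD[OF E_ideal]

lemma not_sub_K: "\<not> E \<subseteq> K" using E K_sub by auto

lemma not_abelian: "\<not> (\<forall>e\<in>E. \<forall>e'\<in>E. \<rho> (tb e e') = 0\<^sub>m n n)"
 using no_abelian[of E] ED(1,6) not_sub_K by blast

definition bracket_sums :: "('k, 'g, 'a) tens set" where
 "bracket_sums = {\<beta>. \<exists>ps. \<beta> = (\<Sum>(e, e')\<leftarrow>ps. tb e e') & (\<forall>(e, e')\<in>set ps. e \<in> E & e' \<in> E)}"

lemma bracket_sums_induct [consumes 1, case_names zero add]:
 assumes "\<beta> \<in> bracket_sums" "P 0" "!!e e' s. e \<in> E ==> e' \<in> E ==> s \<in> bracket_sums ==> P s ==> P (tb e e' + s)"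
 shows "P \<beta>"
proof -
 obtain ps where t: "\<beta> = (\<Sum>(e, e')\<leftarrow>ps. tb e e')" "\<forall>(e, e')\<in>set ps. e \<in> E & e' \<in> E" using assms(1) by (auto simp: bracket_sums_def)
 show ?thesis unfolding t(1) using t(2)
 proof (induction ps)
  case (Cons p ps)
  hence "(\<Sum>(e, e')\<leftarrow>ps. tb e e') \<in> bracket_sums" by (auto simp: bracket_sums_def)
  thus ?case using Cons assms(3) by (cases p) simp
 qed (simp add: assms(2))
qed

lemma bracket_sums_zero: "0 \<in> bracket_sums" by (auto simp: bracket_sums_def intro!: exI[of _ "[]"])

lemma bracket_sums_tb: "e \<in> E ==> e' \<in> E ==> tb e e' \<in> bracket_sums"
 by (auto simp: bracket_sums_def intro!: exI[of _ "[(e,e')]"])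

lemma bracket_sums_add: "s \<in> bracket_sums ==> t \<in> bracket_sums ==> s + t \<in> bracket_sums"
proof -
 assume "s \<in> bracket_sums" "t \<in> bracket_sums"
 then obtain ps qs where "s = (\<Sum>(e, e')\<leftarrow>ps. tb e e')" "\<forall>(e, e')\<in>set ps. e \<in> E & e' \<in> E"
  "t = (\<Sum>(e, e')\<leftarrow>qs. tb e e')" "\<forall>(e, e')\<in>set qs. e \<in> E & e' \<in> E" by (auto simp: bracket_sums_def)
 thus ?thesis unfolding bracket_sums_def by (auto intro!: exI[of _ "ps @ qs"])
qed

lemma bracket_sums_E: "s \<in> bracket_sums ==> s \<in> E"
 by (induction s rule: bracket_sums_induct) (auto intro: ED)

lemma bracket_sums_scale: "s \<in> bracket_sums ==> tens_scale c s \<in> bracket_sums"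
proof (induction s rule: bracket_sums_induct)
 case zero
 thus ?case by (simp add: bracket_sums_zero)
next
 case (add e e' s)
 have "tens_scale c (tb e e' + s) = tb (tens_scale c e) e' + tens_scale c s"
  using add(1,2) ED(1) by (simp add: T.scale_right_distrib tb_left M_TT)
 thus ?case using add ED(4) by (auto intro: bracket_sums_add bracket_sums_tb)
qed

lemma rep_eq_iff: "\<xi> \<in> M ==> \<beta> \<in> M ==> \<rho> \<xi> = \<rho> \<beta> \<longleftrightarrow> \<xi> - \<beta> \<in> K"
 using \<phi>_eq_iff[of \<xi> \<beta>] rep_diff[of \<xi> \<beta>] repD(1)[of \<xi>] repD(1)[of \<beta>] M_diff[of \<xi> \<beta>]
 by (auto simp: K_def \<phi>_def dest: mat_eq_of_diff_zero[of "\<rho> \<xi>" n n "\<rho> \<beta>"])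

lemma jacobi_mod_K:
 assumes "x \<in> M" "y \<in> M" "z \<in> M"
 shows "tb x (tb y z) - (tb (tb x y) z + tb y (tb x z)) \<in> K"
proof -
 have c: "\<rho> x \<in> Mat n n" "\<rho> y \<in> Mat n n" "\<rho> z \<in> Mat n n" using repD(1) assms by auto
 define a b d where "a = \<rho> x" and "b = \<rho> y" and "d = \<rho> z"
 have abd: "a \<in> Mat n n" "b \<in> Mat n n" "d \<in> Mat n n" using c by (auto simp: a_def b_def d_def)
 have m: "tb y z \<in> M" "tb x y \<in> M" "tb x z \<in> M" "tb (tb x y) z \<in> M" "tb y (tb x z) \<in> M" "tb x (tb y z) \<in> M"
  using assms M_closed by auto
 have e1: "p * (q * r - r * q) = p * (q * r) - p * (r * q)" "(q * r - r * q) * p = q * r * p - r * q * p"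
  if "p \<in> Mat n n" "q \<in> Mat n n" "r \<in> Mat n n" for p q r :: "'k mat"
  using that by (auto intro!: mult_minus_distrib_mat minus_mult_distrib_mat)
 have "\<rho> (tb x (tb y z)) = \<rho> (tb (tb x y) z + tb y (tb x z))"
  unfolding repD(4)[OF assms(1) m(1)] repD(2)[OF m(4,5)] repD(4)[OF m(2) assms(3)] repD(4)[OF assms(2) m(3)]
   repD(4)[OF assms(2,3)] repD(4)[OF assms(1,2)] repD(4)[OF assms(1,3)] a_def[symmetric] b_def[symmetric] d_def[symmetric]
  using abd by (simp add: e1 mat_assoc_dim) (rule eq_matI; simp)
 thus ?thesis using rep_eq_iff[OF m(6) M_closed(2)[OF m(4,5)]] by simp
qed

text \<open>The ideal \<open>[E, E] + K\<close> is \<open>E\<close> by minimality, as it is not \<open>K\<close> in the absence of abelian ideals.\<close>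

lemma E_perfect:
 assumes e: "e \<in> E" obtains \<beta> where "\<beta> \<in> bracket_sums" "e - \<beta> \<in> K"
proof -
 define E2 where "E2 = {\<xi> \<in> M. \<exists>\<beta>\<in>bracket_sums. \<xi> - \<beta> \<in> K}"
 note KD = mod_idealD[OF K_ideal]
 have KsubE2: "K \<subseteq> E2" using K_M bracket_sums_zero by (force simp: E2_def)
 have bsM: "\<beta> \<in> M" if "\<beta> \<in> bracket_sums" for \<beta> using bracket_sums_E[OF that] ED(1) by blast
 have E2E: "E2 \<subseteq> E"
 proof
  fix \<xi> assume "\<xi> \<in> E2"
  then obtain \<beta> where "\<beta> \<in> bracket_sums" "\<xi> - \<beta> \<in> K" by (auto simp: E2_def)
  hence "\<xi> - \<beta> + \<beta> \<in> E" using K_sub bracket_sums_E ED(3) by blast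
  thus "\<xi> \<in> E" by simp
 qed
 have sum_br: "\<exists>\<gamma>\<in>bracket_sums. tb x \<beta> - \<gamma> \<in> K & tb \<beta> x + \<gamma> \<in> K" if x: "x \<in> M" and b: "\<beta> \<in> bracket_sums" for x \<beta>
  using b
 proof (induction \<beta> rule: bracket_sums_induct)
  case zero
  thus ?case using x bracket_sums_zero KD(2) by (intro bexI[of _ 0]) (auto simp: tb_right tb_left M_TT)
 next
  case (add e e' s)
  obtain \<gamma> where g: "\<gamma> \<in> bracket_sums" "tb x s - \<gamma> \<in> K" "tb s x + \<gamma> \<in> K" using add.IH by blast
  define \<gamma>' where "\<gamma>' = tb (tb x e) e' + tb e (tb x e')"
  have eM: "e \<in> M" "e' \<in> M" "s \<in> M" using add ED(1) bsM by auto
  have "\<gamma>' \<in> bracket_sums" unfolding \<gamma>'_def using add(1,2) x by (auto intro!: bracket_sums_add bracket_sums_tb ED(5))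
  hence "\<gamma>' + \<gamma> \<in> bracket_sums" using g bracket_sums_add by blast
  moreover have j: "tb x (tb e e') - \<gamma>' \<in> K" unfolding \<gamma>'_def by (rule jacobi_mod_K[OF x eM(1,2)])
  hence "tb x (tb e e' + s) - (\<gamma>' + \<gamma>) \<in> K"
  proof -
   have "tb x (tb e e' + s) - (\<gamma>' + \<gamma>) = (tb x (tb e e') - \<gamma>') + (tb x s - \<gamma>)"
    using x eM by (simp only: tb_right M_TT tb_TT algebra_simps)
   thus ?thesis using KD(3)[OF j g(2)] by (simp only:)
  qed
  moreover have "tb (tb e e' + s) x + (\<gamma>' + \<gamma>) \<in> K"
  proof -
   have eeM: "tb e e' \<in> M" using eM M_closed by auto
   have anti: "tb (tb e e') x + tb x (tb e e') \<in> K"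
   proof -
    have "\<rho> (tb (tb e e') x + tb x (tb e e')) = 0\<^sub>m n n"
     unfolding repD(2)[OF M_closed(5)[OF eeM x] M_closed(5)[OF x eeM]] repD(4)[OF eeM x] repD(4)[OF x eeM]
     by (rule eq_matI) (use repD(1)[OF x] repD(1)[OF eeM] in auto)
    thus ?thesis using x eeM by (simp add: K_def M_closed)
   qed
   have "tb (tb e e' + s) x + (\<gamma>' + \<gamma>) = (tb (tb e e') x + tb x (tb e e')) - (tb x (tb e e') - \<gamma>') + (tb s x + \<gamma>)"
    using x eM by (simp only: tb_left M_TT tb_TT algebra_simps)
   thus ?thesis using KD(3)[OF lie_ideal_diff[OF MM_closed K_ideal anti j] g(3)] by (simp only:)
  qed
  ultimately show ?case by blast
 qed
 have "lie_ideal MM E2"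
  unfolding lie_ideal_def MM_simps
 proof (intro conjI ballI allI)
  show "E2 \<subseteq> M" by (auto simp: E2_def)
  show "0 \<in> E2" using KsubE2 KD(2) by blast
  show "a + b \<in> E2" if ab: "a \<in> E2" "b \<in> E2" for a b
  proof -
   obtain a' b' where h: "a' \<in> bracket_sums" "a - a' \<in> K" "b' \<in> bracket_sums" "b - b' \<in> K" using ab by (auto simp: E2_def)
   hence "a + b - (a' + b') \<in> K" using KD(3)[OF h(2,4)] by (simp add: algebra_simps)
   thus ?thesis using ab h bracket_sums_add M_closed(2) unfolding E2_def by blast
  qed
  show "tens_scale c a \<in> E2" if a: "a \<in> E2" for c a
  proof -
   obtain a' where h: "a' \<in> bracket_sums" "a - a' \<in> K" using a by (auto simp: E2_def)
   have "tens_scale c a - tens_scale c a' \<in> K" using KD(4)[OF h(2), of c] by (simp add: T.scale_right_diff_distrib)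
   thus ?thesis using a bracket_sums_scale[OF h(1)] M_closed(3) unfolding E2_def by blast
  qed
  fix x a assume x: "x \<in> M" and a: "a \<in> E2"
  obtain a' where h: "a' \<in> bracket_sums" "a - a' \<in> K" using a by (auto simp: E2_def)
  have aM: "a \<in> M" "a' \<in> M" using a bsM[OF h(1)] by (auto simp: E2_def)
  obtain \<gamma> where g: "\<gamma> \<in> bracket_sums" "tb x a' - \<gamma> \<in> K" "tb a' x + \<gamma> \<in> K" using sum_br[OF x h(1)] by auto
  have d: "tb x (a - a') = tb x a - tb x a'" "tb (a - a') x = tb a x - tb a' x"
   using lie_bracket_diff[OF MM_closed aM x] by simp_all
  have "tb x a - \<gamma> \<in> K" using KD(3)[OF KD(5)[OF x h(2)] g(2)] d by simp
  thus "tb x a \<in> E2" using g(1) M_closed(5)[OF x aM(1)] unfolding E2_def by blast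
  have "tb a x - (- \<gamma>) \<in> K" using KD(3)[OF KD(6)[OF x h(2)] g(3)] d by simp
  moreover have "- \<gamma> \<in> bracket_sums" using bracket_sums_scale[OF g(1), of "- 1"] by simp
  ultimately show "tb a x \<in> E2" using M_closed(5)[OF aM(1) x] unfolding E2_def by blast
 qed
 hence "mod_ideal E2" using KsubE2 by (simp add: mod_ideal_def)
 hence "E2 = K \<or> E2 = E" using minimal E2E by blast
 moreover have "E2 ~= K"
 proof
  assume k: "E2 = K"
  have "\<rho> (tb a b) = 0\<^sub>m n n" if "a \<in> E" "b \<in> E" for a b
  proof -
   have "tb a b \<in> E2" using bracket_sums_tb[OF that] bsM[OF bracket_sums_tb[OF that]] KD(2)
    unfolding E2_def by (auto intro!: bexI[of _ "tb a b"])
   thus ?thesis using k by (simp add: K_def)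
  qed
  thus False using not_abelian by blast
 qed
 ultimately show ?thesis using e that by (auto simp: E2_def)
qed

text \<open>An invariant \<open>f\<close> can be moved into one of the factors of a bracket, \<open>f [e, e'] = [f e, e']\<close>.\<close>

lemma E_amul: "f \<in> R ==> e \<in> E ==> amul f e \<in> E"
proof -
 assume f: "f \<in> R" and e: "e \<in> E"
 obtain \<beta> where b: "\<beta> \<in> bracket_sums" "e - \<beta> \<in> K" by (rule E_perfect[OF e])
 have 1: "amul f (e - \<beta>) \<in> E" using K_amul[OF f b(2)] K_sub by blast
 have 2: "amul f \<beta> \<in> E" using b(1)
 proof (induction \<beta> rule: bracket_sums_induct)
  case zero
  thus ?case using ED(2) by (simp add: amul_simps)
 next
  case (add e e' s)
  have m: "e \<in> M" "e' \<in> M" "s \<in> M" using add ED(1) bracket_sums_E by auto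
  have "amul f (tb e e' + s) = tb (amul f e) e' + amul f s"
   using m by (simp add: amul_simps tb_TT M_TT tb_amul_left)
  thus ?case using add ED(3) ED(5)[OF amul_M[OF f m(1)] add(2)] by simp
 qed
 have "amul f (e - \<beta> + \<beta>) = amul f (e - \<beta>) + amul f \<beta>"
  using K_M[OF b(2)] bracket_sums_E[OF b(1)] ED(1) by (intro amul_simps(3)) (auto simp: M_TT)
 thus ?thesis using ED(3)[OF 1 2] by simp
qed

text \<open>Multiplication by \<open>f\<close> induces an endomorphism of the finite-dimensional space \<open>E / K\<close>.\<close>

lemma eigenvector_in_E:
 assumes f: "f \<in> R"
 obtains c \<xi> where "\<xi> \<in> E" "\<xi> \<notin> K" "amul f \<xi> - tens_scale c \<xi> \<in> K"
proof -
 define W where "W = \<phi> ` E"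
 have W: "vsub (n * n) W" unfolding W_def by (rule vsub_\<phi>[OF E_ideal])
 obtain e B where B: "B \<in> Mat (n * n) e" "mat_inj B" "mat_im B = W" by (rule vsub_basis[OF W])
 have e0: "e > 0"
 proof (rule ccontr)
  assume "\<not> e > 0"
  hence "W = {0\<^sub>v (n * n)}" using mat_im_trivial[of B "n * n"] B by simp
  moreover have "\<phi> 0 = 0\<^sub>v (n * n)" by (intro eq_vecI) (auto simp: \<phi>_def rep_zero div_mod_bounds)
  ultimately have "\<xi> - 0 \<in> K" if "\<xi> \<in> E" for \<xi>
   using \<phi>_eq_iff[OF ED(1)[OF that] M_closed(1)] that unfolding W_def by auto
  thus False using not_sub_K by auto
 qed
 define pick where "pick w = (SOME \<xi>. \<xi> \<in> E & \<phi> \<xi> = w)" for w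
 have pick: "pick w \<in> E" "\<phi> (pick w) = w" if "w \<in> W" for w
  using someI_ex[of "\<lambda>\<xi>. \<xi> \<in> E & \<phi> \<xi> = w"] that unfolding pick_def W_def by auto
 have well: "\<phi> (amul f \<xi>) = \<phi> (amul f \<beta>)" if "\<xi> \<in> M" "\<beta> \<in> M" "\<phi> \<xi> = \<phi> \<beta>" for \<xi> \<beta>
 proof -
  have k: "\<xi> - \<beta> \<in> K" using that \<phi>_eq_iff by blast
  have "amul f \<xi> = amul f (\<xi> - \<beta>) + amul f \<beta>"
   using amul_simps(3)[of "\<xi> - \<beta>" \<beta> f] M_TT[OF K_M[OF k]] M_TT[OF that(2)] by simp
  hence "amul f \<xi> - amul f \<beta> \<in> K" using K_amul[OF f k] by simp
  thus ?thesis using \<phi>_eq_iff amul_M[OF f] that by blast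
 qed
 define F where "F v = \<phi> (amul f (pick (B *\<^sub>v v)))" for v
 have BW: "B *\<^sub>v v \<in> W" if "v \<in> Vec e" for v using that B by (auto simp: mat_im_def)
 have Fc: "F v \<in> Vec (n * n)" for v by (simp add: F_def)
 have Fadd: "F (u + v) = F u + F v" if uv: "u \<in> Vec e" "v \<in> Vec e" for u v
 proof -
  define a b where "a = pick (B *\<^sub>v u)" and "b = pick (B *\<^sub>v v)"
  have ab: "a \<in> M" "b \<in> M" "\<phi> a = B *\<^sub>v u" "\<phi> b = B *\<^sub>v v" using pick[OF BW] uv ED(1) by (auto simp: a_def b_def)
  have "F (u + v) = \<phi> (amul f (a + b))"
   unfolding F_def
  proof (rule well)
   show "pick (B *\<^sub>v (u + v)) \<in> M" using pick(1)[OF BW] uv ED(1) by auto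
   show "\<phi> (pick (B *\<^sub>v (u + v))) = \<phi> (a + b)" using pick(2)[OF BW[of "u + v"]] uv ab mult_add_distrib_mat_vec[OF B(1) uv] by (simp add: \<phi>_add)
  qed (use ab M_closed in auto)
  also have "amul f (a + b) = amul f a + amul f b" using ab by (simp add: amul_simps M_TT)
  also have "\<phi> ... = F u + F v" using \<phi>_add[OF amul_M[OF f ab(1)] amul_M[OF f ab(2)]] by (simp add: F_def a_def b_def)
  finally show ?thesis .
 qed
 have Fsc: "F (c \<cdot>\<^sub>v v) = c \<cdot>\<^sub>v F v" if v: "v \<in> Vec e" for c v
 proof -
  define b where "b = pick (B *\<^sub>v v)"
  have b: "b \<in> M" "\<phi> b = B *\<^sub>v v" using pick[OF BW] v ED(1) by (auto simp: b_def)
  have "F (c \<cdot>\<^sub>v v) = \<phi> (amul f (tens_scale c b))"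
   unfolding F_def
  proof (rule well)
   show "pick (B *\<^sub>v (c \<cdot>\<^sub>v v)) \<in> M" using pick(1)[OF BW] v ED(1) by auto
   show "\<phi> (pick (B *\<^sub>v (c \<cdot>\<^sub>v v))) = \<phi> (tens_scale c b)" using pick(2)[OF BW[of "c \<cdot>\<^sub>v v"]] v b B(1) by (simp add: \<phi>_scale smult_mult_mat_vec_right)
  qed (use b M_closed in auto)
  also have "amul f (tens_scale c b) = tens_scale c (amul f b)" using b by (simp add: amul_simps M_TT)
  also have "\<phi> ... = c \<cdot>\<^sub>v F v" using \<phi>_scale[OF amul_M[OF f b(1)]] by (simp add: F_def b_def)
  finally show ?thesis .
 qed
 obtain C where C: "C \<in> Mat (n * n) e" "!!v. v \<in> Vec e ==> F v = C *\<^sub>v v"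
  by (rule linear_is_matrix[of e F "n * n"]) (use Fc Fadd Fsc in auto)
 have FW: "F v \<in> W" if "v \<in> Vec e" for v using E_amul[OF f pick(1)[OF BW[OF that]]] by (auto simp: F_def W_def)
 obtain Y where Y: "Y \<in> Mat e e" "C = B * Y"
  by (rule factor_through_mat_im[OF B(1) C(1)]) (use FW C B in auto)
 have "degree (char_poly Y) = e" using degree_monic_char_poly[OF Y(1)] by auto
 then obtain c where "poly (char_poly Y) c = 0" using alg_closed_imp_poly_has_root e0 by metis
 then obtain v where v: "v \<in> Vec e" "v ~= 0\<^sub>v e" "Y *\<^sub>v v = c \<cdot>\<^sub>v v"
  using eigenvalue_root_char_poly[OF Y(1)] Y unfolding eigenvalue_def eigenvector_def by auto
 define \<xi> where "\<xi> = pick (B *\<^sub>v v)"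
 have \<xi>: "\<xi> \<in> E" "\<phi> \<xi> = B *\<^sub>v v" using pick[OF BW[OF v(1)]] by (auto simp: \<xi>_def)
 have \<xi>M: "\<xi> \<in> M" using ED(1)[OF \<xi>(1)] .
 have "\<phi> (amul f \<xi>) = C *\<^sub>v v" using C(2)[OF v(1)] by (simp add: F_def \<xi>_def)
 also have "... = B *\<^sub>v (c \<cdot>\<^sub>v v)" unfolding Y(2) v(3)[symmetric] using B(1) Y(1) v(1) by (simp add: mat_vec_assoc_dim)
 also have "... = \<phi> (tens_scale c \<xi>)" using \<xi> \<xi>M B(1) v(1) by (simp add: \<phi>_scale smult_mult_mat_vec_right)
 finally have "amul f \<xi> - tens_scale c \<xi> \<in> K" using \<phi>_eq_iff amul_M[OF f \<xi>M] M_closed(3)[OF \<xi>M] by blast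
 moreover have "\<xi> \<notin> K"
 proof
  assume "\<xi> \<in> K"
  hence "\<phi> \<xi> = 0\<^sub>v (n * n)" by (intro eq_vecI) (auto simp: \<phi>_def K_def div_mod_bounds)
  thus False using \<xi>(2) v B unfolding mat_inj_def by auto
 qed
 ultimately show ?thesis using that \<xi>(1) by blast
qed

text \<open>An eigenspace of \<open>f\<close> in \<open>E / K\<close> is an ideal, so it is all of \<open>E / K\<close> by minimality.\<close>

lemma scalar_action:
 assumes f: "f \<in> R" shows "\<exists>c. \<forall>\<xi>\<in>E. amul f \<xi> - tens_scale c \<xi> \<in> K"
proof -
 obtain c \<xi> where \<xi>: "\<xi> \<in> E" "\<xi> \<notin> K" "amul f \<xi> - tens_scale c \<xi> \<in> K" by (rule eigenvector_in_E[OF f])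
 define Ec where "Ec = {\<xi> \<in> E. amul f \<xi> - tens_scale c \<xi> \<in> K}"
 note KD = mod_idealD[OF K_ideal]
 have ETT: "!!a. a \<in> E ==> a \<in> TT" using ED(1) M_TT by blast
 have "K \<subseteq> Ec"
 proof
  fix \<kappa> assume k: "\<kappa> \<in> K"
  have "amul f \<kappa> - tens_scale c \<kappa> \<in> K" by (rule lie_ideal_diff[OF MM_closed K_ideal K_amul[OF f k] KD(4)[OF k]])
  thus "\<kappa> \<in> Ec" using k K_sub by (auto simp: Ec_def)
 qed
 moreover have "lie_ideal MM Ec"
  unfolding lie_ideal_def MM_simps
 proof (intro conjI ballI allI)
  show "Ec \<subseteq> M" using ED(1) by (auto simp: Ec_def)
  show "0 \<in> Ec" using ED(2) KD(2) by (simp add: Ec_def amul_simps)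
  show "a + b \<in> Ec" if ab: "a \<in> Ec" "b \<in> Ec" for a b
  proof -
   have "amul f (a + b) - tens_scale c (a + b) = (amul f a - tens_scale c a) + (amul f b - tens_scale c b)"
    using ab ETT by (simp add: amul_simps T.scale_right_distrib Ec_def)
   thus ?thesis using ab KD(3) ED(3) by (auto simp: Ec_def)
  qed
  show "tens_scale d a \<in> Ec" if a: "a \<in> Ec" for d a
  proof -
   have "amul f (tens_scale d a) - tens_scale c (tens_scale d a) = tens_scale d (amul f a - tens_scale c a)"
    using a ETT by (simp add: amul_simps T.scale_right_diff_distrib Ec_def mult.commute)
   thus ?thesis using a KD(4) ED(4) by (auto simp: Ec_def)
  qed
  fix x a assume x: "x \<in> M" and a: "a \<in> Ec"
  have aM: "a \<in> M" "a \<in> E" using a ED(1) by (auto simp: Ec_def)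
  have k: "amul f a - tens_scale c a \<in> K" using a by (simp add: Ec_def)
  have "amul f (tb x a) - tens_scale c (tb x a) = tb x (amul f a - tens_scale c a)"
   using lie_bracket_diff(2)[OF MM_closed amul_M[OF f aM(1)] M_closed(3)[OF aM(1)] x] x aM
   by (simp add: tb_amul_right M_TT tb_right)
  thus "tb x a \<in> Ec" using KD(5)[OF x k] ED(5)[OF x aM(2)] by (simp add: Ec_def)
  have "amul f (tb a x) - tens_scale c (tb a x) = tb (amul f a - tens_scale c a) x"
   using lie_bracket_diff(1)[OF MM_closed amul_M[OF f aM(1)] M_closed(3)[OF aM(1)] x] x aM
   by (simp add: tb_amul_left M_TT tb_left)
  thus "tb a x \<in> Ec" using KD(6)[OF x k] ED(6)[OF x aM(2)] by (simp add: Ec_def)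
 qed
 ultimately have "Ec = K \<or> Ec = E" using minimal by (simp add: mod_ideal_def Ec_def)
 hence "Ec = E" using \<xi> by (auto simp: Ec_def)
 thus ?thesis by (auto simp: Ec_def)
qed

text \<open>The character by which \<open>R\<close> acts on \<open>E / K\<close>.\<close>

definition \<chi> :: "'a => 'k" where "\<chi> f = (SOME c. \<forall>\<xi>\<in>E. amul f \<xi> - tens_scale c \<xi> \<in> K)"

text \<open>The character by which \<open>R\<close> acts on \<open>E / K\<close>.\<close>

lemma \<chi>: "f \<in> R ==> \<xi> \<in> E ==> amul f \<xi> - tens_scale (\<chi> f) \<xi> \<in> K"
 using someI_ex[OF scalar_action] unfolding \<chi>_def by blast

lemma \<chi>_unique:
 assumes f: "f \<in> R" and c: "!!\<xi>. \<xi> \<in> E ==> amul f \<xi> - tens_scale c \<xi> \<in> K" shows "\<chi> f = c"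
proof (rule ccontr)
 assume ne: "\<chi> f ~= c"
 have "\<xi> \<in> K" if a: "\<xi> \<in> E" for \<xi>
 proof -
  have "(amul f \<xi> - tens_scale c \<xi>) - (amul f \<xi> - tens_scale (\<chi> f) \<xi>) \<in> K"
   by (rule lie_ideal_diff[OF MM_closed K_ideal c[OF a] \<chi>[OF f a]])
  hence "tens_scale (\<chi> f - c) \<xi> \<in> K" by (simp add: T.scale_left_diff_distrib)
  hence "tens_scale (1 / (\<chi> f - c)) (tens_scale (\<chi> f - c) \<xi>) \<in> K" by (rule mod_idealD(4)[OF K_ideal])
  thus ?thesis using ne by simp
 qed
 thus False using not_sub_K by blast
qed

lemma \<chi>_char: "charR \<chi>"
 unfolding charR_def
proof (intro conjI ballI allI)
 note KD = mod_idealD[OF K_ideal]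
 have ETT: "!!a. a \<in> E ==> a \<in> TT" using ED(1) M_TT by blast
 fix f assume f: "f \<in> R"
 show "\<chi> (scaleA D c f) = c * \<chi> f" for c
 proof (rule \<chi>_unique[OF R_closed(3)[OF f]])
  fix \<xi> assume a: "\<xi> \<in> E"
  have "amul (scaleA D c f) \<xi> - tens_scale (c * \<chi> f) \<xi> = tens_scale c (amul f \<xi> - tens_scale (\<chi> f) \<xi>)"
   by (simp add: amul_scale_left[OF ETT[OF a]] T.scale_right_diff_distrib)
  thus "amul (scaleA D c f) \<xi> - tens_scale (c * \<chi> f) \<xi> \<in> K" using KD(4)[OF \<chi>[OF f a]] by simp
 qed
 fix h assume h: "h \<in> R"
 show "\<chi> (f + h) = \<chi> f + \<chi> h"
 proof (rule \<chi>_unique[OF R_closed(1)[OF f h]])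
  fix \<xi> assume a: "\<xi> \<in> E"
  have "amul (f + h) \<xi> - tens_scale (\<chi> f + \<chi> h) \<xi> = (amul f \<xi> - tens_scale (\<chi> f) \<xi>) + (amul h \<xi> - tens_scale (\<chi> h) \<xi>)"
   by (simp add: amul_add_left[OF ETT[OF a]] T.scale_left_distrib)
  thus "amul (f + h) \<xi> - tens_scale (\<chi> f + \<chi> h) \<xi> \<in> K" using KD(3)[OF \<chi>[OF f a] \<chi>[OF h a]] by simp
 qed
 show "\<chi> (f * h) = \<chi> f * \<chi> h"
 proof (rule \<chi>_unique[OF R_closed(2)[OF f h]])
  fix \<xi> assume a: "\<xi> \<in> E"
  have "amul (f * h) \<xi> - tens_scale (\<chi> f * \<chi> h) \<xi> =
   (amul f (amul h \<xi>) - tens_scale (\<chi> f) (amul h \<xi>)) + tens_scale (\<chi> f) (amul h \<xi> - tens_scale (\<chi> h) \<xi>)"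
   by (simp add: amul_amul[OF ETT[OF a]] T.scale_right_diff_distrib)
  thus "amul (f * h) \<xi> - tens_scale (\<chi> f * \<chi> h) \<xi> \<in> K"
   using KD(3)[OF \<chi>[OF f E_amul[OF h a]] KD(4)[OF \<chi>[OF h a]]] by simp
 qed
next
 show "\<chi> (unitA D) = 1"
 proof (rule \<chi>_unique[OF R_closed(4)])
  fix \<xi> assume a: "\<xi> \<in> E"
  show "amul (unitA D) \<xi> - tens_scale 1 \<xi> \<in> K" using amul_unit[OF M_TT[OF ED(1)[OF a]]] mod_idealD(2)[OF K_ideal] by simp
 qed
qed

end

section \<open>Vanishing on the maps that vanish at finitely many points\<close>

context minimal_ideal
begin

text \<open>Every element of \<open>E\<close> is congruent modulo \<open>K\<close> to an equivariant map with coefficients in \<open>I\<close>.\<close>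

definition covers :: "'a set => bool" where
 "covers I \<longleftrightarrow> (\<forall>e\<in>E. \<exists>t\<in>M \<inter> gtens I. e - t \<in> K)"

lemma covers_mono: "covers I ==> I \<subseteq> J ==> covers J"
 using gtens_mono[of I J] unfolding covers_def by blast

text \<open>Write an element of \<open>E\<close> as a sum of brackets and replace their entries by congruent maps with coefficients in \<open>I\<close>.\<close>

lemma covers_product:
 assumes I: "covers I" and J: "!!f h. f \<in> I ==> h \<in> I ==> f * h \<in> J"
 shows "covers J"
 unfolding covers_def
proof
 note KD = mod_idealD[OF K_ideal]
 fix e assume e: "e \<in> E"
 obtain \<beta> where b: "\<beta> \<in> bracket_sums" "e - \<beta> \<in> K" by (rule E_perfect[OF e])
 have "\<exists>t\<in>M \<inter> gtens J. \<beta> - t \<in> K" using b(1)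
 proof (induction \<beta> rule: bracket_sums_induct)
  case zero
  thus ?case using KD(2) M_closed(1) gtens_zero by (intro bexI[of _ 0]) auto
 next
  case (add a b s)
  obtain t where t: "t \<in> M" "t \<in> gtens J" "s - t \<in> K" using add.IH by blast
  obtain a' b' where h: "a' \<in> M" "a' \<in> gtens I" "a - a' \<in> K" "b' \<in> M" "b' \<in> gtens I" "b - b' \<in> K"
   using I add(1,2) unfolding covers_def by blast
  have M: "a \<in> M" "b \<in> M" using add ED(1) by auto
  have "tb a b - tb a' b' = tb (a - a') b + tb a' (b - b')"
   using lie_bracket_diff(1)[OF MM_closed M(1) h(1) M(2)] lie_bracket_diff(2)[OF MM_closed M(2) h(4,1)] by simp
  hence k: "tb a b - tb a' b' \<in> K" using KD(3)[OF KD(6)[OF M(2) h(3)] KD(5)[OF h(1,6)]] by simp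
  have "tb a b + s - (tb a' b' + t) = (tb a b - tb a' b') + (s - t)" by (simp only: algebra_simps)
  hence "tb a b + s - (tb a' b' + t) \<in> K" using KD(3)[OF k t(3)] by (simp only:)
  moreover have "tb a' b' + t \<in> M" using h t M_closed by auto
  moreover have "tb a' b' + t \<in> gtens J" by (rule gtens_add[OF gtens_bracket[OF J h(2,5)] t(2)])
  ultimately show ?case by blast
 qed
 then obtain t where t: "t \<in> M" "t \<in> gtens J" "\<beta> - t \<in> K" by blast
 have "e - t = (e - \<beta>) + (\<beta> - t)" by (simp only: algebra_simps)
 hence "e - t \<in> K" using KD(3)[OF b(2) t(3)] by (simp only:)
 thus "\<exists>t\<in>M \<inter> gtens J. e - t \<in> K" using t by blast
qed

text \<open>Two elements of \<open>I + A f\<^sup>j\<close> have their product in \<open>I + A f\<^sup>j\<^sup>+\<^sup>1\<close> for \<open>j \<ge> 1\<close>, so the exponent of \<open>f\<close> can be raised until the power lies in \<open>I\<close>.\<close>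

lemma covers_remove:
 assumes I: "idealA I" and c: "covers (adjoin I f)" and f: "powA f m \<in> I"
 shows "covers I"
proof -
 note ID = idealAD[OF I]
 have "covers (adjoin I (powA f (Suc j)))" for j
 proof (induction j)
  case 0
  thus ?case using c by simp
 next
  case (Suc j)
  show ?case
  proof (rule covers_product[OF Suc])
   fix p q assume "p \<in> adjoin I (powA f (Suc j))" "q \<in> adjoin I (powA f (Suc j))"
   then obtain a h b k where p: "a \<in> I" "p = a + h * powA f (Suc j)" and q: "b \<in> I" "q = b + k * powA f (Suc j)"
    by (auto simp: adjoin_def simp del: powA_simps)
   have "p * q = (a * q + h * powA f (Suc j) * b) + (h * k * powA f j) * powA f (Suc (Suc j))"
    by (simp add: p q algebra_simps)
   moreover have "a * q + h * powA f (Suc j) * b \<in> I" using ID(2)[OF ID(4)[OF p(1)] ID(3)[OF q(1)]] .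
   ultimately show "p * q \<in> adjoin I (powA f (Suc (Suc j)))" unfolding adjoin_def by blast
  qed
 qed
 from this[of m] show ?thesis
 proof (rule covers_mono)
  show "adjoin I (powA f (Suc m)) \<subseteq> I"
  proof
   fix p assume "p \<in> adjoin I (powA f (Suc m))"
   then obtain a h where "a \<in> I" "p = a + (h * f) * powA f m" by (auto simp: adjoin_def mult.assoc)
   thus "p \<in> I" using ID(2)[OF _ ID(3)[OF f]] by blast
  qed
 qed
qed

text \<open>As \<open>E / K\<close> has finite dimension, finitely many coefficients are enough; they are adjoined to \<open>I\<close> and removed again one at a time.\<close>

lemma covers_finite:
 assumes I: "idealA I" and c: "covers {f. \<exists>m. powA f m \<in> I}"
 shows "covers I"
proof -
 define J where "J fs = foldr (\<lambda>f L. adjoin L f) fs I" for fs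
 have J: "idealA (J fs)" "I \<subseteq> J fs" "set fs \<subseteq> J fs" for fs
 proof (induction fs)
  case (Cons f fs)
  have J: "J (f # fs) = adjoin (J fs) f" by (simp add: J_def)
  show "idealA (J (f # fs))" "I \<subseteq> J (f # fs)" "set (f # fs) \<subseteq> J (f # fs)"
   unfolding J using adjoin_ideal[OF Cons(1), of f] Cons(2,3) by auto
 qed (use I in "auto simp: J_def")
 have Jmono: "J fs \<subseteq> J (hs @ fs)" for fs hs
 proof (induction hs)
  case (Cons h hs)
  have "J ((h # hs) @ fs) = adjoin (J (hs @ fs)) h" by (simp add: J_def)
  thus ?case using Cons adjoin_ideal(2)[OF J(1), of "hs @ fs" h] by blast
 qed simp
 have Jmono': "J fs \<subseteq> J (fs @ hs)" for fs hs
  by (induction fs) (use J(2)[of hs] in "auto simp: J_def adjoin_def")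
 define P where "P fs \<longleftrightarrow> (\<forall>f\<in>set fs. \<exists>m. powA f m \<in> I)" for fs
 have step: "\<exists>fs. P fs & (\<exists>t\<in>M \<inter> gtens (J fs). e - t \<in> K)" if e: "e \<in> E" for e
 proof -
  obtain t where t: "t \<in> M" "t \<in> gtens {f. \<exists>m. powA f m \<in> I}" "e - t \<in> K" using c e unfolding covers_def by blast
  then obtain ps where ps: "t = (\<Sum>(u, f)\<leftarrow>ps. pt u f)" "\<forall>(u, f)\<in>set ps. f \<in> {f. \<exists>m. powA f m \<in> I}" unfolding gtens_def by blast
  have "P (map snd ps)" using ps(2) by (auto simp: P_def)
  moreover have "t \<in> gtens (J (map snd ps))" unfolding gtens_def using ps(1) J(3)[of "map snd ps"] by force
  ultimately show ?thesis using t by blast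
 qed
 obtain d B where B: "B \<in> Mat (n * n) d" "mat_inj B" "mat_im B = \<phi> ` E" by (rule vsub_basis[OF vsub_\<phi>[OF E_ideal]])
 define S where "S fs = {v \<in> Vec d. \<exists>t\<in>M \<inter> gtens (J fs). \<phi> t = B *\<^sub>v v}" for fs
 have S: "vsub d (S fs)" for fs
  unfolding vsub_def
 proof (intro conjI ballI allI)
  show "S fs \<subseteq> Vec d" by (auto simp: S_def)
  have "\<phi> 0 = B *\<^sub>v 0\<^sub>v d" using B(1) by (intro eq_vecI) (auto simp: \<phi>_def rep_zero div_mod_bounds)
  thus "0\<^sub>v d \<in> S fs" unfolding S_def using M_closed(1) gtens_zero by (intro CollectI conjI bexI[of _ 0]) auto
  show "u + v \<in> S fs" if uv': "u \<in> S fs" "v \<in> S fs" for u v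
  proof -
   have uv: "u \<in> Vec d" "v \<in> Vec d" using uv' by (auto simp: S_def)
   obtain s t where st: "s \<in> M" "s \<in> gtens (J fs)" "\<phi> s = B *\<^sub>v u" "t \<in> M" "t \<in> gtens (J fs)" "\<phi> t = B *\<^sub>v v"
    using uv' unfolding S_def by blast
   have "\<phi> (s + t) = B *\<^sub>v (u + v)" using st uv mult_add_distrib_mat_vec[OF B(1) uv] by (simp add: \<phi>_add)
   thus ?thesis using uv gtens_add[OF st(2,5)] M_closed(2)[OF st(1,4)] unfolding S_def by auto
  qed
  show "c \<cdot>\<^sub>v v \<in> S fs" if v: "v \<in> S fs" for c v
  proof -
   have vc: "v \<in> Vec d" using v by (auto simp: S_def)
   obtain t where t: "t \<in> M" "t \<in> gtens (J fs)" "\<phi> t = B *\<^sub>v v" using v unfolding S_def by blast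
   have "\<phi> (tens_scale c t) = B *\<^sub>v (c \<cdot>\<^sub>v v)" using t vc B(1) by (simp add: \<phi>_scale smult_mult_mat_vec_right)
   moreover have "c \<cdot>\<^sub>v v \<in> Vec d" using vc by simp
   ultimately show ?thesis using gtens_scale[OF t(2)] M_closed(3)[OF t(1)] unfolding S_def by auto
  qed
 qed
 have Smono: "S fs \<subseteq> S (fs @ hs)" "S fs \<subseteq> S (hs @ fs)" for fs hs
  using gtens_mono[OF Jmono[of fs hs]] gtens_mono[OF Jmono'[of fs hs]] unfolding S_def by blast+
 have "\<exists>fs. P fs & (\<forall>j<l. unit_vec d j \<in> S fs)" if "l \<le> d" for l
  using that
 proof (induction l)
  case 0
  thus ?case by (intro exI[of _ "[]"]) (simp add: P_def)
 next
  case (Suc l)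
  obtain fs where fs: "P fs" "\<forall>j<l. unit_vec d j \<in> S fs" using Suc by auto
  have "B *\<^sub>v unit_vec d l \<in> \<phi> ` E" using B(1) unfolding B(3)[symmetric] by (auto simp: mat_im_def)
  then obtain e where e: "e \<in> E" "\<phi> e = B *\<^sub>v unit_vec d l" by auto
  obtain hs t where hs: "P hs" "t \<in> M" "t \<in> gtens (J hs)" "e - t \<in> K" using step[OF e(1)] by blast
  have "\<phi> t = B *\<^sub>v unit_vec d l" using \<phi>_eq_iff[OF ED(1)[OF e(1)] hs(2)] hs(4) e(2) by simp
  hence "unit_vec d l \<in> S hs" using hs unfolding S_def by auto
  hence "\<forall>j<Suc l. unit_vec d j \<in> S (fs @ hs)" using fs(2) Smono[of fs hs] Smono(2)[of hs fs] less_Suc_eq by auto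
  moreover have "P (fs @ hs)" using fs hs by (auto simp: P_def)
  ultimately show ?case by blast
 qed
 from this[of d] obtain fs where fs: "P fs" "!!j. j < d ==> unit_vec d j \<in> S fs" by blast
 have Sall: "S fs = Vec d" by (rule vsub_units[OF S fs(2)])
 have "covers (J fs)"
  unfolding covers_def
 proof
  fix e assume e: "e \<in> E"
  hence "\<phi> e \<in> mat_im B" unfolding B(3) by simp
  then obtain v where v: "v \<in> Vec d" "\<phi> e = B *\<^sub>v v" using B(1) unfolding mat_im_def by auto
  then obtain t where t: "t \<in> M" "t \<in> gtens (J fs)" "\<phi> t = B *\<^sub>v v" using Sall unfolding S_def by blast
  thus "\<exists>t\<in>M \<inter> gtens (J fs). e - t \<in> K" using \<phi>_eq_iff[OF ED(1)[OF e] t(1)] v(2) by auto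
 qed
 thus ?thesis using fs(1)
 proof (induction fs)
  case Nil
  thus ?case by (simp add: J_def)
 next
  case (Cons f fs)
  obtain m where "powA f m \<in> J fs" using Cons(3) J(2)[of fs] by (auto simp: P_def)
  moreover have "covers (adjoin (J fs) f)" using Cons(2) by (simp add: J_def)
  ultimately have "covers (J fs)" using covers_remove[OF J(1)] by blast
  thus ?case using Cons(1,3) by (simp add: P_def)
 qed
qed

text \<open>If \<open>t\<close> is an equivariant map with coefficients in the ideal, then averaging writes it as a sum of products \<open>r \<beta>\<close> with
  \<open>\<chi> r = 0\<close> and \<open>\<beta>\<close> in \<open>M\<close>.  Since \<open>[e, r \<beta>] = [r e, \<beta>]\<close> and \<open>r e\<close> lies in \<open>K\<close>, the bracket of \<open>E\<close> with \<open>t\<close> lies in \<open>K\<close>.\<close>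

lemma not_covers_ext_ideal: "\<not> covers (ext_ideal \<chi>)"
proof
 assume c: "covers (ext_ideal \<chi>)"
 note KD = mod_idealD[OF K_ideal]
 have pt0: "pt u 0 = 0" for u using pt_simps(2)[of u 0 0] by simp
 have *: "\<rho> (tb e (avg t)) = 0\<^sub>m n n" if t: "t \<in> gtens (ext_ideal \<chi>)" and e: "e \<in> E" for t e
  using t
 proof (induction t rule: gtens_induct)
  case zero
  thus ?case using ED(1)[OF e] by (simp add: avg_zero tb_right M_TT rep_zero)
 next
  case (add u f s)
  have eM: "e \<in> M" using ED(1)[OF e] .
  have split: "\<rho> (tb e (avg (t + t'))) = \<rho> (tb e (avg t)) + \<rho> (tb e (avg t'))" if "t \<in> TT" "t' \<in> TT" for t t'
   using that eM avg_M by (simp add: avg_add tb_right M_TT repD(2) M_closed)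
  have "\<rho> (tb e (avg (pt u f))) = 0\<^sub>m n n" using add(1)
  proof (induction f rule: ext_ideal_induct)
   case zero
   thus ?case using eM by (simp add: pt0 avg_zero tb_right M_TT rep_zero)
  next
   case (add r a s)
   have k: "amul r e \<in> K" using \<chi>[OF add(1) e] add(2) by simp
   have am: "avg (pt u a) \<in> M" by (rule avg_M) (rule TT_pt)
   have "pt u (r * a) = amul r (pt u a)" by (simp add: amul_simps)
   hence "tb e (avg (pt u (r * a))) = tb (amul r e) (avg (pt u a))"
    using add(1) eM am by (simp add: avg_amul TT_pt tb_amul_left tb_amul_right M_TT)
   hence "\<rho> (tb e (avg (pt u (r * a)))) = 0\<^sub>m n n" using rep_tb_zero[OF K_M[OF k] am] k by (simp add: K_def)
   thus ?case using add split[of "pt u (r * a)" "pt u s"] by (simp add: pt_simps TT_pt)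
  qed
  thus ?case using add split[of "pt u f" s] by (simp add: TT_pt gtens_TT)
 qed
 have "\<rho> (tb e e') = 0\<^sub>m n n" if e: "e \<in> E" "e' \<in> E" for e e'
 proof -
  obtain t where t: "t \<in> M" "t \<in> gtens (ext_ideal \<chi>)" "e' - t \<in> K" using c e(2) unfolding covers_def by blast
  have M: "e \<in> M" "e' \<in> M" using e ED(1) by auto
  have "tb e e' - tb e t \<in> K" using KD(5)[OF M(1) t(3)] lie_bracket_diff(2)[OF MM_closed M(2) t(1) M(1)] by simp
  hence "\<rho> (tb e e') = \<rho> (tb e t)" using rep_eq_iff M_closed(5) M t(1) by metis
  thus ?thesis using *[OF t(2) e(1)] avg_id[OF t(1)] by simp
 qed
 thus False using not_abelian by blast
qed

text \<open>A map that vanishes at \<open>x\<close> vanishes on the orbit of \<open>x\<close>, and then its coefficients are nilpotent modulo the ideal generated by the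
  kernel of \<open>\<chi>\<close>.  So the opposite would contradict the two lemmas above.\<close>

lemma nonvanishing_at_point:
 assumes x: "x \<in> X" "!!r. r \<in> R ==> x r = \<chi> r"
 shows "\<exists>e\<in>E. \<forall>z\<in>M. val x z = 0 \<longrightarrow> e - z \<notin> K"
proof (rule ccontr)
 assume "\<not> ?thesis"
 hence h: "\<exists>z\<in>M. val x z = 0 & e - z \<in> K" if "e \<in> E" for e using that by blast
 have "(r \<in> R & x r = 0) = (r \<in> R & \<chi> r = 0)" for r using x(2) by auto
 hence eq: "ext_ideal x = ext_ideal \<chi>" by (simp only: ext_ideal_def)
 have "covers {f. \<exists>m. powA f m \<in> ext_ideal x}"
  unfolding covers_def
 proof
  fix e assume "e \<in> E"
  then obtain z where z: "z \<in> M" "val x z = 0" "e - z \<in> K" using h by blast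
  have "z \<in> gtens {f. \<forall>y\<in>orb x. y f = 0}"
  proof (rule vanishing_coefficients[OF M_TT[OF z(1)]])
   show "orb x \<subseteq> X" using orb_in_X[OF x(1)] by blast
   show "val y z = 0" if "y \<in> orb x" for y
    using that val_point_act[OF z(1) x(1)] z(2) actg_zero unfolding orb_iff by auto
  qed
  moreover have "{f. \<forall>y\<in>orb x. y f = 0} \<subseteq> {f. \<exists>m. powA f m \<in> ext_ideal x}"
  proof
   fix f assume f: "f \<in> {f. \<forall>y\<in>orb x. y f = 0}"
   have "x (actA D g f) = 0" if g: "g \<in> \<Gamma>" for g
   proof -
    have "pact (ginv g) x \<in> orb x" unfolding orb_iff by (rule bexI[OF refl \<Gamma>.inv_closed[OF g]])
    thus ?thesis using f by (simp add: point_act_apply[OF g])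
   qed
   thus "f \<in> {f. \<exists>m. powA f m \<in> ext_ideal x}" using orbit_vanishing_nilpotent[OF x(1)] by blast
  qed
  ultimately show "\<exists>t\<in>M \<inter> gtens {f. \<exists>m. powA f m \<in> ext_ideal x}. e - t \<in> K" using gtens_mono z by blast
 qed
 hence "covers (ext_ideal x)" by (rule covers_finite[OF ext_ideal_ideal])
 thus False using not_covers_ext_ideal eq by simp
qed

end

context traceless_irreducible
begin

definition ker_plus_K :: "('a => 'k) list => ('k, 'g, 'a) tens set" where
 "ker_plus_K xs = {\<xi> \<in> M. \<exists>z\<in>ker_eval xs. \<xi> - z \<in> K}"

lemma mod_ideal_ker_plus_K:
 assumes xs: "set xs \<subseteq> X" shows "mod_ideal (ker_plus_K xs)"
proof -
 note KD = mod_idealD[OF K_ideal]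
 note ZD = mod_idealD[OF ker_eval_ideal[OF xs]]
 have "K \<subseteq> ker_plus_K xs" using K_M ZD(2) unfolding ker_plus_K_def by force
 moreover have "lie_ideal MM (ker_plus_K xs)"
  unfolding lie_ideal_def MM_simps
 proof (intro conjI ballI allI)
  show "ker_plus_K xs \<subseteq> M" by (auto simp: ker_plus_K_def)
  show "0 \<in> ker_plus_K xs" using KD(2) \<open>K \<subseteq> _\<close> by blast
  show "a + b \<in> ker_plus_K xs" if ab: "a \<in> ker_plus_K xs" "b \<in> ker_plus_K xs" for a b
  proof -
   obtain y z where h: "y \<in> ker_eval xs" "a - y \<in> K" "z \<in> ker_eval xs" "b - z \<in> K" using ab unfolding ker_plus_K_def by blast
   have "a + b - (y + z) = (a - y) + (b - z)" by (simp only: algebra_simps)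
   hence "a + b - (y + z) \<in> K" using KD(3)[OF h(2,4)] by (simp only:)
   thus ?thesis using ab ZD(3)[OF h(1,3)] M_closed(2) unfolding ker_plus_K_def by blast
  qed
  show "tens_scale c a \<in> ker_plus_K xs" if a: "a \<in> ker_plus_K xs" for c a
  proof -
   obtain y where h: "y \<in> ker_eval xs" "a - y \<in> K" using a unfolding ker_plus_K_def by blast
   have "tens_scale c a - tens_scale c y \<in> K" using KD(4)[OF h(2), of c] by (simp add: T.scale_right_diff_distrib)
   thus ?thesis using a ZD(4)[OF h(1)] M_closed(3) unfolding ker_plus_K_def by blast
  qed
  fix x a assume x: "x \<in> M" and a: "a \<in> ker_plus_K xs"
  obtain y where h: "y \<in> ker_eval xs" "a - y \<in> K" using a unfolding ker_plus_K_def by blast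
  have aM: "a \<in> M" "y \<in> M" using a h ZD(1) unfolding ker_plus_K_def by auto
  have "tb x a - tb x y \<in> K" "tb a x - tb y x \<in> K"
   using KD(5)[OF x h(2)] KD(6)[OF x h(2)] lie_bracket_diff[OF MM_closed aM x] by simp_all
  thus "tb x a \<in> ker_plus_K xs" "tb a x \<in> ker_plus_K xs"
   using ZD(5)[OF x h(1)] ZD(6)[OF x h(1)] M_closed(5) x aM unfolding ker_plus_K_def by blast+
 qed
 ultimately show ?thesis by (simp add: mod_ideal_def)
qed

text \<open>The orbit of the new point \<open>x\<close> does not meet \<open>xs\<close>, because the elements of \<open>E\<close> are congruent to maps that vanish on the orbits of
  the points in \<open>xs\<close>, and not all of them to maps that vanish at \<open>x\<close>.\<close>

lemma separated_extend:
 assumes xs: "separated xs" and ne: "ker_plus_K xs ~= K"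
 obtains x where "separated (x # xs)" "ker_plus_K (x # xs) \<subset> ker_plus_K xs"
proof -
 have xsX: "set xs \<subseteq> X" using xs by (auto simp: separated_def)
 obtain E where E: "mod_ideal E" "E ~= K" "E \<subseteq> ker_plus_K xs" "!!E'. mod_ideal E' ==> E' \<subseteq> E ==> E' = K \<or> E' = E"
  using minimal_ideal_exists[OF mod_ideal_ker_plus_K[OF xsX] ne] by blast
 interpret E: minimal_ideal D n \<rho> E by unfold_locales (use E in auto)
 obtain x where x: "x \<in> X" "!!r. r \<in> R ==> x r = E.\<chi> r" using lying_over[OF E.\<chi>_char] by blast
 obtain e where e: "e \<in> E" "!!z. z \<in> M ==> val x z = 0 ==> e - z \<notin> K" using E.nonvanishing_at_point[OF x] by blast
 have far: "x \<notin> orb y" if y: "y \<in> set xs" for y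
 proof
  assume "x \<in> orb y"
  then obtain g where g: "g \<in> \<Gamma>" "x = pact g y" by (auto simp: orb_iff)
  obtain z where z: "z \<in> M" "val y z = 0" "e - z \<in> K" using e(1) E(3) y unfolding ker_plus_K_def ker_eval_def by blast
  have "val x z = 0" using val_point_act[OF z(1) _ g(1), of y] y xsX g(1) z(2) actg_zero unfolding g(2) by auto
  thus False using e(2) z by blast
 qed
 hence "x \<notin> set xs" using orb_refl by blast
 moreover have "y \<notin> orb x" if "y \<in> set xs" for y using far[OF that] orb_sym by blast
 ultimately have "separated (x # xs)" using xs x(1) far by (auto simp: separated_def)
 moreover have "ker_plus_K (x # xs) \<subseteq> ker_plus_K xs" by (auto simp: ker_plus_K_def ker_eval_def)
 moreover have "e \<in> ker_plus_K xs" "e \<notin> ker_plus_K (x # xs)" using e E(3) by (auto simp: ker_plus_K_def ker_eval_def)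
 ultimately show ?thesis using that by blast
qed

text \<open>Adding points by \<open>separated_extend\<close> lowers the dimension of the image of \<open>ker_eval xs\<close> in \<open>M / K\<close> each time.\<close>

theorem factors_through_evaluation:
 obtains xs where "separated xs" "ker_eval xs \<subseteq> K"
proof -
 have "\<exists>ys. separated ys & ker_eval ys \<subseteq> K" if "separated xs" for xs
  using that
 proof (induction "vdim (n * n) (\<phi> ` ker_plus_K xs)" arbitrary: xs rule: less_induct)
  case less
  show ?case
  proof (cases "ker_plus_K xs = K")
   case True
   have "ker_eval xs \<subseteq> ker_plus_K xs"
    using mod_idealD(2)[OF K_ideal] unfolding ker_plus_K_def by (force simp: ker_eval_def)
   thus ?thesis using True less by blast
  next
   case False
   obtain x where x: "separated (x # xs)" "ker_plus_K (x # xs) \<subset> ker_plus_K xs" by (rule separated_extend[OF less(2) False])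
   have "vdim (n * n) (\<phi> ` ker_plus_K (x # xs)) < vdim (n * n) (\<phi> ` ker_plus_K xs)"
    by (rule mod_ideal_measure[OF mod_ideal_ker_plus_K mod_ideal_ker_plus_K x(2)]) (use x less in "auto simp: separated_def")
   thus ?thesis using less(1) x by blast
  qed
 qed
 from this[of "[]"] show ?thesis using that by (auto simp: separated_def)
qed

end

section \<open>Evaluation representations\<close>

lemma pull_rep_tensor: "pull_rep f (tensor \<pi> \<tau>) = tensor (pull_rep f \<pi>) (pull_rep f \<tau>)"
 by (cases \<pi>; cases \<tau>) (simp add: pull_rep_def tensor_rep_def)

lemma pull_rep_trivial: "pull_rep f trivial_rep = trivial_rep"
 by (simp add: pull_rep_def trivial_rep_def)

lemma pull_rep_pull_rep: "pull_rep f (pull_rep h \<pi>) = pull_rep (\<lambda>x. h (f x)) \<pi>"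
 by (simp add: pull_rep_def)

lemma pull_rep_pair: "pull_rep f (n, \<rho>) = (n, \<lambda>x. \<rho> (f x))" by (simp add: pull_rep_def)

lemma fst_pull_rep [simp]: "fst (pull_rep f \<pi>) = fst \<pi>" and snd_pull_rep [simp]: "snd (pull_rep f \<pi>) x = snd \<pi> (f x)"
 by (simp_all add: pull_rep_def)

definition lie_hom :: "('k::field, 'h::ab_group_add) lie_struct => ('k, 'l::ab_group_add) lie_struct => ('h => 'l) => bool" where
 "lie_hom H L f \<longleftrightarrow> (\<forall>x\<in>carr H. f x \<in> carr L) &
  (\<forall>x\<in>carr H. \<forall>y\<in>carr H. f (x + y) = f x + f y & f (lie_bracket H x y) = lie_bracket L (f x) (f y)) &
  (\<forall>c. \<forall>x\<in>carr H. f (lie_scale H c x) = lie_scale L c (f x))"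

lemma is_rep_pull_rep: "lie_hom H L f ==> is_rep L \<pi> ==> is_rep H (pull_rep f \<pi>)"
 by (cases \<pi>) (simp add: is_rep_pair pull_rep_pair lie_hom_def)

lemma rep_iso_pull_rep: "lie_hom H L f ==> rep_iso L \<pi> \<tau> ==> rep_iso H (pull_rep f \<pi>) (pull_rep f \<tau>)"
 by (cases \<pi>; cases \<tau>) (auto simp: rep_iso_def pull_rep_pair lie_hom_def)

lemma irr_fam_pull:
 assumes i: "irr_fam n S \<nu>" and f: "!!x. x \<in> S' ==> f x \<in> S" "!!s. s \<in> S ==> \<exists>x\<in>S'. f x = s"
 shows "irr_fam n S' (\<lambda>x. \<nu> (f x))"
 unfolding irr_fam_def
proof (intro conjI ballI allI impI)
 show "n > 0" by (rule irr_famD(1)[OF i])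
 show "\<nu> (f x) \<in> Mat n n" if "x \<in> S'" for x using irr_famD(2)[OF i f(1)[OF that]] .
 fix W assume W: "vsub n W & (\<forall>x\<in>S'. \<forall>w\<in>W. \<nu> (f x) *\<^sub>v w \<in> W)"
 show "W = {0\<^sub>v n} \<or> W = Vec n"
 proof (rule irr_famD(3)[OF i])
  show "vsub n W" using W by blast
  fix s w assume "s \<in> S" "w \<in> W"
  thus "\<nu> s *\<^sub>v w \<in> W" using f(2) W by metis
 qed
qed

lemma irr_fam_push:
 assumes i: "irr_fam n S' \<rho>" and f: "!!x. x \<in> S' ==> f x \<in> S & \<nu> (f x) = \<rho> x" and c: "!!s. s \<in> S ==> \<nu> s \<in> Mat n n"
 shows "irr_fam n S \<nu>"
 unfolding irr_fam_def
proof (intro conjI ballI allI impI c)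
 show "n > 0" by (rule irr_famD(1)[OF i])
 fix W assume W: "vsub n W & (\<forall>x\<in>S. \<forall>w\<in>W. \<nu> x *\<^sub>v w \<in> W)"
 show "W = {0\<^sub>v n} \<or> W = Vec n"
 proof (rule irr_famD(3)[OF i])
  show "vsub n W" using W by blast
  fix x w assume "x \<in> S'" "w \<in> W"
  thus "\<rho> x *\<^sub>v w \<in> W" using f W by metis
 qed
qed

lemma fst_tensor_list: "fst (tensor_list \<rho>s) = prod_list (map fst \<rho>s)"
proof (induction \<rho>s)
 case (Cons \<pi> \<rho>s)
 have "fst (tensor \<pi> \<tau>) = fst \<pi> * fst \<tau>" for \<tau> :: "('b, 'a) rep" by (simp add: tensor_rep_def case_prod_unfold)
 thus ?case using Cons by simp
qed (simp add: trivial_rep_def)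

lemma rep_iso_trivial_tensor:
 assumes r: "is_rep L \<pi>" shows "rep_iso L (tensor trivial_rep \<pi>) \<pi>"
proof -
 obtain n \<rho> where \<pi>: "\<pi> = (n, \<rho>)" by (cases \<pi>)
 have t: "tensor trivial_rep \<pi> = (1 * n, \<lambda>x. ksum 1 n (0\<^sub>m 1 1) (\<rho> x))"
  unfolding trivial_rep_def \<pi> tensor_rep_pair by simp
 have eq: "ksum 1 n (0\<^sub>m 1 1) (\<rho> x) = \<rho> x" if "x \<in> carr L" for x
 proof -
  have "(0\<^sub>m 1 1 :: 'a mat) = form_mat 0" by (intro eq_matI) (auto simp: form_mat_def)
  moreover have "0 \<cdot>\<^sub>m 1\<^sub>m n + \<rho> x = \<rho> x" using is_repD(1)[OF r[unfolded \<pi>] that] by (intro eq_matI) auto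
  ultimately show ?thesis using ksum_form_left[OF is_repD(1)[OF r[unfolded \<pi>] that]] by simp
 qed
 have "is_rep L (tensor trivial_rep \<pi>)" by (rule is_rep_tensor[OF is_rep_trivial r])
 hence "is_rep L (n, \<lambda>x. ksum 1 n (0\<^sub>m 1 1) (\<rho> x))" unfolding t by simp
 hence "rep_iso L (n, \<lambda>x. ksum 1 n (0\<^sub>m 1 1) (\<rho> x)) (n, \<rho>)" using eq by (rule rep_iso_eqI)
 thus ?thesis unfolding t unfolding \<pi> by simp
qed

lemma rep_iso_tensor_list_tensor:
 assumes "!!x. x \<in> set xs ==> is_rep L (\<rho> x)" "!!x. x \<in> set xs ==> is_rep L (\<nu> x)"
 shows "rep_iso L (tensor_list (map (\<lambda>x. tensor (\<rho> x) (\<nu> x)) xs))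
  (tensor (tensor_list (map \<rho> xs)) (tensor_list (map \<nu> xs)))"
 using assms
proof (induction xs)
 case Nil
 show ?case using rep_iso_sym[OF _ _ rep_iso_trivial_tensor] is_rep_tensor is_rep_trivial by fastforce
next
 case (Cons x xs)
 let ?r = "tensor_list (map \<rho> xs)" and ?s = "tensor_list (map \<nu> xs)"
 let ?t = "tensor_list (map (\<lambda>x. tensor (\<rho> x) (\<nu> x)) xs)"
 have r: "is_rep L (\<rho> x)" "is_rep L (\<nu> x)" "is_rep L ?r" "is_rep L ?s" "is_rep L ?t"
  using Cons(2,3) by (auto intro!: is_rep_tensor_list is_rep_tensor)
 note rs = is_rep_tensor[OF r(3,4)] and rt = is_rep_tensor[OF r(1,2)]
 note srs = is_rep_tensor[OF r(2) rs] and ss = is_rep_tensor[OF r(2,4)]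
 note rss = is_rep_tensor[OF r(3) ss]
 have 1: "rep_iso L (tensor (tensor (\<rho> x) (\<nu> x)) ?t) (tensor (tensor (\<rho> x) (\<nu> x)) (tensor ?r ?s))"
  by (rule rep_iso_tensor[OF rt rt r(5) rs rep_iso_refl[OF rt]]) (use Cons in auto)
 have 2: "rep_iso L (tensor (tensor (\<rho> x) (\<nu> x)) (tensor ?r ?s)) (tensor (\<rho> x) (tensor (\<nu> x) (tensor ?r ?s)))"
  by (rule rep_iso_sym[OF is_rep_tensor[OF r(1) srs] is_rep_tensor[OF rt rs] rep_iso_tensor_assoc[OF r(1,2) rs]])
 have 3: "rep_iso L (tensor (\<rho> x) (tensor (\<nu> x) (tensor ?r ?s))) (tensor (\<rho> x) (tensor ?r (tensor (\<nu> x) ?s)))"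
  by (rule rep_iso_tensor[OF r(1) r(1) srs rss rep_iso_refl[OF r(1)] rep_iso_tensor_swap[OF r(2,3,4)]])
 have 4: "rep_iso L (tensor (\<rho> x) (tensor ?r (tensor (\<nu> x) ?s))) (tensor (tensor (\<rho> x) ?r) (tensor (\<nu> x) ?s))"
  by (rule rep_iso_tensor_assoc[OF r(1,3) ss])
 note tr = is_rep_tensor[OF rt r(5)] is_rep_tensor[OF rt rs] is_rep_tensor[OF r(1) srs] is_rep_tensor[OF r(1) rss]
  is_rep_tensor[OF is_rep_tensor[OF r(1,3)] ss]
 show ?case
  using rep_iso_trans[OF tr(1,2,5) 1 rep_iso_trans[OF tr(2,3,5) 2 rep_iso_trans[OF tr(3,4,5) 3 4]]] by simp
qed

context equivariant_map_algebra
begin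

abbreviation "evr \<equiv> eval_rep D"

lemma eval_rep_tensor_list: "evr xs \<rho> = tensor_list (map (\<lambda>x. pull_rep (val x) (\<rho> x)) xs)"
 unfolding eval_rep_def outer_tensor_rep_def
 by (induction xs) (simp_all add: pull_rep_trivial pull_rep_tensor pull_rep_pull_rep)

lemma val_hom: "x \<in> X ==> lie_hom MM (FA x) (val x)"
 unfolding lie_hom_def by (simp add: val_in_FA val_simps val_tb M_TT)

lemma is_rep_eval:
 assumes "set xs \<subseteq> X" "!!x. x \<in> set xs ==> is_rep (FA x) (\<rho> x)" shows "is_rep MM (evr xs \<rho>)"
 unfolding eval_rep_tensor_list
proof (rule is_rep_tensor_list)
 fix \<pi> assume "\<pi> \<in> set (map (\<lambda>x. pull_rep (val x) (\<rho> x)) xs)"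
 then obtain x where x: "x \<in> set xs" "\<pi> = pull_rep (val x) (\<rho> x)" by auto
 show "is_rep MM \<pi>" unfolding x(2) by (rule is_rep_pull_rep[OF val_hom assms(2)[OF x(1)]]) (use assms(1) x(1) in blast)
qed

lemma eval_rep_cong:
 "(!!x. x \<in> set xs ==> \<rho> x = \<nu> x) ==> evr xs \<rho> = evr xs \<nu>"
 unfolding eval_rep_tensor_list by (intro arg_cong[of _ _ tensor_list] map_cong refl) simp

lemma eval_surjective_separated:
 assumes xs: "separated xs" and x: "x \<in> set xs" and u: "u \<in> carr (FA x)"
 obtains \<xi> where "\<xi> \<in> M" "val x \<xi> = u" "!!y. y \<in> set xs ==> y ~= x ==> val y \<xi> = 0"
proof -
 have "x \<in> X" "set xs - {x} \<subseteq> X" "!!y. y \<in> set xs - {x} ==> y \<notin> orb x" using xs x by (auto simp: separated_def)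
 thus ?thesis using eval_surjective_at[of x "set xs - {x}" u] u that by (metis DiffI List.finite_set finite_Diff singletonD)
qed

definition only_at :: "('a => 'k) list => ('a => 'k) => ('k, 'g, 'a) tens set" where
 "only_at xs x = {\<xi> \<in> M. \<forall>y\<in>set xs. y ~= x \<longrightarrow> val y \<xi> = 0}"

lemma irr_fam_only_at:
 assumes xs: "separated xs" and x: "x \<in> set xs" and \<rho>: "irrep (FA x) (n, \<rho>)"
 shows "irr_fam n (only_at xs x) (\<lambda>\<xi>. \<rho> (val x \<xi>))"
proof (rule irr_fam_pull[of n "carr (FA x)" \<rho> _ "val x"])
 show "irr_fam n (carr (FA x)) \<rho>" using \<rho> by (simp add: irreducible_rep_iff)
 have xX: "x \<in> X" using xs x by (auto simp: separated_def)
 show "val x \<xi> \<in> carr (FA x)" if "\<xi> \<in> only_at xs x" for \<xi> using that xX by (auto simp: only_at_def val_in_FA)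
 show "\<exists>\<xi>\<in>only_at xs x. val x \<xi> = u" if u: "u \<in> carr (FA x)" for u
 proof -
  obtain \<xi> where "\<xi> \<in> M" "val x \<xi> = u" "!!y. y \<in> set xs ==> y ~= x ==> val y \<xi> = 0"
   by (rule eval_surjective_separated[OF xs x u]) blast
  thus ?thesis by (intro bexI[of _ \<xi>]) (simp_all add: only_at_def)
 qed
qed

lemma rep_zero_at: "is_rep (FA x) \<pi> ==> snd \<pi> 0 = 0\<^sub>m (fst \<pi>) (fst \<pi>)"
 using is_rep_zero[OF FA_closed, of x "fst \<pi>" "snd \<pi>"] by simp

lemma irreducible_eval_rep:
 assumes xs: "separated xs" and \<rho>: "!!x. x \<in> set xs ==> irrep (FA x) (\<rho> x)"
 shows "irrep MM (evr xs \<rho>)"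
proof -
 have xX: "x \<in> X" if "x \<in> set xs" for x using xs that by (auto simp: separated_def)
 have d: "distinct xs" using xs by (simp add: separated_def)
 note r = irrep_is_rep[OF \<rho>]
 let ?L = "map (\<lambda>x. pull_rep (val x) (\<rho> x)) xs"
 have "irr_fam (fst (tensor_list ?L)) M (snd (tensor_list ?L))"
 proof (rule irr_tensor_list)
  fix \<pi> \<xi> assume "\<pi> \<in> set ?L" "\<xi> \<in> M"
  then obtain x where x: "x \<in> set xs" "\<pi> = pull_rep (val x) (\<rho> x)" by auto
  thus "snd \<pi> \<xi> \<in> Mat (fst \<pi>) (fst \<pi>)"
   using is_repD(1)[of "FA x" "fst (\<rho> x)" "snd (\<rho> x)"] r[OF x(1)] val_in_FA[OF \<open>\<xi> \<in> M\<close> xX[OF x(1)]] by simp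
 next
  fix i assume i: "i < length ?L"
  let ?S = "{\<xi> \<in> M. \<forall>j<length ?L. j ~= i \<longrightarrow> snd (?L ! j) \<xi> = 0\<^sub>m (fst (?L ! j)) (fst (?L ! j))}"
  have xi: "xs ! i \<in> set xs" using i by simp
  have "irr_fam (fst (\<rho> (xs ! i))) (only_at xs (xs ! i)) (\<lambda>\<xi>. snd (\<rho> (xs ! i)) (val (xs ! i) \<xi>))"
   by (rule irr_fam_only_at[OF xs xi]) (simp add: \<rho>[OF xi])
  moreover have "only_at xs (xs ! i) \<subseteq> ?S"
   using d i rep_zero_at[OF r] unfolding only_at_def by (auto simp: nth_eq_iff_index_eq)
  moreover have "snd (\<rho> (xs ! i)) (val (xs ! i) \<xi>) \<in> Mat (fst (\<rho> (xs ! i))) (fst (\<rho> (xs ! i)))" if "\<xi> \<in> M" for \<xi>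
   using is_repD(1)[of "FA (xs ! i)" "fst (\<rho> (xs ! i))" "snd (\<rho> (xs ! i))"] r[OF xi] val_in_FA[OF that xX[OF xi]] by simp
  ultimately have "irr_fam (fst (\<rho> (xs ! i))) ?S (\<lambda>\<xi>. snd (\<rho> (xs ! i)) (val (xs ! i) \<xi>))"
   by (intro irr_fam_extend[of _ "only_at xs (xs ! i)" _ ?S]) auto
  thus "irr_fam (fst (?L ! i)) ?S (snd (?L ! i))" using i by (simp add: pull_rep_def)
 qed
 moreover have "is_rep MM (tensor_list ?L)" using is_rep_eval[of xs \<rho>] r xX unfolding eval_rep_tensor_list by blast
 ultimately show ?thesis unfolding eval_rep_tensor_list
  using irreducible_rep_iff[of MM "fst (tensor_list ?L)" "snd (tensor_list ?L)"] by simp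
qed

lemma rep_factors_through_val:
 assumes x: "x \<in> X" and \<pi>: "irrep MM (m, \<pi>)" and z: "!!\<xi>. \<xi> \<in> M ==> val x \<xi> = 0 ==> \<pi> \<xi> = 0\<^sub>m m m"
 obtains \<nu> where "irrep (FA x) (m, \<nu>)" "!!\<xi>. \<xi> \<in> M ==> \<pi> \<xi> = \<nu> (val x \<xi>)"
proof -
 define s where "s u = (SOME \<xi>. \<xi> \<in> M & val x \<xi> = u)" for u
 have "\<exists>\<xi>. \<xi> \<in> M & val x \<xi> = u" if "u \<in> carr (FA x)" for u
  using eval_surjective_at[OF x, of "{}" u] that by auto
 hence s: "s u \<in> M" "val x (s u) = u" if "u \<in> carr (FA x)" for u
  using someI_ex[of "\<lambda>\<xi>. \<xi> \<in> M & val x \<xi> = u"] that unfolding s_def by auto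
 note r = irrep_is_rep[OF \<pi>]
 note rD = is_repD[OF r, unfolded MM_simps]
 have wd: "\<pi> \<xi> = \<pi> \<beta>" if "\<xi> \<in> M" "\<beta> \<in> M" "val x \<xi> = val x \<beta>" for \<xi> \<beta>
 proof -
  have "\<pi> (\<xi> - \<beta>) = 0\<^sub>m m m" using that by (intro z M_diff) (auto simp: val_diff x M_TT)
  hence "\<pi> \<xi> - \<pi> \<beta> = 0\<^sub>m m m" using is_rep_diff[OF MM_closed r that(1,2)] by simp
  thus ?thesis by (rule mat_eq_of_diff_zero[OF rD(1)[OF that(1)] rD(1)[OF that(2)]])
 qed
 define \<nu> where "\<nu> u = \<pi> (s u)" for u
 have \<nu>: "\<pi> \<xi> = \<nu> (val x \<xi>)" if "\<xi> \<in> M" for \<xi>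
  unfolding \<nu>_def using s[OF val_in_FA[OF that x]] by (intro wd[OF that]) auto
 have "is_rep (FA x) (m, \<nu>)"
  unfolding is_rep_pair FA_simps
 proof (intro conjI ballI allI)
  fix u assume u: "u \<in> carr (FA x)"
  show "\<nu> u \<in> Mat m m" using rD(1) s[OF u] by (simp add: \<nu>_def)
  show "\<nu> (scaleg D c u) = c \<cdot>\<^sub>m \<nu> u" for c
   using \<nu>[OF M_closed(3)[OF s(1)[OF u]], of c] rD(3)[OF s(1)[OF u]] s[OF u] \<nu>[OF s(1)[OF u]] by (simp add: val_simps x M_TT)
  fix v assume v: "v \<in> carr (FA x)"
  show "\<nu> (u + v) = \<nu> u + \<nu> v"
   using \<nu>[OF M_closed(2)[OF s(1)[OF u] s(1)[OF v]]] rD(2)[OF s(1)[OF u] s(1)[OF v]] s[OF u] s[OF v] \<nu>[OF s(1)[OF u]] \<nu>[OF s(1)[OF v]]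
   by (simp add: val_simps x M_TT)
  show "\<nu> (brg D u v) = \<nu> u * \<nu> v - \<nu> v * \<nu> u"
   using \<nu>[OF M_closed(5)[OF s(1)[OF u] s(1)[OF v]]] rD(4)[OF s(1)[OF u] s(1)[OF v]] s[OF u] s[OF v] \<nu>[OF s(1)[OF u]] \<nu>[OF s(1)[OF v]]
   by (simp add: val_tb x M_TT)
 qed
 moreover have "irr_fam m (carr (FA x)) \<nu>"
 proof (rule irr_fam_push)
  show "irr_fam m M \<pi>" using \<pi> by (simp add: irreducible_rep_iff)
  show "val x \<xi> \<in> carr (FA x) & \<nu> (val x \<xi>) = \<pi> \<xi>" if "\<xi> \<in> M" for \<xi> using \<nu> val_in_FA x that by auto
  show "\<nu> u \<in> Mat m m" if "u \<in> carr (FA x)" for u using rD(1) s[OF that] by (simp add: \<nu>_def)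
 qed
 ultimately have "irrep (FA x) (m, \<nu>)" by (simp add: irreducible_rep_iff)
 thus ?thesis using that \<nu> by blast
qed

lemma irreducible_zero_trivial:
 assumes \<eta>: "irrep MM (n, \<eta>)" and z: "!!\<xi>. \<xi> \<in> M ==> \<eta> \<xi> = 0\<^sub>m n n"
 shows "rep_iso MM (n, \<eta>) trivial_rep"
proof -
 have ir: "irr_fam n M \<eta>" and r: "is_rep MM (n, \<eta>)" using \<eta> by (auto simp: irreducible_rep_iff)
 have n: "n > 0" using irr_famD(1)[OF ir] .
 define Q :: "'k mat" where "Q = mat 1 n (\<lambda>_. 1)"
 have "n = 1"
 proof (rule schur_iso(1)[OF ir, of 1 "\<lambda>_. 0\<^sub>m 1 1" Q])
  show "irr_fam 1 M (\<lambda>_. 0\<^sub>m 1 1 :: 'k mat)" by (rule irr_fam_one) simp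
  show "Q ~= 0\<^sub>m 1 n"
  proof
   assume "Q = 0\<^sub>m 1 n"
   hence "Q $$ (0,0) = 0" using n by simp
   thus False using n by (simp add: Q_def)
  qed
 qed (auto simp: Q_def z)
 thus ?thesis unfolding trivial_rep_def using r z by (auto intro!: rep_iso_eqI)
qed

text \<open>The ideals of the maps vanishing at the first point and at the remaining points span \<open>M\<close> and meet in the kernel of \<open>\<eta>\<close>.  So the
  representation is a tensor product of one that depends on the value at the first point, and one to which induction applies.\<close>

theorem evaluation_decomposition:
 assumes "separated xs" "irrep MM (n, \<eta>)" "!!\<xi>. \<xi> \<in> ker_eval xs ==> \<eta> \<xi> = 0\<^sub>m n n"
 shows "\<exists>\<rho>. (\<forall>x\<in>set xs. irrep (FA x) (\<rho> x)) & rep_iso MM (n, \<eta>) (evr xs \<rho>)"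
 using assms
proof (induction xs arbitrary: n \<eta>)
 case Nil
 hence "rep_iso MM (n, \<eta>) trivial_rep" by (intro irreducible_zero_trivial) (auto simp: ker_eval_def)
 thus ?case by (simp add: eval_rep_tensor_list)
next
 case (Cons x xs)
 have x: "x \<in> X" "set xs \<subseteq> X" "x \<notin> set xs" "!!y. y \<in> set xs ==> y \<notin> orb x" and sep: "separated xs"
  using Cons(2) by (auto simp: separated_def)
 obtain m \<pi> d \<tau> where dec: "irrep MM (m, \<pi>)" "irrep MM (d, \<tau>)" "rep_iso MM (n, \<eta>) (tensor (m, \<pi>) (d, \<tau>))"
  "!!\<xi>. \<xi> \<in> ker_eval [x] ==> \<pi> \<xi> = 0\<^sub>m m m" "!!\<xi>. \<xi> \<in> ker_eval xs ==> \<tau> \<xi> = 0\<^sub>m d d"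
 proof (rule decompose_rep[OF MM_closed Cons(3), of "ker_eval xs" "ker_eval [x]"])
  show "lie_ideal MM (ker_eval xs)" "lie_ideal MM (ker_eval [x])" using x by (auto intro: ker_eval_ideal)
  show "\<exists>\<beta>\<in>ker_eval xs. \<xi> - \<beta> \<in> ker_eval [x]" if \<xi>: "\<xi> \<in> M" for \<xi>
  proof -
   obtain \<beta> where "\<beta> \<in> M" "val x \<beta> = val x \<xi>" "!!y. y \<in> set xs ==> val y \<beta> = 0"
    using eval_surjective_at[OF x(1) _ x(2) x(4) val_in_FA[OF \<xi> x(1)]] by blast
   thus ?thesis using \<xi> x(1) by (intro bexI[of _ \<beta>]) (auto simp: ker_eval_def M_diff val_diff M_TT)
  qed
  show "\<eta> \<xi> = 0\<^sub>m n n" if "\<xi> \<in> ker_eval xs" "\<xi> \<in> ker_eval [x]" for \<xi>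
   using that by (intro Cons(4)) (auto simp: ker_eval_def)
 qed blast+
 obtain \<rho> where \<rho>: "\<forall>y\<in>set xs. irrep (FA y) (\<rho> y)" "rep_iso MM (d, \<tau>) (evr xs \<rho>)"
  using Cons(1)[OF sep dec(2,5)] by blast
 obtain \<nu> where \<nu>: "irrep (FA x) (m, \<nu>)" "!!\<xi>. \<xi> \<in> M ==> \<pi> \<xi> = \<nu> (val x \<xi>)"
  using rep_factors_through_val[OF x(1) dec(1)] dec(4) by (auto simp: ker_eval_def)
 let ?\<rho> = "\<rho>(x := (m, \<nu>))"
 have eval: "evr (x # xs) ?\<rho> = tensor (pull_rep (val x) (m, \<nu>)) (evr xs \<rho>)"
 proof -
  have "evr xs ?\<rho> = evr xs \<rho>" by (rule eval_rep_cong) (use x(3) in auto)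
  thus ?thesis by (simp add: eval_rep_tensor_list del: fun_upd_apply) simp
 qed
 have r: "is_rep MM (m, \<pi>)" "is_rep MM (d, \<tau>)" "is_rep MM (evr xs \<rho>)" "is_rep MM (pull_rep (val x) (m, \<nu>))" "is_rep MM (n, \<eta>)"
  using irrep_is_rep[OF dec(1)] irrep_is_rep[OF dec(2)] is_rep_eval[OF x(2), of \<rho>] irrep_is_rep \<rho>(1)
   is_rep_pull_rep[OF val_hom[OF x(1)] irrep_is_rep[OF \<nu>(1)]] irrep_is_rep[OF Cons(3)] by blast+
 have "rep_iso MM (m, \<pi>) (pull_rep (val x) (m, \<nu>))" unfolding pull_rep_pair by (rule rep_iso_eqI[OF r(1)]) (simp add: \<nu>(2))
 hence "rep_iso MM (tensor (m, \<pi>) (d, \<tau>)) (evr (x # xs) ?\<rho>)" unfolding eval using r \<rho>(2) by (intro rep_iso_tensor)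
 hence "rep_iso MM (n, \<eta>) (evr (x # xs) ?\<rho>)"
  using rep_iso_trans[OF r(5) is_rep_tensor[OF r(1,2)] _ dec(3)] is_rep_tensor[OF r(4,3)] unfolding eval by blast
 moreover have "\<forall>y\<in>set (x # xs). irrep (FA y) (?\<rho> y)" using \<rho>(1) \<nu>(1) by auto
 ultimately show ?case by blast
qed

end

section \<open>Equivariant families of classes\<close>

context equivariant_map_algebra
begin

lemma separated_eq:
 assumes "separated xs" "x \<in> set xs" "y \<in> set xs" "y \<in> orb x" shows "x = y"
proof (rule ccontr)
 assume "x ~= y"
 moreover have "\<forall>x\<in>set xs. \<forall>y\<in>set xs. y ~= x \<longrightarrow> y \<notin> orb x" using assms(1) unfolding separated_def by (elim conjE)
 ultimately have "y \<notin> orb x" using assms(2,3) by simp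
 thus False using assms(4) by simp
qed

lemma actg_inv_hom:
 assumes g: "g \<in> \<Gamma>" shows "lie_hom (FA (pact g x)) (FA x) (actg D (ginv g))"
proof -
 note gi = \<Gamma>.inv_closed[OF g]
 have "actg D (ginv g) u \<in> carr (FA x)" if u: "u \<in> carr (FA (pact g x))" for u
  unfolding FA_iff
 proof (intro ballI impI)
  fix h assume h: "h \<in> \<Gamma>" "pact h x = x"
  let ?k = "gmult g (gmult h (ginv g))"
  have k: "?k \<in> \<Gamma>" using g h(1) gi by simp
  have "pact ?k (pact g x) = pact g x"
   using g gi h by (simp add: point_act_mult point_act_inv)
  hence "actg D ?k u = u" using u k unfolding FA_iff by blast
  hence "actg D g (actg D h (actg D (ginv g) u)) = u" using g gi h(1) by (simp add: act_mult)
  thus "actg D h (actg D (ginv g) u) = actg D (ginv g) u" using act_inv(3)[OF g] by metis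
 qed
 thus ?thesis unfolding lie_hom_def by (simp add: actg_hom[OF gi])
qed

lemma actg_lie_hom:
 assumes g: "g \<in> \<Gamma>" shows "lie_hom (FA x) (FA (pact g x)) (actg D g)"
 using actg_inv_hom[OF \<Gamma>.inv_closed[OF g], of "pact g x"] g by (simp add: point_act_inv)

lemma class_act_iso_class:
 assumes g: "g \<in> \<Gamma>" and \<pi>: "is_rep (FA x) \<pi>"
 shows "class_act D g (iso_class (FA x) \<pi>) = iso_class (FA (pact g x)) (pull_rep (actg D (ginv g)) \<pi>)"
proof
 show "class_act D g (iso_class (FA x) \<pi>) \<subseteq> iso_class (FA (pact g x)) (pull_rep (actg D (ginv g)) \<pi>)"
  unfolding class_act_def iso_class_def using is_rep_pull_rep[OF actg_inv_hom[OF g]] rep_iso_pull_rep[OF actg_inv_hom[OF g]] by blast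
 show "iso_class (FA (pact g x)) (pull_rep (actg D (ginv g)) \<pi>) \<subseteq> class_act D g (iso_class (FA x) \<pi>)"
 proof
  fix \<tau> assume "\<tau> \<in> iso_class (FA (pact g x)) (pull_rep (actg D (ginv g)) \<pi>)"
  hence \<tau>: "is_rep (FA (pact g x)) \<tau>" "rep_iso (FA (pact g x)) (pull_rep (actg D (ginv g)) \<pi>) \<tau>"
   by (auto simp: iso_class_def)
  have "pull_rep (actg D g) (pull_rep (actg D (ginv g)) \<pi>) = \<pi>" by (cases \<pi>) (simp add: pull_rep_def act_inv[OF g])
  hence "rep_iso (FA x) \<pi> (pull_rep (actg D g) \<tau>)" using rep_iso_pull_rep[OF actg_lie_hom[OF g] \<tau>(2)] by simp
  hence "pull_rep (actg D g) \<tau> \<in> iso_class (FA x) \<pi>" using is_rep_pull_rep[OF actg_lie_hom[OF g] \<tau>(1)] by (simp add: iso_class_def)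
  moreover have "\<tau> = pull_rep (actg D (ginv g)) (pull_rep (actg D g) \<tau>)" by (cases \<tau>) (simp add: pull_rep_def act_inv[OF g])
  ultimately show "\<tau> \<in> class_act D g (iso_class (FA x) \<pi>)" unfolding class_act_def by blast
 qed
qed

lemma class_act_mult:
 assumes "g \<in> \<Gamma>" "h \<in> \<Gamma>" shows "class_act D (gmult g h) C = class_act D g (class_act D h C)"
proof -
 have "actg D (ginv (gmult g h)) = (\<lambda>u. actg D (ginv h) (actg D (ginv g) u))"
  using assms by (intro ext) (simp add: \<Gamma>.inv_mult_group act_mult)
 thus ?thesis by (simp add: class_act_def image_image pull_rep_pull_rep)
qed

lemma class_act_zero: "g \<in> \<Gamma> ==> class_act D g (zero_class D x) = zero_class D (pact g x)"
 unfolding zero_class_def by (simp add: class_act_iso_class is_rep_trivial pull_rep_trivial)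

lemma irreducible_pull_actg:
 assumes g: "g \<in> \<Gamma>" and \<pi>: "irrep (FA x) \<pi>"
 shows "irrep (FA (pact g x)) (pull_rep (actg D (ginv g)) \<pi>)"
proof -
 obtain n p where p: "\<pi> = (n, p)" by (cases \<pi>)
 have "irr_fam n (carr (FA (pact g x))) (\<lambda>u. p (actg D (ginv g) u))"
 proof (rule irr_fam_pull[of n "carr (FA x)" p _ "actg D (ginv g)"])
  show "irr_fam n (carr (FA x)) p" using \<pi> by (simp add: p irreducible_rep_iff)
  show "actg D (ginv g) u \<in> carr (FA x)" if "u \<in> carr (FA (pact g x))" for u
   using actg_inv_hom[OF g, of x] that unfolding lie_hom_def by blast
  show "\<exists>v\<in>carr (FA (pact g x)). actg D (ginv g) v = u" if "u \<in> carr (FA x)" for u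
   using actg_lie_hom[OF g, of x] that act_inv(3)[OF g] unfolding lie_hom_def by blast
 qed
 thus ?thesis using is_rep_pull_rep[OF actg_inv_hom[OF g] irrep_is_rep[OF \<pi>]]
  by (simp add: p pull_rep_pair irreducible_rep_iff)
qed

lemma class_act_irr:
 assumes "g \<in> \<Gamma>" "C \<in> irr_classes (FA x)" shows "class_act D g C \<in> irr_classes (FA (pact g x))"
 using assms irreducible_pull_actg class_act_iso_class irrep_is_rep unfolding irr_classes_iff by metis

text \<open>The isotropy algebra consists of fixed vectors of the stabiliser.\<close>

lemma class_act_stabilizer:
 assumes h: "h \<in> \<Gamma>" "pact h x = x" and C: "C \<in> irr_classes (FA x)"
 shows "class_act D h C = C"
proof -
 obtain \<pi> where \<pi>: "irrep (FA x) \<pi>" "C = iso_class (FA x) \<pi>" using C unfolding irr_classes_iff by blast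
 obtain n p where p: "\<pi> = (n, p)" by (cases \<pi>)
 note r = irrep_is_rep[OF \<pi>(1)]
 have "pact (ginv h) x = x" using point_act_inv(1)[OF h(1), of x] h(2) by simp
 hence "actg D (ginv h) u = u" if "u \<in> carr (FA x)" for u
  using that \<Gamma>.inv_closed[OF h(1)] unfolding FA_iff by blast
 hence i: "rep_iso (FA x) \<pi> (pull_rep (actg D (ginv h)) \<pi>)" using r unfolding p pull_rep_pair by (intro rep_iso_eqI) auto
 have "is_rep (FA x) (pull_rep (actg D (ginv h)) \<pi>)"
  by (rule is_rep_pull_rep[OF actg_inv_hom[OF h(1), of x, unfolded h(2)] r])
 thus ?thesis unfolding \<pi>(2) class_act_iso_class[OF h(1) r] h(2) using iso_class_eq_iff[OF r] i by metis
qed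

lemma class_act_eq:
 assumes "g \<in> \<Gamma>" "h \<in> \<Gamma>" "pact g x = pact h x" "C \<in> irr_classes (FA x)"
 shows "class_act D g C = class_act D h C"
proof -
 note hi = \<Gamma>.inv_closed[OF assms(2)]
 have k: "gmult (ginv h) g \<in> \<Gamma>" using hi assms(1) by simp
 have "pact (gmult (ginv h) g) x = x" using assms hi by (simp add: point_act_mult point_act_inv)
 hence "class_act D (gmult (ginv h) g) C = C" by (rule class_act_stabilizer[OF k _ assms(4)])
 moreover have "gmult h (gmult (ginv h) g) = g" using assms(1,2) hi by (simp add: \<Gamma>.m_assoc[symmetric])
 ultimately show ?thesis using class_act_mult[OF assms(2) k, of C] by simp
qed

abbreviation "EC \<equiv> equivariant_classes D"

lemma ECD:
 assumes "\<Psi> \<in> EC"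
 shows "x \<in> X ==> \<Psi> x \<in> irr_classes (FA x)" "finite (supp D \<Psi>)" "supp D \<Psi> \<subseteq> X"
  "g \<in> \<Gamma> ==> x \<in> X ==> \<Psi> (pact g x) = class_act D g (\<Psi> x)" "\<Psi> \<in> extensional X"
 using assms unfolding equivariant_classes_def supp_def PiE_def by auto

lemma EC_mem:
 assumes "\<Psi> \<in> EC" "x \<in> X" "\<pi> \<in> \<Psi> x" shows "irrep (FA x) \<pi>" "\<Psi> x = iso_class (FA x) \<pi>"
 using irr_classes_mem[OF ECD(1)[OF assms(1,2)] assms(3)] by auto

lemma EC_rep: "\<Psi> \<in> EC ==> x \<in> X ==> \<pi> \<in> \<Psi> x ==> is_rep (FA x) \<pi>"
 by (rule irrep_is_rep[OF EC_mem(1)])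

lemma EC_nonempty: "\<Psi> \<in> EC ==> x \<in> X ==> (SOME \<pi>. \<pi> \<in> \<Psi> x) \<in> \<Psi> x"
 using irr_classes_nonempty[OF ECD(1)] by (metis someI)

lemma supp_orbit:
 assumes \<Psi>: "\<Psi> \<in> EC" and x: "x \<in> X" and y: "y \<in> orb x"
 shows "y \<in> supp D \<Psi> \<longleftrightarrow> x \<in> supp D \<Psi>"
proof -
 have *: "v \<in> supp D \<Psi>" if "w \<in> supp D \<Psi>" "v \<in> X" "w \<in> orb v" for v w
 proof -
  obtain g where g: "g \<in> \<Gamma>" "w = pact g v" using \<open>w \<in> orb v\<close> by (auto simp: orb_iff)
  have "\<Psi> v ~= zero_class D v"
  proof
   assume "\<Psi> v = zero_class D v"
   hence "\<Psi> w = zero_class D w" using ECD(4)[OF \<Psi> g(1) that(2)] class_act_zero[OF g(1)] g(2) by simp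
   thus False using that(1) by (simp add: supp_def)
  qed
  thus ?thesis using that(2) by (simp add: supp_def)
 qed
 show ?thesis using *[OF _ x y] *[OF _ orb_in_X[OF x y] orb_sym[OF y]] by blast
qed

text \<open>Carry the classes along the orbits; by \<open>class_act_eq\<close> the choice of the group element does not matter.\<close>

lemma extend_classes:
 assumes xs: "separated xs" and C: "!!x. x \<in> set xs ==> C x \<in> irr_classes (FA x)"
 obtains \<Psi> where "\<Psi> \<in> EC" "!!x. x \<in> set xs ==> \<Psi> x = C x" "!!y. y \<in> supp D \<Psi> ==> \<exists>x\<in>set xs. y \<in> orb x"
proof -
 have xX: "x \<in> X" if "x \<in> set xs" for x using xs that by (auto simp: separated_def)
 define \<Psi> where "\<Psi> = (\<lambda>y\<in>X. if \<exists>x\<in>set xs. y \<in> orb x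
   then (SOME c. \<exists>x\<in>set xs. \<exists>g\<in>\<Gamma>. y = pact g x & c = class_act D g (C x)) else zero_class D y)"
 have val: "\<Psi> (pact g x) = class_act D g (C x)" if x: "x \<in> set xs" and g: "g \<in> \<Gamma>" for g x
 proof -
  have "(SOME c. \<exists>x'\<in>set xs. \<exists>h\<in>\<Gamma>. pact g x = pact h x' & c = class_act D h (C x')) = class_act D g (C x)"
  proof (rule some_equality)
   show "\<exists>x'\<in>set xs. \<exists>h\<in>\<Gamma>. pact g x = pact h x' & class_act D g (C x) = class_act D h (C x')" using x g by blast
   fix c assume "\<exists>x'\<in>set xs. \<exists>h\<in>\<Gamma>. pact g x = pact h x' & c = class_act D h (C x')"
   then obtain x' h where h: "x' \<in> set xs" "h \<in> \<Gamma>" "pact g x = pact h x'" "c = class_act D h (C x')" by blast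
   have "pact g x \<in> orb x" unfolding orb_iff by (rule bexI[OF refl g])
   moreover have "pact g x \<in> orb x'" unfolding orb_iff by (rule bexI[of _ h]) (fact h(3), fact h(2))
   ultimately have "x' \<in> orb x" using orb_trans orb_sym by blast
   hence "x' = x" using separated_eq[OF xs x h(1)] by simp
   thus "c = class_act D g (C x)" using class_act_eq[OF g h(2) _ C[OF x]] h(3,4) by simp
  qed
  moreover have "\<exists>x'\<in>set xs. pact g x \<in> orb x'" using x g unfolding orb_iff by blast
  ultimately show ?thesis using point_act_in[OF g xX[OF x]] by (simp add: \<Psi>_def)
 qed
 have out: "\<Psi> y = zero_class D y" if "y \<in> X" "\<not> (\<exists>x\<in>set xs. y \<in> orb x)" for y using that by (simp add: \<Psi>_def)
 have supp: "\<exists>x\<in>set xs. y \<in> orb x" if "y \<in> supp D \<Psi>" for y using out that unfolding supp_def by blast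
 have "\<Psi> \<in> EC"
  unfolding equivariant_classes_def
 proof (intro CollectI conjI ballI)
  have "\<Psi> y \<in> irr_classes (FA y)" if y: "y \<in> X" for y
  proof (cases "\<exists>x\<in>set xs. y \<in> orb x")
   case True
   then obtain x g where "x \<in> set xs" "g \<in> \<Gamma>" "y = pact g x" by (auto simp: orb_iff)
   thus ?thesis using val class_act_irr C by simp
  next
   case False
   thus ?thesis using out[OF y] irreducible_rep_one[of "FA y" "\<lambda>_. 0\<^sub>m 1 1"] is_rep_trivial[of "FA y"]
    unfolding zero_class_def trivial_rep_def irr_classes_iff by metis
  qed
  thus "\<Psi> \<in> (\<Pi>\<^sub>E x\<in>X. irr_classes (FA x))" by (auto simp: PiE_iff \<Psi>_def)
  have "supp D \<Psi> \<subseteq> (\<Union>x\<in>set xs. orb x)" using supp by blast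
  thus "finite (supp D \<Psi>)" by (rule finite_subset) (simp add: orb_finite)
  fix g y assume g: "g \<in> \<Gamma>" and y: "y \<in> X"
  show "\<Psi> (pact g y) = class_act D g (\<Psi> y)"
  proof (cases "\<exists>x\<in>set xs. y \<in> orb x")
   case True
   then obtain x h where x: "x \<in> set xs" "h \<in> \<Gamma>" "y = pact h x" by (auto simp: orb_iff)
   thus ?thesis using val[OF x(1), of "gmult g h"] val[OF x(1,2)] g by (simp add: point_act_mult class_act_mult)
  next
   case False
   have "pact g y \<in> orb y" using g by (auto simp: orb_iff)
   hence "\<not> (\<exists>x\<in>set xs. pact g y \<in> orb x)" using False orb_trans orb_sym by blast
   thus ?thesis using out[OF y False] out[OF point_act_in[OF g y]] class_act_zero[OF g] by simp
  qed
 qed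
 moreover have "\<Psi> x = C x" if "x \<in> set xs" for x
  using val[OF that \<Gamma>.one_closed] class_act_stabilizer[OF \<Gamma>.one_closed point_act_one C[OF that]] by (simp add: point_act_one)
 ultimately show ?thesis using that supp by blast
qed

lemma exists_cover:
 assumes "finite Z" "Z \<subseteq> X" "separated ys"
 shows "\<exists>xs. separated xs & set ys \<subseteq> set xs & set xs \<subseteq> set ys \<union> Z & (\<forall>z\<in>Z. \<exists>x\<in>set xs. z \<in> orb x)"
 using assms(1,2)
proof (induction Z rule: finite_induct)
 case empty
 thus ?case using assms(3) by blast
next
 case (insert z Z)
 then obtain xs where xs: "separated xs" "set ys \<subseteq> set xs" "set xs \<subseteq> set ys \<union> Z" "\<forall>z\<in>Z. \<exists>x\<in>set xs. z \<in> orb x" by blast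
 show ?case
 proof (cases "\<exists>x\<in>set xs. z \<in> orb x")
  case True
  thus ?thesis using xs by (intro exI[of _ xs]) blast
 next
  case False
  hence "z \<notin> set xs" "!!x. x \<in> set xs ==> x \<notin> orb z" using orb_refl orb_sym by blast+
  hence "separated (z # xs)" using xs(1) insert(4) False unfolding separated_def by auto
  thus ?thesis using xs orb_refl by (intro exI[of _ "z # xs"]) auto
 qed
qed

text \<open>Unlike a transversal of the support, a cover may contain points outside the support.  Thus several families have a
  cover in common.\<close>

definition cover :: "(('a => 'k) => ('k, 'g) rep set) => ('a => 'k) list => bool" where
 "cover \<Psi> xs \<longleftrightarrow> separated xs & (\<forall>z\<in>supp D \<Psi>. \<exists>x\<in>set xs. z \<in> orb x)"

lemma separated_in_X: "separated xs ==> x \<in> set xs ==> x \<in> X"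
 by (auto simp: separated_def)

text \<open>On equivariant maps, the value at \<open>g x\<close> is \<open>g\<close> applied to the value at \<open>x\<close>.\<close>

lemma eval_translate:
 assumes \<Psi>: "\<Psi> \<in> EC" and x: "x \<in> X" "y \<in> orb x" and \<rho>: "\<rho> \<in> \<Psi> x" and \<nu>: "\<nu> \<in> \<Psi> y"
 shows "rep_iso MM (pull_rep (val x) \<rho>) (pull_rep (val y) \<nu>)"
proof -
 obtain g where g: "g \<in> \<Gamma>" "y = pact g x" using x(2) by (auto simp: orb_iff)
 have y: "y \<in> X" by (rule orb_in_X[OF x])
 obtain \<pi> where \<pi>: "\<pi> \<in> \<Psi> x" "\<nu> = pull_rep (actg D (ginv g)) \<pi>"
  using \<nu> unfolding g(2) ECD(4)[OF \<Psi> g(1) x(1)] class_act_def by blast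
 obtain n p where p: "\<pi> = (n, p)" by (cases \<pi>)
 have r: "is_rep (FA x) \<rho>" "is_rep (FA x) \<pi>" "is_rep (FA y) \<nu>"
  using EC_rep[OF \<Psi> x(1) \<rho>] EC_rep[OF \<Psi> x(1) \<pi>(1)] EC_rep[OF \<Psi> y \<nu>] .
 note r' = is_rep_pull_rep[OF val_hom[OF x(1)] r(1)] is_rep_pull_rep[OF val_hom[OF x(1)] r(2)] is_rep_pull_rep[OF val_hom[OF y] r(3)]
 have "rep_iso (FA x) \<rho> \<pi>" using EC_mem(2)[OF \<Psi> x(1) \<rho>] \<pi>(1) iso_class_memD by blast
 hence "rep_iso MM (pull_rep (val x) \<rho>) (pull_rep (val x) \<pi>)" by (rule rep_iso_pull_rep[OF val_hom[OF x(1)]])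
 moreover have "rep_iso MM (pull_rep (val x) \<pi>) (pull_rep (val y) \<nu>)"
  using r'(2) unfolding p \<pi>(2) pull_rep_pair
  by (rule rep_iso_eqI) (simp add: g(2) val_point_act[OF _ x(1) g(1)] act_inv[OF g(1)])
 ultimately show ?thesis by (rule rep_iso_trans[OF r'])
qed

lemma is_rep_eval_EC:
 assumes "\<Psi> \<in> EC" "set xs \<subseteq> X" "!!x. x \<in> set xs ==> \<rho> x \<in> \<Psi> x" shows "is_rep MM (evr xs \<rho>)"
 by (rule is_rep_eval[OF assms(2) EC_rep[OF assms(1) _ assms(3)]]) (use assms(2) in blast)+

text \<open>A point outside the support contributes a trivial factor.\<close>

lemma eval_drop:
 assumes \<Psi>: "\<Psi> \<in> EC" and "set xs \<subseteq> X" "!!x. x \<in> set xs ==> \<rho> x \<in> \<Psi> x"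
 shows "rep_iso MM (evr xs \<rho>) (evr (filter (\<lambda>x. x \<in> supp D \<Psi>) xs) \<rho>)"
 using assms(2,3)
proof (induction xs)
 case Nil
 thus ?case using is_rep_eval[of "[]"] by (auto intro: rep_iso_refl)
next
 case (Cons x xs)
 let ?f = "filter (\<lambda>x. x \<in> supp D \<Psi>) xs"
 have x: "x \<in> X" "set xs \<subseteq> X" "\<rho> x \<in> \<Psi> x" and m: "!!y. y \<in> set xs ==> \<rho> y \<in> \<Psi> y" using Cons by auto
 have IH: "rep_iso MM (evr xs \<rho>) (evr ?f \<rho>)" using Cons(1)[OF x(2) m] .
 have r: "is_rep MM (evr xs \<rho>)" "is_rep MM (evr ?f \<rho>)"
  using is_rep_eval_EC[OF \<Psi> x(2) m] is_rep_eval_EC[OF \<Psi>, of ?f] x(2) m by auto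
 have rx: "is_rep MM (pull_rep (val x) (\<rho> x))"
  by (rule is_rep_pull_rep[OF val_hom[OF x(1)] irrep_is_rep[OF EC_mem(1)[OF \<Psi> x(1,3)]]])
 have e: "evr (x # zs) \<rho> = tensor (pull_rep (val x) (\<rho> x)) (evr zs \<rho>)" for zs
  by (simp add: eval_rep_tensor_list)
 show ?case
 proof (cases "x \<in> supp D \<Psi>")
  case True
  thus ?thesis using rep_iso_tensor[OF rx rx r rep_iso_refl[OF rx] IH] by (simp add: e)
 next
  case False
  hence "\<Psi> x = iso_class (FA x) trivial_rep" using x(1) by (simp add: supp_def zero_class_def)
  hence "rep_iso (FA x) (\<rho> x) trivial_rep" using x(3) iso_class_eq_iff[OF _ is_rep_trivial] EC_mem[OF \<Psi> x(1,3)] irrep_is_rep by metis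
  hence "rep_iso MM (pull_rep (val x) (\<rho> x)) trivial_rep" using rep_iso_pull_rep[OF val_hom[OF x(1)]] pull_rep_trivial by metis
  hence 1: "rep_iso MM (tensor (pull_rep (val x) (\<rho> x)) (evr xs \<rho>)) (tensor trivial_rep (evr ?f \<rho>))"
   by (rule rep_iso_tensor[OF rx is_rep_trivial r _ IH])
  have "rep_iso MM (tensor (pull_rep (val x) (\<rho> x)) (evr xs \<rho>)) (evr ?f \<rho>)"
   by (rule rep_iso_trans[OF is_rep_tensor[OF rx r(1)] is_rep_tensor[OF is_rep_trivial r(2)] r(2) 1 rep_iso_trivial_tensor[OF r(2)]])
  thus ?thesis using False by (simp add: e)
 qed
qed

text \<open>Drop the points outside the support.  What remains are two transversals, which are matched orbit by orbit.\<close>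

lemma eval_unique:
 assumes \<Psi>: "\<Psi> \<in> EC" and xs: "cover \<Psi> xs" and ys: "cover \<Psi> ys"
  and \<rho>: "!!x. x \<in> set xs ==> \<rho> x \<in> \<Psi> x" and \<nu>: "!!y. y \<in> set ys ==> \<nu> y \<in> \<Psi> y"
 shows "rep_iso MM (evr xs \<rho>) (evr ys \<nu>)"
proof -
 have sep: "separated xs" "separated ys" using xs ys by (auto simp: cover_def)
 have X: "set xs \<subseteq> X" "set ys \<subseteq> X" using sep by (auto simp: separated_def)
 define xs' where "xs' = filter (\<lambda>x. x \<in> supp D \<Psi>) xs"
 define ys' where "ys' = filter (\<lambda>x. x \<in> supp D \<Psi>) ys"
 have sub: "set xs' \<subseteq> set xs" "set ys' \<subseteq> set ys" by (auto simp: xs'_def ys'_def)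
 define b where "b x = (SOME y. y \<in> set ys' & y \<in> orb x)" for x
 have b: "b x \<in> set ys'" "b x \<in> orb x" if "x \<in> set xs'" for x
 proof -
  have x: "x \<in> supp D \<Psi>" "x \<in> X" using that X by (auto simp: xs'_def)
  then obtain y where y: "y \<in> set ys" "x \<in> orb y" using ys by (auto simp: cover_def)
  hence "y \<in> set ys' & y \<in> orb x" using x supp_orbit[OF \<Psi> x(2) orb_sym] orb_sym[OF y(2)] by (auto simp: ys'_def)
  thus "b x \<in> set ys'" "b x \<in> orb x" using someI[of "\<lambda>y. y \<in> set ys' & y \<in> orb x" y] by (auto simp: b_def)
 qed
 have one: "y = y'" if "y \<in> set ys" "y' \<in> set ys" "y' \<in> orb y" for y y'
  using separated_eq[OF sep(2) that] .
 have one': "x = x'" if "x \<in> set xs" "x' \<in> set xs" "x' \<in> orb x" for x x'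
  using separated_eq[OF sep(1) that] .
 have "inj_on b (set xs')"
 proof (rule inj_onI)
  fix x x' assume x: "x \<in> set xs'" "x' \<in> set xs'" "b x = b x'"
  have "x' \<in> orb x" using b(2)[OF x(1)] b(2)[OF x(2)] x(3) orb_sym orb_trans by metis
  thus "x = x'" using one' x sub by blast
 qed
 hence "distinct (map b xs')" using sep(1) by (simp add: distinct_map xs'_def separated_def)
 moreover have "distinct ys'" using sep(2) by (simp add: ys'_def separated_def)
 moreover have "set (map b xs') = set ys'"
 proof
  show "set (map b xs') \<subseteq> set ys'" using b by auto
  show "set ys' \<subseteq> set (map b xs')"
  proof
   fix y assume y: "y \<in> set ys'"
   hence "y \<in> supp D \<Psi>" by (simp add: ys'_def)
   then obtain x where x: "x \<in> set xs" "y \<in> orb x" using xs unfolding cover_def by blast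
   have xX: "x \<in> X" using x(1) X by blast
   have x': "x \<in> set xs'" using x(1) supp_orbit[OF \<Psi> xX x(2)] \<open>y \<in> supp D \<Psi>\<close> by (simp add: xs'_def)
   have "b x = y"
   proof (rule one)
    show "b x \<in> set ys" "y \<in> set ys" using b(1)[OF x'] y sub by auto
    show "y \<in> orb (b x)" using orb_trans[OF orb_sym[OF b(2)[OF x']] x(2)] .
   qed
   thus "y \<in> set (map b xs')" using x' by auto
  qed
 qed
 ultimately have ms: "mset (map b xs') = mset ys'" using set_eq_iff_mset_eq_distinct by blast
 let ?px = "\<lambda>x. pull_rep (val x) (\<rho> x)" and ?py = "\<lambda>y. pull_rep (val y) (\<nu> y)"
 have rpx: "is_rep MM (?px x)" if "x \<in> set xs" for x
  by (rule is_rep_pull_rep[OF val_hom irrep_is_rep[OF EC_mem(1)[OF \<Psi> _ \<rho>[OF that]]]]) (use X that in blast)+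
 have rpy: "is_rep MM (?py y)" if "y \<in> set ys" for y
  by (rule is_rep_pull_rep[OF val_hom irrep_is_rep[OF EC_mem(1)[OF \<Psi> _ \<nu>[OF that]]]]) (use X that in blast)+
 have 1: "rep_iso MM (evr xs \<rho>) (evr xs' \<rho>)" unfolding xs'_def by (rule eval_drop[OF \<Psi> X(1) \<rho>])
 have 4: "rep_iso MM (evr ys \<nu>) (evr ys' \<nu>)" unfolding ys'_def by (rule eval_drop[OF \<Psi> X(2) \<nu>])
 have 2: "rep_iso MM (tensor_list (map ?px xs')) (tensor_list (map (\<lambda>x. ?py (b x)) xs'))"
 proof (rule tensor_list_cong)
  have "rep_iso MM (?px x) (?py (b x))" if x: "x \<in> set xs'" for x
  proof (rule eval_translate[OF \<Psi> _ b(2)[OF x]])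
   show "x \<in> X" "\<rho> x \<in> \<Psi> x" "\<nu> (b x) \<in> \<Psi> (b x)" using x X sub \<rho> \<nu> b(1)[OF x] by auto
  qed
  thus "list_all2 (rep_iso MM) (map ?px xs') (map (\<lambda>x. ?py (b x)) xs')" by (simp add: list_all2_conv_all_nth)
  fix \<pi> assume "\<pi> \<in> set (map ?px xs') \<union> set (map (\<lambda>x. ?py (b x)) xs')"
  then consider x where "x \<in> set xs'" "\<pi> = ?px x" | x where "x \<in> set xs'" "\<pi> = ?py (b x)" by auto
  thus "is_rep MM \<pi>" using rpx rpy b(1) sub by cases blast+
 qed
 have 3: "rep_iso MM (tensor_list (map (\<lambda>x. ?py (b x)) xs')) (tensor_list (map ?py ys'))"
 proof (rule tensor_list_perm)
  have "mset (map ?py (map b xs')) = mset (map ?py ys')" using ms by (metis mset_map)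
  thus "mset (map (\<lambda>x. ?py (b x)) xs') = mset (map ?py ys')" by (simp add: comp_def)
  fix \<pi> assume "\<pi> \<in> set (map (\<lambda>x. ?py (b x)) xs')"
  then obtain x where "x \<in> set xs'" "\<pi> = ?py (b x)" by auto
  thus "is_rep MM \<pi>" using rpy b(1) sub by blast
 qed
 have r: "is_rep MM (evr xs \<rho>)" "is_rep MM (evr ys \<nu>)" "is_rep MM (evr xs' \<rho>)" "is_rep MM (evr ys' \<nu>)"
  by (rule is_rep_eval_EC[OF \<Psi>]; use X sub \<rho> \<nu> in blast)+
 have rm: "is_rep MM (tensor_list (map (\<lambda>x. ?py (b x)) xs'))"
 proof (rule is_rep_tensor_list)
  fix \<pi> assume "\<pi> \<in> set (map (\<lambda>x. ?py (b x)) xs')"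
  then obtain x where "x \<in> set xs'" "\<pi> = ?py (b x)" by auto
  thus "is_rep MM \<pi>" using rpy b(1) sub by blast
 qed
 have "rep_iso MM (evr xs' \<rho>) (evr ys' \<nu>)"
  using rep_iso_trans[OF _ rm _ 2 3] r(3,4) unfolding eval_rep_tensor_list by blast
 hence "rep_iso MM (evr xs' \<rho>) (evr ys \<nu>)" by (rule rep_iso_trans[OF r(3,4,2) _ rep_iso_sym[OF r(2,4) 4]])
 thus ?thesis by (rule rep_iso_trans[OF r(1,3,2) 1])
qed

lemma orbit_transversal_iff:
 assumes \<Psi>: "\<Psi> \<in> EC" shows "orbit_transversal D \<Psi> xs \<longleftrightarrow> cover \<Psi> xs & set xs \<subseteq> supp D \<Psi>"
proof
 assume t: "orbit_transversal D \<Psi> xs"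
 have s: "set xs \<subseteq> supp D \<Psi>" "distinct xs" using t by (auto simp: orbit_transversal_def)
 have u: "y = z" if "x \<in> supp D \<Psi>" "y \<in> set xs" "y \<in> orb x" "z \<in> set xs" "z \<in> orb x" for x y z
  using t that unfolding orbit_transversal_def by blast
 have "y \<notin> orb x" if "x \<in> set xs" "y \<in> set xs" "y ~= x" for x y
 proof
  assume "y \<in> orb x"
  moreover have "x \<in> supp D \<Psi>" using s(1) that(1) by blast
  ultimately show False using u[OF _ that(1) orb_refl that(2)] that(3) by simp
 qed
 hence "separated xs" using s ECD(3)[OF \<Psi>] by (simp add: separated_def subset_trans)
 moreover have "\<exists>x\<in>set xs. z \<in> orb x" if "z \<in> supp D \<Psi>" for z
  using t that orb_sym unfolding orbit_transversal_def by blast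
 ultimately show "cover \<Psi> xs & set xs \<subseteq> supp D \<Psi>" using s by (simp add: cover_def)
next
 assume c: "cover \<Psi> xs & set xs \<subseteq> supp D \<Psi>"
 hence sep: "separated xs" by (simp add: cover_def)
 have "\<exists>!y. y \<in> set xs \<inter> orb x" if x: "x \<in> supp D \<Psi>" for x
 proof -
  obtain y where y: "y \<in> set xs" "x \<in> orb y" using c x unfolding cover_def by blast
  show ?thesis
  proof (rule ex1I[of _ y])
   show "y \<in> set xs \<inter> orb x" using y orb_sym by blast
   fix z assume z: "z \<in> set xs \<inter> orb x"
   hence "z \<in> orb y" using y(2) orb_trans by blast
   thus "z = y" using separated_eq[OF sep y(1), of z] z by simp
  qed
 qed
 thus "orbit_transversal D \<Psi> xs" using c sep by (simp add: orbit_transversal_def separated_def)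
qed

lemma ev_class_eq:
 assumes \<Psi>: "\<Psi> \<in> EC" and xs: "cover \<Psi> xs" and \<rho>: "!!x. x \<in> set xs ==> \<rho> x \<in> \<Psi> x"
 shows "ev_class D \<Psi> = iso_class MM (evr xs \<rho>)"
proof -
 let ?S = "{iso_class MM (evr ys \<nu>) | ys \<nu>. orbit_transversal D \<Psi> ys & (\<forall>y\<in>set ys. \<nu> y \<in> \<Psi> y)}"
 have cX: "set ys \<subseteq> X" if "cover \<Psi> ys" for ys using that by (auto simp: cover_def separated_def)
 have "C = iso_class MM (evr xs \<rho>)" if "C \<in> ?S" for C
 proof -
  obtain ys \<nu> where C: "C = iso_class MM (evr ys \<nu>)" "cover \<Psi> ys" "!!y. y \<in> set ys ==> \<nu> y \<in> \<Psi> y"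
  proof -
   obtain ys \<nu> where "C = iso_class MM (evr ys \<nu>)" "orbit_transversal D \<Psi> ys" "\<forall>y\<in>set ys. \<nu> y \<in> \<Psi> y"
    using \<open>C \<in> ?S\<close> by blast
   thus thesis using orbit_transversal_iff[OF \<Psi>, of ys] by (intro that[of ys \<nu>]) simp_all
  qed
  have "rep_iso MM (evr ys \<nu>) (evr xs \<rho>)" by (rule eval_unique[OF \<Psi> C(2) xs C(3) \<rho>])
  thus ?thesis unfolding C(1)
   by (subst iso_class_eq_iff[OF is_rep_eval_EC[OF \<Psi> cX[OF C(2)] C(3)] is_rep_eval_EC[OF \<Psi> cX[OF xs] \<rho>]])
 qed
 moreover have "?S ~= {}"
 proof -
  obtain ys where ys: "separated ys" "set ys \<subseteq> supp D \<Psi>" "\<forall>z\<in>supp D \<Psi>. \<exists>y\<in>set ys. z \<in> orb y"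
   using exists_cover[OF ECD(2,3)[OF \<Psi>], of "[]"] by (auto simp: separated_def)
  hence "orbit_transversal D \<Psi> ys" using orbit_transversal_iff[OF \<Psi>] by (simp add: cover_def)
  moreover have "\<forall>y\<in>set ys. (SOME \<pi>. \<pi> \<in> \<Psi> y) \<in> \<Psi> y" using EC_nonempty[OF \<Psi>] ys(2) ECD(3)[OF \<Psi>] by blast
  ultimately have "iso_class MM (evr ys (\<lambda>y. SOME \<pi>. \<pi> \<in> \<Psi> y)) \<in> ?S" by blast
  thus ?thesis by blast
 qed
 ultimately have "?S = {iso_class MM (evr xs \<rho>)}" by blast
 thus ?thesis unfolding ev_class_def by simp
qed

end

section \<open>One-dimensional representations and linear forms\<close>

abbreviation form_rep :: "('l => 'k) => ('k::field, 'l) rep" where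
 "form_rep l \<equiv> (1, \<lambda>x. form_mat (l x))"

lemma form_class_eq: "form_class L l = iso_class L (form_rep l)"
 by (simp add: form_class_def form_mat_def)

lemma is_rep_form_iff:
 assumes L: "lie_closed L"
 shows "is_rep L (form_rep l) \<longleftrightarrow> (\<forall>x\<in>carr L. \<forall>y\<in>carr L. l (x + y) = l x + l y & l (lie_bracket L x y) = 0) &
  (\<forall>c. \<forall>x\<in>carr L. l (lie_scale L c x) = c * l x)"
 using is_rep_form[OF L, of l] is_rep_formD(2-4)[of L "\<lambda>x. form_mat (l x)"] by (auto simp del: One_nat_def)

lemma rep_iso_form_tensor:
 assumes L: "lie_closed L" and l: "is_rep L (form_rep l)" and r: "is_rep L (n, \<rho>)"
 shows "rep_iso L (tensor (form_rep l) (n, \<rho>)) (n, \<lambda>x. l x \<cdot>\<^sub>m 1\<^sub>m n + \<rho> x)"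
proof -
 have "is_rep L (tensor (form_rep l) (n, \<rho>))" by (rule is_rep_tensor[OF l r])
 hence "is_rep L (n, \<lambda>x. ksum 1 n (form_mat (l x)) (\<rho> x))" unfolding tensor_rep_pair by simp
 hence "rep_iso L (n, \<lambda>x. ksum 1 n (form_mat (l x)) (\<rho> x)) (n, \<lambda>x. l x \<cdot>\<^sub>m 1\<^sub>m n + \<rho> x)"
  by (rule rep_iso_eqI) (rule ksum_form_left[OF is_repD(1)[OF r]])
 thus ?thesis unfolding tensor_rep_pair by simp
qed

lemma irreducible_form_tensor:
 assumes L: "lie_closed L" and l: "is_rep L (form_rep l)" and \<pi>: "irrep L \<pi>"
 shows "irrep L (tensor (form_rep l) \<pi>)" "irrep L (tensor \<pi> (form_rep l))"
proof -
 obtain n \<rho> where p: "\<pi> = (n, \<rho>)" by (cases \<pi>)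
 have r: "is_rep L (n, \<rho>)" and ir: "irr_fam n (carr L) \<rho>" using \<pi> by (auto simp: p irreducible_rep_iff)
 note t = is_rep_tensor[OF l r]
 have "irr_fam n (carr L) (\<lambda>x. ksum 1 n (form_mat (l x)) (\<rho> x))"
  by (rule irr_fam_shift[OF ir]) (rule ksum_form_left[OF is_repD(1)[OF r]])
 thus *: "irrep L (tensor (form_rep l) \<pi>)"
  using t unfolding p tensor_rep_pair irreducible_rep_iff by simp
 show "irrep L (tensor \<pi> (form_rep l))"
  using irreducible_rep_iso[OF *[unfolded p] is_rep_tensor[OF r l] rep_iso_tensor_comm[OF l r]] unfolding p .
qed

lemma rep_iso_form_form_tensor:
 assumes L: "lie_closed L" and r: "is_rep L (form_rep a)" "is_rep L (form_rep b)" "is_rep L (form_rep c)" "is_rep L \<pi>"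
  and abc: "!!x. x \<in> carr L ==> c x = a x + b x"
 shows "rep_iso L (tensor (form_rep a) (tensor (form_rep b) \<pi>)) (tensor (form_rep c) \<pi>)"
proof -
 obtain n \<rho> where p: "\<pi> = (n, \<rho>)" by (cases \<pi>)
 have r4: "is_rep L (n, \<rho>)" using r(4) by (simp add: p)
 have t: "is_rep L (tensor (form_rep a) (tensor (form_rep b) \<pi>))" by (rule is_rep_tensor[OF r(1) is_rep_tensor[OF r(2,4)]])
 have "ksum 1 (1 * n) (form_mat (a x)) (ksum 1 n (form_mat (b x)) (\<rho> x)) = ksum 1 n (form_mat (c x)) (\<rho> x)"
  if x: "x \<in> carr L" for x
 proof -
  have \<rho>: "\<rho> x \<in> Mat n n" by (rule is_repD(1)[OF r4 x])
  have "ksum 1 n (form_mat (b x)) (\<rho> x) \<in> Mat n n" using ksum_carrier[OF form_mat_carrier \<rho>] by simp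
  thus ?thesis using \<rho> unfolding mult_1 ksum_form_left[OF \<rho>]
   by (subst ksum_form_left) (auto simp: abc[OF x] algebra_simps intro!: eq_matI)
 qed
 thus ?thesis using t unfolding p tensor_rep_pair mult_1 by (intro rep_iso_eqI) auto
qed

lemma tensor_list_forms:
 fixes c :: "'x => 'l => 'k::field"
 shows "tensor_list (map (\<lambda>x. form_rep (c x)) xs) = form_rep (\<lambda>\<xi>. \<Sum>x\<leftarrow>xs. c x \<xi>)"
proof (induction xs)
 case Nil
 have "form_mat 0 = (0\<^sub>m 1 1 :: 'k mat)" by (intro eq_matI) (auto simp: form_mat_def)
 thus ?case by (simp add: trivial_rep_def)
next
 case (Cons x xs)
 have "ksum 1 1 (form_mat a) (form_mat b) = form_mat (a + b)" for a b :: 'k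
  unfolding ksum_form_left[OF form_mat_carrier] by (rule eq_matI) (auto simp: form_mat_def)
 thus ?case using Cons by (simp add: tensor_rep_pair)
qed

lemma prod_list_one: "prod_list xs = (1::nat) ==> n \<in> set xs ==> n = 1"
 by (induction xs) auto

context equivariant_map_algebra
begin

lemma rep_iso_formD:
 "rep_iso MM (form_rep l) (form_rep l') ==> \<xi> \<in> M ==> l \<xi> = l' \<xi>"
proof -
 assume "rep_iso MM (form_rep l) (form_rep l')" and \<xi>: "\<xi> \<in> M"
 then obtain P Q where P: "P \<in> Mat 1 1" "Q \<in> Mat 1 1" "P * Q = 1\<^sub>m 1"
  and e: "P * form_mat (l \<xi>) = form_mat (l' \<xi>) * P" unfolding rep_iso_pair by blast
 have ix: "(A * B) $$ (0,0) = A $$ (0,0) * B $$ (0,0)" if "A \<in> Mat 1 1" "B \<in> Mat 1 1" for A B :: "'k mat"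
  using that by (simp add: scalar_prod_def)
 have "P $$ (0,0) * Q $$ (0,0) = 1" using ix[OF P(1,2)] P(3) by simp
 moreover have "P $$ (0,0) * l \<xi> = (P * form_mat (l \<xi>)) $$ (0,0)" by (simp only: ix[OF P(1) form_mat_carrier] form_mat_index)
 moreover have "(P * form_mat (l \<xi>)) $$ (0,0) = l' \<xi> * P $$ (0,0)" unfolding e by (simp only: ix[OF form_mat_carrier P(1)] form_mat_index)
 ultimately have "P $$ (0,0) ~= 0" "P $$ (0,0) * l \<xi> = P $$ (0,0) * l' \<xi>" by (metis mult_zero_left zero_neq_one, metis mult.commute)
 thus ?thesis by simp
qed

abbreviation "dual \<equiv> abelian_dual MM"

lemma dual_form_rep: assumes "l \<in> dual" shows "is_rep MM (form_rep l)"
proof -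
 have "l (tb \<xi> \<beta>) = 0" if "\<xi> \<in> M" "\<beta> \<in> M" for \<xi> \<beta>
 proof -
  have "tb \<xi> \<beta> \<in> derived MM" unfolding derived_def MM_simps using that by (intro T.span_base) blast
  thus ?thesis using assms by (simp add: abelian_dual_def)
 qed
 thus ?thesis using assms unfolding is_rep_form_iff[OF MM_closed] abelian_dual_def by simp
qed

lemma form_rep_dual:
 assumes l: "is_rep MM (form_rep l)" shows "restrict l M \<in> dual"
proof -
 note lD = l[unfolded is_rep_form_iff[OF MM_closed] MM_simps]
 have l0: "l 0 = 0" using lD M_closed(1) by (metis add_cancel_right_left)
 have "derived MM \<subseteq> {\<xi> \<in> M. l \<xi> = 0}"
  unfolding derived_def MM_simps
 proof (rule T.span_minimal)
  show "{tb x y |x y. x \<in> M & y \<in> M} \<subseteq> {\<xi> \<in> M. l \<xi> = 0}" using lD M_closed by auto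
  show "T.subspace {\<xi> \<in> M. l \<xi> = 0}" using lD M_closed l0 by (auto intro!: T.subspaceI)
 qed
 thus ?thesis using lD M_closed unfolding abelian_dual_def by (auto simp: subset_iff)
qed

lemma dual_ext: "l \<in> dual ==> l' \<in> dual ==> (!!\<xi>. \<xi> \<in> M ==> l \<xi> = l' \<xi>) ==> l = l'"
 by (rule extensionalityI[of _ M]) (auto simp: abelian_dual_def)

lemma form_class_inj:
 assumes "l \<in> dual" "l' \<in> dual" "form_class MM l = form_class MM l'" shows "l = l'"
proof (rule dual_ext[OF assms(1,2)])
 have "rep_iso MM (form_rep l) (form_rep l')"
  using assms(3) unfolding form_class_eq iso_class_eq_iff[OF dual_form_rep[OF assms(1)] dual_form_rep[OF assms(2)]] .
 thus "l \<xi> = l' \<xi>" if "\<xi> \<in> M" for \<xi> using rep_iso_formD that by blast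
qed

lemma class_form_form_class: "l \<in> dual ==> class_form MM (form_class MM l) = l"
 unfolding class_form_def by (rule the_equality) (auto intro: form_class_inj)

lemma ex_reps:
 assumes "\<Psi> \<in> EC" "set xs \<subseteq> X" obtains \<rho> where "!!x. x \<in> set xs ==> \<rho> x \<in> \<Psi> x"
proof -
 have "(SOME \<pi>. \<pi> \<in> \<Psi> x) \<in> \<Psi> x" if "x \<in> set xs" for x by (rule EC_nonempty[OF assms(1)]) (use assms(2) that in blast)
 thus ?thesis by (rule that)
qed

lemma cover_in_X: "cover \<Psi> xs ==> set xs \<subseteq> X"
 by (auto simp: cover_def separated_def)

lemma irreducible_ev:
 assumes \<Psi>: "\<Psi> \<in> EC" and xs: "separated xs" and \<rho>: "!!x. x \<in> set xs ==> \<rho> x \<in> \<Psi> x"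
 shows "irrep MM (evr xs \<rho>)"
 by (rule irreducible_eval_rep[OF xs EC_mem(1)[OF \<Psi> separated_in_X[OF xs] \<rho>]])

lemma form_tensor_ev_eq:
 assumes l: "l \<in> dual" and \<Psi>: "\<Psi> \<in> EC" and xs: "cover \<Psi> xs" and \<rho>: "!!x. x \<in> set xs ==> \<rho> x \<in> \<Psi> x"
 shows "form_tensor_ev D l \<Psi> = iso_class MM (tensor (form_rep l) (evr xs \<rho>))"
proof -
 have e: "ev_class D \<Psi> = iso_class MM (evr xs \<rho>)" by (rule ev_class_eq[OF \<Psi> xs \<rho>])
 show ?thesis unfolding form_tensor_ev_def form_class_eq e
  by (rule class_tensor_iso_class[OF dual_form_rep[OF l] is_rep_eval_EC[OF \<Psi> cover_in_X[OF xs] \<rho>]])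
qed

lemma exists_cover2:
 assumes \<Psi>: "\<Psi> \<in> EC" and \<Psi>': "\<Psi>' \<in> EC" and ys: "separated ys"
 obtains xs where "cover \<Psi> xs" "cover \<Psi>' xs" "set ys \<subseteq> set xs"
proof -
 have "finite (supp D \<Psi> \<union> supp D \<Psi>')" "supp D \<Psi> \<union> supp D \<Psi>' \<subseteq> X" using ECD(2,3)[OF \<Psi>] ECD(2,3)[OF \<Psi>'] by auto
 from exists_cover[OF this ys] show ?thesis using that unfolding cover_def by blast
qed

lemma exists_cover1:
 assumes \<Psi>: "\<Psi> \<in> EC" obtains xs where "cover \<Psi> xs"
proof -
 have "separated []" by (simp add: separated_def)
 thus ?thesis by (rule exists_cover2[OF \<Psi> \<Psi>]) (rule that)
qed

lemma form_tensor_ev_irr: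
 assumes l: "l \<in> dual" and \<Psi>: "\<Psi> \<in> EC" shows "form_tensor_ev D l \<Psi> \<in> irr_classes MM"
proof -
 obtain xs where xs: "cover \<Psi> xs" by (rule exists_cover1[OF \<Psi>])
 obtain \<rho> where \<rho>: "!!x. x \<in> set xs ==> \<rho> x \<in> \<Psi> x" by (rule ex_reps[OF \<Psi> cover_in_X[OF xs]]) blast
 have "separated xs" using xs by (simp add: cover_def)
 hence "irrep MM (evr xs \<rho>)" by (rule irreducible_ev[OF \<Psi> _ \<rho>])
 hence "irrep MM (tensor (form_rep l) (evr xs \<rho>))"
  by (rule irreducible_form_tensor(1)[OF MM_closed dual_form_rep[OF l]])
 moreover have "form_tensor_ev D l \<Psi> = iso_class MM (tensor (form_rep l) (evr xs \<rho>))"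
  by (rule form_tensor_ev_eq[OF l \<Psi> xs \<rho>])
 ultimately show ?thesis unfolding irr_classes_def by simp
qed

lemma irreducible_is_form_tensor_eval:
 assumes irr: "irrep MM (n, \<eta>)"
 obtains l xs \<rho> where "l \<in> dual" "separated xs" "!!x. x \<in> set xs ==> irrep (FA x) (\<rho> x)"
  "rep_iso MM (n, \<eta>) (tensor (form_rep l) (evr xs \<rho>))"
proof -
 obtain l \<eta>' where t: "is_rep MM (form_rep l)" "irrep MM (n, \<eta>')" "!!\<xi>. \<xi> \<in> M ==> mtrace (\<eta>' \<xi>) = 0"
  "!!\<xi>. \<xi> \<in> M ==> \<eta> \<xi> = l \<xi> \<cdot>\<^sub>m 1\<^sub>m n + \<eta>' \<xi>" by (rule traceless_twist[OF MM_closed irr]) blast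
 interpret ti: traceless_irreducible D n \<eta>' by unfold_locales (use t in auto)
 obtain xs where xs: "separated xs" "ker_eval xs \<subseteq> ti.K" by (rule ti.factors_through_evaluation)
 obtain \<rho> where \<rho>: "\<forall>x\<in>set xs. irrep (FA x) (\<rho> x)" "rep_iso MM (n, \<eta>') (evr xs \<rho>)"
  using evaluation_decomposition[OF xs(1) t(2)] xs(2) unfolding ti.K_def by blast
 let ?l = "restrict l M"
 have l: "?l \<in> dual" by (rule form_rep_dual[OF t(1)])
 note rl = dual_form_rep[OF l] and r' = irrep_is_rep[OF t(2)] and r = irrep_is_rep[OF irr]
 have re: "is_rep MM (evr xs \<rho>)" by (rule irrep_is_rep[OF irreducible_eval_rep[OF xs(1)]]) (use \<rho> in blast)
 have 1: "rep_iso MM (n, \<eta>) (n, \<lambda>\<xi>. ?l \<xi> \<cdot>\<^sub>m 1\<^sub>m n + \<eta>' \<xi>)" by (rule rep_iso_eqI[OF r]) (simp add: t(4))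
 have rt: "is_rep MM (n, \<lambda>\<xi>. ?l \<xi> \<cdot>\<^sub>m 1\<^sub>m n + \<eta>' \<xi>)"
  by (rule is_rep_congI[OF r MM_closed]) (simp add: t(4))
 note 2 = rep_iso_sym[OF is_rep_tensor[OF rl r'] rt rep_iso_form_tensor[OF MM_closed rl r']]
 have 3: "rep_iso MM (tensor (form_rep ?l) (n, \<eta>')) (tensor (form_rep ?l) (evr xs \<rho>))"
  by (rule rep_iso_tensor[OF rl rl r' re rep_iso_refl[OF rl] \<rho>(2)])
 have "rep_iso MM (n, \<eta>) (tensor (form_rep ?l) (evr xs \<rho>))"
  by (rule rep_iso_trans[OF r rt is_rep_tensor[OF rl re] 1 rep_iso_trans[OF rt is_rep_tensor[OF rl r'] is_rep_tensor[OF rl re] 2 3]])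
 thus ?thesis using that[OF l xs(1)] \<rho>(1) by blast
qed

theorem form_tensor_ev_surj:
 "(\<lambda>(l, \<Psi>). form_tensor_ev D l \<Psi>) ` (dual \<times> EC) = irr_classes MM"
proof
 show "(\<lambda>(l, \<Psi>). form_tensor_ev D l \<Psi>) ` (dual \<times> EC) \<subseteq> irr_classes MM" using form_tensor_ev_irr by auto
 show "irr_classes MM \<subseteq> (\<lambda>(l, \<Psi>). form_tensor_ev D l \<Psi>) ` (dual \<times> EC)"
 proof
  fix C assume "C \<in> irr_classes MM"
  then obtain n \<eta> where C: "irrep MM (n, \<eta>)" "C = iso_class MM (n, \<eta>)" by (auto simp: irr_classes_iff)
  obtain l xs \<rho> where h: "l \<in> dual" "separated xs" "!!x. x \<in> set xs ==> irrep (FA x) (\<rho> x)"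
   "rep_iso MM (n, \<eta>) (tensor (form_rep l) (evr xs \<rho>))" by (rule irreducible_is_form_tensor_eval[OF C(1)]) blast
  have "iso_class (FA x) (\<rho> x) \<in> irr_classes (FA x)" if "x \<in> set xs" for x using h(3)[OF that] unfolding irr_classes_iff by blast
  then obtain \<Psi> where \<Psi>: "\<Psi> \<in> EC" "!!x. x \<in> set xs ==> \<Psi> x = iso_class (FA x) (\<rho> x)" "!!y. y \<in> supp D \<Psi> ==> \<exists>x\<in>set xs. y \<in> orb x"
   by (rule extend_classes[OF h(2), of "\<lambda>x. iso_class (FA x) (\<rho> x)"]) blast+
  have c: "cover \<Psi> xs" using \<Psi>(3) h(2) by (simp add: cover_def)
  have m: "\<rho> x \<in> \<Psi> x" if "x \<in> set xs" for x using \<Psi>(2)[OF that] iso_class_self[OF irrep_is_rep[OF h(3)[OF that]]] by simp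
  have re: "is_rep MM (evr xs \<rho>)" by (rule irrep_is_rep[OF irreducible_eval_rep[OF h(2,3)]])
  have "form_tensor_ev D l \<Psi> = iso_class MM (tensor (form_rep l) (evr xs \<rho>))"
   by (rule form_tensor_ev_eq[OF h(1) \<Psi>(1) c m])
  hence "form_tensor_ev D l \<Psi> = C" unfolding C(2)
   using iso_class_eq_iff[OF irrep_is_rep[OF C(1)] is_rep_tensor[OF dual_form_rep[OF h(1)] re]] h(4) by simp
  thus "C \<in> (\<lambda>(l, \<Psi>). form_tensor_ev D l \<Psi>) ` (dual \<times> EC)" using h(1) \<Psi>(1) by force
 qed
qed

lemma irreducible_eval_tensor_one:
 assumes irr: "irrep MM \<pi>"
 shows "\<exists>\<epsilon> \<tau>. evaluation_representation D \<epsilon> & is_rep MM \<tau> & fst \<tau> = 1 & rep_iso MM \<pi> (tensor \<epsilon> \<tau>)"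
proof -
 obtain n \<eta> where p: "\<pi> = (n, \<eta>)" by (cases \<pi>)
 obtain l xs \<rho> where h: "l \<in> dual" "separated xs" "!!x. x \<in> set xs ==> irrep (FA x) (\<rho> x)"
   "rep_iso MM (n, \<eta>) (tensor (form_rep l) (evr xs \<rho>))"
  by (rule irreducible_is_form_tensor_eval[OF irr[unfolded p]]) blast
 have re: "is_rep MM (evr xs \<rho>)" by (rule irrep_is_rep[OF irreducible_eval_rep[OF h(2,3)]])
 note rl = dual_form_rep[OF h(1)]
 have "rep_iso MM \<pi> (tensor (evr xs \<rho>) (form_rep l))" unfolding p
  by (rule rep_iso_trans[OF irrep_is_rep[OF irr[unfolded p]] is_rep_tensor[OF rl re] is_rep_tensor[OF re rl] h(4) rep_iso_tensor_comm[OF rl re]])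
 moreover have "evaluation_representation D (evr xs \<rho>)"
  unfolding evaluation_representation_def using h(2) irrep_is_rep[OF h(3)] by (intro exI[of _ xs] exI[of _ \<rho>]) (simp add: separated_def)
 ultimately show ?thesis using rl by (intro exI[of _ "evr xs \<rho>"] exI[of _ "form_rep l"]) simp
qed

end

section \<open>When two twisted evaluation representations are isomorphic\<close>

lemma form_rep_zero: "form_rep (\<lambda>_. 0) = trivial_rep"
proof -
 have "form_mat 0 = (0\<^sub>m 1 1 :: 'b mat)" by (intro eq_matI) (auto simp: form_mat_def)
 thus ?thesis by (simp add: trivial_rep_def)
qed

context equivariant_map_algebra
begin

text \<open>The dimension of an evaluation representation is the product of the dimensions of its factors.\<close>

lemma one_dimensional_values:
 assumes \<Phi>: "\<Phi> \<in> EC" and d: "class_dim (ev_class D \<Phi>) = 1" and x: "x \<in> X" and \<pi>: "\<pi> \<in> \<Phi> x"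
 shows "fst \<pi> = 1"
proof -
 have "separated [x]" using x by (simp add: separated_def)
 then obtain xs where xs: "cover \<Phi> xs" "set [x] \<subseteq> set xs" by (rule exists_cover2[OF \<Phi> \<Phi>])
 obtain \<rho> where \<rho>: "!!y. y \<in> set xs ==> \<rho> y \<in> \<Phi> y" by (rule ex_reps[OF \<Phi> cover_in_X[OF xs(1)]]) blast
 have "ev_class D \<Phi> = iso_class MM (evr xs \<rho>)" by (rule ev_class_eq[OF \<Phi> xs(1) \<rho>])
 moreover have "is_rep MM (evr xs \<rho>)" by (rule is_rep_eval_EC[OF \<Phi> cover_in_X[OF xs(1)] \<rho>])
 ultimately have "fst (evr xs \<rho>) = 1" using d class_dim_iso_class by metis
 hence "prod_list (map fst (map (\<lambda>y. pull_rep (val y) (\<rho> y)) xs)) = 1" unfolding eval_rep_tensor_list fst_tensor_list .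
 moreover have "fst (\<rho> x) \<in> set (map fst (map (\<lambda>y. pull_rep (val y) (\<rho> y)) xs))" using xs(2) by (simp add: image_image)
 ultimately have "fst (\<rho> x) = 1" by (rule prod_list_one)
 moreover have "\<rho> x \<in> \<Phi> x" by (rule \<rho>) (use xs(2) in simp)
 hence "rep_iso (FA x) (\<rho> x) \<pi>" using EC_mem(2)[OF \<Phi> x] \<pi> iso_class_memD by metis
 hence "fst (\<rho> x) = fst \<pi>" by (rule rep_iso_fst)
 ultimately show ?thesis by simp
qed

lemma one_dimensional_form:
 assumes L: "lie_closed L" and "is_rep L \<pi>" "fst \<pi> = 1"
 obtains l where "is_rep L (form_rep l)" "rep_iso L \<pi> (form_rep l)"
proof -
 obtain p where p: "\<pi> = (1, p)" using assms(3) by (cases \<pi>) auto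
 have r: "is_rep L (1, p)" using assms(2) p by simp
 have "rep_iso L (1, p) (form_rep (\<lambda>x. p x $$ (0,0)))" by (rule rep_iso_eqI[OF r is_rep_formD(1)[OF r]])
 moreover have "is_rep L (form_rep (\<lambda>x. p x $$ (0,0)))"
  by (rule is_rep_congI[OF r L is_rep_formD(1)[OF r]])
 ultimately show ?thesis using that[of "\<lambda>x. p x $$ (0,0)"] unfolding p by (simp only:)
qed

lemma tensor_fun_class_apply:
 assumes \<Psi>: "\<Psi> \<in> EC" and \<Phi>: "\<Phi> \<in> EC" and x: "x \<in> X" and m: "\<pi> \<in> \<Psi> x" "\<tau> \<in> \<Phi> x"
 shows "tensor_fun_class D \<Psi> \<Phi> x = iso_class (FA x) (tensor \<pi> \<tau>)"
 using class_tensor_iso_class[OF EC_rep[OF \<Psi> x m(1)] EC_rep[OF \<Phi> x m(2)]] EC_mem(2)[OF \<Psi> x m(1)] EC_mem(2)[OF \<Phi> x m(2)] x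
 by (simp add: tensor_fun_class_def)

lemma supp_tensor_fun_class:
 assumes \<Psi>: "\<Psi> \<in> EC" and \<Phi>: "\<Phi> \<in> EC"
 shows "supp D (tensor_fun_class D \<Psi> \<Phi>) \<subseteq> supp D \<Psi> \<union> supp D \<Phi>"
proof
 fix x assume x: "x \<in> supp D (tensor_fun_class D \<Psi> \<Phi>)"
 hence xX: "x \<in> X" and ne: "tensor_fun_class D \<Psi> \<Phi> x ~= zero_class D x" by (auto simp: supp_def)
 show "x \<in> supp D \<Psi> \<union> supp D \<Phi>"
 proof (rule ccontr)
  assume "x \<notin> supp D \<Psi> \<union> supp D \<Phi>"
  hence z: "\<Psi> x = zero_class D x" "\<Phi> x = zero_class D x" using xX by (auto simp: supp_def)
  have "trivial_rep \<in> \<Psi> x" "trivial_rep \<in> \<Phi> x" unfolding z zero_class_def by (simp_all add: iso_class_self is_rep_trivial)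
  hence "tensor_fun_class D \<Psi> \<Phi> x = iso_class (FA x) (tensor trivial_rep trivial_rep)"
   by (rule tensor_fun_class_apply[OF \<Psi> \<Phi> xX])
  also have "... = zero_class D x" unfolding zero_class_def
   using iso_class_eq_iff[OF is_rep_tensor[OF is_rep_trivial is_rep_trivial] is_rep_trivial] rep_iso_trivial_tensor[OF is_rep_trivial] by blast
  finally show False using ne by simp
 qed
qed

lemma tensor_fun_class_EC:
 assumes \<Psi>: "\<Psi> \<in> EC" and \<Phi>: "\<Phi> \<in> EC" and d: "class_dim (ev_class D \<Phi>) = 1"
 shows "tensor_fun_class D \<Psi> \<Phi> \<in> EC"
 unfolding equivariant_classes_def
proof (intro CollectI conjI ballI)
 have mem: "(SOME \<pi>. \<pi> \<in> \<Psi> x) \<in> \<Psi> x" "(SOME \<pi>. \<pi> \<in> \<Phi> x) \<in> \<Phi> x" if "x \<in> X" for x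
  using EC_nonempty[OF \<Psi> that] EC_nonempty[OF \<Phi> that] .
 have "tensor_fun_class D \<Psi> \<Phi> x \<in> irr_classes (FA x)" if x: "x \<in> X" for x
 proof -
  define \<pi> \<tau> where "\<pi> = (SOME \<pi>. \<pi> \<in> \<Psi> x)" and "\<tau> = (SOME \<pi>. \<pi> \<in> \<Phi> x)"
  have m: "\<pi> \<in> \<Psi> x" "\<tau> \<in> \<Phi> x" using mem[OF x] by (auto simp: \<pi>_def \<tau>_def)
  note r = EC_rep[OF \<Psi> x m(1)] EC_rep[OF \<Phi> x m(2)]
  obtain l where l: "is_rep (FA x) (form_rep l)" "rep_iso (FA x) \<tau> (form_rep l)"
   by (rule one_dimensional_form[OF FA_closed r(2) one_dimensional_values[OF \<Phi> d x m(2)]])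
  have "rep_iso (FA x) (tensor \<pi> \<tau>) (tensor \<pi> (form_rep l))"
   by (rule rep_iso_tensor[OF r(1,1,2) l(1) rep_iso_refl[OF r(1)] l(2)])
  hence "rep_iso (FA x) (tensor \<pi> (form_rep l)) (tensor \<pi> \<tau>)"
   by (rule rep_iso_sym[OF is_rep_tensor[OF r] is_rep_tensor[OF r(1) l(1)]])
  hence "irrep (FA x) (tensor \<pi> \<tau>)"
   by (rule irreducible_rep_iso[OF irreducible_form_tensor(2)[OF FA_closed l(1) EC_mem(1)[OF \<Psi> x m(1)]] is_rep_tensor[OF r]])
  thus ?thesis unfolding tensor_fun_class_apply[OF \<Psi> \<Phi> x m] irr_classes_def by (intro imageI CollectI)
 qed
 thus "tensor_fun_class D \<Psi> \<Phi> \<in> (\<Pi>\<^sub>E x\<in>X. irr_classes (FA x))" by (simp add: PiE_iff tensor_fun_class_def)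
 show "finite (supp D (tensor_fun_class D \<Psi> \<Phi>))"
  using ECD(2)[OF \<Psi>] ECD(2)[OF \<Phi>] finite_subset[OF supp_tensor_fun_class[OF \<Psi> \<Phi>]] by simp
 fix g x assume g: "g \<in> \<Gamma>" and x: "x \<in> X"
 define \<pi> \<tau> where "\<pi> = (SOME \<pi>. \<pi> \<in> \<Psi> x)" and "\<tau> = (SOME \<pi>. \<pi> \<in> \<Phi> x)"
 have m: "\<pi> \<in> \<Psi> x" "\<tau> \<in> \<Phi> x" using mem[OF x] by (auto simp: \<pi>_def \<tau>_def)
 let ?p = "pull_rep (actg D (ginv g))"
 have m': "?p \<pi> \<in> \<Psi> (pact g x)" "?p \<tau> \<in> \<Phi> (pact g x)"
  using m unfolding ECD(4)[OF \<Psi> g x] ECD(4)[OF \<Phi> g x] class_act_def by auto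
 show "tensor_fun_class D \<Psi> \<Phi> (pact g x) = class_act D g (tensor_fun_class D \<Psi> \<Phi> x)"
  unfolding tensor_fun_class_apply[OF \<Psi> \<Phi> x m] tensor_fun_class_apply[OF \<Psi> \<Phi> point_act_in[OF g x] m']
   class_act_iso_class[OF g is_rep_tensor[OF EC_rep[OF \<Psi> x m(1)] EC_rep[OF \<Phi> x m(2)]]] pull_rep_tensor ..
qed

lemma ev_class_tensor:
 assumes \<Psi>: "\<Psi> \<in> EC" and \<Phi>: "\<Phi> \<in> EC" and d: "class_dim (ev_class D \<Phi>) = 1"
  and xs: "cover \<Psi> xs" "cover \<Phi> xs" and \<rho>: "!!x. x \<in> set xs ==> \<rho> x \<in> \<Psi> x" and \<nu>: "!!x. x \<in> set xs ==> \<nu> x \<in> \<Phi> x"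
 shows "ev_class D (tensor_fun_class D \<Psi> \<Phi>) = iso_class MM (tensor (evr xs \<rho>) (evr xs \<nu>))"
proof -
 note X = cover_in_X[OF xs(1)]
 have xX: "x \<in> X" if "x \<in> set xs" for x using X that by blast
 note T = tensor_fun_class_EC[OF \<Psi> \<Phi> d]
 let ?t = "\<lambda>x. tensor (\<rho> x) (\<nu> x)"
 have c: "cover (tensor_fun_class D \<Psi> \<Phi>) xs"
  using xs supp_tensor_fun_class[OF \<Psi> \<Phi>] unfolding cover_def by blast
 have m: "?t x \<in> tensor_fun_class D \<Psi> \<Phi> x" if "x \<in> set xs" for x
  using tensor_fun_class_apply[OF \<Psi> \<Phi> xX[OF that] \<rho>[OF that] \<nu>[OF that]]
   iso_class_self[OF is_rep_tensor[OF EC_rep[OF \<Psi> xX[OF that] \<rho>[OF that]] EC_rep[OF \<Phi> xX[OF that] \<nu>[OF that]]]] by simp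
 have e: "ev_class D (tensor_fun_class D \<Psi> \<Phi>) = iso_class MM (evr xs ?t)" by (rule ev_class_eq[OF T c m])
 have r: "is_rep MM (evr xs ?t)" by (rule is_rep_eval_EC[OF T X m])
 have rr: "is_rep MM (evr xs \<rho>)" "is_rep MM (evr xs \<nu>)"
  by (rule is_rep_eval_EC[OF \<Psi> X \<rho>], assumption) (rule is_rep_eval_EC[OF \<Phi> X \<nu>])
 have "rep_iso MM (tensor_list (map (\<lambda>x. tensor (pull_rep (val x) (\<rho> x)) (pull_rep (val x) (\<nu> x))) xs))
  (tensor (tensor_list (map (\<lambda>x. pull_rep (val x) (\<rho> x)) xs)) (tensor_list (map (\<lambda>x. pull_rep (val x) (\<nu> x)) xs)))"
 proof (rule rep_iso_tensor_list_tensor)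
  fix x assume x: "x \<in> set xs"
  show "is_rep MM (pull_rep (val x) (\<rho> x))" by (rule is_rep_pull_rep[OF val_hom[OF xX[OF x]] EC_rep[OF \<Psi> xX[OF x] \<rho>[OF x]]])
  show "is_rep MM (pull_rep (val x) (\<nu> x))" by (rule is_rep_pull_rep[OF val_hom[OF xX[OF x]] EC_rep[OF \<Phi> xX[OF x] \<nu>[OF x]]])
 qed
 hence "rep_iso MM (evr xs ?t) (tensor (evr xs \<rho>) (evr xs \<nu>))"
  unfolding eval_rep_tensor_list pull_rep_tensor .
 thus ?thesis unfolding e using iso_class_eq_iff[OF r is_rep_tensor[OF rr]] by blast
qed

lemma one_dimensional_ev_form:
 assumes \<Phi>: "\<Phi> \<in> EC" and d: "class_dim (ev_class D \<Phi>) = 1"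
 obtains l where "l \<in> dual" "ev_class D \<Phi> = form_class MM l"
proof -
 obtain xs where xs: "cover \<Phi> xs" by (rule exists_cover1[OF \<Phi>])
 obtain \<rho> where \<rho>: "!!y. y \<in> set xs ==> \<rho> y \<in> \<Phi> y" by (rule ex_reps[OF \<Phi> cover_in_X[OF xs(1)]]) blast
 have e: "ev_class D \<Phi> = iso_class MM (evr xs \<rho>)" by (rule ev_class_eq[OF \<Phi> xs \<rho>])
 have r: "is_rep MM (evr xs \<rho>)" by (rule is_rep_eval_EC[OF \<Phi> cover_in_X[OF xs] \<rho>])
 have "fst (evr xs \<rho>) = 1" using d class_dim_iso_class[OF r] e by simp
 then obtain l where l: "is_rep MM (form_rep l)" "rep_iso MM (evr xs \<rho>) (form_rep l)" by (rule one_dimensional_form[OF MM_closed r])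
 note l' = form_rep_dual[OF l(1)]
 have "rep_iso MM (form_rep l) (form_rep (restrict l M))" by (rule rep_iso_eqI[OF l(1)]) simp
 hence "rep_iso MM (evr xs \<rho>) (form_rep (restrict l M))" by (rule rep_iso_trans[OF r l(1) dual_form_rep[OF l'] l(2)])
 hence "ev_class D \<Phi> = form_class MM (restrict l M)" unfolding e form_class_eq using iso_class_eq_iff[OF r dual_form_rep[OF l']] by blast
 thus ?thesis by (rule that[OF l'])
qed

text \<open>With \<open>m\<close> the form of \<open>\<Phi>\<close>, both sides are \<open>l' \<otimes> m \<otimes> ev\<^sub>\<Psi>\<close>.\<close>

lemma form_tensor_ev_eqI:
 assumes l: "l \<in> dual" "l' \<in> dual" and \<Psi>: "\<Psi> \<in> EC" "\<Psi>' \<in> EC" and \<Phi>: "\<Phi> \<in> EC" "class_dim (ev_class D \<Phi>) = 1"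
  and e: "l' = diff_form MM l (class_form MM (ev_class D \<Phi>))" "ev_class D \<Psi>' = ev_class D (tensor_fun_class D \<Psi> \<Phi>)"
 shows "form_tensor_ev D l \<Psi> = form_tensor_ev D l' \<Psi>'"
proof -
 obtain m where m: "m \<in> dual" "ev_class D \<Phi> = form_class MM m" by (rule one_dimensional_ev_form[OF \<Phi>])
 have lm: "l \<xi> = l' \<xi> + m \<xi>" if "\<xi> \<in> M" for \<xi>
  using that unfolding e(1) m(2) class_form_form_class[OF m(1)] by (simp add: diff_form_def)
 have "separated []" by (simp add: separated_def)
 then obtain xs where xs: "cover \<Psi> xs" "cover \<Phi> xs" by (rule exists_cover2[OF \<Psi>(1) \<Phi>(1)])
 obtain \<rho> where \<rho>: "!!y. y \<in> set xs ==> \<rho> y \<in> \<Psi> y" by (rule ex_reps[OF \<Psi>(1) cover_in_X[OF xs(1)]]) blast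
 obtain \<nu> where \<nu>: "!!y. y \<in> set xs ==> \<nu> y \<in> \<Phi> y" by (rule ex_reps[OF \<Phi>(1) cover_in_X[OF xs(1)]]) blast
 let ?p = "evr xs \<rho>" and ?q = "evr xs \<nu>"
 have r: "is_rep MM ?p" "is_rep MM ?q"
  by (rule is_rep_eval_EC[OF \<Psi>(1) cover_in_X[OF xs(1)] \<rho>], assumption) (rule is_rep_eval_EC[OF \<Phi>(1) cover_in_X[OF xs(1)] \<nu>])
 note f = dual_form_rep[OF l(1)] dual_form_rep[OF l(2)] dual_form_rep[OF m(1)]
 have "ev_class D \<Phi> = iso_class MM ?q" by (rule ev_class_eq[OF \<Phi>(1) xs(2) \<nu>])
 hence q: "rep_iso MM ?q (form_rep m)" using iso_class_eq_iff[OF r(2) f(3)] m(2) form_class_eq by metis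
 have pq: "rep_iso MM (tensor ?p ?q) (tensor (form_rep m) ?p)"
  by (rule rep_iso_trans[OF is_rep_tensor[OF r] is_rep_tensor[OF r(1) f(3)] is_rep_tensor[OF f(3) r(1)]
    rep_iso_tensor[OF r(1,1,2) f(3) rep_iso_refl[OF r(1)] q] rep_iso_tensor_comm[OF r(1) f(3)]])
 have "ev_class D (tensor_fun_class D \<Psi> \<Phi>) = iso_class MM (tensor ?p ?q)" by (rule ev_class_tensor[OF \<Psi>(1) \<Phi> xs \<rho> \<nu>])
 also have "... = iso_class MM (tensor (form_rep m) ?p)"
  using iso_class_eq_iff[OF is_rep_tensor[OF r] is_rep_tensor[OF f(3) r(1)]] pq by blast
 finally have "form_tensor_ev D l' \<Psi>' = class_tensor MM (iso_class MM (form_rep l')) (iso_class MM (tensor (form_rep m) ?p))"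
  unfolding form_tensor_ev_def e(2) form_class_eq by simp
 also have "... = iso_class MM (tensor (form_rep l') (tensor (form_rep m) ?p))"
  by (rule class_tensor_iso_class[OF f(2) is_rep_tensor[OF f(3) r(1)]])
 also have "... = iso_class MM (tensor (form_rep l) ?p)"
  using iso_class_eq_iff[OF is_rep_tensor[OF f(2) is_rep_tensor[OF f(3) r(1)]] is_rep_tensor[OF f(1) r(1)]]
   rep_iso_form_form_tensor[OF MM_closed f(2,3,1) r(1) lm] by blast
 also have "... = form_tensor_ev D l \<Psi>" by (rule form_tensor_ev_eq[OF l(1) \<Psi>(1) xs(1) \<rho>, symmetric])
 finally show ?thesis by simp
qed

lemma form_rep_sum:
 assumes l: "is_rep MM (form_rep l)" and "!!i. i \<in> I ==> t i \<in> M" "finite I"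
 shows "l (\<Sum>i\<in>I. t i) = (\<Sum>i\<in>I. l (t i))"
 using assms(3,2)
proof (induction I rule: finite_induct)
 case empty
 have "l (0 + 0) = l 0 + l 0" using l M_closed(1) unfolding is_rep_form_iff[OF MM_closed] by blast
 thus ?case by simp
next
 case (insert i I)
 thus ?case using l M_sum[of I t] unfolding is_rep_form_iff[OF MM_closed] by simp
qed

text \<open>The quotient of \<open>M\<close> by \<open>ker_eval xs\<close> is the direct sum of the isotropy algebras, so \<open>\<mu>\<close> is the sum of its restrictions \<open>m x\<close> to the
  summands.  The value \<open>m x u\<close> is found by applying \<open>\<mu>\<close> to a map that takes the value \<open>u\<close> at \<open>x\<close> and vanishes at the other points.\<close>

lemma form_vanishing_on_kernel_is_ev:
 assumes xs: "separated xs" and \<mu>: "\<mu> \<in> dual" and z: "!!\<xi>. \<xi> \<in> ker_eval xs ==> \<mu> \<xi> = 0"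
 obtains \<Phi> where "\<Phi> \<in> EC" "cover \<Phi> xs" "ev_class D \<Phi> = form_class MM \<mu>"
proof -
 have xX: "x \<in> X" if "x \<in> set xs" for x using separated_in_X[OF xs that] .
 define s where "s x u = (SOME \<xi>. \<xi> \<in> only_at xs x & val x \<xi> = u)" for x u
 have s: "s x u \<in> only_at xs x" "val x (s x u) = u" if x: "x \<in> set xs" and u: "u \<in> carr (FA x)" for x u
 proof -
  obtain \<xi> where "\<xi> \<in> M" "val x \<xi> = u" "!!y. y \<in> set xs ==> y ~= x ==> val y \<xi> = 0"
   by (rule eval_surjective_separated[OF xs x u]) blast
  hence "\<xi> \<in> only_at xs x & val x \<xi> = u" by (simp add: only_at_def)
  from someI[of "\<lambda>\<xi>. \<xi> \<in> only_at xs x & val x \<xi> = u", OF this]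
  show "s x u \<in> only_at xs x" "val x (s x u) = u" by (auto simp: s_def)
 qed
 have oM: "\<xi> \<in> M" if "\<xi> \<in> only_at xs x" for \<xi> x using that by (simp add: only_at_def)
 have o0: "val y \<xi> = 0" if "\<xi> \<in> only_at xs x" "y \<in> set xs" "y ~= x" for \<xi> x y using that by (simp add: only_at_def)
 note f = dual_form_rep[OF \<mu>]
 note fD = f[unfolded is_rep_form_iff[OF MM_closed] MM_simps]
 have diff: "\<mu> (\<xi> - \<beta>) = \<mu> \<xi> - \<mu> \<beta>" if "\<xi> \<in> M" "\<beta> \<in> M" for \<xi> \<beta>
 proof -
  have "\<mu> ((\<xi> - \<beta>) + \<beta>) = \<mu> (\<xi> - \<beta>) + \<mu> \<beta>" using fD M_diff[OF that] that(2) by blast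
  thus ?thesis by simp
 qed
 define m where "m x u = \<mu> (s x u)" for x u
 have m: "\<mu> \<xi> = m x (val x \<xi>)" if x: "x \<in> set xs" and a: "\<xi> \<in> only_at xs x" for x \<xi>
 proof -
  note sx = s[OF x val_in_FA[OF oM[OF a] xX[OF x]]]
  have "\<xi> - s x (val x \<xi>) \<in> ker_eval xs"
   unfolding ker_eval_def
  proof (intro CollectI conjI ballI)
   show "\<xi> - s x (val x \<xi>) \<in> M" using M_diff oM a sx by blast
   fix y assume y: "y \<in> set xs"
   show "val y (\<xi> - s x (val x \<xi>)) = 0"
    using val_diff[OF xX[OF y] M_TT[OF oM[OF a]] M_TT[OF oM[OF sx(1)]]] o0[OF a y] o0[OF sx(1) y] sx(2) by (cases "y = x") auto
  qed
  thus ?thesis using z diff[OF oM[OF a] oM[OF sx(1)]] by (simp add: m_def)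
 qed
 have fm: "is_rep (FA x) (form_rep (m x))" if x: "x \<in> set xs" for x
  unfolding is_rep_form_iff[OF FA_closed] FA_simps
 proof (intro conjI ballI allI)
  note xx = xX[OF x]
  fix u assume u: "u \<in> carr (FA x)"
  note su = s[OF x u]
  have sm: "s x u \<in> M" using oM su by blast
  have "tens_scale c (s x u) \<in> only_at xs x" for c
   using su(1) xX by (auto simp: only_at_def M_closed val_simps M_TT)
  thus "m x (scaleg D c u) = c * m x u" for c
   using m[OF x, of "tens_scale c (s x u)"] fD sm su(2) by (simp add: val_simps xx M_TT m_def)
  fix v assume v: "v \<in> carr (FA x)"
  note sv = s[OF x v]
  have sn: "s x v \<in> M" using oM sv by blast
  have "s x u + s x v \<in> only_at xs x" "tb (s x u) (s x v) \<in> only_at xs x"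
   using su(1) sv(1) xX by (auto simp: only_at_def M_closed val_simps val_tb M_TT brg_zero)
  thus "m x (u + v) = m x u + m x v" "m x (brg D u v) = 0"
   using m[OF x, of "s x u + s x v"] m[OF x, of "tb (s x u) (s x v)"] fD sm sn su(2) sv(2)
   by (simp_all add: val_simps val_tb xx M_TT m_def)
 qed
 have C: "iso_class (FA x) (form_rep (m x)) \<in> irr_classes (FA x)" if "x \<in> set xs" for x
  unfolding irr_classes_def by (intro imageI CollectI irreducible_rep_one fm[OF that])
 obtain \<Phi> where \<Phi>: "\<Phi> \<in> EC" "!!x. x \<in> set xs ==> \<Phi> x = iso_class (FA x) (form_rep (m x))"
  "!!y. y \<in> supp D \<Phi> ==> \<exists>x\<in>set xs. y \<in> orb x"
  by (rule extend_classes[OF xs C]) blast+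
 have c: "cover \<Phi> xs" using xs \<Phi>(3) by (simp add: cover_def)
 have mem: "form_rep (m x) \<in> \<Phi> x" if "x \<in> set xs" for x unfolding \<Phi>(2)[OF that] by (rule iso_class_self[OF fm[OF that]])
 have ev: "ev_class D \<Phi> = iso_class MM (evr xs (\<lambda>x. form_rep (m x)))" by (rule ev_class_eq[OF \<Phi>(1) c mem])
 have ef: "evr xs (\<lambda>x. form_rep (m x)) = form_rep (\<lambda>\<xi>. \<Sum>x\<leftarrow>xs. m x (val x \<xi>))"
  unfolding eval_rep_tensor_list pull_rep_pair by (rule tensor_list_forms)
 have "(\<Sum>x\<leftarrow>xs. m x (val x \<xi>)) = \<mu> \<xi>" if \<xi>: "\<xi> \<in> M" for \<xi>
 proof -
  define \<beta> where "\<beta> x = s x (val x \<xi>)" for x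
  have \<beta>: "\<beta> x \<in> only_at xs x" "val x (\<beta> x) = val x \<xi>" if "x \<in> set xs" for x
   using s[OF that val_in_FA[OF \<xi> xX[OF that]]] by (simp_all add: \<beta>_def)
  have S: "(\<Sum>x\<in>set xs. \<beta> x) \<in> M" by (rule M_sum[OF oM[OF \<beta>(1)]])
  have "val y (\<Sum>x\<in>set xs. \<beta> x) = val y \<xi>" if y: "y \<in> set xs" for y
  proof -
   have "val y (\<Sum>x\<in>set xs. \<beta> x) = (\<Sum>x\<in>set xs. val y (\<beta> x))" by (rule val_sum[OF xX[OF y] M_TT[OF oM[OF \<beta>(1)]]])
   also have "... = (\<Sum>x\<in>set xs. if x = y then val y \<xi> else 0)"
    by (rule sum.cong[OF refl]) (use \<beta> o0[OF \<beta>(1) y] in auto)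
   finally show ?thesis using y by simp
  qed
  hence "\<xi> - (\<Sum>x\<in>set xs. \<beta> x) \<in> ker_eval xs"
   using M_diff[OF \<xi> S] val_diff[OF xX M_TT[OF \<xi>] M_TT[OF S]] by (simp add: ker_eval_def)
  hence "\<mu> \<xi> = \<mu> (\<Sum>x\<in>set xs. \<beta> x)" using z diff[OF \<xi> S] by simp
  also have "... = (\<Sum>x\<in>set xs. \<mu> (\<beta> x))" by (rule form_rep_sum[OF f oM[OF \<beta>(1)]]) simp_all
  also have "... = (\<Sum>x\<in>set xs. m x (val x \<xi>))" by (simp add: m_def \<beta>_def)
  also have "... = (\<Sum>x\<leftarrow>xs. m x (val x \<xi>))" using xs by (simp add: separated_def sum_list_distinct_conv_sum_set)
  finally show ?thesis by simp
 qed
 hence "rep_iso MM (form_rep \<mu>) (form_rep (\<lambda>\<xi>. \<Sum>x\<leftarrow>xs. m x (val x \<xi>)))" by (intro rep_iso_eqI[OF f]) simp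
 moreover have "is_rep MM (evr xs (\<lambda>x. form_rep (m x)))" by (rule is_rep_eval_EC[OF \<Phi>(1) cover_in_X[OF c] mem])
 ultimately have "ev_class D \<Phi> = form_class MM \<mu>"
  unfolding ev form_class_eq ef using iso_class_eq_iff[OF f] by blast
 thus ?thesis by (rule that[OF \<Phi>(1) c])
qed

lemma eval_rep_vanish:
 assumes \<Psi>: "\<Psi> \<in> EC" and xs: "set xs \<subseteq> X" and \<rho>: "!!x. x \<in> set xs ==> \<rho> x \<in> \<Psi> x" and \<xi>: "\<xi> \<in> ker_eval xs"
 shows "snd (evr xs \<rho>) \<xi> = 0\<^sub>m (fst (evr xs \<rho>)) (fst (evr xs \<rho>))"
 unfolding eval_rep_tensor_list
proof (rule tensor_list_vanish)
 fix \<pi> assume "\<pi> \<in> set (map (\<lambda>x. pull_rep (val x) (\<rho> x)) xs)"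
 then obtain x where x: "x \<in> set xs" "\<pi> = pull_rep (val x) (\<rho> x)" by auto
 have xX: "x \<in> X" using x(1) xs by blast
 show "snd \<pi> \<xi> = 0\<^sub>m (fst \<pi>) (fst \<pi>)" using rep_zero_at[OF EC_rep[OF \<Psi> xX \<rho>[OF x(1)]]] \<xi> x by (simp add: ker_eval_def)
qed

text \<open>Tensoring with \<open>- l'\<close> turns the equation into \<open>\<mu> \<otimes> ev\<^sub>\<Psi> = ev\<^sub>\<Psi>'\<close> for \<open>\<mu> = l - l'\<close>.  On \<open>ker_eval xs\<close>, for a common cover \<open>xs\<close>, both evaluation
  representations vanish, hence so does \<open>\<mu>\<close>, and \<open>\<mu>\<close> is \<open>ev\<^sub>\<Phi>\<close> for some \<open>\<Phi>\<close>.\<close>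

lemma form_tensor_ev_eqD:
 assumes l: "l \<in> dual" "l' \<in> dual" and \<Psi>: "\<Psi> \<in> EC" "\<Psi>' \<in> EC" and e: "form_tensor_ev D l \<Psi> = form_tensor_ev D l' \<Psi>'"
 obtains \<Phi> where "\<Phi> \<in> EC" "class_dim (ev_class D \<Phi>) = 1" "l' = diff_form MM l (class_form MM (ev_class D \<Phi>))"
  "ev_class D \<Psi>' = ev_class D (tensor_fun_class D \<Psi> \<Phi>)"
proof -
 have "separated []" by (simp add: separated_def)
 then obtain xs where xs: "cover \<Psi> xs" "cover \<Psi>' xs" by (rule exists_cover2[OF \<Psi>])
 note X = cover_in_X[OF xs(1)]
 have sep: "separated xs" using xs(1) by (simp add: cover_def)
 obtain \<rho> where \<rho>: "!!y. y \<in> set xs ==> \<rho> y \<in> \<Psi> y" by (rule ex_reps[OF \<Psi>(1) X]) blast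
 obtain \<rho>' where \<rho>': "!!y. y \<in> set xs ==> \<rho>' y \<in> \<Psi>' y" by (rule ex_reps[OF \<Psi>(2) X]) blast
 obtain n \<eta> where p: "evr xs \<rho> = (n, \<eta>)" by (cases "evr xs \<rho>")
 obtain n' \<eta>' where p': "evr xs \<rho>' = (n', \<eta>')" by (cases "evr xs \<rho>'")
 have irr: "irrep MM (n, \<eta>)" unfolding p[symmetric] by (rule irreducible_ev[OF \<Psi>(1) sep \<rho>])
 have irr': "irrep MM (n', \<eta>')" unfolding p'[symmetric] by (rule irreducible_ev[OF \<Psi>(2) sep \<rho>'])
 note r = irrep_is_rep[OF irr] and r' = irrep_is_rep[OF irr']
 note f = dual_form_rep[OF l(1)] dual_form_rep[OF l(2)]
 note f1 = f(1)[unfolded is_rep_form_iff[OF MM_closed]] and f2 = f(2)[unfolded is_rep_form_iff[OF MM_closed]]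
 have "form_tensor_ev D l \<Psi> = iso_class MM (tensor (form_rep l) (n, \<eta>))"
  unfolding p[symmetric] by (rule form_tensor_ev_eq[OF l(1) \<Psi>(1) xs(1) \<rho>])
 moreover have "form_tensor_ev D l' \<Psi>' = iso_class MM (tensor (form_rep l') (n', \<eta>'))"
  unfolding p'[symmetric] by (rule form_tensor_ev_eq[OF l(2) \<Psi>(2) xs(2) \<rho>'])
 ultimately have iso: "rep_iso MM (tensor (form_rep l) (n, \<eta>)) (tensor (form_rep l') (n', \<eta>'))"
  using e iso_class_eq_iff[OF is_rep_tensor[OF f(1) r] is_rep_tensor[OF f(2) r']] by simp
 define neg where "neg \<xi> = - l' \<xi>" for \<xi>
 have fneg: "is_rep MM (form_rep neg)" unfolding is_rep_form_iff[OF MM_closed] neg_def using f2 by simp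
 define \<mu> where "\<mu> = diff_form MM l l'"
 have \<mu>_apply: "\<mu> \<xi> = l \<xi> - l' \<xi>" if "\<xi> \<in> M" for \<xi> using that by (simp add: \<mu>_def diff_form_def)
 have "is_rep MM (form_rep (\<lambda>\<xi>. l \<xi> - l' \<xi>))"
  unfolding is_rep_form_iff[OF MM_closed] using f1 f2 by (simp add: algebra_simps)
 from form_rep_dual[OF this] have \<mu>: "\<mu> \<in> dual" by (simp add: \<mu>_def diff_form_def)
 note f\<mu> = dual_form_rep[OF \<mu>]
 note t = is_rep_tensor
 have f0: "is_rep MM (form_rep (\<lambda>_. 0))" unfolding is_rep_form_iff[OF MM_closed] by simp
 have 1: "rep_iso MM (tensor (form_rep \<mu>) (n, \<eta>)) (tensor (form_rep neg) (tensor (form_rep l) (n, \<eta>)))"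
  by (rule rep_iso_sym[OF t[OF fneg t[OF f(1) r]] t[OF f\<mu> r] rep_iso_form_form_tensor[OF MM_closed fneg f(1) f\<mu> r]])
   (simp add: \<mu>_apply neg_def)
 have 2: "rep_iso MM (tensor (form_rep neg) (tensor (form_rep l) (n, \<eta>))) (tensor (form_rep neg) (tensor (form_rep l') (n', \<eta>')))"
  by (rule rep_iso_tensor[OF fneg fneg t[OF f(1) r] t[OF f(2) r'] rep_iso_refl[OF fneg] iso])
 have 3: "rep_iso MM (tensor (form_rep neg) (tensor (form_rep l') (n', \<eta>'))) (tensor (form_rep (\<lambda>_. 0)) (n', \<eta>'))"
  by (rule rep_iso_form_form_tensor[OF MM_closed fneg f(2) f0 r']) (simp add: neg_def)
 have 4: "rep_iso MM (tensor (form_rep (\<lambda>_. 0)) (n', \<eta>')) (n', \<eta>')"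
 proof -
  have "(form_rep (\<lambda>_. 0) :: ('k, ('k, 'g, 'a) tens) rep) = trivial_rep" by (rule form_rep_zero)
  thus ?thesis using rep_iso_trivial_tensor[OF r'] by simp
 qed
 note 34 = rep_iso_trans[OF t[OF fneg t[OF f(2) r']] t[OF f0 r'] r' 3 4]
 note 24 = rep_iso_trans[OF t[OF fneg t[OF f(1) r]] t[OF fneg t[OF f(2) r']] r' 2 34]
 have iso': "rep_iso MM (tensor (form_rep \<mu>) (n, \<eta>)) (n', \<eta>')"
  by (rule rep_iso_trans[OF t[OF f\<mu> r] t[OF fneg t[OF f(1) r]] r' 1 24])
 have "\<mu> \<xi> = 0" if \<xi>: "\<xi> \<in> ker_eval xs" for \<xi>
 proof -
  have aM: "\<xi> \<in> M" using \<xi> by (simp add: ker_eval_def)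
  have "\<eta> \<xi> = 0\<^sub>m n n" using eval_rep_vanish[OF \<Psi>(1) X \<rho> \<xi>] p by simp
  moreover have "\<eta>' \<xi> = 0\<^sub>m n' n'" using eval_rep_vanish[OF \<Psi>(2) X \<rho>' \<xi>] p' by simp
  moreover have "rep_iso MM (n, \<lambda>\<xi>. ksum 1 n (form_mat (\<mu> \<xi>)) (\<eta> \<xi>)) (n', \<eta>')" using iso' unfolding tensor_rep_pair by simp
  then obtain P Q where P: "n = n'" "P \<in> Mat n n" "Q \<in> Mat n n" "P * Q = 1\<^sub>m n"
   and i: "P * ksum 1 n (form_mat (\<mu> \<xi>)) (\<eta> \<xi>) = \<eta>' \<xi> * P" using aM unfolding rep_iso_pair by blast
  ultimately have "P * (\<mu> \<xi> \<cdot>\<^sub>m 1\<^sub>m n + 0\<^sub>m n n) = 0\<^sub>m n n * P" using ksum_form_left[of "0\<^sub>m n n" n "\<mu> \<xi>"] i by simp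
  moreover have "\<mu> \<xi> \<cdot>\<^sub>m 1\<^sub>m n + 0\<^sub>m n n = \<mu> \<xi> \<cdot>\<^sub>m 1\<^sub>m n" by (rule eq_matI) auto
  moreover have "0\<^sub>m n n * P = 0\<^sub>m n n" using P(2) by simp
  ultimately have "P * (\<mu> \<xi> \<cdot>\<^sub>m 1\<^sub>m n) = 0\<^sub>m n n" by simp
  hence "\<mu> \<xi> \<cdot>\<^sub>m P = 0\<^sub>m n n" using mult_smult_distrib[OF P(2) one_Mat, of "\<mu> \<xi>"] right_mult_one_mat[OF P(2)] by simp
  hence "\<mu> \<xi> \<cdot>\<^sub>m (P * Q) = 0\<^sub>m n n" using mult_smult_assoc_mat[OF P(2,3), of "\<mu> \<xi>"] left_mult_zero_mat[OF P(3)] by simp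
  hence "(\<mu> \<xi> \<cdot>\<^sub>m 1\<^sub>m n) $$ (0,0) = 0\<^sub>m n n $$ (0,0)" using P(4) by simp
  thus ?thesis using irr unfolding irreducible_rep_def by simp
 qed
 then obtain \<Phi> where \<Phi>: "\<Phi> \<in> EC" "cover \<Phi> xs" "ev_class D \<Phi> = form_class MM \<mu>" by (rule form_vanishing_on_kernel_is_ev[OF sep \<mu>])
 have d: "class_dim (ev_class D \<Phi>) = 1" unfolding \<Phi>(3) form_class_eq using class_dim_iso_class[OF f\<mu>] by simp
 have l'_eq: "l' = diff_form MM l (class_form MM (ev_class D \<Phi>))"
  unfolding \<Phi>(3) class_form_form_class[OF \<mu>]
  by (rule extensionalityI[of _ M]) (use l(2) in "auto simp: abelian_dual_def diff_form_def \<mu>_apply")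
 obtain \<nu> where \<nu>: "!!y. y \<in> set xs ==> \<nu> y \<in> \<Phi> y" by (rule ex_reps[OF \<Phi>(1) X]) blast
 have q: "is_rep MM (evr xs \<nu>)" by (rule is_rep_eval_EC[OF \<Phi>(1) X \<nu>])
 have "ev_class D \<Phi> = iso_class MM (evr xs \<nu>)" by (rule ev_class_eq[OF \<Phi>(1,2) \<nu>])
 hence qi: "rep_iso MM (evr xs \<nu>) (form_rep \<mu>)" using \<Phi>(3) iso_class_eq_iff[OF q f\<mu>] form_class_eq by metis
 have "rep_iso MM (tensor (n, \<eta>) (evr xs \<nu>)) (tensor (form_rep \<mu>) (n, \<eta>))"
  by (rule rep_iso_trans[OF t[OF r q] t[OF r f\<mu>] t[OF f\<mu> r] rep_iso_tensor[OF r r q f\<mu> rep_iso_refl[OF r] qi] rep_iso_tensor_comm[OF r f\<mu>]])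
 from rep_iso_trans[OF t[OF r q] t[OF f\<mu> r] r' this iso']
 have "iso_class MM (tensor (n, \<eta>) (evr xs \<nu>)) = iso_class MM (n', \<eta>')" using iso_class_eq_iff[OF t[OF r q] r'] by blast
 moreover have "ev_class D (tensor_fun_class D \<Psi> \<Phi>) = iso_class MM (tensor (n, \<eta>) (evr xs \<nu>))"
  unfolding p[symmetric] by (rule ev_class_tensor[OF \<Psi>(1) \<Phi>(1) d xs(1) \<Phi>(2) \<rho> \<nu>])
 moreover have "ev_class D \<Psi>' = iso_class MM (n', \<eta>')" unfolding p'[symmetric] by (rule ev_class_eq[OF \<Psi>(2) xs(2) \<rho>'])
 ultimately have "ev_class D \<Psi>' = ev_class D (tensor_fun_class D \<Psi> \<Phi>)" by simp
 thus ?thesis by (rule that[OF \<Phi>(1) d l'_eq])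
qed

lemma zero_fun_class_EC: "zero_fun_class D \<in> EC" and cover_zero: "cover (zero_fun_class D) []"
proof -
 have s: "separated []" by (simp add: separated_def)
 obtain \<Psi> where \<Psi>: "\<Psi> \<in> EC" "!!y. y \<in> supp D \<Psi> ==> \<exists>x\<in>set []. y \<in> orb x"
  by (rule extend_classes[OF s, of undefined]) auto
 have "\<Psi> = zero_fun_class D"
  by (rule extensionalityI[of _ X]) (use \<Psi> ECD(5)[OF \<Psi>(1)] in "auto simp: zero_fun_class_def supp_def")
 thus "zero_fun_class D \<in> EC" "cover (zero_fun_class D) []" using \<Psi> s by (auto simp: cover_def)
qed

lemma inj_form_tensor_zero: "inj_on (\<lambda>l. form_tensor_ev D l (zero_fun_class D)) dual"
proof (rule inj_onI)
 have e: "form_tensor_ev D l (zero_fun_class D) = form_class MM l" if l: "l \<in> dual" for l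
 proof -
  note f = dual_form_rep[OF l]
  note t = is_rep_tensor[OF f is_rep_trivial] is_rep_tensor[OF is_rep_trivial f]
  have "form_tensor_ev D l (zero_fun_class D) = iso_class MM (tensor (form_rep l) (evr [] undefined))"
   by (rule form_tensor_ev_eq[OF l zero_fun_class_EC cover_zero]) simp
  moreover have "rep_iso MM (tensor (form_rep l) trivial_rep) (form_rep l)"
   by (rule rep_iso_trans[OF t f rep_iso_tensor_comm[OF f is_rep_trivial] rep_iso_trivial_tensor[OF f]])
  ultimately show ?thesis using iso_class_eq_iff[OF t(1) f] by (simp add: eval_rep_tensor_list form_class_eq)
 qed
 fix l l' assume "l \<in> dual" "l' \<in> dual" "form_tensor_ev D l (zero_fun_class D) = form_tensor_ev D l' (zero_fun_class D)"
 thus "l = l'" using e form_class_inj by metis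
qed

text \<open>On the maps that vanish at all points but \<open>x\<close>, the given isomorphism has a nonzero block between the factors at \<open>x\<close>, which are
  irreducible, so Schur's lemma applies.\<close>

lemma eval_rep_determines_factors:
 assumes xs: "separated xs" and x: "x \<in> set xs"
  and \<rho>: "!!y. y \<in> set xs ==> irrep (FA y) (\<rho> y)" and \<nu>: "!!y. y \<in> set xs ==> irrep (FA y) (\<nu> y)"
  and i: "rep_iso MM (evr xs \<rho>) (evr xs \<nu>)"
 shows "rep_iso (FA x) (\<rho> x) (\<nu> x)"
proof -
 let ?L = "map (\<lambda>x. pull_rep (val x) (\<rho> x)) xs" and ?L' = "map (\<lambda>x. pull_rep (val x) (\<nu> x)) xs"
 have xX: "y \<in> X" if "y \<in> set xs" for y using separated_in_X[OF xs that] .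
 have dist: "distinct xs" using xs by (simp add: separated_def)
 obtain j where j: "j < length xs" "xs ! j = x" using x by (auto simp: in_set_conv_nth)
 obtain n p where np: "\<rho> x = (n, p)" by (cases "\<rho> x")
 obtain m q where mq: "\<nu> x = (m, q)" by (cases "\<nu> x")
 let ?N = "fst (tensor_list ?L)" and ?N' = "fst (tensor_list ?L')"
 have "irrep MM (evr xs \<rho>)" by (rule irreducible_eval_rep[OF xs \<rho>])
 hence N0: "?N > 0" unfolding eval_rep_tensor_list irreducible_rep_def by (auto simp: case_prod_unfold)
 have "rep_iso MM (?N, snd (tensor_list ?L)) (?N', snd (tensor_list ?L'))" using i unfolding eval_rep_tensor_list by simp
 then obtain P Pi where NN: "?N = ?N'" and P: "P \<in> Mat ?N ?N" "Pi \<in> Mat ?N ?N" "P * Pi = 1\<^sub>m ?N"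
  and int: "!!\<xi>. \<xi> \<in> M ==> P * snd (tensor_list ?L) \<xi> = snd (tensor_list ?L') \<xi> * P" unfolding rep_iso_pair by blast
 have Pne: "P ~= 0\<^sub>m ?N' ?N"
 proof
  assume "P = 0\<^sub>m ?N' ?N"
  hence "1\<^sub>m ?N = (0\<^sub>m ?N ?N :: 'k mat)" using P(2,3) NN by simp
  hence "(1\<^sub>m ?N :: 'k mat) $$ (0,0) = 0\<^sub>m ?N ?N $$ (0,0)" by (rule arg_cong)
  thus False using N0 by simp
 qed
 have vanish: "snd (pull_rep (val y) (\<tau> y)) \<xi> = 0\<^sub>m (fst (\<tau> y)) (fst (\<tau> y))"
  if "is_rep (FA y) (\<tau> y)" "\<xi> \<in> only_at xs x" "y \<in> set xs" "y ~= x" for \<tau> y \<xi>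
  using rep_zero_at[OF that(1)] that(2-) by (simp add: only_at_def)
 have carr: "snd (pull_rep (val y) (\<tau> y)) \<xi> \<in> Mat (fst (\<tau> y)) (fst (\<tau> y))"
  if "is_rep (FA y) (\<tau> y)" "\<xi> \<in> only_at xs x" "y \<in> set xs" for \<tau> y \<xi>
  using is_repD(1)[of "FA y" "fst (\<tau> y)" "snd (\<tau> y)"] that val_in_FA[OF _ xX[OF that(3)], of \<xi>] by (simp add: only_at_def)
 have "\<exists>R\<in>Mat (fst (?L' ! j)) (fst (?L ! j)). R ~= 0\<^sub>m (fst (?L' ! j)) (fst (?L ! j)) &
  (\<forall>\<xi>\<in>only_at xs x. R * snd (?L ! j) \<xi> = snd (?L' ! j) \<xi> * R)"
 proof (rule tensor_list_intertwiner[of ?L ?L' j "only_at xs x" P])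
  fix \<pi> \<xi> assume a: "\<pi> \<in> set ?L \<union> set ?L'" "\<xi> \<in> only_at xs x"
  then consider y where "y \<in> set xs" "\<pi> = pull_rep (val y) (\<rho> y)" | y where "y \<in> set xs" "\<pi> = pull_rep (val y) (\<nu> y)" by auto
  thus "snd \<pi> \<xi> \<in> Mat (fst \<pi>) (fst \<pi>)"
  proof cases
   case 1
   thus ?thesis using carr[of y \<rho>, OF irrep_is_rep[OF \<rho>[OF 1(1)]] a(2) 1(1)] by simp
  next
   case 2
   thus ?thesis using carr[of y \<nu>, OF irrep_is_rep[OF \<nu>[OF 2(1)]] a(2) 2(1)] by simp
  qed
 next
  fix k \<xi> assume k: "k < length ?L" "k ~= j" and a: "\<xi> \<in> only_at xs x"
  have y: "xs ! k \<in> set xs" "xs ! k ~= x" using k j dist by (auto simp: nth_eq_iff_index_eq)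
  show "snd (?L ! k) \<xi> = 0\<^sub>m (fst (?L ! k)) (fst (?L ! k)) & snd (?L' ! k) \<xi> = 0\<^sub>m (fst (?L' ! k)) (fst (?L' ! k))"
   using vanish[of "xs ! k" \<rho>, OF irrep_is_rep[OF \<rho>[OF y(1)]] a y] vanish[of "xs ! k" \<nu>, OF irrep_is_rep[OF \<nu>[OF y(1)]] a y] k by simp
 next
  show "P \<in> Mat ?N' ?N" using P(1) NN by simp
  show "P * snd (tensor_list ?L) \<xi> = snd (tensor_list ?L') \<xi> * P" if "\<xi> \<in> only_at xs x" for \<xi>
   using int that by (simp add: only_at_def)
 qed (use j Pne in auto)
 then obtain R where R: "R \<in> Mat m n" "R ~= 0\<^sub>m m n" "!!\<xi>. \<xi> \<in> only_at xs x ==> R * p (val x \<xi>) = q (val x \<xi>) * R"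
  using j by (auto simp: np mq)
 have ip: "irr_fam n (only_at xs x) (\<lambda>\<xi>. p (val x \<xi>))" by (rule irr_fam_only_at[OF xs x]) (use \<rho>[OF x] np in simp)
 have iq: "irr_fam m (only_at xs x) (\<lambda>\<xi>. q (val x \<xi>))" by (rule irr_fam_only_at[OF xs x]) (use \<nu>[OF x] mq in simp)
 note sch = schur_iso[OF ip iq R(1,2)]
 have nm: "n = m" and inv: "invertible_mat R" using sch(1,3) R(3) by auto
 have "R * p u = q u * R" if u: "u \<in> carr (FA x)" for u
 proof -
  obtain \<xi> where a: "\<xi> \<in> M" "val x \<xi> = u" "!!y. y \<in> set xs ==> y ~= x ==> val y \<xi> = 0"
   by (rule eval_surjective_separated[OF xs x u]) blast
  thus ?thesis using R(3)[of \<xi>] by (simp add: only_at_def)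
 qed
 thus ?thesis using R(1) nm inv unfolding np mq rep_iso_def by auto
qed

lemma inj_zero_form_tensor: "inj_on (\<lambda>\<Psi>. form_tensor_ev D (zero_form MM) \<Psi>) EC"
proof (rule inj_onI)
 fix \<Psi> \<Psi>' assume \<Psi>: "\<Psi> \<in> EC" "\<Psi>' \<in> EC" and e: "form_tensor_ev D (zero_form MM) \<Psi> = form_tensor_ev D (zero_form MM) \<Psi>'"
 have f0: "is_rep MM (form_rep (\<lambda>_. 0))" unfolding is_rep_form_iff[OF MM_closed] by simp
 from form_rep_dual[OF this] have z: "zero_form MM \<in> dual" by (simp add: zero_form_def)
 note fz = dual_form_rep[OF z]
 have tz: "rep_iso MM (tensor (form_rep (zero_form MM)) \<pi>) \<pi>" if \<pi>: "is_rep MM \<pi>" for \<pi>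
 proof -
  have "trivial_rep = (form_rep (\<lambda>_. 0) :: ('k, ('k, 'g, 'a) tens) rep)" by (rule form_rep_zero[symmetric])
  moreover have "rep_iso MM (form_rep (zero_form MM)) (form_rep (\<lambda>_. 0))" by (rule rep_iso_eqI[OF fz]) (simp add: zero_form_def)
  ultimately have "rep_iso MM (form_rep (zero_form MM)) trivial_rep" by simp
  hence "rep_iso MM (tensor (form_rep (zero_form MM)) \<pi>) (tensor trivial_rep \<pi>)"
   by (rule rep_iso_tensor[OF fz is_rep_trivial \<pi> \<pi> _ rep_iso_refl[OF \<pi>]])
  thus ?thesis
   by (rule rep_iso_trans[OF is_rep_tensor[OF fz \<pi>] is_rep_tensor[OF is_rep_trivial \<pi>] \<pi> _ rep_iso_trivial_tensor[OF \<pi>]])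
 qed
 have "\<Psi> x = \<Psi>' x" if x: "x \<in> X" for x
 proof -
  have "separated [x]" using x by (simp add: separated_def)
  then obtain xs where xs: "cover \<Psi> xs" "cover \<Psi>' xs" "set [x] \<subseteq> set xs" by (rule exists_cover2[OF \<Psi>])
  note X = cover_in_X[OF xs(1)]
  have sep: "separated xs" using xs(1) by (simp add: cover_def)
  have xx: "x \<in> set xs" using xs(3) by simp
  obtain \<rho> where \<rho>: "!!y. y \<in> set xs ==> \<rho> y \<in> \<Psi> y" by (rule ex_reps[OF \<Psi>(1) X]) blast
  obtain \<nu> where \<nu>: "!!y. y \<in> set xs ==> \<nu> y \<in> \<Psi>' y" by (rule ex_reps[OF \<Psi>(2) X]) blast
  have r: "is_rep MM (evr xs \<rho>)" by (rule is_rep_eval_EC[OF \<Psi>(1) X \<rho>])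
  have r': "is_rep MM (evr xs \<nu>)" by (rule is_rep_eval_EC[OF \<Psi>(2) X \<nu>])
  note t = is_rep_tensor[OF fz r] is_rep_tensor[OF fz r']
  have "form_tensor_ev D (zero_form MM) \<Psi> = iso_class MM (tensor (form_rep (zero_form MM)) (evr xs \<rho>))"
   by (rule form_tensor_ev_eq[OF z \<Psi>(1) xs(1) \<rho>])
  moreover have "form_tensor_ev D (zero_form MM) \<Psi>' = iso_class MM (tensor (form_rep (zero_form MM)) (evr xs \<nu>))"
   by (rule form_tensor_ev_eq[OF z \<Psi>(2) xs(2) \<nu>])
  ultimately have "rep_iso MM (tensor (form_rep (zero_form MM)) (evr xs \<rho>)) (tensor (form_rep (zero_form MM)) (evr xs \<nu>))"
   using e iso_class_eq_iff[OF t] by simp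
  hence "rep_iso MM (tensor (form_rep (zero_form MM)) (evr xs \<rho>)) (evr xs \<nu>)" by (rule rep_iso_trans[OF t r' _ tz[OF r']])
  hence i: "rep_iso MM (evr xs \<rho>) (evr xs \<nu>)" by (rule rep_iso_trans[OF r t(1) r' rep_iso_sym[OF t(1) r tz[OF r]]])
  have ri: "irrep (FA y) (\<rho> y)" if "y \<in> set xs" for y by (rule EC_mem(1)[OF \<Psi>(1) separated_in_X[OF sep that] \<rho>[OF that]])
  have si: "irrep (FA y) (\<nu> y)" if "y \<in> set xs" for y by (rule EC_mem(1)[OF \<Psi>(2) separated_in_X[OF sep that] \<nu>[OF that]])
  have "rep_iso (FA x) (\<rho> x) (\<nu> x)" by (rule eval_rep_determines_factors[OF sep xx ri si i])
  hence "iso_class (FA x) (\<rho> x) = iso_class (FA x) (\<nu> x)" using iso_class_eq_iff[OF irrep_is_rep[OF ri[OF xx]] irrep_is_rep[OF si[OF xx]]] by simp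
  thus ?thesis using EC_mem(2)[OF \<Psi>(1) x \<rho>[OF xx]] EC_mem(2)[OF \<Psi>(2) x \<nu>[OF xx]] by simp
 qed
 thus "\<Psi> = \<Psi>'" by (rule extensionalityI[OF ECD(5)[OF \<Psi>(1)] ECD(5)[OF \<Psi>(2)]])
qed

end

theorem theorem5p5:
  fixes D :: "('c, 'k::{alg_closed_field, field_char_0}, 'a::comm_ring, 'g::ab_group_add) equivariant_data"
  assumes "equivariant_setting D"
  shows
    "((\<lambda>(l, \<Psi>). form_tensor_ev D l \<Psi>) ` (abelian_dual (map_alg D) \<times> equivariant_classes D)
       = irr_classes (map_alg D)) \<and>
     (\<forall>\<pi>. irreducible_rep (map_alg D) \<pi> \<longrightarrow>
       (\<exists>\<epsilon> \<tau>. evaluation_representation D \<epsilon> \<and> is_rep (map_alg D) \<tau> \<and> fst \<tau> = 1 \<and>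
          rep_iso (map_alg D) \<pi> (tensor_rep \<epsilon> \<tau>))) \<and>
     (\<forall>\<Psi>\<in>equivariant_classes D. \<forall>\<Phi>\<in>equivariant_classes D. class_dim (ev_class D \<Phi>) = 1 \<longrightarrow>
       tensor_fun_class D \<Psi> \<Phi> \<in> equivariant_classes D) \<and>
     (\<forall>l\<in>abelian_dual (map_alg D). \<forall>l'\<in>abelian_dual (map_alg D).
     \<forall>\<Psi>\<in>equivariant_classes D. \<forall>\<Psi>'\<in>equivariant_classes D.
       form_tensor_ev D l \<Psi> = form_tensor_ev D l' \<Psi>' \<longleftrightarrow>
       (\<exists>\<Phi>\<in>equivariant_classes D. class_dim (ev_class D \<Phi>) = 1 \<and>
          l' = diff_form (map_alg D) l (class_form (map_alg D) (ev_class D \<Phi>)) \<and>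
          ev_class D \<Psi>' = ev_class D (tensor_fun_class D \<Psi> \<Phi>))) \<and>
     (inj_on (\<lambda>l. form_tensor_ev D l (zero_fun_class D)) (abelian_dual (map_alg D))) \<and>
     (inj_on (\<lambda>\<Psi>. form_tensor_ev D (zero_form (map_alg D)) \<Psi>) (equivariant_classes D))"
proof -
 interpret equivariant_map_algebra D by unfold_locales (rule assms)
 show ?thesis
 proof (intro conjI allI impI ballI)
  fix l l' \<Psi> \<Psi>' assume h: "l \<in> dual" "l' \<in> dual" "\<Psi> \<in> EC" "\<Psi>' \<in> EC"
  show "form_tensor_ev D l \<Psi> = form_tensor_ev D l' \<Psi>' \<longleftrightarrow>
   (\<exists>\<Phi>\<in>EC. class_dim (ev_class D \<Phi>) = 1 & l' = diff_form MM l (class_form MM (ev_class D \<Phi>)) &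
     ev_class D \<Psi>' = ev_class D (tensor_fun_class D \<Psi> \<Phi>))"
  proof
   assume "form_tensor_ev D l \<Psi> = form_tensor_ev D l' \<Psi>'"
   from form_tensor_ev_eqD[OF h this] show "\<exists>\<Phi>\<in>EC. class_dim (ev_class D \<Phi>) = 1 & l' = diff_form MM l (class_form MM (ev_class D \<Phi>)) &
     ev_class D \<Psi>' = ev_class D (tensor_fun_class D \<Psi> \<Phi>)" by blast
  qed (elim bexE conjE, rule form_tensor_ev_eqI[OF h])
 qed (fact form_tensor_ev_surj irreducible_eval_tensor_one tensor_fun_class_EC inj_form_tensor_zero inj_zero_form_tensor)+
qed

end
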